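(* If $Z\subset S^n$ with $n\geq 3$ is a surface that contains two great circles through a general point and is not contained in a hyperplane section of $S^n$, then $n=3$ and its stereographic projection $\mu(Z)$ is either a Blum cyclide, a Perseus cyclide or a ring cyclide.
   Context: A surface means a real irreducible algebraic surface. $S^n\subset\mathbb{R}^{n+1}$ is the unit sphere, and $\mu\colon S^3\dashrightarrow\mathbb{R}^3$, $\mu(y)=(y_1,y_2,y_3)/(1-y_4)$, is stereographic projection from $(0,0,0,1)$. For a surface $W\subset\mathbb{R}^3$ let $X_W$ be the Zariski closure of $\mu^{-1}(W)$ in $\mathbb{P}^4$ (via $(y_1,\dots,y_4)\mapsto(1:y_1:\dots:y_4)$). The Möbius degree of $W$ is $\deg X_W$. The surface $W$ is $\lambda$-circled if $X_W$ contains at least $\lambda$ circles through a general point and, for $\lambda<\infty$, $W$ is not $(\lambda+1)$-circled. A Darboux cyclide is a surface in $\mathbb{R}^3$ of Möbius degree four. A ring cyclide, Perseus cyclide, Blum cyclide is a Darboux cyclide without real singularities (that is, $X_W$ has no real singular points) that is $4$-circled, $5$-circled, $6$-circled, respectively. *)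

theory Defs
  imports
    "HOL-Analysis.Analysis"
    "HOL-Library.Poly_Mapping"
    "HOL-Library.Function_Algebras"
    "HOL-Library.Extended_Nat"
begin

section \<open>Multivariate polynomials\<close>

type_synonym ('v, 'a) mpoly = "('v \<Rightarrow>\<^sub>0 nat) \<Rightarrow>\<^sub>0 'a"

definition peval :: "('v \<Rightarrow> 'a) \<Rightarrow> ('v, 'a::comm_semiring_1) mpoly \<Rightarrow> 'a" where
  "peval x f =
     (\<Sum>m\<in>Poly_Mapping.keys f. Poly_Mapping.lookup f m *
        (\<Prod>i\<in>Poly_Mapping.keys m. x i ^ Poly_Mapping.lookup m i))"

definition homogeneous :: "('v, 'a::zero) mpoly \<Rightarrow> bool" where
  "homogeneous f \<longleftrightarrow>
     (\<exists>d. \<forall>m\<in>Poly_Mapping.keys f. (\<Sum>i\<in>Poly_Mapping.keys m. Poly_Mapping.lookup m i) = d)"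


section \<open>Irreducibility and dimension\<close>

text \<open>The argument \<open>cl\<close> is the predicate singling out the Zariski closed sets.\<close>

definition irreducible_closed :: "('a set \<Rightarrow> bool) \<Rightarrow> 'a set \<Rightarrow> bool" where
  "irreducible_closed cl V \<longleftrightarrow>
     cl V \<and> V \<noteq> {} \<and> (\<forall>A B. cl A \<and> cl B \<and> V = A \<union> B \<longrightarrow> V = A \<or> V = B)"

definition krull_dim :: "('a set \<Rightarrow> bool) \<Rightarrow> 'a set \<Rightarrow> enat" where
  "krull_dim cl V = Sup {enat d | d. \<exists>F :: nat \<Rightarrow> 'a set.
     (\<forall>i\<le>d. irreducible_closed cl (F i) \<and> F i \<subseteq> V) \<and> (\<forall>i<d. F i \<subset> F (Suc i))}"


section \<open>Real algebraic surfaces\<close>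

text \<open>
  Following \<^const>\<open>Euclidean_space\<close> and \<^const>\<open>nsphere\<close>, a point of \<open>m\<close>-space is a sequence
  vanishing from index \<open>m\<close> on, so its coordinates are numbered from \<open>0\<close> (the usual
  \<open>y\<^sub>1, \<dots>, y\<^sub>4\<close> are \<open>y 0, \<dots>, y 3\<close>).  Polynomials may involve any variables; those with
  index \<open>\<ge> m\<close> evaluate to zero, so this gives the same closed sets as \<open>m\<close> variables do.
\<close>

definition real_closed :: "nat \<Rightarrow> (nat \<Rightarrow> real) set \<Rightarrow> bool" where
  "real_closed m V \<longleftrightarrow> (\<exists>F :: (nat, real) mpoly set.
     V = {x \<in> topspace (Euclidean_space m). \<forall>f\<in>F. peval x f = 0})"

definition surface :: "nat \<Rightarrow> (nat \<Rightarrow> real) set \<Rightarrow> bool" where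
  "surface m W \<longleftrightarrow> irreducible_closed (real_closed m) W \<and> krull_dim (real_closed m) W = 2"


section \<open>Circles\<close>

definition dot :: "nat \<Rightarrow> (nat \<Rightarrow> real) \<Rightarrow> (nat \<Rightarrow> real) \<Rightarrow> real" where
  "dot m u v = (\<Sum>i<m. u i * v i)"

definition circle_around :: "nat \<Rightarrow> (nat \<Rightarrow> real) \<Rightarrow> real \<Rightarrow> (nat \<Rightarrow> real) set \<Rightarrow> bool" where
  "circle_around m c r C \<longleftrightarrow>
     (\<exists>u \<in> topspace (Euclidean_space m). \<exists>v \<in> topspace (Euclidean_space m).
        dot m u u = 1 \<and> dot m v v = 1 \<and> dot m u v = 0 \<and>
        C = {\<lambda>i. c i + r * (cos t * u i + sin t * v i) | t. True})"

definition circle :: "nat \<Rightarrow> (nat \<Rightarrow> real) set \<Rightarrow> bool" where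
  "circle m C \<longleftrightarrow> (\<exists>c \<in> topspace (Euclidean_space m). \<exists>r>0. circle_around m c r C)"

definition great_circle :: "nat \<Rightarrow> (nat \<Rightarrow> real) set \<Rightarrow> bool" where
  "great_circle n C \<longleftrightarrow> circle_around (Suc n) 0 1 C"

text \<open>Here and below, a property holds at a general point of an irreducible set if it holds
  at all its real points outside some proper Zariski closed subset.\<close>

definition two_great_circles_through_general_point :: "nat \<Rightarrow> (nat \<Rightarrow> real) set \<Rightarrow> bool" where
  "two_great_circles_through_general_point n Z \<longleftrightarrow>
     (\<exists>B. real_closed (Suc n) B \<and> \<not> Z \<subseteq> B \<and>
        (\<forall>p \<in> Z - B. \<exists>C D. C \<noteq> D \<and> great_circle n C \<and> great_circle n D \<and>
           p \<in> C \<inter> D \<and> C \<union> D \<subseteq> Z))"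

definition in_hyperplane_section :: "nat \<Rightarrow> (nat \<Rightarrow> real) set \<Rightarrow> bool" where
  "in_hyperplane_section n Z \<longleftrightarrow>
     (\<exists>a b. (\<exists>i\<le>n. a i \<noteq> 0) \<and> Z \<subseteq> {x \<in> topspace (nsphere n). dot (Suc n) a x = b})"


section \<open>Complex projective varieties\<close>

text \<open>A point of complex projective \<open>N\<close>-space is the set of all its vectors of homogeneous
  coordinates \<open>x 0, \<dots>, x N\<close> (continued by zeros).\<close>

type_synonym pt = "(nat \<Rightarrow> complex) set"

definition proj_point :: "(nat \<Rightarrow> complex) \<Rightarrow> pt" where
  "proj_point x = {\<lambda>i. c * x i | c. c \<noteq> 0}"

definition proj_space :: "nat \<Rightarrow> pt set" where
  "proj_space N = proj_point ` {x. x \<noteq> 0 \<and> (\<forall>i>N. x i = 0)}"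

definition vanishes_at :: "(nat, complex) mpoly \<Rightarrow> pt \<Rightarrow> bool" where
  "vanishes_at f P \<longleftrightarrow> (\<forall>x\<in>P. peval x f = 0)"

definition proj_closed :: "nat \<Rightarrow> pt set \<Rightarrow> bool" where
  "proj_closed N V \<longleftrightarrow> (\<exists>F. (\<forall>f\<in>F. homogeneous f) \<and>
     V = {P \<in> proj_space N. \<forall>f\<in>F. vanishes_at f P})"

definition proj_closure :: "nat \<Rightarrow> pt set \<Rightarrow> pt set" where
  "proj_closure N A = \<Inter> {V. proj_closed N V \<and> A \<subseteq> V}"

definition proj_dim :: "nat \<Rightarrow> pt set \<Rightarrow> enat" where
  "proj_dim N X = krull_dim (proj_closed N) X"

text \<open>\<open>X\<close> has degree \<open>d\<close> if it meets a general linear subspace of codimension \<open>dim X\<close> in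
  exactly \<open>d\<close> points.  The subspace is the common zero locus of the linear forms
  \<open>\<Sum>i\<le>N. a (j, i) * x i\<close>, and it is general if a certain nonzero polynomial \<open>G\<close> in the
  coefficients \<open>a (j, i)\<close> does not vanish.\<close>

definition has_degree :: "nat \<Rightarrow> pt set \<Rightarrow> nat \<Rightarrow> bool" where
  "has_degree N X d \<longleftrightarrow>
     (\<exists>G :: (nat \<times> nat, complex) mpoly. G \<noteq> 0 \<and>
        (\<forall>a. peval a G \<noteq> 0 \<longrightarrow>
          (let S = {P \<in> X. \<forall>j. enat j < proj_dim N X \<longrightarrow>
                             (\<forall>x\<in>P. (\<Sum>i\<le>N. a (j, i) * x i) = 0)}
           in finite S \<and> card S = d)))"

text \<open>The Zariski tangent space, at a representative \<open>x\<close> of a point of \<open>X\<close>, of the affine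
  cone over \<open>X\<close>: the kernel of the Jacobian of the homogeneous ideal of \<open>X\<close>.  At a nonsingular
  point its dimension is one more than that of \<open>X\<close>.\<close>

definition cone_tangent_space :: "nat \<Rightarrow> pt set \<Rightarrow> (nat \<Rightarrow> complex) \<Rightarrow> (nat \<Rightarrow> complex) set" where
  "cone_tangent_space N X x =
     {v. (\<forall>i>N. v i = 0) \<and>
         (\<forall>f. homogeneous f \<and> (\<forall>Q\<in>X. vanishes_at f Q) \<longrightarrow>
            ((\<lambda>t. peval (\<lambda>i. x i + t * v i) f) has_field_derivative 0) (at 0))}"

definition singular_point :: "nat \<Rightarrow> pt set \<Rightarrow> pt \<Rightarrow> bool" where
  "singular_point N X P \<longleftrightarrow> P \<in> X \<and>
     (\<exists>x\<in>P. enat (vector_space.dim (\<lambda>c v i. c * v i) (cone_tangent_space N X x))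
              \<noteq> eSuc (proj_dim N X))"

lemma vector_space_pointwise: "vector_space (\<lambda>(c::complex) v (i::nat). c * v i)"
  by unfold_locales (auto simp: fun_eq_iff algebra_simps)

definition real_point :: "pt \<Rightarrow> bool" where
  "real_point P \<longleftrightarrow> (\<exists>r :: nat \<Rightarrow> real. P = proj_point (\<lambda>i. of_real (r i)))"


section \<open>Stereographic projection and cyclides\<close>

definition north_pole :: "nat \<Rightarrow> real" where
  "north_pole = (\<lambda>i. if i = 3 then 1 else 0)"

definition stereo :: "(nat \<Rightarrow> real) \<Rightarrow> (nat \<Rightarrow> real)" where
  "stereo y = (\<lambda>i. if i < 3 then y i / (1 - y 3) else 0)"

definition stereo_image :: "(nat \<Rightarrow> real) set \<Rightarrow> (nat \<Rightarrow> real) set" where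
  "stereo_image Z = stereo ` (Z - {north_pole})"

definition stereo_preimage :: "(nat \<Rightarrow> real) set \<Rightarrow> (nat \<Rightarrow> real) set" where
  "stereo_preimage W = {y \<in> topspace (nsphere 3) - {north_pole}. stereo y \<in> W}"

text \<open>The embedding \<open>(y\<^sub>1, \<dots>, y\<^sub>m) \<mapsto> (1 : y\<^sub>1 : \<dots> : y\<^sub>m)\<close> of affine into projective space.\<close>

definition embed :: "(nat \<Rightarrow> real) \<Rightarrow> pt" where
  "embed y = proj_point (\<lambda>i. case i of 0 \<Rightarrow> 1 | Suc j \<Rightarrow> of_real (y j))"

definition moebius_model :: "(nat \<Rightarrow> real) set \<Rightarrow> pt set" where
  "moebius_model W = proj_closure 4 (embed ` stereo_preimage W)"

definition has_moebius_degree :: "(nat \<Rightarrow> real) set \<Rightarrow> nat \<Rightarrow> bool" where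
  "has_moebius_degree W d \<longleftrightarrow> has_degree 4 (moebius_model W) d"

text \<open>All real points of \<open>moebius_model W\<close> lie on the 3-sphere, hence are of the form
  \<open>embed y\<close>, and the irreducible real conics with real points on it are Euclidean circles.\<close>

definition circles_through :: "(nat \<Rightarrow> real) set \<Rightarrow> (nat \<Rightarrow> real) \<Rightarrow> (nat \<Rightarrow> real) set set" where
  "circles_through W y = {C. circle 4 C \<and> y \<in> C \<and> embed ` C \<subseteq> moebius_model W}"

definition at_least_circled :: "enat \<Rightarrow> (nat \<Rightarrow> real) set \<Rightarrow> bool" where
  "at_least_circled \<kappa> W \<longleftrightarrow>
     (\<exists>B. proj_closed 4 B \<and> \<not> moebius_model W \<subseteq> B \<and>
        (\<forall>y \<in> topspace (Euclidean_space 4). embed y \<in> moebius_model W - B \<longrightarrow>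
           (finite (circles_through W y) \<longrightarrow> \<kappa> \<le> enat (card (circles_through W y)))))"

definition circled :: "enat \<Rightarrow> (nat \<Rightarrow> real) set \<Rightarrow> bool" where
  "circled \<kappa> W \<longleftrightarrow> at_least_circled \<kappa> W \<and> (\<kappa> < \<infinity> \<longrightarrow> \<not> at_least_circled (\<kappa> + 1) W)"

definition darboux_cyclide :: "(nat \<Rightarrow> real) set \<Rightarrow> bool" where
  "darboux_cyclide W \<longleftrightarrow> surface 3 W \<and> has_moebius_degree W 4"

definition without_real_singularities :: "(nat \<Rightarrow> real) set \<Rightarrow> bool" where
  "without_real_singularities W \<longleftrightarrow>
     \<not> (\<exists>P. real_point P \<and> singular_point 4 (moebius_model W) P)"

definition ring_cyclide :: "(nat \<Rightarrow> real) set \<Rightarrow> bool" where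
  "ring_cyclide W \<longleftrightarrow> darboux_cyclide W \<and> without_real_singularities W \<and> circled 4 W"

definition perseus_cyclide :: "(nat \<Rightarrow> real) set \<Rightarrow> bool" where
  "perseus_cyclide W \<longleftrightarrow> darboux_cyclide W \<and> without_real_singularities W \<and> circled 5 W"

definition blum_cyclide :: "(nat \<Rightarrow> real) set \<Rightarrow> bool" where
  "blum_cyclide W \<longleftrightarrow> darboux_cyclide W \<and> without_real_singularities W \<and> circled 6 W"

end

theory Submission
  imports Defs "HOL-Computational_Algebra.Fundamental_Theorem_Algebra"
begin

text \<open>
  A great circle spans a plane through the origin, so the cone \<open>X\<close> over \<open>Z\<close> contains two planes
  through its general line: projectively, \<open>Z\<close> is a surface with two lines through a general
  point. Such a surface is a quadric in 3-space, for the following reason. Fix a general circle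
  \<open>C0\<close> of \<open>Z\<close>; through almost all its points passes a second circle of \<open>Z\<close>. That the plane of such
  a circle lies in \<open>X\<close> is a polynomial condition on a point \<open>x\<close> of \<open>C0\<close> and a point \<open>z\<close> of \<open>Z\<close>;
  by pseudo-division all these conditions follow from one equation \<open>h = 0\<close>, and \<open>h\<close> has a simple
  zero at a suitable pair. By the intermediate value theorem the zero can be followed when \<open>z\<close>
  moves, in particular along another circle of \<open>Z\<close> skew to \<open>C0\<close>. So infinitely many circles
  of \<open>Z\<close> meet two skew circles (\<open>transversals\<close>). Infinitely many great circles are dense in \<open>Z\<close>,
  because a proper closed subset of the surface containing them would lengthen the chain
  point, circle, surface (\<open>surface_many_great_circles\<close>). Hence \<open>Z\<close> lies in the 4-space spanned by
  the two skew circles, and its cone is stable under scaling the two summands independently.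
  The images of one further circle under these scalings sweep out a hyperboloid (\<open>quadric\<close>).

  Diagonalising its quadratic form \<open>q\<close> relative to the norm gives coordinates \<open>\<eta>\<close> in which \<open>Z\<close> is
  \<open>\<eta>0\<^sup>2 + \<eta>1\<^sup>2 = \<eta>2\<^sup>2 + \<eta>3\<^sup>2\<close>, \<open>\<Sum> \<kappa> j * \<eta> j\<^sup>2 = 1\<close> with \<open>\<kappa> j > 0\<close>, \<open>\<kappa> 0 \<le> \<kappa> 1\<close> and
  \<open>\<kappa> 2 \<le> \<kappa> 3\<close> (\<open>principal_coordinates\<close>). The rest is read off from these equations. The Moebius model
  is the complete intersection of the two homogenised quadrics (\<open>moebius_model_eq\<close>); it is smooth at
  its real points, as both gradients are visibly independent there (\<open>no_real_singularities\<close>).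
  A general linear section of codimension two is a conic on the first quadric, cut by the
  second in the zeros of a quartic (\<open>moebius_degree\<close>). A circle of \<open>Z\<close> through \<open>y\<close> is the sphere
  section of \<open>y + U\<close> for a plane \<open>U\<close> that is isotropic for \<open>q - l * norm\<^sup>2\<close> and orthogonal to \<open>y\<close> with
  respect to this form. Only \<open>l = 0\<close>, \<open>l = 1 / \<kappa> 1\<close> and \<open>l = - 1 / \<kappa> 3\<close> admit such planes, and for general \<open>y\<close> they admit
  2 planes, 2 planes (1 if \<open>\<kappa> 0 = \<kappa> 1\<close>) and 2 planes (1 if \<open>\<kappa> 2 = \<kappa> 3\<close>) (\<open>card_circs\<close>). So the
  projection is 6-, 5- or 4-circled according to the number of equalities.
\<close>

section \<open>Polynomial functions\<close>

definition mono_eval :: "('v => 'a::comm_semiring_1) => ('v \<Rightarrow>\<^sub>0 nat) => 'a" where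
 "mono_eval x m = (\<Prod>i\<in>Poly_Mapping.keys m. x i ^ Poly_Mapping.lookup m i)"

lemma mono_eval_superset:
 assumes "finite S" "Poly_Mapping.keys m \<subseteq> S"
 shows "mono_eval x m = (\<Prod>i\<in>S. x i ^ Poly_Mapping.lookup m i)"
 unfolding mono_eval_def using assms by (intro prod.mono_neutral_left) (auto simp: in_keys_iff)

lemma mono_eval_0 [simp]: "mono_eval x 0 = 1"
 by (simp add: mono_eval_def)

lemma mono_eval_add: "mono_eval x (m + m') = mono_eval x m * mono_eval x m'"
proof -
 let ?S = "Poly_Mapping.keys m \<union> Poly_Mapping.keys m'"
 have "mono_eval x (m + m') = (\<Prod>i\<in>?S. x i ^ Poly_Mapping.lookup (m + m') i)"
  by (rule mono_eval_superset) (auto simp: in_keys_iff lookup_add)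
 moreover have "mono_eval x m = (\<Prod>i\<in>?S. x i ^ Poly_Mapping.lookup m i)"
  "mono_eval x m' = (\<Prod>i\<in>?S. x i ^ Poly_Mapping.lookup m' i)"
  by (auto intro!: mono_eval_superset)
 ultimately show ?thesis
  by (simp add: lookup_add power_add prod.distrib)
qed

lemma peval_superset:
 assumes "finite S" "Poly_Mapping.keys f \<subseteq> S"
 shows "peval x f = (\<Sum>m\<in>S. Poly_Mapping.lookup f m * mono_eval x m)"
 unfolding peval_def mono_eval_def[symmetric] using assms
 by (intro sum.mono_neutral_left) (auto simp: in_keys_iff)

lemma peval_add: "peval x (f + g) = peval x f + peval x g"
proof -
 let ?S = "Poly_Mapping.keys f \<union> Poly_Mapping.keys g"
 have "Poly_Mapping.keys (f + g) \<subseteq> ?S" by (rule keys_add)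
 then show ?thesis
  by (simp add: peval_superset[of ?S] lookup_add distrib_right sum.distrib)
qed

lemma peval_0 [simp]: "peval x 0 = 0"
 by (simp add: peval_def)

lemma peval_single: "peval x (Poly_Mapping.single m c) = c * mono_eval x m"
 by (subst peval_superset[of "{m}"]) auto

lemma peval_const [simp]: "peval x (Poly_Mapping.single 0 c) = c"
 by (simp add: peval_single)

lemma peval_var [simp]: "peval x (Poly_Mapping.single (Poly_Mapping.single i 1) 1) = x i"
 by (simp add: peval_single mono_eval_def)

lemma peval_sum: "peval x (sum f A) = (\<Sum>a\<in>A. peval x (f a))"
 by (induction A rule: infinite_finite_induct) (auto simp: peval_add)

lemma mpoly_sum_singles:
 "f = (\<Sum>m\<in>Poly_Mapping.keys f. Poly_Mapping.single m (Poly_Mapping.lookup f m))"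
 by (rule poly_mapping_eqI)
  (auto simp: lookup_sum lookup_single when_def in_keys_iff)

lemma peval_mult: "peval x (f * g) = peval x f * peval x g"
proof -
 let ?s = "\<lambda>h m. Poly_Mapping.single m (Poly_Mapping.lookup h m)"
 have "f * g = (\<Sum>m\<in>Poly_Mapping.keys f. \<Sum>m'\<in>Poly_Mapping.keys g. ?s f m * ?s g m')"
  by (subst mpoly_sum_singles[of f], subst mpoly_sum_singles[of g]) (rule sum_product)
 then have "peval x (f * g) = (\<Sum>m\<in>Poly_Mapping.keys f. \<Sum>m'\<in>Poly_Mapping.keys g.
   peval x (?s f m) * peval x (?s g m'))"
  by (simp add: peval_sum mult_single peval_single mono_eval_add algebra_simps)
 also have "\<dots> = peval x (\<Sum>m\<in>Poly_Mapping.keys f. ?s f m) * peval x (\<Sum>m\<in>Poly_Mapping.keys g. ?s g m)"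
  by (simp add: peval_sum sum_product)
 finally show ?thesis by (simp flip: mpoly_sum_singles)
qed

lemma peval_1 [simp]: "peval x 1 = 1"
 using peval_const[of x 1] by simp

lemma peval_uminus: "peval x (- f) = - peval x (f :: ('v, 'a::comm_ring_1) mpoly)"
 using peval_add[of x f "-f"] by (simp add: add_eq_0_iff2)

lemma peval_power: "peval x (f ^ k) = peval x f ^ k"
 by (induction k) (auto simp: peval_mult)

text \<open>Polynomials are sums of terms, so a property that holds for constants and variables and is
  preserved by sums and products holds for all of them.\<close>

lemma mpoly_induct [case_names const var add mult]:
 fixes P :: "('v, 'a::comm_ring_1) mpoly => bool"
 assumes const: "\<And>c. P (Poly_Mapping.single 0 c)"
  and var: "\<And>i. P (Poly_Mapping.single (Poly_Mapping.single i 1) 1)"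
  and add: "\<And>f g. P f ==> P g ==> P (f + g)"
  and mult: "\<And>f g. P f ==> P g ==> P (f * g)"
 shows "P f"
proof -
 have P1: "P 1" using const[of 1] by simp
 have mono: "P (Poly_Mapping.single m 1)" for m :: "'v \<Rightarrow>\<^sub>0 nat"
 proof (induction "\<Sum>i\<in>Poly_Mapping.keys m. Poly_Mapping.lookup m i" arbitrary: m)
  case 0
  then have "m = 0" by (simp add: in_keys_iff poly_mapping_eq_iff fun_eq_iff)
  then show ?case using P1 by simp
 next
  case (Suc k)
  then have "m \<noteq> 0" by auto
  then obtain i where i: "i \<in> Poly_Mapping.keys m" by (metis all_not_in_conv keys_eq_empty)
  define m' where "m' = m - Poly_Mapping.single i 1"
  have m: "m = m' + Poly_Mapping.single i 1"
   using i by (auto intro!: poly_mapping_eqI simp: m'_def lookup_add lookup_minus lookup_single when_def in_keys_iff)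
  have "(\<Sum>i\<in>Poly_Mapping.keys m. Poly_Mapping.lookup m i) =
   (\<Sum>j\<in>Poly_Mapping.keys m. Poly_Mapping.lookup m' j + (if j = i then 1 else 0))"
  proof (rule sum.cong[OF refl])
   fix j
   show "Poly_Mapping.lookup m j = Poly_Mapping.lookup m' j + (if j = i then 1 else 0)"
    by (subst m) (auto simp: lookup_add lookup_single when_def)
  qed
  also have "\<dots> = (\<Sum>j\<in>Poly_Mapping.keys m. Poly_Mapping.lookup m' j) + 1"
   using i by (simp add: sum.distrib)
  also have "(\<Sum>j\<in>Poly_Mapping.keys m. Poly_Mapping.lookup m' j) =
    (\<Sum>j\<in>Poly_Mapping.keys m'. Poly_Mapping.lookup m' j)"
   by (rule sum.mono_neutral_right) (auto simp: m'_def in_keys_iff lookup_minus)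
  finally have "k = (\<Sum>j\<in>Poly_Mapping.keys m'. Poly_Mapping.lookup m' j)"
   using Suc.hyps(2) by simp
  then have "P (Poly_Mapping.single m' 1)" by (rule Suc.hyps(1))
  from mult[OF this var[of i]] show ?case by (simp add: mult_single m[unfolded One_nat_def, symmetric])
 qed
 have sing: "P (Poly_Mapping.single m c)" for m c
  using mult[OF const[of c] mono[of m]] by (simp add: mult_single)
 have "P (\<Sum>m\<in>A. Poly_Mapping.single m (Poly_Mapping.lookup f m))" for A
  by (induction A rule: infinite_finite_induct) (use const[of 0] sing add in auto)
 then show ?thesis by (subst mpoly_sum_singles)
qed

text \<open>Evaluation is all that the arguments below need, and functions are more convenient than
  their coefficient tables: closure under composition, for instance, is an induction.\<close>

definition polyfuns :: "(('v => 'a::comm_ring_1) => 'a) set" where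
 "polyfuns = range (\<lambda>p x. peval x p)"

lemma polyfuns_const [intro, simp]: "(\<lambda>x. c) \<in> polyfuns"
 unfolding polyfuns_def by (rule range_eqI[of _ _ "Poly_Mapping.single 0 c"]) auto

lemma polyfuns_var [intro, simp]: "(\<lambda>x. x i) \<in> polyfuns"
 unfolding polyfuns_def
 by (rule range_eqI[of _ _ "Poly_Mapping.single (Poly_Mapping.single i 1) 1"]) (simp add: fun_eq_iff del: One_nat_def)

lemma polyfuns_add [intro]: "f \<in> polyfuns ==> g \<in> polyfuns ==> (\<lambda>x. f x + g x) \<in> polyfuns"
 unfolding polyfuns_def by (auto simp flip: peval_add)

lemma polyfuns_mult [intro]: "f \<in> polyfuns ==> g \<in> polyfuns ==> (\<lambda>x. f x * g x) \<in> polyfuns"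
 unfolding polyfuns_def by (auto simp flip: peval_mult)

lemma polyfuns_uminus [intro]: "f \<in> polyfuns ==> (\<lambda>x. - f x) \<in> polyfuns"
 unfolding polyfuns_def by (auto simp flip: peval_uminus)

lemma polyfuns_diff [intro]: "f \<in> polyfuns ==> g \<in> polyfuns ==> (\<lambda>x. f x - g x) \<in> polyfuns"
 using polyfuns_add[of f "\<lambda>x. - g x"] polyfuns_uminus[of g] by simp

lemma polyfuns_power [intro]: "f \<in> polyfuns ==> (\<lambda>x. f x ^ k) \<in> polyfuns"
 unfolding polyfuns_def by (auto simp flip: peval_power)

lemma polyfuns_sum [intro]: "(\<And>a. a \<in> A ==> f a \<in> polyfuns) ==> (\<lambda>x. \<Sum>a\<in>A. f a x) \<in> polyfuns"
 by (induction A rule: infinite_finite_induct) auto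

lemma peval_polyfuns [intro, simp]: "(\<lambda>x. peval x p) \<in> polyfuns"
 by (auto simp: polyfuns_def)

lemma polyfuns_induct [consumes 1, case_names const var add mult]:
 assumes "f \<in> polyfuns"
  and "\<And>c. P (\<lambda>x. c)"
  and "\<And>i. P (\<lambda>x. x i)"
  and "\<And>f g. f \<in> polyfuns ==> g \<in> polyfuns ==> P f ==> P g ==> P (\<lambda>x. f x + g x)"
  and "\<And>f g. f \<in> polyfuns ==> g \<in> polyfuns ==> P f ==> P g ==> P (\<lambda>x. f x * g x)"
 shows "P f"
proof -
 obtain p where p: "f = (\<lambda>x. peval x p)" using assms(1) by (auto simp: polyfuns_def)
 have "P (\<lambda>x. peval x p)"
 proof (induction p rule: mpoly_induct)
  case (const c) then show ?case using assms(2) by simp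
 next
  case (var i) then show ?case using assms(3) by (simp del: One_nat_def)
 next
  case (add f g) then show ?case using assms(4) by (simp add: peval_add)
 next
  case (mult f g) then show ?case using assms(5) by (simp add: peval_mult)
 qed
 then show ?thesis using p by simp
qed

lemma polyfuns_comp:
 assumes "f \<in> polyfuns" "\<And>i. g i \<in> polyfuns"
 shows "(\<lambda>x. f (\<lambda>i. g i x)) \<in> polyfuns"
 using assms(1) by (induction f rule: polyfuns_induct) (use assms(2) in auto)

text \<open>Along a line a polynomial function is a polynomial in one variable.\<close>

lemma polyfuns_line:
 assumes "f \<in> polyfuns"
 shows "\<exists>P. \<forall>t. f (\<lambda>i. p i + t * q i) = poly P t"
 using assms
proof (induction f rule: polyfuns_induct)
 case (const c) then show ?case by (intro exI[of _ "[:c:]"]) simp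
next
 case (var i) then show ?case by (intro exI[of _ "[:p i, q i:]"]) (simp add: algebra_simps)
next
 case (add f g)
 then obtain P Q where "\<forall>t. f (\<lambda>i. p i + t * q i) = poly P t" "\<forall>t. g (\<lambda>i. p i + t * q i) = poly Q t" by blast
 then show ?case by (intro exI[of _ "P + Q"]) simp
next
 case (mult f g)
 then obtain P Q where "\<forall>t. f (\<lambda>i. p i + t * q i) = poly P t" "\<forall>t. g (\<lambda>i. p i + t * q i) = poly Q t" by blast
 then show ?case by (intro exI[of _ "P * Q"]) simp
qed

text \<open>On a line through two points where the factors do not vanish both are nonzero polynomials in
  one variable, and so is their product.\<close>

lemma polyfuns_no_zero_divisors:
 fixes f g :: "('v => 'a::field_char_0) => 'a"
 assumes "f \<in> polyfuns" "g \<in> polyfuns" "\<And>x. f x * g x = 0" "f p \<noteq> 0"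
 shows "g q = 0"
proof -
 let ?l = "\<lambda>t i. p i + t * (q i - p i)"
 obtain P where P: "\<And>t. f (?l t) = poly P t" using polyfuns_line[OF assms(1), of p "\<lambda>i. q i - p i"] by blast
 obtain Q where Q: "\<And>t. g (?l t) = poly Q t" using polyfuns_line[OF assms(2), of p "\<lambda>i. q i - p i"] by blast
 have "poly (P * Q) t = 0" for t using assms(3)[of "?l t"] P Q by simp
 then have "P * Q = 0" using poly_all_0_iff_0 by blast
 moreover have "P \<noteq> 0" using P[of 0] assms(4) by auto
 ultimately have "Q = 0" by simp
 then show ?thesis using Q[of 1] by simp
qed

section \<open>Homogeneous forms\<close>

definition mdegree :: "('v \<Rightarrow>\<^sub>0 nat) => nat" where
 "mdegree m = (\<Sum>i\<in>Poly_Mapping.keys m. Poly_Mapping.lookup m i)"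

lemma mdegree_superset:
 assumes "finite S" "Poly_Mapping.keys m \<subseteq> S"
 shows "mdegree m = (\<Sum>i\<in>S. Poly_Mapping.lookup m i)"
 unfolding mdegree_def using assms by (intro sum.mono_neutral_left) (auto simp: in_keys_iff)

lemma mdegree_add: "mdegree (m + m') = mdegree m + mdegree m'"
proof -
 let ?S = "Poly_Mapping.keys m \<union> Poly_Mapping.keys m'"
 have "Poly_Mapping.keys (m + m') \<subseteq> ?S" by (rule keys_add)
 then show ?thesis by (simp add: mdegree_superset[of ?S] lookup_add sum.distrib)
qed

text \<open>The degree is an index, so that the zero polynomial is a form of every degree.\<close>

definition forms :: "nat => (('v => 'a::comm_ring_1) => 'a) set" where
 "forms d = {\<lambda>x. peval x p | p. \<forall>m\<in>Poly_Mapping.keys p. mdegree m = d}"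

lemma formsE:
 assumes "f \<in> forms d"
 obtains p where "f = (\<lambda>x. peval x p)" "\<And>m. m \<in> Poly_Mapping.keys p ==> mdegree m = d" "homogeneous p"
 using assms unfolding forms_def homogeneous_def mdegree_def by blast

lemma homogeneous_forms: "homogeneous p ==> \<exists>d. (\<lambda>x. peval x p) \<in> forms d"
 unfolding forms_def homogeneous_def mdegree_def by blast

lemma forms_polyfuns: "f \<in> forms d ==> f \<in> polyfuns"
 by (auto simp: forms_def)

lemma forms_const [intro, simp]: "(\<lambda>x. c) \<in> forms 0"
 unfolding forms_def
 by (rule CollectI, rule exI[of _ "Poly_Mapping.single 0 c"]) (simp add: mdegree_def)

lemma forms_0 [intro, simp]: "(\<lambda>x. 0) \<in> forms d"
 unfolding forms_def by (rule CollectI, rule exI[of _ 0]) simp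

lemma forms_var [intro, simp]: "(\<lambda>x. x i) \<in> forms (Suc 0)"
 unfolding forms_def
 by (rule CollectI, rule exI[of _ "Poly_Mapping.single (Poly_Mapping.single i 1) 1"])
  (simp add: mdegree_def peval_var[unfolded One_nat_def])

lemma forms_add [intro]:
 assumes "f \<in> forms d" "g \<in> forms d" shows "(\<lambda>x. f x + g x) \<in> forms d"
proof -
 obtain p q where *: "f = (\<lambda>x. peval x p)" "\<And>m. m \<in> Poly_Mapping.keys p ==> mdegree m = d"
  "g = (\<lambda>x. peval x q)" "\<And>m. m \<in> Poly_Mapping.keys q ==> mdegree m = d"
  using assms by (auto simp: forms_def)
 then show ?thesis using keys_add[of p q] unfolding forms_def
  by (intro CollectI exI[of _ "p + q"]) (auto simp: peval_add)
qed

lemma forms_mult: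
 assumes "f \<in> forms d" "g \<in> forms e" shows "(\<lambda>x. f x * g x) \<in> forms (d + e)"
proof -
 obtain p q where *: "f = (\<lambda>x. peval x p)" "\<And>m. m \<in> Poly_Mapping.keys p ==> mdegree m = d"
  "g = (\<lambda>x. peval x q)" "\<And>m. m \<in> Poly_Mapping.keys q ==> mdegree m = e"
  using assms by (auto simp: forms_def)
 then show ?thesis using keys_mult[of p q] unfolding forms_def
  by (intro CollectI exI[of _ "p * q"]) (auto simp: peval_mult mdegree_add)
qed

lemma forms_mult' [intro]:
 "f \<in> forms d ==> g \<in> forms e ==> d + e = k ==> (\<lambda>x. f x * g x) \<in> forms k"
 using forms_mult by blast

lemma forms_cmult [intro]: "f \<in> forms d ==> (\<lambda>x. c * f x) \<in> forms d"
 using forms_mult[of "\<lambda>x. c" 0 f d] by simp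

lemma forms_uminus [intro]: "f \<in> forms d ==> (\<lambda>x. - f x) \<in> forms d"
 using forms_cmult[of f d "-1"] by simp

lemma forms_diff [intro]: "f \<in> forms d ==> g \<in> forms d ==> (\<lambda>x. f x - g x) \<in> forms d"
 using forms_add[of f d "\<lambda>x. - g x"] forms_uminus[of g d] by simp

lemma forms_sum [intro]: "(\<And>a. a \<in> A ==> f a \<in> forms d) ==> (\<lambda>x. \<Sum>a\<in>A. f a x) \<in> forms d"
 by (induction A rule: infinite_finite_induct) auto

lemma forms_power: "f \<in> forms d ==> (\<lambda>x. f x ^ k) \<in> forms (k * d)"
 by (induction k) (auto simp: forms_mult)

lemma forms_power' [intro]: "f \<in> forms d ==> k * d = e ==> (\<lambda>x. f x ^ k) \<in> forms e"
 using forms_power by blast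

lemma mono_eval_scale: "mono_eval (\<lambda>i. c * x i) m = c ^ mdegree m * mono_eval x m"
 by (simp add: mono_eval_def mdegree_def power_mult_distrib prod.distrib power_sum)

lemma forms_scale:
 assumes "f \<in> forms d" shows "f (\<lambda>i. c * x i) = c ^ d * f x"
proof -
 obtain p where p: "f = (\<lambda>x. peval x p)" "\<And>m. m \<in> Poly_Mapping.keys p ==> mdegree m = d"
  using assms by (auto simp: forms_def)
 then show ?thesis
  by (simp add: peval_def mono_eval_scale sum_distrib_left algebra_simps flip: mono_eval_def cong: sum.cong)
qed

section \<open>Underdetermined linear systems\<close>

lemma underdetermined_system:
 fixes A :: "nat => nat => 'a::field"
 assumes "k < m"
 shows "\<exists>x. (\<exists>i<m. x i \<noteq> 0) \<and> (\<forall>i\<ge>m. x i = 0) \<and> (\<forall>j<k. (\<Sum>i<m. A j i * x i) = 0)"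
 using assms
proof (induction m arbitrary: A k)
 case 0 then show ?case by simp
next
 case (Suc m)
 show ?case
 proof (cases "\<exists>j0<k. A j0 m \<noteq> 0")
  case False
  then show ?thesis
   by (intro exI[of _ "\<lambda>i. if i = m then 1 else 0"]) (auto simp: if_distrib cong: if_cong)
 next
  case True
  then obtain j0 where j0: "j0 < k" "A j0 m \<noteq> 0" by blast
  define sw where "sw j = (if j < j0 then j else Suc j)" for j
  define A' where "A' j i = A (sw j) i - A (sw j) m / A j0 m * A j0 i" for j i
  have "k - 1 < m" using Suc.prems j0 by linarith
  from Suc.IH[OF this, of A'] obtain x where x: "\<exists>i<m. x i \<noteq> 0" "\<forall>i\<ge>m. x i = 0"
   "\<forall>j<k - 1. (\<Sum>i<m. A' j i * x i) = 0" by blast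
  define y where "y i = (if i = m then - (\<Sum>i<m. A j0 i * x i) / A j0 m else x i)" for i
  have y: "(\<Sum>i<Suc m. A j i * y i) = (\<Sum>i<m. A j i * x i) + A j m * y m" for j
   by (simp add: y_def)
  have "(\<Sum>i<Suc m. A j i * y i) = 0" if "j < k" for j
  proof (cases "j = j0")
   case True then show ?thesis unfolding y using j0 by (simp add: y_def)
  next
   case False
   define j' where "j' = (if j < j0 then j else j - 1)"
   have j': "j' < k - 1" "sw j' = j" using False that j0 by (auto simp: j'_def sw_def)
   have "0 = (\<Sum>i<m. A' j' i * x i)" using x(3) j'(1) by simp
   also have "\<dots> = (\<Sum>i<m. A j i * x i) - A j m / A j0 m * (\<Sum>i<m. A j0 i * x i)"
    by (simp add: A'_def j'(2) left_diff_distrib sum_subtractf sum_distrib_left mult.assoc)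
   finally show ?thesis unfolding y by (simp add: y_def)
  qed
  moreover have "\<exists>i<Suc m. y i \<noteq> 0" using x(1) by (auto simp: y_def)
  moreover have "\<forall>i\<ge>Suc m. y i = 0" using x(2) by (auto simp: y_def)
  ultimately show ?thesis by blast
 qed
qed

section \<open>Zariski topologies\<close>

text \<open>Real affine and complex projective closed sets are treated together: \<open>T\<close> is the set of
  predicates of the form "the polynomial \<open>f\<close> vanishes at \<open>x\<close>", and all that matters is that they are
  closed under disjunction (multiply the polynomials).\<close>

locale zariski =
 fixes S :: "'p set" and T :: "('p => bool) set"
 assumes disj: "s \<in> T ==> t \<in> T ==> \<exists>r\<in>T. \<forall>x\<in>S. r x \<longleftrightarrow> s x \<or> t x"
begin

definition cl :: "'p set => bool" where
 "cl V \<longleftrightarrow> (\<exists>F\<subseteq>T. V = {x\<in>S. \<forall>t\<in>F. t x})"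

definition zc :: "'p set => 'p set" where
 "zc A = {x\<in>S. \<forall>t\<in>T. (\<forall>a\<in>A. t a) --> t x}"

definition prime :: "'p set => bool" where
 "prime A \<longleftrightarrow> A \<noteq> {} \<and> (\<forall>s\<in>T. \<forall>t\<in>T. (\<forall>x\<in>A. s x \<or> t x) --> (\<forall>x\<in>A. s x) \<or> (\<forall>x\<in>A. t x))"

lemma cl_sub: "cl V ==> V \<subseteq> S"
 by (auto simp: cl_def)

lemma cl_Int: "cl A ==> cl B ==> cl (A \<inter> B)"
 unfolding cl_def
proof (elim exE conjE)
 fix F G assume "F \<subseteq> T" "A = {x \<in> S. \<forall>t\<in>F. t x}" "G \<subseteq> T" "B = {x \<in> S. \<forall>t\<in>G. t x}"
 then show "\<exists>F\<subseteq>T. A \<inter> B = {x \<in> S. \<forall>t\<in>F. t x}" by (intro exI[of _ "F \<union> G"]) auto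
qed

lemma cl_test: "t \<in> T ==> cl {x\<in>S. t x}"
 unfolding cl_def by (intro exI[of _ "{t}"]) auto

lemma cl_separate:
 assumes "cl V" "x \<in> S" "x \<notin> V" obtains t where "t \<in> T" "\<forall>v\<in>V. t v" "\<not> t x"
proof -
 obtain F where F: "F \<subseteq> T" "V = {x\<in>S. \<forall>t\<in>F. t x}" using assms(1) by (auto simp: cl_def)
 then obtain t where "t \<in> F" "\<not> t x" using assms(2,3) by auto
 then show ?thesis using F that[of t] by auto
qed

lemma cl_Un: assumes "cl A" "cl B" shows "cl (A \<union> B)"
proof -
 define F where "F = {t\<in>T. \<forall>x\<in>A \<union> B. t x}"
 have "A \<union> B = {x\<in>S. \<forall>t\<in>F. t x}"
 proof
  show "A \<union> B \<subseteq> {x\<in>S. \<forall>t\<in>F. t x}" using cl_sub assms by (auto simp: F_def)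
  show "{x\<in>S. \<forall>t\<in>F. t x} \<subseteq> A \<union> B"
  proof (rule ccontr)
   assume "\<not> ?thesis"
   then obtain x where x: "x \<in> S" "\<forall>t\<in>F. t x" "x \<notin> A" "x \<notin> B" by blast
   obtain s where s: "s \<in> T" "\<forall>v\<in>A. s v" "\<not> s x" by (rule cl_separate[OF assms(1) x(1,3)])
   obtain t where t: "t \<in> T" "\<forall>v\<in>B. t v" "\<not> t x" by (rule cl_separate[OF assms(2) x(1,4)])
   obtain r where r: "r \<in> T" "\<forall>y\<in>S. r y \<longleftrightarrow> s y \<or> t y" using disj[OF s(1) t(1)] by blast
   then have "r \<in> F" using s t cl_sub[OF assms(1)] cl_sub[OF assms(2)] by (auto simp: F_def)
   then show False using x r s t by blast
  qed
 qed
 then show ?thesis unfolding cl_def by (intro exI[of _ F]) (auto simp: F_def)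
qed

text \<open>Irreducibility says that the vanishing ideal is prime, which is the form used in all later
  arguments since it also makes sense for sets that are not closed.\<close>

lemma irreducible_iff: "irreducible_closed cl V \<longleftrightarrow> cl V \<and> prime V"
proof (intro iffI conjI)
 assume irr: "irreducible_closed cl V"
 then show clV: "cl V" by (simp add: irreducible_closed_def)
 show "prime V" unfolding prime_def
 proof (intro conjI ballI impI)
  show "V \<noteq> {}" using irr by (simp add: irreducible_closed_def)
  fix s t assume st: "s \<in> T" "t \<in> T" "\<forall>x\<in>V. s x \<or> t x"
  let ?A = "V \<inter> {x\<in>S. s x}" and ?B = "V \<inter> {x\<in>S. t x}"
  have "V = ?A \<union> ?B" "cl ?A" "cl ?B"
   using st cl_sub[OF clV] by (auto intro!: cl_Int clV cl_test)
  then have "V = ?A \<or> V = ?B" using irr unfolding irreducible_closed_def by blast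
  then show "(\<forall>x\<in>V. s x) \<or> (\<forall>x\<in>V. t x)" by blast
 qed
next
 assume *: "cl V \<and> prime V"
 show "irreducible_closed cl V" unfolding irreducible_closed_def
 proof (intro conjI allI impI)
  show "cl V" "V \<noteq> {}" using * by (auto simp: prime_def)
  fix A B assume AB: "cl A \<and> cl B \<and> V = A \<union> B"
  show "V = A \<or> V = B"
  proof (rule ccontr)
   assume "\<not> ?thesis"
   then obtain x y where xy: "x \<in> V" "x \<notin> A" "y \<in> V" "y \<notin> B" using AB by blast
   have S: "x \<in> S" "y \<in> S" using xy AB cl_sub by blast+
   obtain s where s: "s \<in> T" "\<forall>v\<in>A. s v" "\<not> s x" using cl_separate[OF _ S(1) xy(2)] AB by blast
   obtain t where t: "t \<in> T" "\<forall>v\<in>B. t v" "\<not> t y" using cl_separate[OF _ S(2) xy(4)] AB by blast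
   have "\<forall>v\<in>V. s v \<or> t v" using AB s t by blast
   then show False using * s t xy unfolding prime_def by blast
  qed
 qed
qed

lemma cl_zc: "cl (zc A)"
 unfolding cl_def zc_def by (intro exI[of _ "{t\<in>T. \<forall>a\<in>A. t a}"]) auto

lemma zc_superset: "A \<subseteq> S ==> A \<subseteq> zc A"
 by (auto simp: zc_def)

lemma zcD: "x \<in> zc A ==> t \<in> T ==> (\<forall>a\<in>A. t a) ==> t x"
 unfolding zc_def by (elim CollectE conjE) (drule (1) bspec, drule (1) mp)

lemma zc_least: assumes "cl V" "A \<subseteq> V" shows "zc A \<subseteq> V"
proof
 fix x assume x: "x \<in> zc A"
 then have xS: "x \<in> S" by (simp add: zc_def)
 show "x \<in> V"
 proof (rule ccontr)
  assume "x \<notin> V"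
  then obtain t where t: "t \<in> T" "\<forall>v\<in>V. t v" "\<not> t x" by (rule cl_separate[OF assms(1) xS])
  have "\<forall>a\<in>A. t a" using t(2) assms(2) by auto
  then show False using zcD[OF x t(1)] t(3) by simp
 qed
qed

lemma zc_test: "t \<in> T ==> A \<subseteq> S ==> (\<forall>x\<in>zc A. t x) \<longleftrightarrow> (\<forall>x\<in>A. t x)"
 using zc_superset[of A] by (auto simp: zc_def)

lemma prime_zc: assumes "A \<subseteq> S" "prime A" shows "irreducible_closed cl (zc A)"
 unfolding irreducible_iff
proof (intro conjI cl_zc)
 have ne: "zc A \<noteq> {}" using assms(2) zc_superset[OF assms(1)] unfolding prime_def by blast
 show "prime (zc A)" unfolding prime_def
 proof (intro conjI ballI impI ne)
  fix s t assume st: "s \<in> T" "t \<in> T" "\<forall>x\<in>zc A. s x \<or> t x"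
  then have "\<forall>x\<in>A. s x \<or> t x" using zc_superset[OF assms(1)] by blast
  then have "(\<forall>x\<in>A. s x) \<or> (\<forall>x\<in>A. t x)" using st assms(2) unfolding prime_def by blast
  then show "(\<forall>x\<in>zc A. s x) \<or> (\<forall>x\<in>zc A. t x)" using zc_test[OF _ assms(1)] st by blast
 qed
qed

end

lemma krull_dim_ge:
 fixes F :: "nat => 'a set"
 assumes "\<And>i. i \<le> d ==> irreducible_closed cl (F i)" "\<And>i. i \<le> d ==> F i \<subseteq> V"
  "\<And>i. i < d ==> F i \<subset> F (Suc i)"
 shows "enat d \<le> krull_dim cl V"
 unfolding krull_dim_def using assms by (intro Sup_upper) blast

lemma krull_dim_le:
 assumes "\<And>F. (\<And>i. i \<le> Suc d ==> irreducible_closed cl (F i)) ==> (\<And>i. i \<le> Suc d ==> F i \<subseteq> V) ==>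
  (\<And>i. i < Suc d ==> F i \<subset> F (Suc i)) ==> False"
 shows "krull_dim cl V \<le> enat d"
 unfolding krull_dim_def
proof (rule Sup_least, clarify)
 fix e and F :: "nat => 'a set"
 assume F: "\<forall>i\<le>e. irreducible_closed cl (F i) \<and> F i \<subseteq> V" "\<forall>i<e. F i \<subset> F (Suc i)"
 show "enat e \<le> enat d"
 proof (rule ccontr)
  assume "\<not> ?thesis"
  then have "Suc d \<le> e" by simp
  then show False using F by (intro assms[of F]) auto
 qed
qed

abbreviation Eucl :: "nat => (nat => real) set" where
 "Eucl m \<equiv> topspace (Euclidean_space m)"

lemma Eucl_iff: "x \<in> Eucl m \<longleftrightarrow> (\<forall>i\<ge>m. x i = 0)"
 by (simp add: topspace_Euclidean_space)

definition vanish_tests :: "(('a => real) => bool) set" where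
 "vanish_tests = {\<lambda>x. f x = 0 | f. f \<in> polyfuns}"

lemma vanish_testsI: "f \<in> polyfuns ==> (\<lambda>x. f x = 0) \<in> vanish_tests"
 unfolding vanish_tests_def by (rule CollectI, rule exI[of _ f]) simp

interpretation real_z: zariski "Eucl m" vanish_tests for m
proof
 fix s t :: "(nat => real) => bool" assume "s \<in> vanish_tests" "t \<in> vanish_tests"
 then obtain f g where *: "s = (\<lambda>x. f x = 0)" "f \<in> polyfuns" "t = (\<lambda>x. g x = 0)" "g \<in> polyfuns"
  by (auto simp: vanish_tests_def)
 then have "(\<lambda>x. f x * g x = 0) \<in> vanish_tests" by (intro vanish_testsI polyfuns_mult)
 then show "\<exists>r\<in>vanish_tests. \<forall>x\<in>Eucl m. r x = (s x \<or> t x)"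
  by (intro bexI[of _ "\<lambda>x. f x * g x = 0"]) (simp_all add: *)
qed

lemma real_closed_cl: "real_closed m = real_z.cl m"
proof
 fix V
 show "real_closed m V = real_z.cl m V"
 proof
  assume "real_closed m V"
  then obtain F where F: "V = {x \<in> Eucl m. \<forall>f\<in>F. peval x f = 0}" by (auto simp: real_closed_def)
  show "real_z.cl m V" unfolding real_z.cl_def
   by (rule exI[of _ "(\<lambda>f x. peval x f = 0) ` F"]) (auto simp: F vanish_tests_def)
 next
  assume "real_z.cl m V"
  then obtain F where F: "F \<subseteq> vanish_tests" "V = {x\<in>Eucl m. \<forall>t\<in>F. t x}" by (auto simp: real_z.cl_def)
  show "real_closed m V" unfolding real_closed_def
  proof (rule exI[of _ "{p. (\<lambda>x. peval x p = 0) \<in> F}"])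
   show "V = {x \<in> Eucl m. \<forall>f\<in>{p. (\<lambda>x. peval x p = 0) \<in> F}. peval x f = 0}"
   proof -
    have "\<exists>p. t = (\<lambda>x. peval x p = 0)" if "t \<in> F" for t
     using subsetD[OF F(1) that] unfolding vanish_tests_def polyfuns_def by auto
    then have "F = (\<lambda>p x. peval x p = 0) ` {p. (\<lambda>x. peval x p = 0) \<in> F}" by auto
    then have "(\<forall>t\<in>F. t x) \<longleftrightarrow> (\<forall>t\<in>(\<lambda>p x. peval x p = 0) ` {p. (\<lambda>x. peval x p = 0) \<in> F}. t x)" for x
     by (rule arg_cong)
    then show ?thesis unfolding F(2) by simp
   qed
  qed
 qed
qed

lemma real_closedI:
 assumes "G \<subseteq> polyfuns" "V = {x\<in>Eucl m. \<forall>g\<in>G. g x = 0}"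
 shows "real_closed m V"
 unfolding real_closed_cl real_z.cl_def
 by (rule exI[of _ "(\<lambda>g x. g x = 0) ` G"]) (use assms vanish_testsI in auto)

lemma real_closed_separate:
 assumes "real_closed m V" "x \<in> Eucl m" "x \<notin> V"
 obtains f where "f \<in> polyfuns" "\<forall>v\<in>V. f v = 0" "f x \<noteq> 0"
 using real_z.cl_separate[OF assms[unfolded real_closed_cl]] by (auto simp: vanish_tests_def)

lemma real_closed_Int: "real_closed m A ==> real_closed m B ==> real_closed m (A \<inter> B)"
 by (simp add: real_closed_cl real_z.cl_Int)

lemma real_closed_sub: "real_closed m A ==> A \<subseteq> Eucl m"
 by (simp add: real_closed_cl real_z.cl_sub)

lemma real_closed_zero: "f \<in> polyfuns ==> real_closed m {x\<in>Eucl m. f x = 0}"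
 by (rule real_closedI[of "{f}"]) auto

definition poly_prime :: "('v => real) set => bool" where
 "poly_prime V \<longleftrightarrow> V \<noteq> {} \<and> (\<forall>f\<in>polyfuns. \<forall>g\<in>polyfuns. (\<forall>x\<in>V. f x = 0 \<or> g x = 0) -->
   (\<forall>x\<in>V. f x = 0) \<or> (\<forall>x\<in>V. g x = 0))"

lemma prime_poly_prime: "real_z.prime V = poly_prime V"
proof -
 have T: "vanish_tests = (\<lambda>f x. f x = 0) ` (polyfuns :: (('a => real) => real) set)"
  by (auto simp: vanish_tests_def)
 show ?thesis unfolding real_z.prime_def poly_prime_def unfolding T ball_simps ..
qed

lemma real_irreducible_iff:
 "irreducible_closed (real_closed m) V \<longleftrightarrow> real_closed m V \<and> poly_prime V"
 unfolding real_closed_cl real_z.irreducible_iff prime_poly_prime ..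

lemma real_irreducible_zc:
 "A \<subseteq> Eucl m ==> poly_prime A ==> irreducible_closed (real_closed m) (real_z.zc m A)"
 unfolding real_closed_cl by (rule real_z.prime_zc) (simp_all add: prime_poly_prime)

lemma poly_primeD:
 assumes "poly_prime V" "f \<in> polyfuns" "g \<in> polyfuns" "\<And>x. x \<in> V ==> f x * g x = 0"
  and "p \<in> V" "f p \<noteq> 0" "x \<in> V"
 shows "g x = 0"
 using assms unfolding poly_prime_def mult_eq_0_iff by blast

section \<open>The descending chain condition\<close>

lemma nat_incseq_subseq: "\<exists>r :: nat => nat. strict_mono r \<and> mono (\<lambda>n. a (r n) :: nat)"
proof -
 have ex: "\<exists>j\<ge>N. \<forall>i\<ge>N. a j \<le> a i" for N
  using ex_has_least_nat[of "\<lambda>j. j \<ge> N" N a] by auto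
 define nx where "nx N = (SOME j. j \<ge> N \<and> (\<forall>i\<ge>N. a j \<le> a i))" for N
 have nx: "nx N \<ge> N" "\<And>i. i \<ge> N ==> a (nx N) \<le> a i" for N
  using someI_ex[OF ex[of N]] by (auto simp: nx_def)
 define r where "r = rec_nat (nx 0) (\<lambda>_ j. nx (Suc j))"
 have r0: "r 0 = nx 0" and rS: "r (Suc n) = nx (Suc (r n))" for n by (auto simp: r_def)
 have sm: "strict_mono r" unfolding strict_mono_Suc_iff
 proof
  show "r n < r (Suc n)" for n using nx(1)[of "Suc (r n)"] by (simp add: rS)
 qed
 have "a (r n) \<le> a (r (Suc n))" for n
 proof (cases n)
  case 0 then show ?thesis using nx(2)[of 0] by (simp add: r0)
 next
  case (Suc k)
  have "Suc (r k) \<le> r (Suc n)" using sm Suc by (simp add: Suc_le_eq strict_mono_less)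
  then show ?thesis using nx(2)[of "Suc (r k)" "r (Suc n)"] by (simp add: Suc rS)
 qed
 then show ?thesis using sm by (intro exI[of _ r]) (simp add: mono_iff_le_Suc)
qed

text \<open>Dickson's lemma: pass to a subsequence on which the exponents of each variable in turn are
  weakly increasing.\<close>

lemma dickson:
 fixes M :: "nat => (nat \<Rightarrow>\<^sub>0 nat)"
 assumes "\<And>n. Poly_Mapping.keys (M n) \<subseteq> {..<m}"
 shows "\<exists>i j N. i < j \<and> M j = N + M i"
proof -
 have "\<exists>r :: nat => nat. strict_mono r \<and> (\<forall>i<k. mono (\<lambda>n. Poly_Mapping.lookup (M (r n)) i))" for k
 proof (induction k)
  case 0 then show ?case by (intro exI[of _ id]) (auto simp: strict_mono_def)
 next
  case (Suc k)
  then obtain r :: "nat => nat" where r: "strict_mono r" "\<forall>i<k. mono (\<lambda>n. Poly_Mapping.lookup (M (r n)) i)" by blast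
  obtain q :: "nat => nat" where q: "strict_mono q" "mono (\<lambda>n. Poly_Mapping.lookup (M (r (q n))) k)"
   using nat_incseq_subseq[of "\<lambda>n. Poly_Mapping.lookup (M (r n)) k"] by blast
  have "strict_mono (r \<circ> q)" using r q by (simp add: strict_mono_o)
  moreover have "mono (\<lambda>n. Poly_Mapping.lookup (M ((r \<circ> q) n)) i)" if "i < Suc k" for i
  proof (cases "i = k")
   case True then show ?thesis using q by simp
  next
   case False
   then have "mono (\<lambda>n. Poly_Mapping.lookup (M (r n)) i)" using that r by simp
   then show ?thesis using strict_mono_mono[OF q(1)] unfolding mono_def by simp
  qed
  ultimately show ?case by blast
 qed
 then obtain r :: "nat => nat" where r: "strict_mono r" "\<forall>i<m. mono (\<lambda>n. Poly_Mapping.lookup (M (r n)) i)" by blast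
 have le: "Poly_Mapping.lookup (M (r 0)) i \<le> Poly_Mapping.lookup (M (r 1)) i" for i
 proof (cases "i < m")
  case True then show ?thesis using r(2) by (simp add: mono_def)
 next
  case False
  then have "i \<notin> Poly_Mapping.keys (M (r 0))" using assms by blast
  then show ?thesis by (simp add: in_keys_iff)
 qed
 have "M (r 1) = (M (r 1) - M (r 0)) + M (r 0)"
  using le by (intro poly_mapping_eqI) (simp add: lookup_add lookup_minus)
 moreover have "r 0 < r 1" using r(1) by (simp add: strict_mono_less)
 ultimately show ?thesis by blast
qed

lemma monomial_ge_0: "0 \<le> (N :: nat \<Rightarrow>\<^sub>0 nat)"
proof (rule ccontr)
 assume "\<not> 0 \<le> N"
 then have "N < 0" by simp
 then show False by (simp add: less_poly_mapping.rep_eq less_fun_def)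
qed

lemma no_descending_monomials:
 fixes M :: "nat => (nat \<Rightarrow>\<^sub>0 nat)"
 assumes "\<And>n. Poly_Mapping.keys (M n) \<subseteq> {..<m}" "\<And>n. M (Suc n) < M n"
 shows False
proof -
 obtain i j N where ij: "i < j" "M j = N + M i" using dickson[of M m] assms(1) by blast
 have "M (i + Suc d) < M i" for d
  by (induction d) (use assms(2) less_trans in auto)
 from this[of "j - i - 1"] have "M j < M i" using ij(1) by simp
 moreover have "M i \<le> M j" using ij(2) add_right_mono[OF monomial_ge_0, of "M i" N] by simp
 ultimately show False by simp
qed

text \<open>The linear order on monomials has the least element \<open>0\<close> and is compatible with addition, so by
  Dickson's lemma it is well-founded on the monomials in finitely many variables.\<close>

lemma monomial_min:
 fixes Q :: "(nat \<Rightarrow>\<^sub>0 nat) set"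
 assumes "Q \<noteq> {}" "\<And>M. M \<in> Q ==> Poly_Mapping.keys M \<subseteq> {..<m}"
 shows "\<exists>M\<in>Q. \<forall>M'\<in>Q. M \<le> M'"
proof (rule ccontr)
 assume "\<not> ?thesis"
 then have *: "\<exists>M'\<in>Q. M' < M" if "M \<in> Q" for M using that by (meson not_le)
 obtain M0 where M0: "M0 \<in> Q" using assms(1) by blast
 define nx where "nx M = (SOME M'. M' \<in> Q \<and> M' < M)" for M
 have nx: "nx M \<in> Q" "nx M < M" if "M \<in> Q" for M
  using someI_ex[of "\<lambda>M'. M' \<in> Q \<and> M' < M"] *[OF that] unfolding nx_def by blast+
 define s where "s = rec_nat M0 (\<lambda>_. nx)"
 have s: "s n \<in> Q" for n by (induction n) (auto simp: s_def M0 nx)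
 have "s (Suc n) < s n" for n using nx(2)[OF s[of n]] by (simp add: s_def)
 then show False using no_descending_monomials[of s m] s assms(2) by blast
qed

lemma lookup_single_mult:
 fixes g :: "(nat, real) mpoly"
 shows "Poly_Mapping.lookup (Poly_Mapping.single N c * g) (N + M) = c * Poly_Mapping.lookup g M"
proof -
 have "Poly_Mapping.single N c * g =
   (\<Sum>M'\<in>Poly_Mapping.keys g. Poly_Mapping.single (N + M') (c * Poly_Mapping.lookup g M'))"
  by (subst mpoly_sum_singles[of g]) (simp add: sum_distrib_left mult_single)
 then show ?thesis
  by (simp add: lookup_sum lookup_single when_def in_keys_iff)
qed

definition in_vars :: "nat => (nat, real) mpoly => bool" where
 "in_vars m f \<longleftrightarrow> (\<forall>M\<in>Poly_Mapping.keys f. Poly_Mapping.keys M \<subseteq> {..<m})"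

lemma restrict_vars: "\<exists>g. in_vars m g \<and> (\<forall>x\<in>Eucl m. peval x g = peval x f)"
proof -
 let ?K = "{M\<in>Poly_Mapping.keys f. Poly_Mapping.keys M \<subseteq> {..<m}}"
 define g where "g = (\<Sum>M\<in>?K. Poly_Mapping.single M (Poly_Mapping.lookup f M))"
 have "Poly_Mapping.lookup g M = (if M \<in> ?K then Poly_Mapping.lookup f M else 0)" for M
  by (simp add: g_def lookup_sum lookup_single when_def)
 then have "Poly_Mapping.keys g \<subseteq> ?K" by (auto simp: in_keys_iff[of _ g] split: if_splits)
 then have "in_vars m g" unfolding in_vars_def by blast
 moreover have "peval x g = peval x f" if "x \<in> Eucl m" for x
 proof -
  have "mono_eval x M = 0" if M: "M \<in> Poly_Mapping.keys f - ?K" for M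
  proof -
   obtain i where "i \<in> Poly_Mapping.keys M" "i \<ge> m" using M by force
   then show ?thesis using \<open>x \<in> Eucl m\<close> unfolding mono_eval_def
    by (intro prod_zero bexI[of _ i]) (auto simp: Eucl_iff in_keys_iff)
  qed
  then have "(\<Sum>M\<in>?K. Poly_Mapping.lookup f M * mono_eval x M) = (\<Sum>M\<in>Poly_Mapping.keys f. Poly_Mapping.lookup f M * mono_eval x M)"
   by (intro sum.mono_neutral_left) auto
  moreover have "peval x g = (\<Sum>M\<in>?K. Poly_Mapping.lookup f M * mono_eval x M)"
   by (simp only: g_def peval_sum peval_single)
  moreover have "peval x f = (\<Sum>M\<in>Poly_Mapping.keys f. Poly_Mapping.lookup f M * mono_eval x M)"
   by (simp add: peval_def mono_eval_def)
  ultimately show ?thesis by simp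
 qed
 ultimately show ?thesis by blast
qed

text \<open>This is Hilbert's basis theorem in the form of Gordan's proof. Among the polynomials that
  vanish on \<open>V (Suc k)\<close> but not on \<open>V k\<close> choose \<open>g k\<close> with least leading monomial. By Dickson's lemma some
  leading monomial divides a later one; cancelling it gives a polynomial of the same kind
  as the later one with a smaller leading monomial.\<close>

lemma real_closed_dcc:
 assumes "\<And>k. real_closed m (V k)" "\<And>k. V (Suc k) \<subset> V k"
 shows False
proof -
 have anti: "V j \<subseteq> V i" if "i \<le> j" for i j using assms(2) that by (metis lift_Suc_antimono_le psubset_imp_subset)
 define I where "I k = {f. in_vars m f \<and> (\<forall>x\<in>V k. peval x f = 0)}" for k
 have I_mono: "I i \<subseteq> I j" if "i \<le> j" for i j using anti[OF that] by (auto simp: I_def)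
 define D where "D k = I (Suc k) - I k" for k
 have D_ne: "D k \<noteq> {}" for k
 proof -
  obtain p where p: "p \<in> V k" "p \<notin> V (Suc k)" using assms(2) by blast
  have pE: "p \<in> Eucl m" using p real_closed_sub[OF assms(1)] by blast
  obtain f where f: "f \<in> polyfuns" "\<forall>v\<in>V (Suc k). f v = 0" "f p \<noteq> 0"
   by (rule real_closed_separate[OF assms(1) pE p(2)])
  then obtain f' where f': "f = (\<lambda>x. peval x f')" by (auto simp: polyfuns_def)
  obtain g where g: "in_vars m g" "\<forall>x\<in>Eucl m. peval x g = peval x f'" using restrict_vars by blast
  have "peval x g = f x" if "x \<in> V (Suc k)" for x
   using g(2) subsetD[OF real_closed_sub[OF assms(1)] that] by (simp add: f')
  moreover have "peval p g \<noteq> 0" using g(2) pE f(3) by (simp add: f')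
  ultimately have "g \<in> D k" using g(1) f(2) p(1) unfolding D_def I_def by auto
  then show ?thesis by blast
 qed
 define lm where "lm f = Max (Poly_Mapping.keys f)" for f :: "(nat, real) mpoly"
 have D0: "Poly_Mapping.keys f \<noteq> {}" if "f \<in> D k" for f k
  using that by (auto simp: D_def I_def in_vars_def)
 have lm_in: "lm f \<in> Poly_Mapping.keys f" if "f \<in> D k" for f k
  unfolding lm_def using D0[OF that] by (intro Max_in) auto
 have lm_vars: "Poly_Mapping.keys (lm f) \<subseteq> {..<m}" if "f \<in> D k" for f k
  using lm_in[OF that] that by (auto simp: D_def I_def in_vars_def)
 have "\<exists>g\<in>D k. \<forall>f\<in>D k. lm g \<le> lm f" for k
  using monomial_min[of "lm ` D k" m] D_ne[of k] lm_vars by fastforce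
 then obtain g where g: "\<And>k. g k \<in> D k" "\<And>k f. f \<in> D k ==> lm (g k) \<le> lm f" by metis
 obtain i j N where ij: "i < j" "lm (g j) = N + lm (g i)"
  using dickson[of "\<lambda>k. lm (g k)" m] lm_vars[OF g(1)] by blast
 define c where "c = Poly_Mapping.lookup (g j) (lm (g j)) / Poly_Mapping.lookup (g i) (lm (g i))"
 define h where "h = g j + Poly_Mapping.single N (- c) * g i"
 have nz: "Poly_Mapping.lookup (g i) (lm (g i)) \<noteq> 0" using lm_in[OF g(1)[of i]] by (simp add: in_keys_iff)
 have keys_h: "M \<in> Poly_Mapping.keys (g j) \<or> (\<exists>M'\<in>Poly_Mapping.keys (g i). M = N + M')"
  if "M \<in> Poly_Mapping.keys h" for M
  using that keys_add[of "g j" "Poly_Mapping.single N (- c) * g i"]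
   keys_mult[of "Poly_Mapping.single N (-c)" "g i"] unfolding h_def by (auto split: if_splits)
 have N: "Poly_Mapping.keys N \<subseteq> {..<m}"
 proof -
  have "Poly_Mapping.keys N \<subseteq> Poly_Mapping.keys (N + lm (g i))" by (auto simp: in_keys_iff lookup_add)
  then show ?thesis using lm_vars[OF g(1)[of j]] unfolding ij(2) by blast
 qed
 have "in_vars m h" unfolding in_vars_def
 proof
  fix M assume "M \<in> Poly_Mapping.keys h"
  from keys_h[OF this] show "Poly_Mapping.keys M \<subseteq> {..<m}"
   using g(1)[of i] g(1)[of j] N keys_add[of N] unfolding D_def I_def in_vars_def by blast
 qed
 have gi: "peval x (g i) = 0" if "x \<in> V j" for x
  using g(1)[of i] anti[of "Suc i" j] ij(1) that by (auto simp: D_def I_def)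
 have hx: "peval x h = peval x (g j)" if "x \<in> V j" for x
  using gi[OF that] by (simp add: h_def peval_add peval_mult)
 have "h \<in> D j"
  using \<open>in_vars m h\<close> g(1)[of j] hx anti[of j "Suc j"] unfolding D_def I_def by auto
 then have le: "lm (g j) \<le> lm h" using g(2) by blast
 have "lm h \<in> Poly_Mapping.keys h" using lm_in[OF \<open>h \<in> D j\<close>] .
 moreover have "lm h \<le> lm (g j)" using keys_h[OF calculation]
 proof
  assume "lm h \<in> Poly_Mapping.keys (g j)" then show ?thesis unfolding lm_def by simp
 next
  assume "\<exists>M'\<in>Poly_Mapping.keys (g i). lm h = N + M'"
  then obtain M' where M': "M' \<in> Poly_Mapping.keys (g i)" "lm h = N + M'" by blast
  then have "M' \<le> lm (g i)" unfolding lm_def by simp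
  then show ?thesis unfolding M'(2) ij(2) by (rule add_left_mono)
 qed
 ultimately have "lm (g j) \<in> Poly_Mapping.keys h" using le by simp
 moreover have "Poly_Mapping.lookup h (lm (g j)) = 0"
  unfolding h_def lookup_add ij(2) lookup_single_mult using nz by (simp add: c_def ij(2))
 ultimately show False by (simp add: in_keys_iff)
qed

lemma real_closed_minimal:
 assumes "V \<in> Q" "\<And>V. V \<in> Q ==> real_closed m V"
 shows "\<exists>Y\<in>Q. \<forall>Y'\<in>Q. \<not> Y' \<subset> Y"
proof (rule ccontr)
 assume "\<not> ?thesis"
 then have *: "\<exists>Y'\<in>Q. Y' \<subset> Y" if "Y \<in> Q" for Y using that by blast
 define nx where "nx Y = (SOME Y'. Y' \<in> Q \<and> Y' \<subset> Y)" for Y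
 have nx: "nx Y \<in> Q" "nx Y \<subset> Y" if "Y \<in> Q" for Y
  using someI_ex[of "\<lambda>Y'. Y' \<in> Q \<and> Y' \<subset> Y"] *[OF that] unfolding nx_def by blast+
 define s where "s = rec_nat V (\<lambda>_. nx)"
 have s: "s n \<in> Q" for n by (induction n) (auto simp: s_def assms nx)
 have "s (Suc n) \<subset> s n" for n using nx(2)[OF s[of n]] by (simp add: s_def)
 then show False using real_closed_dcc[of m s] s assms(2) by blast
qed

section \<open>Great circles\<close>

lemma dot_commute: "dot m u v = dot m v u"
 by (simp add: dot_def mult.commute)

lemma dot_lc: "dot m (\<lambda>i. s * u i + t * v i) w = s * dot m u w + t * dot m v w"
 by (simp add: dot_def sum.distrib sum_distrib_left algebra_simps)

lemma dot_lc': "dot m w (\<lambda>i. s * u i + t * v i) = s * dot m w u + t * dot m w v"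
 by (simp add: dot_def sum.distrib sum_distrib_left algebra_simps)

lemma dot_scale: "dot m (\<lambda>i. s * u i) w = s * dot m u w" "dot m w (\<lambda>i. s * u i) = s * dot m w u"
 by (simp_all add: dot_def sum_distrib_left algebra_simps)

lemma dot_polyfuns [intro, simp]: "(\<lambda>x. dot m a x) \<in> polyfuns"
 unfolding dot_def by (intro polyfuns_sum polyfuns_mult polyfuns_const polyfuns_var)

lemma dot_self_polyfuns [intro, simp]: "(\<lambda>x. dot m x x) \<in> polyfuns"
 unfolding dot_def by (intro polyfuns_sum polyfuns_mult polyfuns_const polyfuns_var)

lemma dot_self_ge: "0 \<le> dot m x x"
 by (simp add: dot_def sum_nonneg)

lemma dot_self_0: assumes "x \<in> Eucl m" "dot m x x = 0" shows "x = (\<lambda>i. 0)"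
proof
 fix i
 have "\<forall>i\<in>{..<m}. x i * x i = 0"
  using assms(2) unfolding dot_def by (subst (asm) sum_nonneg_eq_0_iff) auto
 then show "x i = 0" using assms(1) by (cases "i < m") (auto simp: Eucl_iff)
qed

lemma dot_self_pos: assumes "x \<in> Eucl m" "x \<noteq> (\<lambda>i. 0)" shows "0 < dot m x x"
 using dot_self_0[OF assms(1)] assms(2) dot_self_ge[of m x] by fastforce

lemma Eucl_lc [intro]: "u \<in> Eucl m ==> v \<in> Eucl m ==> (\<lambda>i. s * u i + t * v i) \<in> Eucl m"
 by (simp add: Eucl_iff)

lemma Eucl_scale [intro]: "u \<in> Eucl m ==> (\<lambda>i. s * u i) \<in> Eucl m"
 by (simp add: Eucl_iff)

lemma nsphere_iff: "x \<in> topspace (nsphere n) \<longleftrightarrow> x \<in> Eucl (Suc n) \<and> dot (Suc n) x x = 1"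
 by (auto simp: nsphere Eucl_iff dot_def power2_eq_square lessThan_Suc_atMost)

definition ortho :: "nat => (nat => real) => (nat => real) => bool" where
 "ortho m u v \<longleftrightarrow> u \<in> Eucl m \<and> v \<in> Eucl m \<and> dot m u u = 1 \<and> dot m v v = 1 \<and> dot m u v = 0"

definition plane :: "(nat => real) => (nat => real) => (nat => real) set" where
 "plane u v = {\<lambda>i. s * u i + t * v i | s t. True}"

definition gcirc :: "nat => (nat => real) => (nat => real) => (nat => real) set" where
 "gcirc m u v = {x \<in> plane u v. dot m x x = 1}"

definition indep2 :: "(nat => real) => (nat => real) => bool" where
 "indep2 u v \<longleftrightarrow> (\<forall>s t. (\<forall>i. s * u i + t * v i = 0) --> s = 0 \<and> t = 0)"

lemma indep2D: "indep2 u v ==> (\<And>i. s * u i + t * v i = 0) ==> s = 0 \<and> t = 0"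
 unfolding indep2_def by blast

lemma plane_memI [intro]: "(\<lambda>i. s * u i + t * v i) \<in> plane u v"
 unfolding plane_def by blast

lemma plane_mem: "u \<in> plane u v" "v \<in> plane u v"
 using plane_memI[of 1 u 0 v] plane_memI[of 0 u 1 v] by simp_all

lemma plane_lc: assumes "x \<in> plane u v" "y \<in> plane u v" shows "(\<lambda>i. s * x i + t * y i) \<in> plane u v"
proof -
 obtain a b c d where "x = (\<lambda>i. a * u i + b * v i)" "y = (\<lambda>i. c * u i + d * v i)"
  using assms by (auto simp: plane_def)
 then have "(\<lambda>i. s * x i + t * y i) = (\<lambda>i. (s * a + t * c) * u i + (s * b + t * d) * v i)"
  by (auto simp: algebra_simps)
 then show ?thesis by (simp only: plane_memI)
qed

lemma plane_subset: "x \<in> plane u v ==> y \<in> plane u v ==> plane x y \<subseteq> plane u v"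
 unfolding plane_def[of x y] using plane_lc by blast

lemma plane_Eucl: "u \<in> Eucl m ==> v \<in> Eucl m ==> plane u v \<subseteq> Eucl m"
 unfolding plane_def by blast

lemma indep2_plane_eq:
 assumes "indep2 x y" "x \<in> plane u v" "y \<in> plane u v"
 shows "plane x y = plane u v"
proof
 show "plane x y \<subseteq> plane u v" using assms plane_subset by blast
 obtain a b c d where x: "x = (\<lambda>i. a * u i + b * v i)" and y: "y = (\<lambda>i. c * u i + d * v i)"
  using assms by (auto simp: plane_def)
 have "a * d - b * c \<noteq> 0"
 proof
  assume *: "a * d - b * c = 0"
  have "d * x i + (- b) * y i = (a * d - b * c) * u i" "c * x i + (- a) * y i = - (a * d - b * c) * v i" for i
   by (auto simp: x y algebra_simps)
  then have z: "d * x i + (- b) * y i = 0" "c * x i + (- a) * y i = 0" for i unfolding * by simp_all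
  have "d = 0 \<and> - b = 0" by (rule indep2D[OF assms(1)]) (rule z)
  moreover have "c = 0 \<and> - a = 0" by (rule indep2D[OF assms(1)]) (rule z)
  ultimately have "a = 0" "b = 0" by simp_all
  then show False using indep2D[OF assms(1), of 1 0] by (simp add: x)
 qed
 moreover define D where "D = a * d - b * c"
 ultimately have D: "D \<noteq> 0" by simp
 have "d * x i - b * y i = D * u i" "a * y i - c * x i = D * v i" for i
  by (auto simp: x y D_def algebra_simps)
 then have "u i = (d * x i - b * y i) / D" "v i = (a * y i - c * x i) / D" for i using D by simp_all
 then have "u = (\<lambda>i. d / D * x i + (- b / D) * y i)" "v = (\<lambda>i. (- c / D) * x i + a / D * y i)"
  by (auto simp: diff_divide_distrib)
 then have "u \<in> plane x y" "v \<in> plane x y" by (metis plane_memI)+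
 then show "plane u v \<subseteq> plane x y" by (rule plane_subset)
qed

lemma ortho_indep2: assumes "ortho m u v" shows "indep2 u v"
 unfolding indep2_def
proof (intro allI impI)
 fix s t assume "\<forall>i. s * u i + t * v i = 0"
 then have *: "(\<lambda>i. s * u i + t * v i) = (\<lambda>i. 0)" by auto
 have "dot m u (\<lambda>i. s * u i + t * v i) = s" "dot m v (\<lambda>i. s * u i + t * v i) = t"
  using assms by (auto simp: dot_lc' ortho_def dot_commute)
 then show "s = 0 \<and> t = 0" unfolding * by (simp add: dot_def)
qed

lemma great_circle_iff: "great_circle n C \<longleftrightarrow> (\<exists>u v. ortho (Suc n) u v \<and> C = gcirc (Suc n) u v)"
proof -
 have "{\<lambda>i. 0 i + 1 * (cos t * u i + sin t * v i) | t. True} = gcirc (Suc n) u v" if "ortho (Suc n) u v" for u v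
 proof -
  have d: "dot (Suc n) (\<lambda>i. a * u i + b * v i) (\<lambda>i. a * u i + b * v i) = a\<^sup>2 + b\<^sup>2" for a b
   using that by (simp add: dot_lc dot_lc' ortho_def dot_commute[of _ v u] power2_eq_square)
  show ?thesis
  proof (intro equalityI subsetI)
   fix x assume "x \<in> {\<lambda>i. 0 i + 1 * (cos t * u i + sin t * v i) | t. True}"
   then obtain t where "x = (\<lambda>i. cos t * u i + sin t * v i)" by auto
   then show "x \<in> gcirc (Suc n) u v" unfolding gcirc_def using d[of "cos t" "sin t"] by auto
  next
   fix x assume "x \<in> gcirc (Suc n) u v"
   then obtain a b where x: "x = (\<lambda>i. a * u i + b * v i)" "dot (Suc n) x x = 1" by (auto simp: gcirc_def plane_def)
   then have "a\<^sup>2 + b\<^sup>2 = 1" using d by simp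
   then obtain t where "a = cos t" "b = sin t" using sincos_total_2pi by metis
   then show "x \<in> {\<lambda>i. 0 i + 1 * (cos t * u i + sin t * v i) | t. True}" using x by auto
  qed
 qed
 then show ?thesis unfolding great_circle_def circle_around_def ortho_def by (metis (no_types, lifting))
qed

lemma gcirc_great:
 assumes "indep2 x y" "x \<in> Eucl (Suc n)" "y \<in> Eucl (Suc n)"
 shows "great_circle n (gcirc (Suc n) x y)"
proof -
 let ?d = "dot (Suc n)"
 have x0: "x \<noteq> (\<lambda>i. 0)"
 proof
  assume "x = (\<lambda>i. 0)" then show False using indep2D[OF assms(1), of 1 0] by simp
 qed
 define u where "u = (\<lambda>i. (1 / sqrt (?d x x)) * x i)"
 have dx: "?d x x > 0" using dot_self_pos assms x0 by blast
 then have uu: "?d u u = 1" unfolding u_def dot_scale by (simp add: field_simps)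
 define w where "w = (\<lambda>i. 1 * y i + (- ?d y u) * u i)"
 have uw: "?d u w = 0" using uu unfolding w_def dot_lc' by (simp add: dot_commute)
 have uE: "u \<in> Eucl (Suc n)" unfolding u_def using assms by blast
 have wE: "w \<in> Eucl (Suc n)" unfolding w_def using assms uE by blast
 have w0: "w \<noteq> (\<lambda>i. 0)"
 proof
  assume "w = (\<lambda>i. 0)"
  then have "\<forall>i. (- ?d y u / sqrt (?d x x)) * x i + 1 * y i = 0"
   unfolding w_def u_def by (auto simp: fun_eq_iff algebra_simps)
  then show False using indep2D[OF assms(1), of _ 1] by (metis zero_neq_one)
 qed
 define v where "v = (\<lambda>i. (1 / sqrt (?d w w)) * w i)"
 have dw: "?d w w > 0" using dot_self_pos wE w0 by blast
 then have vv: "?d v v = 1" unfolding v_def dot_scale by (simp add: field_simps)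
 have "?d u v = 0" unfolding v_def dot_scale uw by simp
 then have o: "ortho (Suc n) u v" using uu vv uE wE unfolding ortho_def v_def by blast
 have up: "u \<in> plane x y" unfolding u_def using plane_memI[of "1 / sqrt (?d x x)" x 0 y] by simp
 have wp: "w \<in> plane x y" unfolding w_def by (rule plane_lc[OF plane_mem(2) up])
 have "v \<in> plane x y" unfolding v_def using plane_lc[OF wp wp, of "1 / sqrt (?d w w)" 0] by simp
 then have "plane u v = plane x y" using indep2_plane_eq[OF ortho_indep2[OF o]] up by blast
 then have "gcirc (Suc n) x y = gcirc (Suc n) u v" unfolding gcirc_def by simp
 then show ?thesis unfolding great_circle_iff using o by blast
qed

lemma great_circle_plane:
 assumes "great_circle n C" "x \<in> C" "y \<in> C" "y \<noteq> x" "y \<noteq> (\<lambda>i. - x i)"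
 shows "C = gcirc (Suc n) x y \<and> indep2 x y"
proof -
 obtain u v where uv: "ortho (Suc n) u v" "C = gcirc (Suc n) u v" using assms(1) great_circle_iff by blast
 have d: "dot (Suc n) x x = 1" "dot (Suc n) y y = 1" using assms uv by (auto simp: gcirc_def)
 have "indep2 x y" unfolding indep2_def
 proof (intro allI impI)
  fix s t assume *: "\<forall>i. s * x i + t * y i = 0"
  have t0: "t = 0"
  proof (rule ccontr)
   assume t: "t \<noteq> 0"
   then have y: "y = (\<lambda>i. (- s / t) * x i)" using * by (auto simp: fun_eq_iff field_simps add_eq_0_iff2)
   have "(- s / t) * ((- s / t) * 1) = 1" using d(2) unfolding y dot_scale d(1) .
   then have "(- s / t)\<^sup>2 = 1" by (simp only: power2_eq_square mult_1_right)
   then consider "- s / t = 1" | "- s / t = -1" unfolding power2_eq_1_iff by blast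
   then show False
   proof cases
    case 1 then show False using y assms(4) by (simp only: mult_1)
   next
    case 2 then show False using y assms(5) by (simp only: mult_minus1)
   qed
  qed
  have "dot (Suc n) (\<lambda>i. s * x i) x = s" using d by (simp add: dot_scale)
  moreover have "(\<lambda>i. s * x i) = (\<lambda>i. 0)" using * t0 by auto
  ultimately have "s = 0" by (simp add: dot_def)
  then show "s = 0 \<and> t = 0" using t0 by simp
 qed
 moreover have "plane x y = plane u v"
  using indep2_plane_eq[OF calculation] assms uv by (auto simp: gcirc_def)
 ultimately show ?thesis using uv by (simp add: gcirc_def)
qed

lemma great_circle_sphere: "great_circle n C ==> x \<in> C ==> x \<in> Eucl (Suc n) \<and> dot (Suc n) x x = 1"
 unfolding great_circle_iff gcirc_def ortho_def using plane_Eucl by fastforce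

lemma great_circle_minus: assumes "great_circle n C" "x \<in> C" shows "(\<lambda>i. - x i) \<in> C"
proof -
 obtain u v where C: "C = gcirc (Suc n) u v" using assms(1) great_circle_iff by blast
 then have "x \<in> plane u v" "dot (Suc n) x x = 1" using assms(2) by (auto simp: gcirc_def)
 then show ?thesis unfolding C gcirc_def using plane_lc[of x u v x "-1" 0] by (simp add: dot_def)
qed

lemma great_circle_eqI:
 assumes "great_circle n C" "great_circle n D" "x \<in> C" "y \<in> C" "x \<in> D" "y \<in> D" "y \<noteq> x" "y \<noteq> (\<lambda>i. - x i)"
 shows "C = D"
 using great_circle_plane assms by metis

lemma great_circle_closed: assumes "great_circle n C" shows "real_closed (Suc n) C"
proof -
 obtain u v where uv: "ortho (Suc n) u v" "C = gcirc (Suc n) u v" using assms(1) great_circle_iff by blast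
 let ?d = "dot (Suc n)"
 let ?G = "insert (\<lambda>x. ?d x x - 1) (range (\<lambda>i x. x i - (?d u x * u i + ?d v x * v i)))"
 show ?thesis
 proof (rule real_closedI)
  show "?G \<subseteq> polyfuns"
   by (auto intro!: polyfuns_diff polyfuns_add polyfuns_mult polyfuns_const polyfuns_var)
  show "C = {x \<in> Eucl (Suc n). \<forall>g\<in>?G. g x = 0}"
  proof (intro equalityI subsetI)
   fix x assume "x \<in> C"
   then obtain s t where x: "x = (\<lambda>i. s * u i + t * v i)" "?d x x = 1" using uv by (auto simp: gcirc_def plane_def)
   have "?d u x = s" "?d v x = t" using uv(1) unfolding x(1) by (auto simp: dot_lc' ortho_def dot_commute)
   then show "x \<in> {x \<in> Eucl (Suc n). \<forall>g\<in>?G. g x = 0}"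
    using x great_circle_sphere[OF assms \<open>x \<in> C\<close>] by simp
  next
   fix x assume "x \<in> {x \<in> Eucl (Suc n). \<forall>g\<in>?G. g x = 0}"
   then have "?d x x = 1" "x = (\<lambda>i. ?d u x * u i + ?d v x * v i)" by auto
   moreover have "(\<lambda>i. ?d u x * u i + ?d v x * v i) \<in> plane u v" by (rule plane_memI)
   ultimately show "x \<in> C" unfolding uv(2) gcirc_def by simp
  qed
 qed
qed

section \<open>Polynomials on circles\<close>

text \<open>The circle is parametrised rationally, and the factor \<open>(1 + s\<^sup>2) ^ k\<close> clears the denominators.\<close>

lemma circle_rational:
 assumes "f \<in> polyfuns"
 shows "\<exists>P k. \<forall>s::real. f (\<lambda>i. c i + ((1 - s\<^sup>2) / (1 + s\<^sup>2)) * u i + (2 * s / (1 + s\<^sup>2)) * v i) * (1 + s\<^sup>2) ^ k = poly P s"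
 using assms
proof (induction f rule: polyfuns_induct)
 case (const a)
 show ?case by (rule exI[of _ "[:a:]"], rule exI[of _ 0]) simp
next
 case (var i)
 have "(c i + ((1 - s\<^sup>2) / (1 + s\<^sup>2)) * u i + (2 * s / (1 + s\<^sup>2)) * v i) * (1 + s\<^sup>2) ^ 1
   = poly ([:c i:] * [:1,0,1:] + [:u i:] * [:1,0,-1:] + [:v i:] * [:0,2:]) s" for s
 proof -
  have "1 + s\<^sup>2 \<noteq> 0" by (metis add_nonneg_eq_0_iff one_neq_zero zero_le_one zero_le_power2)
  then have "(c i + ((1 - s\<^sup>2) / (1 + s\<^sup>2)) * u i + (2 * s / (1 + s\<^sup>2)) * v i) * (1 + s\<^sup>2) ^ 1
    = c i * (1 + s\<^sup>2) + (1 - s\<^sup>2) * u i + 2 * s * v i" by (simp add: distrib_right)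
  then show ?thesis by (simp add: power2_eq_square algebra_simps)
 qed
 then show ?case by blast
next
 case (add f g)
 let ?x = "\<lambda>s i. c i + ((1 - s\<^sup>2) / (1 + s\<^sup>2)) * u i + (2 * s / (1 + s\<^sup>2)) * v i"
 obtain P k Q l where "\<And>s. f (?x s) * (1 + s\<^sup>2) ^ k = poly P s" "\<And>s. g (?x s) * (1 + s\<^sup>2) ^ l = poly Q s"
  using add.IH by blast
 moreover have "(f (?x s) + g (?x s)) * (1 + s\<^sup>2) ^ (k + l) =
   (f (?x s) * (1 + s\<^sup>2) ^ k) * (1 + s\<^sup>2) ^ l + (g (?x s) * (1 + s\<^sup>2) ^ l) * (1 + s\<^sup>2) ^ k" for s
  by (simp add: power_add algebra_simps)
 ultimately have "(f (?x s) + g (?x s)) * (1 + s\<^sup>2) ^ (k + l) = poly (P * [:1,0,1:] ^ l + Q * [:1,0,1:] ^ k) s" for s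
  by (simp add: poly_power power2_eq_square)
 then show ?case by blast
next
 case (mult f g)
 let ?x = "\<lambda>s i. c i + ((1 - s\<^sup>2) / (1 + s\<^sup>2)) * u i + (2 * s / (1 + s\<^sup>2)) * v i"
 obtain P k Q l where "\<And>s. f (?x s) * (1 + s\<^sup>2) ^ k = poly P s" "\<And>s. g (?x s) * (1 + s\<^sup>2) ^ l = poly Q s"
  using mult.IH by blast
 moreover have "(f (?x s) * g (?x s)) * (1 + s\<^sup>2) ^ (k + l) =
   (f (?x s) * (1 + s\<^sup>2) ^ k) * (g (?x s) * (1 + s\<^sup>2) ^ l)" for s
  by (simp add: power_add algebra_simps)
 ultimately have "(f (?x s) * g (?x s)) * (1 + s\<^sup>2) ^ (k + l) = poly (P * Q) s" for s
  by simp
 then show ?case by blast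
qed

text \<open>The parametrisation starts at an arbitrary given point \<open>x\<close>, so it does not matter that it misses the
  opposite point.\<close>

lemma circle_param_infinite_zeros:
 assumes f: "f \<in> polyfuns"
  and C: "C = {\<lambda>i. c i + a * u i + b * v i | a b. a\<^sup>2 + b\<^sup>2 = (1::real)}"
  and inf: "infinite {x\<in>C. f x = 0}" and x: "x \<in> C"
 shows "f x = 0"
proof -
 obtain a0 b0 where ab0: "x = (\<lambda>i. c i + a0 * u i + b0 * v i)" "a0\<^sup>2 + b0\<^sup>2 = 1" using x C by blast
 define u' where "u' = (\<lambda>i. a0 * u i + b0 * v i)"
 define v' where "v' = (\<lambda>i. (- b0) * u i + a0 * v i)"
 define X where "X s = (\<lambda>i. c i + ((1 - s\<^sup>2) / (1 + s\<^sup>2)) * u' i + (2 * s / (1 + s\<^sup>2)) * v' i)" for s :: real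
 obtain P k where P: "\<And>s. f (X s) * (1 + s\<^sup>2) ^ k = poly P s"
  using circle_rational[OF f, of c u' v'] unfolding X_def by blast
 define anti where "anti = (\<lambda>i. c i + (-1) * u' i)"
 have cover: "\<exists>s. y = X s" if y: "y \<in> C" "y \<noteq> anti" for y
 proof -
  obtain a b where ab: "y = (\<lambda>i. c i + a * u i + b * v i)" "a\<^sup>2 + b\<^sup>2 = 1" using y C by blast
  define a' where "a' = a * a0 + b * b0"
  define b' where "b' = b * a0 - a * b0"
  have e: "a'\<^sup>2 + b'\<^sup>2 = 1"
  proof -
   have "a'\<^sup>2 + b'\<^sup>2 = (a\<^sup>2 + b\<^sup>2) * (a0\<^sup>2 + b0\<^sup>2)" unfolding a'_def b'_def by algebra
   then show ?thesis using ab ab0 by simp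
  qed
  have ab': "a = a' * a0 - b' * b0" "b = a' * b0 + b' * a0"
   using ab0(2) unfolding a'_def b'_def by algebra+
  have y': "y = (\<lambda>i. c i + a' * u' i + b' * v' i)"
  proof
   fix i
   have "y i = c i + (a' * a0 - b' * b0) * u i + (a' * b0 + b' * a0) * v i"
    unfolding ab(1) ab'[symmetric] ..
   then show "y i = c i + a' * u' i + b' * v' i" unfolding u'_def v'_def by (simp add: algebra_simps)
  qed
  have "a' \<noteq> -1"
  proof
   assume "a' = -1"
   then have "b' = 0" using e by simp
   then show False using y(2) y' \<open>a' = -1\<close> by (simp add: anti_def)
  qed
  then have a1: "1 + a' \<noteq> 0" by linarith
  define s where "s = b' / (1 + a')"
  have s2: "1 + s\<^sup>2 = 2 / (1 + a')"
  proof -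
   have "1 + s\<^sup>2 = ((1 + a')\<^sup>2 + b'\<^sup>2) / (1 + a')\<^sup>2" using a1 by (simp add: s_def field_simps)
   also have "(1 + a')\<^sup>2 + b'\<^sup>2 = 2 * (1 + a')" using e by (simp add: power2_eq_square algebra_simps)
   finally have "1 + s\<^sup>2 = 2 * (1 + a') / ((1 + a') * (1 + a'))" unfolding power2_eq_square .
   also have "\<dots> = 2 / (1 + a')" using a1 by (rule nonzero_mult_divide_mult_cancel_right)
   finally show ?thesis .
  qed
  then have "1 - s\<^sup>2 = 2 - 2 / (1 + a')" by linarith
  then have "(1 - s\<^sup>2) / (1 + s\<^sup>2) = a'" unfolding s2 using a1 by (simp add: field_simps)
  moreover have "2 * s / (1 + s\<^sup>2) = b'" unfolding s2 using a1 by (simp add: s_def)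
  ultimately have "y = X s" unfolding X_def y' by simp
  then show ?thesis ..
 qed
 have "P = 0"
 proof (rule ccontr)
  assume "P \<noteq> 0"
  then have "finite {s. poly P s = 0}" by (rule poly_roots_finite)
  moreover have "{x\<in>C. f x = 0} \<subseteq> insert anti (X ` {s. poly P s = 0})"
  proof
   fix y assume y: "y \<in> {x\<in>C. f x = 0}"
   show "y \<in> insert anti (X ` {s. poly P s = 0})"
   proof (cases "y = anti")
    case False
    then obtain s where "y = X s" using cover y by blast
    then show ?thesis using P[of s] y by auto
   qed simp
  qed
  ultimately show False using inf finite_subset by blast
 qed
 moreover have "X 0 = x" unfolding X_def ab0(1) u'_def by (simp add: algebra_simps)
 ultimately show ?thesis using P[of 0] by simp
qed

lemma circle_around_param:
 assumes "circle_around m c r C"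
 obtains u v where "ortho m u v" "C = {\<lambda>i. c i + a * (r * u i) + b * (r * v i) | a b. a\<^sup>2 + b\<^sup>2 = (1::real)}"
  "C = {\<lambda>i. c i + r * (cos t * u i + sin t * v i) | t. True}"
proof -
 obtain u v where uv: "ortho m u v" "C = {\<lambda>i. c i + r * (cos t * u i + sin t * v i) | t. True}"
  using assms unfolding circle_around_def ortho_def by blast
 have "C = {\<lambda>i. c i + a * (r * u i) + b * (r * v i) | a b. a\<^sup>2 + b\<^sup>2 = (1::real)}"
 proof (intro equalityI subsetI)
  fix x assume "x \<in> C"
  then obtain t where "x = (\<lambda>i. c i + r * (cos t * u i + sin t * v i))" using uv by blast
  then have "x = (\<lambda>i. c i + cos t * (r * u i) + sin t * (r * v i))" by (simp add: algebra_simps)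
  then show "x \<in> {\<lambda>i. c i + a * (r * u i) + b * (r * v i) | a b. a\<^sup>2 + b\<^sup>2 = (1::real)}"
   using sin_cos_squared_add2[of t] by blast
 next
  fix x assume "x \<in> {\<lambda>i. c i + a * (r * u i) + b * (r * v i) | a b. a\<^sup>2 + b\<^sup>2 = (1::real)}"
  then obtain a b where x: "x = (\<lambda>i. c i + a * (r * u i) + b * (r * v i))" "a\<^sup>2 + b\<^sup>2 = 1" by blast
  obtain t where "a = cos t" "b = sin t" using sincos_total_2pi x(2) by metis
  then have "x = (\<lambda>i. c i + r * (cos t * u i + sin t * v i))" using x by (simp add: algebra_simps)
  then show "x \<in> C" using uv by blast
 qed
 then show thesis using that uv by blast
qed

lemma circle_finite_zeros:
 assumes "circle_around m c r C" "f \<in> polyfuns" "p \<in> C" "f p \<noteq> 0"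
 shows "finite {x\<in>C. f x = 0}"
proof (rule ccontr)
 assume inf: "infinite {x\<in>C. f x = 0}"
 obtain u v where "C = {\<lambda>i. c i + a * (r * u i) + b * (r * v i) | a b. a\<^sup>2 + b\<^sup>2 = (1::real)}"
  by (rule circle_around_param[OF assms(1)])
 from circle_param_infinite_zeros[OF assms(2) this inf assms(3)] show False using assms(4) by simp
qed

lemma circle_infinite:
 assumes "circle_around m c r C" "r \<noteq> 0"
 shows "infinite C"
proof
 assume fin: "finite C"
 obtain u v where uv: "ortho m u v" "C = {\<lambda>i. c i + r * (cos t * u i + sin t * v i) | t. True}"
  by (rule circle_around_param[OF assms(1)])
 define g where "g x = (dot m u x - dot m u c) / r" for x
 have "{-1..1} \<subseteq> g ` C"
 proof
  fix a :: real assume "a \<in> {-1..1}"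
  then have "cos (arccos a) = a" by (simp add: cos_arccos)
  moreover define x where "x = (\<lambda>i. c i + r * (cos (arccos a) * u i + sin (arccos a) * v i))"
  moreover have "dot m u x = dot m u c + r * (cos (arccos a) * dot m u u + sin (arccos a) * dot m u v)"
   unfolding x_def dot_def by (simp add: algebra_simps sum.distrib sum_distrib_left)
  ultimately have "g x = a" using uv(1) assms(2) by (simp add: g_def ortho_def)
  moreover have "x \<in> C" using uv x_def by blast
  ultimately show "a \<in> g ` C" by blast
 qed
 then have "finite {-1..1::real}" using fin finite_surj by blast
 then show False by (simp add: infinite_Icc)
qed

lemma circle_prime:
 assumes "circle_around m c r C" "r \<noteq> 0"
 shows "poly_prime C"
 unfolding poly_prime_def
proof (intro conjI ballI impI)
 show "C \<noteq> {}" using circle_infinite[OF assms] by auto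
 fix f g :: "(nat => real) => real" assume fg: "f \<in> polyfuns" "g \<in> polyfuns" "\<forall>x\<in>C. f x = 0 \<or> g x = 0"
 show "(\<forall>x\<in>C. f x = 0) \<or> (\<forall>x\<in>C. g x = 0)"
 proof (rule ccontr)
  assume "\<not> ?thesis"
  then have "finite {x\<in>C. f x = 0}" "finite {x\<in>C. g x = 0}"
   using circle_finite_zeros[OF assms(1)] fg by blast+
  moreover have "C \<subseteq> {x\<in>C. f x = 0} \<union> {x\<in>C. g x = 0}" using fg(3) by blast
  ultimately show False using circle_infinite[OF assms] finite_subset by blast
 qed
qed

lemma great_circle_around: "great_circle n C ==> circle_around (Suc n) 0 1 C"
 by (simp add: great_circle_def)

lemma great_circle_finite_meet:
 assumes "great_circle n C" "real_closed (Suc n) B" "p \<in> C" "p \<notin> B"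
 shows "finite (C \<inter> B)"
proof -
 have "p \<in> Eucl (Suc n)" using great_circle_sphere assms by blast
 then obtain f where f: "f \<in> polyfuns" "\<forall>v\<in>B. f v = 0" "f p \<noteq> 0"
  using real_closed_separate[OF assms(2)] assms(4) by blast
 have "C \<inter> B \<subseteq> {x\<in>C. f x = 0}" using f(2) by auto
 then show ?thesis
  using circle_finite_zeros[OF great_circle_around[OF assms(1)] f(1) assms(3) f(3)] finite_subset by blast
qed

lemma great_circle_infinite: "great_circle n C ==> infinite C"
 by (rule circle_infinite[OF great_circle_around]) auto

lemma great_circle_irreducible:
 "great_circle n C ==> irreducible_closed (real_closed (Suc n)) C"
 unfolding real_irreducible_iff
 using great_circle_closed circle_prime[OF great_circle_around] by auto

lemma point_irreducible:
 assumes "p \<in> Eucl m" shows "irreducible_closed (real_closed m) {p}"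
 unfolding real_irreducible_iff
proof
 show "real_closed m {p}"
 proof (rule real_closedI)
  show "range (\<lambda>i x. x i - p i) \<subseteq> polyfuns"
   by (auto intro!: polyfuns_diff polyfuns_const polyfuns_var)
  show "{p} = {x \<in> Eucl m. \<forall>g\<in>range (\<lambda>i x. x i - p i). g x = 0}" using assms by auto
 qed
 show "poly_prime {p}" by (auto simp: poly_prime_def)
qed

text \<open>Otherwise choose a minimal closed \<open>Y\<close> in the zero set of \<open>f\<close> that contains infinitely many of the
  circles. Minimality makes \<open>Y\<close> irreducible, and then a point, a circle, \<open>Y\<close> and \<open>Z\<close> form a chain that
  is too long for a surface.\<close>

lemma surface_many_great_circles:
 assumes Z: "surface (Suc n) Z" and inf: "infinite CC"
  and CC: "\<And>C. C \<in> CC ==> great_circle n C" "\<And>C. C \<in> CC ==> C \<subseteq> Z"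
  and f: "f \<in> polyfuns" "\<And>C x. C \<in> CC ==> x \<in> C ==> f x = 0"
 shows "\<forall>x\<in>Z. f x = 0"
proof (rule ccontr)
 assume nz: "\<not> ?thesis"
 let ?m = "Suc n"
 have Zirr: "irreducible_closed (real_closed ?m) Z" and dim: "krull_dim (real_closed ?m) Z = 2"
  using Z by (auto simp: surface_def)
 have Zcl: "real_closed ?m Z" using Zirr by (simp add: irreducible_closed_def)
 define Q where "Q = {Y. real_closed ?m Y \<and> Y \<subseteq> Z \<and> infinite {C\<in>CC. C \<subseteq> Y}}"
 define Y0 where "Y0 = Z \<inter> {x\<in>Eucl ?m. f x = 0}"
 have Y0: "real_closed ?m Y0" unfolding Y0_def using Zcl real_closed_zero[OF f(1)] real_closed_Int by blast
 have "C \<subseteq> Y0" if "C \<in> CC" for C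
  using CC[OF that] f(2)[OF that] great_circle_sphere[OF CC(1)[OF that]] by (auto simp: Y0_def)
 then have "{C\<in>CC. C \<subseteq> Y0} = CC" by blast
 then have Y0Q: "Y0 \<in> Q" using Y0 inf by (auto simp: Q_def Y0_def)
 define Q' where "Q' = {Y\<in>Q. Y \<subseteq> Y0}"
 have "\<exists>Y\<in>Q'. \<forall>Y'\<in>Q'. \<not> Y' \<subset> Y"
  by (rule real_closed_minimal[of Y0 Q' ?m]) (use Y0Q in \<open>auto simp: Q'_def Q_def\<close>)
 then obtain Y where Y: "Y \<in> Q'" "\<And>Y'. Y' \<in> Q' ==> \<not> Y' \<subset> Y" by blast
 have Ycl: "real_closed ?m Y" and YZ: "Y \<subseteq> Z" and Yinf: "infinite {C\<in>CC. C \<subseteq> Y}" and YY0: "Y \<subseteq> Y0"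
  using Y(1) by (auto simp: Q'_def Q_def)
 have Yirr: "irreducible_closed (real_closed ?m) Y" unfolding irreducible_closed_def
 proof (intro conjI allI impI Ycl)
  obtain C where "C \<in> CC" "C \<subseteq> Y" using Yinf not_finite_existsD by blast
  then show "Y \<noteq> {}" using great_circle_infinite[OF CC(1)] by fastforce
  fix A B assume AB: "real_closed ?m A \<and> real_closed ?m B \<and> Y = A \<union> B"
  have "C \<subseteq> A \<or> C \<subseteq> B" if C: "C \<in> CC" "C \<subseteq> Y" for C
  proof -
   have irr: "irreducible_closed (real_closed ?m) C" using great_circle_irreducible CC C by blast
   have "C = (C \<inter> A) \<union> (C \<inter> B)" using C AB by blast
   moreover have "real_closed ?m (C \<inter> A)" "real_closed ?m (C \<inter> B)"
    using AB irr real_closed_Int by (auto simp: irreducible_closed_def)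
   ultimately have "C = C \<inter> A \<or> C = C \<inter> B" using irr unfolding irreducible_closed_def by blast
   then show ?thesis by blast
  qed
  then have "{C\<in>CC. C \<subseteq> Y} \<subseteq> {C\<in>CC. C \<subseteq> A} \<union> {C\<in>CC. C \<subseteq> B}" by blast
  then have "infinite {C\<in>CC. C \<subseteq> A} \<or> infinite {C\<in>CC. C \<subseteq> B}"
   using Yinf finite_subset by blast
  then have "A \<in> Q' \<or> B \<in> Q'" using AB YZ YY0 by (auto simp: Q'_def Q_def)
  then show "Y = A \<or> Y = B" using Y(2) AB by blast
 qed
 obtain C where C: "C \<in> CC" "C \<subseteq> Y" using Yinf not_finite_existsD by blast
 obtain p where p: "p \<in> C" using great_circle_infinite[OF CC(1)[OF C(1)]] by fastforce
 have "C \<noteq> Y"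
 proof
  assume "C = Y"
  have "{C\<in>CC. C \<subseteq> Y} \<subseteq> {Y}"
  proof
   fix D assume "D \<in> {C\<in>CC. C \<subseteq> Y}"
   then have D: "D \<in> CC" "D \<subseteq> Y" by auto
   obtain x where x: "x \<in> D" using great_circle_infinite[OF CC(1)[OF D(1)]] by fastforce
   obtain y where y: "y \<in> D" "y \<noteq> x" "y \<noteq> (\<lambda>i. - x i)"
   proof -
    have "\<not> D \<subseteq> {x, \<lambda>i. - x i}" using great_circle_infinite[OF CC(1)[OF D(1)]] finite_subset by blast
    then show thesis using that by blast
   qed
   have "x \<in> C" "y \<in> C" using D x y \<open>C = Y\<close> by blast+
   then have "D = C" by (rule great_circle_eqI[OF CC(1)[OF D(1)] CC(1)[OF C(1)] x y(1) _ _ y(2,3)])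
   then show "D \<in> {Y}" using \<open>C = Y\<close> by simp
  qed
  then show False using Yinf finite_subset by blast
 qed
 have YneZ: "Y \<noteq> Z" using YY0 nz by (auto simp: Y0_def)
 define F where "F = (\<lambda>i. [{p}, C, Y, Z] ! i)"
 have pE: "p \<in> Eucl ?m" using great_circle_sphere CC C p by blast
 have irr: "irreducible_closed (real_closed ?m) (F i)" if "i \<le> 3" for i
 proof -
  have "i = 0 \<or> i = 1 \<or> i = 2 \<or> i = 3" using that by auto
  then show ?thesis using point_irreducible[OF pE] great_circle_irreducible[OF CC(1)[OF C(1)]] Yirr Zirr
   by (auto simp: F_def)
 qed
 have sub: "F i \<subseteq> Z" if "i \<le> 3" for i
 proof -
  have "i = 0 \<or> i = 1 \<or> i = 2 \<or> i = 3" using that by auto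
  then show ?thesis using p C YZ by (auto simp: F_def)
 qed
 have strict: "F i \<subset> F (Suc i)" if "i < 3" for i
 proof -
  have "i = 0 \<or> i = 1 \<or> i = 2" using that by auto
  moreover have "{p} \<noteq> C" using great_circle_infinite[OF CC(1)[OF C(1)]] by auto
  ultimately show ?thesis using p C YZ \<open>C \<noteq> Y\<close> YneZ by (auto simp: F_def)
 qed
 have "enat 3 \<le> krull_dim (real_closed ?m) Z" by (rule krull_dim_ge[where F = F]) (use irr sub strict in auto)
 then show False unfolding dim by (simp add: numeral_eq_enat)
qed

section \<open>Dual bases\<close>

definition lin_indep :: "nat => (nat => nat => real) => bool" where
 "lin_indep k g \<longleftrightarrow> (\<forall>c. (\<forall>i. (\<Sum>j<k. c j * g j i) = 0) --> (\<forall>j<k. c j = 0))"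

lemma dot_sum: "dot m l (\<lambda>i. \<Sum>j\<in>J. c j * g j i) = (\<Sum>j\<in>J. c j * dot m l (g j))"
 unfolding dot_def by (simp add: sum_distrib_left sum.swap[of _ J] mult.left_commute)

lemma exists_orthogonal:
 assumes "k < m"
 shows "\<exists>d\<in>Eucl m. (\<exists>i<m. d i \<noteq> 0) \<and> (\<forall>j<k. dot m d (g j) = 0)"
proof -
 obtain x where x: "\<exists>i<m. x i \<noteq> 0" "\<forall>i\<ge>m. x i = 0" "\<forall>j<k. (\<Sum>i<m. g j i * x i) = 0"
  using underdetermined_system[OF assms, of g] by blast
 then show ?thesis by (intro bexI[of _ x]) (auto simp: Eucl_iff dot_def mult.commute)
qed

lemma dual_basis:
 assumes g: "\<And>j. j < m ==> g j \<in> Eucl m" and ind: "lin_indep m g"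
 shows "\<exists>l. (\<forall>i<m. l i \<in> Eucl m) \<and>
  (\<forall>i<m. \<forall>j<m. dot m (l i) (g j) = (if i = j then 1 else 0)) \<and>
  (\<forall>y\<in>Eucl m. \<forall>i. y i = (\<Sum>j<m. dot m (l j) y * g j i))"
proof -
 have span: "\<exists>c. \<forall>i. y i = (\<Sum>j<m. c j * g j i)" if y: "y \<in> Eucl m" for y
 proof -
  obtain c where c: "\<exists>j<Suc m. c j \<noteq> 0" "\<forall>i<m. (\<Sum>j<Suc m. (if j = m then y i else g j i) * c j) = 0"
   using underdetermined_system[of m "Suc m" "\<lambda>i j. if j = m then y i else g j i"] by auto
  have s: "(\<Sum>j<m. c j * g j i) + c m * y i = 0" for i
  proof (cases "i < m")
   case True then show ?thesis using c(2) by (simp add: mult.commute)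
  next
   case False then show ?thesis using g y by (simp add: Eucl_iff)
  qed
  have "c m \<noteq> 0"
  proof
   assume "c m = 0"
   then have "\<forall>j<m. c j = 0" using ind s unfolding lin_indep_def by simp
   then show False using c(1) \<open>c m = 0\<close> by (metis less_Suc_eq)
  qed
  have "y i = (\<Sum>j<m. (- c j / c m) * g j i)" for i
  proof -
   have "y i = - (\<Sum>j<m. c j * g j i) / c m" using s[of i] \<open>c m \<noteq> 0\<close> by (simp add: field_simps)
   then show ?thesis by (simp add: sum_negf sum_divide_distrib)
  qed
  then show ?thesis by (intro exI[of _ "\<lambda>j. - c j / c m"]) blast
 qed
 have ex: "\<exists>d\<in>Eucl m. \<forall>j<m. dot m d (g j) = (if i = j then 1 else 0)" if i: "i < m" for i
 proof -
  obtain d where d: "d \<in> Eucl m" "\<exists>k<m. d k \<noteq> 0"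
   "\<forall>j<m - 1. dot m d (g (if j < i then j else Suc j)) = 0"
   using exists_orthogonal[of "m - 1" m "\<lambda>j. g (if j < i then j else Suc j)"] i by auto
  have z: "dot m d (g j) = 0" if "j < m" "j \<noteq> i" for j
  proof (cases "j < i")
   case True then show ?thesis using d(3)[rule_format, of j] i by simp
  next
   case False
   then have j: "\<not> j - 1 < i" "Suc (j - 1) = j" "j - 1 < m - 1" using that by linarith+
   show ?thesis using d(3)[rule_format, OF j(3)] by (simp only: j(1,2) if_False)
  qed
  have nz: "dot m d (g i) \<noteq> 0"
  proof
   assume "dot m d (g i) = 0"
   then have all: "dot m d (g j) = 0" if "j < m" for j using z that by blast
   obtain c where "\<forall>i. d i = (\<Sum>j<m. c j * g j i)" using span[OF d(1)] by blast
   then have "d = (\<lambda>i. \<Sum>j<m. c j * g j i)" by blast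
   then have "dot m d d = (\<Sum>j<m. c j * dot m d (g j))" by (metis dot_sum)
   then have "dot m d d = 0" using all by simp
   then show False using dot_self_0[OF d(1)] d(2) by auto
  qed
  define e where "e = (\<lambda>k. (1 / dot m d (g i)) * d k)"
  have "dot m e (g j) = 1 / dot m d (g i) * dot m d (g j)" for j unfolding e_def dot_scale ..
  then have "\<forall>j<m. dot m e (g j) = (if i = j then 1 else 0)" using z nz by auto
  moreover have "e \<in> Eucl m" unfolding e_def using d(1) by blast
  ultimately show ?thesis by blast
 qed
 then obtain l where l: "\<And>i. i < m ==> l i \<in> Eucl m"
  "\<And>i j. i < m ==> j < m ==> dot m (l i) (g j) = (if i = j then 1 else 0)" by metis
 have "y i = (\<Sum>j<m. dot m (l j) y * g j i)" if y: "y \<in> Eucl m" for y i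
 proof -
  obtain c where c: "\<forall>i. y i = (\<Sum>j<m. c j * g j i)" using span[OF y] by blast
  then have yc: "y = (\<lambda>i. \<Sum>j<m. c j * g j i)" by blast
  have "dot m (l j) y = c j" if "j < m" for j
  proof -
   have "dot m (l j) y = (\<Sum>k<m. c k * (if j = k then 1 else 0))"
    unfolding yc dot_sum using l(2)[OF that] by (intro sum.cong) auto
   also have "\<dots> = c j" using that by (simp add: if_distrib cong: if_cong)
   finally show ?thesis .
  qed
  then show ?thesis using c by simp
 qed
 then show ?thesis using l by blast
qed

section \<open>Polynomials in one variable over polynomial functions\<close>

text \<open>The variable \<open>x\<close> runs over the points \<open>a + x * b\<close> of a fixed line, while the coefficients are polynomials
  in the coordinates of a point \<open>z\<close> of the surface.\<close>

definition EV :: "(nat => real) => (nat, real) mpoly poly => real => real" where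
 "EV z h x = peval z (poly h (Poly_Mapping.single 0 x))"

lemma EV_add: "EV z (g + h) x = EV z g x + EV z h x"
 by (simp add: EV_def peval_add)

lemma EV_mult: "EV z (g * h) x = EV z g x * EV z h x"
 by (simp add: EV_def peval_mult)

lemma EV_smult: "EV z (smult c h) x = peval z c * EV z h x"
 by (simp add: EV_def peval_mult)

lemma EV_0 [simp]: "EV z 0 x = 0"
 by (simp add: EV_def)

lemma EV_pCons: "EV z (pCons c h) x = peval z c + x * EV z h x"
 by (simp add: EV_def peval_add peval_mult)

lemma EV_monom: "EV z (monom c k) x = peval z c * x ^ k"
 by (simp add: EV_def poly_monom peval_mult peval_power)

lemma EV_poly: "EV z h x = poly (map_poly (peval z) h) x"
 by (induction h) (auto simp: EV_pCons map_poly_pCons)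

lemma EV_pderiv: "EV z (pderiv h) x = poly (pderiv (map_poly (peval z) h)) x"
proof (induction h)
 case (pCons a h)
 have "EV z (pderiv (pCons a h)) x = EV z h x + x * EV z (pderiv h) x"
  by (simp add: pderiv_pCons EV_add EV_pCons)
 then show ?case by (simp add: pCons map_poly_pCons pderiv_pCons EV_poly[of z h])
qed simp

lemma EV_polyfuns: "(\<lambda>z. EV z h x) \<in> polyfuns"
 by (simp add: EV_def)

lemma EV_degree_0: "degree h = 0 ==> EV z h x = peval z (lead_coeff h)"
 by (elim degree_eq_zeroE) (simp add: EV_pCons)

lemma EV_line:
 assumes "f \<in> polyfuns"
 shows "\<exists>h. \<forall>z x. EV z h x = f (\<lambda>i. s * z i + t * (a i + x * b i))"
 using assms
proof (induction f rule: polyfuns_induct)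
 case (const c)
 show ?case by (rule exI[of _ "[:Poly_Mapping.single 0 c:]"]) (simp add: EV_pCons)
next
 case (var i)
 let ?v = "Poly_Mapping.single (Poly_Mapping.single i 1) (1::real)"
 have "EV z [:Poly_Mapping.single 0 s * ?v + Poly_Mapping.single 0 (t * a i), Poly_Mapping.single 0 (t * b i):] x
   = s * z i + t * (a i + x * b i)" for z x
  by (simp add: EV_pCons peval_add peval_mult algebra_simps del: One_nat_def)
 then show ?case by blast
next
 case (add f g)
 then show ?case by (metis EV_add)
next
 case (mult f g)
 then show ?case by (metis EV_mult)
qed

text \<open>Leading coefficients that vanish on \<open>Z\<close> can be dropped.\<close>

lemma EV_truncate:
 "(\<forall>z\<in>Z. \<forall>x. EV z h x = 0) \<or>
  (\<exists>h'. degree h' \<le> degree h \<and> (\<exists>z\<in>Z. peval z (lead_coeff h') \<noteq> 0) \<and> (\<forall>z\<in>Z. \<forall>x. EV z h' x = EV z h x))"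
proof (induction "degree h" arbitrary: h rule: less_induct)
 case less
 show ?case
 proof (cases "\<exists>z\<in>Z. peval z (lead_coeff h) \<noteq> 0")
  case True then show ?thesis by blast
 next
  case False
  show ?thesis
  proof (cases "degree h = 0")
   case True
   then have "\<forall>z\<in>Z. \<forall>x. EV z h x = 0" using EV_degree_0[OF True] False by simp
   then show ?thesis ..
  next
   case deg: False
   define h2 where "h2 = h - monom (lead_coeff h) (degree h)"
   have "degree h2 \<le> degree h" unfolding h2_def by (intro degree_diff_le) (auto simp: degree_monom_le)
   moreover have "coeff h2 (degree h) = 0" by (simp add: h2_def)
   ultimately have d: "degree h2 < degree h" using deg
    by (metis degree_0 le_neq_implies_less leading_coeff_0_iff)
   have "h = h2 + monom (lead_coeff h) (degree h)" by (simp add: h2_def)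
   then have e: "EV z h2 x = EV z h x" if "z \<in> Z" for z x
    using False that by (metis EV_add EV_monom add.right_neutral mult_zero_left)
   from less[OF d] show ?thesis
   proof
    assume "\<forall>z\<in>Z. \<forall>x. EV z h2 x = 0" then show ?thesis using e by simp
   next
    assume "\<exists>h'. degree h' \<le> degree h2 \<and> (\<exists>z\<in>Z. peval z (lead_coeff h') \<noteq> 0) \<and> (\<forall>z\<in>Z. \<forall>x. EV z h' x = EV z h2 x)"
    then obtain h' where "degree h' \<le> degree h2" "\<exists>z\<in>Z. peval z (lead_coeff h') \<noteq> 0" "\<forall>z\<in>Z. \<forall>x. EV z h' x = EV z h2 x"
     by blast
    then show ?thesis using d e by (intro disjI2 exI[of _ h']) auto
   qed
  qed
 qed
qed

lemma simple_root_sign_change: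
 fixes p :: "real poly"
 assumes "poly p x0 = 0" "poly (pderiv p) x0 \<noteq> 0"
 obtains x1 x2 where "x1 < x2" "poly p x1 * poly p x2 < 0"
proof (cases "poly (pderiv p) x0 > 0")
 case True
 obtain d where d: "d > 0" "\<forall>h>0. h < d --> poly p x0 < poly p (x0 + h)"
  using DERIV_pos_inc_right[OF poly_DERIV True] by blast
 obtain e where e: "e > 0" "\<forall>h>0. h < e --> poly p (x0 - h) < poly p x0"
  using DERIV_pos_inc_left[OF poly_DERIV True] by blast
 have "poly p (x0 - e / 2) < 0" "poly p (x0 + d / 2) > 0" using d e assms(1) by auto
 then show thesis using that[of "x0 - e / 2" "x0 + d / 2"] d e by (simp add: mult_neg_pos)
next
 case False
 then have neg: "poly (pderiv p) x0 < 0" using assms(2) by simp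
 obtain d where d: "d > 0" "\<forall>h>0. h < d --> poly p x0 > poly p (x0 + h)"
  using DERIV_neg_dec_right[OF poly_DERIV neg] by blast
 obtain e where e: "e > 0" "\<forall>h>0. h < e --> poly p (x0 - h) > poly p x0"
  using DERIV_neg_dec_left[OF poly_DERIV neg] by blast
 have "poly p (x0 - e / 2) > 0" "poly p (x0 + d / 2) < 0" using d e assms(1) by auto
 then show thesis using that[of "x0 - e / 2" "x0 + d / 2"] d e by (simp add: mult_pos_neg)
qed

lemma polyfuns_continuous:
 fixes f :: "('v => real) => real"
 assumes "f \<in> polyfuns" "\<And>i. continuous_on S (\<lambda>t. c t i)"
 shows "continuous_on S (\<lambda>t. f (c t))"
 using assms(1) by (induction f rule: polyfuns_induct) (use assms(2) in \<open>auto intro!: continuous_intros\<close>)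

text \<open>Multiplication by a high even power of \<open>r\<close> leaves a polynomial in \<open>y\<close> and \<open>r\<close>, in which the even powers
  of \<open>r\<close> are polynomials in \<open>y\<close>.\<close>

lemma polyfuns_homogenize:
 fixes f :: "(nat => real) => real"
 assumes "f \<in> polyfuns"
 shows "\<exists>N. \<exists>A\<in>polyfuns. \<exists>B\<in>polyfuns. \<forall>y r. r \<noteq> 0 \<and> r\<^sup>2 = dot m y y -->
  (r\<^sup>2) ^ N * f (\<lambda>i. y i / r) = A y + r * B y"
 using assms
proof (induction f rule: polyfuns_induct)
 case (const c)
 show ?case
  by (rule exI[of _ 0], rule bexI[of _ "\<lambda>y. c"], rule bexI[of _ "\<lambda>y. 0"]) auto
next
 case (var i)
 have "(r\<^sup>2) ^ 1 * (y i / r) = 0 + r * y i" if "r \<noteq> 0" for y :: "nat => real" and r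
  using that by (simp add: power2_eq_square)
 note eq = this
 show ?case
 proof (rule exI[of _ 1], rule bexI[of _ "\<lambda>y. 0"], rule bexI[of _ "\<lambda>y. y i"], intro allI impI)
  fix y :: "nat => real" and r assume "r \<noteq> 0 \<and> r\<^sup>2 = dot m y y"
  then show "(r\<^sup>2) ^ 1 * (y i / r) = 0 + r * y i" using eq by blast
 qed auto
next
 case (add f g)
 obtain N A B where 1: "A \<in> polyfuns" "B \<in> polyfuns"
  "\<And>y r. r \<noteq> 0 \<and> r\<^sup>2 = dot m y y ==> (r\<^sup>2) ^ N * f (\<lambda>i. y i / r) = A y + r * B y"
  using add.IH(1) by blast
 obtain N' A' B' where 2: "A' \<in> polyfuns" "B' \<in> polyfuns"
  "\<And>y r. r \<noteq> 0 \<and> r\<^sup>2 = dot m y y ==> (r\<^sup>2) ^ N' * g (\<lambda>i. y i / r) = A' y + r * B' y"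
  using add.IH(2) by blast
 have "(r\<^sup>2) ^ (N + N') * (f (\<lambda>i. y i / r) + g (\<lambda>i. y i / r)) =
   (dot m y y ^ N' * A y + dot m y y ^ N * A' y) + r * (dot m y y ^ N' * B y + dot m y y ^ N * B' y)"
  if r: "r \<noteq> 0 \<and> r\<^sup>2 = dot m y y" for y r
 proof -
  have "(r\<^sup>2) ^ (N + N') * (f (\<lambda>i. y i / r) + g (\<lambda>i. y i / r)) =
   (r\<^sup>2) ^ N' * ((r\<^sup>2) ^ N * f (\<lambda>i. y i / r)) + (r\<^sup>2) ^ N * ((r\<^sup>2) ^ N' * g (\<lambda>i. y i / r))"
   by (simp add: power_add algebra_simps)
  also have "\<dots> = (r\<^sup>2) ^ N' * (A y + r * B y) + (r\<^sup>2) ^ N * (A' y + r * B' y)"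
   using 1(3)[OF r] 2(3)[OF r] by simp
  also have "\<dots> = (dot m y y) ^ N' * (A y + r * B y) + (dot m y y) ^ N * (A' y + r * B' y)"
   using r by simp
  finally show ?thesis by (simp add: algebra_simps)
 qed
 note eq = this
 show ?case
  by (rule exI[of _ "N + N'"], rule bexI[of _ "\<lambda>y. dot m y y ^ N' * A y + dot m y y ^ N * A' y"],
    rule bexI[of _ "\<lambda>y. dot m y y ^ N' * B y + dot m y y ^ N * B' y"], intro allI impI, rule eq)
   (use 1 2 in \<open>auto intro!: polyfuns_add polyfuns_mult polyfuns_power\<close>)
next
 case (mult f g)
 obtain N A B where 1: "A \<in> polyfuns" "B \<in> polyfuns"
  "\<And>y r. r \<noteq> 0 \<and> r\<^sup>2 = dot m y y ==> (r\<^sup>2) ^ N * f (\<lambda>i. y i / r) = A y + r * B y"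
  using mult.IH(1) by blast
 obtain N' A' B' where 2: "A' \<in> polyfuns" "B' \<in> polyfuns"
  "\<And>y r. r \<noteq> 0 \<and> r\<^sup>2 = dot m y y ==> (r\<^sup>2) ^ N' * g (\<lambda>i. y i / r) = A' y + r * B' y"
  using mult.IH(2) by blast
 have "(r\<^sup>2) ^ (N + N') * (f (\<lambda>i. y i / r) * g (\<lambda>i. y i / r)) =
   (A y * A' y + dot m y y * (B y * B' y)) + r * (A y * B' y + B y * A' y)"
  if r: "r \<noteq> 0 \<and> r\<^sup>2 = dot m y y" for y r
 proof -
  have "(r\<^sup>2) ^ (N + N') * (f (\<lambda>i. y i / r) * g (\<lambda>i. y i / r)) =
   ((r\<^sup>2) ^ N * f (\<lambda>i. y i / r)) * ((r\<^sup>2) ^ N' * g (\<lambda>i. y i / r))"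
   by (simp add: power_add algebra_simps)
  also have "\<dots> = (A y + r * B y) * (A' y + r * B' y)"
   using 1(3)[OF r] 2(3)[OF r] by simp
  also have "\<dots> = (A y * A' y + r\<^sup>2 * (B y * B' y)) + r * (A y * B' y + B y * A' y)"
   by (simp add: algebra_simps power2_eq_square)
  finally show ?thesis using r by simp
 qed
 note eq = this
 show ?case
  by (rule exI[of _ "N + N'"], rule bexI[of _ "\<lambda>y. A y * A' y + dot m y y * (B y * B' y)"],
    rule bexI[of _ "\<lambda>y. A y * B' y + B y * A' y"], intro allI impI, rule eq)
   (use 1 2 in \<open>auto intro!: polyfuns_add polyfuns_mult\<close>)
qed

lemma planeE: "p \<in> plane u v ==> \<exists>s t. \<forall>i. p i = s * u i + t * v i"
 by (auto simp: plane_def)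

lemma great_circle_meet_finite:
 assumes "great_circle n C" "great_circle n D" "C \<noteq> D" shows "finite (C \<inter> D)"
proof (cases "C \<inter> D = {}")
 case False
 then obtain x where x: "x \<in> C" "x \<in> D" by blast
 have "C \<inter> D \<subseteq> {x, \<lambda>i. - x i}"
  using great_circle_eqI[OF assms(1,2) x(1) _ x(2)] assms(3) by blast
 then show ?thesis using finite_subset by blast
qed simp

lemma gcirc_plane:
 assumes "u \<in> Eucl m" "v \<in> Eucl m" "p \<in> plane u v" "gcirc m u v \<subseteq> plane x y"
 shows "p \<in> plane x y"
proof (cases "p = (\<lambda>i. 0)")
 case True then show ?thesis using plane_memI[of 0 x 0 y] by simp
next
 case False
 have pE: "p \<in> Eucl m" using plane_Eucl[OF assms(1,2)] assms(3) by blast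
 define r where "r = sqrt (dot m p p)"
 have r: "r > 0" "r * r = dot m p p" using dot_self_pos[OF pE False] by (auto simp: r_def)
 define q where "q = (\<lambda>i. (1 / r) * p i)"
 have "q \<in> plane u v" unfolding q_def using plane_lc[OF assms(3,3), of "1 / r" 0] by simp
 moreover have "dot m q q = 1" unfolding q_def dot_scale r(2)[symmetric] using r(1) by simp
 ultimately have q: "q \<in> plane x y" using assms(4) by (auto simp: gcirc_def)
 have "p = (\<lambda>i. r * q i + 0 * q i)" using r by (auto simp: q_def)
 then show ?thesis using plane_lc[OF q q, of r 0] by simp
qed

section \<open>Doubly ruled surfaces in a sphere\<close>

text \<open>The hypotheses of the theorem, with the exceptional set \<open>B\<close> of the definition made a parameter.\<close>

locale doubly_ruled =
 fixes n :: nat and Z B :: "(nat => real) set"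
 assumes n3: "3 \<le> n" and surf: "surface (Suc n) Z" and sph: "Z \<subseteq> topspace (nsphere n)"
  and Bcl: "real_closed (Suc n) B" and ZB: "\<not> Z \<subseteq> B"
  and two: "\<And>p. p \<in> Z - B ==> \<exists>C D. C \<noteq> D \<and> great_circle n C \<and> great_circle n D \<and> p \<in> C \<inter> D \<and> C \<union> D \<subseteq> Z"
  and spanning: "\<not> in_hyperplane_section n Z"
begin

lemma Zcl: "real_closed (Suc n) Z" and Zprime: "poly_prime Z"
 using surf unfolding surface_def real_irreducible_iff by auto

lemma ZE: "z \<in> Z ==> z \<in> Eucl (Suc n)" and Zunit: "z \<in> Z ==> dot (Suc n) z z = 1"
 using sph by (auto simp: nsphere_iff subset_iff)

lemma not_hyperplane:
 assumes "\<exists>i<Suc n. \<alpha> i \<noteq> 0" "\<forall>x\<in>Z. dot (Suc n) \<alpha> x = 0" shows False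
proof -
 have "Z \<subseteq> {x \<in> topspace (nsphere n). dot (Suc n) \<alpha> x = 0}" using assms(2) sph by auto
 moreover have "\<exists>i\<le>n. \<alpha> i \<noteq> 0" using assms(1) less_Suc_eq_le by auto
 ultimately show False using spanning unfolding in_hyperplane_section_def by blast
qed

lemma hyperplane_finite:
 assumes "\<exists>i<Suc n. \<alpha> i \<noteq> 0"
 shows "finite {C. great_circle n C \<and> C \<subseteq> Z \<and> (\<forall>x\<in>C. dot (Suc n) \<alpha> x = 0)}" (is "finite ?S")
proof (rule ccontr)
 assume inf: "infinite ?S"
 have "\<forall>x\<in>Z. dot (Suc n) \<alpha> x = 0"
  by (rule surface_many_great_circles[OF surf inf]) auto
 then show False using not_hyperplane assms by blast
qed

lemma other_circle:
 assumes "p \<in> Z" "p \<notin> B"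
 shows "\<exists>D. great_circle n D \<and> D \<subseteq> Z \<and> p \<in> D \<and> D \<noteq> C"
 using two[of p] assms by (metis DiffI Int_iff Un_subset_iff)

text \<open>Great circles are symmetric, so this holds off \<open>B\<close>, and \<open>Z - B\<close> is dense in \<open>Z\<close>.\<close>

lemma Z_minus: assumes "x \<in> Z" shows "(\<lambda>i. - x i) \<in> Z"
proof (rule ccontr)
 assume nZ: "(\<lambda>i. - x i) \<notin> Z"
 have "(\<lambda>i. - x i) \<in> Eucl (Suc n)" using ZE[OF assms] by (simp add: Eucl_iff)
 then obtain f where f: "f \<in> polyfuns" "\<forall>v\<in>Z. f v = 0" "f (\<lambda>i. - x i) \<noteq> 0"
  using real_closed_separate[OF Zcl _ nZ] by blast
 obtain q where q: "q \<in> Z" "q \<notin> B" using ZB by blast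
 obtain g where g: "g \<in> polyfuns" "\<forall>v\<in>B. g v = 0" "g q \<noteq> 0"
  using real_closed_separate[OF Bcl ZE[OF q(1)] q(2)] by blast
 have f': "(\<lambda>y. f (\<lambda>i. - y i)) \<in> polyfuns"
  by (rule polyfuns_comp[OF f(1)]) auto
 have "f (\<lambda>i. - y i) * g y = 0" if y: "y \<in> Z" for y
 proof (cases "y \<in> B")
  case False
  obtain D where "great_circle n D" "D \<subseteq> Z" "y \<in> D" using other_circle[OF y False] by blast
  then have "(\<lambda>i. - y i) \<in> Z" using great_circle_minus by blast
  then show ?thesis using f(2) by simp
 qed (use g in simp)
 from poly_primeD[OF Zprime f' g(1) this assms _ q(1)] show False using f(3) g(3) by simp
qed

text \<open>The cone over \<open>Z\<close>: it turns great circles of \<open>Z\<close> into planes.\<close>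

definition X :: "(nat => real) set" where
 "X = {\<lambda>i. r * z i | r z. z \<in> Z}"

lemma X_Eucl: "X \<subseteq> Eucl (Suc n)"
 unfolding X_def using ZE by blast

lemma ZX: "z \<in> Z ==> z \<in> X"
 unfolding X_def by (rule CollectI, rule exI[of _ 1]) auto

lemma X_scale: assumes "y \<in> X" shows "(\<lambda>i. s * y i) \<in> X"
proof -
 obtain r z where "z \<in> Z" "y = (\<lambda>i. r * z i)" using assms by (auto simp: X_def)
 then have "(\<lambda>i. s * y i) = (\<lambda>i. (s * r) * z i)" by (simp add: mult.assoc)
 then show ?thesis using \<open>z \<in> Z\<close> unfolding X_def by blast
qed

lemma X_unit: assumes "y \<in> X" "dot (Suc n) y y = 1" shows "y \<in> Z"
proof -
 obtain r z where rz: "z \<in> Z" "y = (\<lambda>i. r * z i)" using assms by (auto simp: X_def)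
 have "r * (r * 1) = 1" using assms(2) unfolding rz(2) dot_scale Zunit[OF rz(1)] .
 then have "r\<^sup>2 = 1" by (simp add: power2_eq_square)
 then consider "r = 1" | "r = -1" unfolding power2_eq_1_iff by blast
 then show ?thesis
 proof cases
  case 1 then show ?thesis using rz by simp
 next
  case 2 then show ?thesis using rz Z_minus by simp
 qed
qed

text \<open>A polynomial \<open>f\<close> that separates \<open>y / r\<close> with \<open>r = \<bar>y\<bar>\<close> from \<open>Z\<close> is, up to a power of \<open>r\<^sup>2\<close>, of the form
  \<open>A y + r * B y\<close>. Both \<open>r\<^sup>2 * A y\<close> and \<open>r\<^sup>2 * B y\<close> vanish on \<open>X\<close>, as \<open>r\<close> can be replaced by \<open>- r\<close>; not both vanish at \<open>y\<close>.\<close>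

lemma X_closed: "real_closed (Suc n) X"
proof (rule real_closedI)
 let ?G = "{g\<in>polyfuns. \<forall>y\<in>X. g y = 0}" and ?d = "dot (Suc n)"
 show "?G \<subseteq> polyfuns" by blast
 show "X = {y\<in>Eucl (Suc n). \<forall>g\<in>?G. g y = 0}"
 proof (intro equalityI subsetI)
  fix y assume "y \<in> X" then show "y \<in> {y\<in>Eucl (Suc n). \<forall>g\<in>?G. g y = 0}" using X_Eucl by auto
 next
  fix y assume y: "y \<in> {y\<in>Eucl (Suc n). \<forall>g\<in>?G. g y = 0}"
  then have yE: "y \<in> Eucl (Suc n)" by simp
  show "y \<in> X"
  proof (rule ccontr)
   assume yX: "y \<notin> X"
   obtain z where z: "z \<in> Z" using Zprime by (auto simp: poly_prime_def)
   have "y \<noteq> (\<lambda>i. 0)" using X_scale[OF ZX[OF z], of 0] yX by auto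
   then have dy: "?d y y > 0" using dot_self_pos[OF yE] by blast
   define r where "r = sqrt (?d y y)"
   have r: "r > 0" "r\<^sup>2 = ?d y y" using dy by (auto simp: r_def)
   have "(\<lambda>i. y i / r) \<notin> Z"
   proof
    assume "(\<lambda>i. y i / r) \<in> Z"
    from X_scale[OF ZX[OF this], of r] show False using yX r by simp
   qed
   moreover have "(\<lambda>i. y i / r) \<in> Eucl (Suc n)" using yE by (simp add: Eucl_iff)
   ultimately obtain f where f: "f \<in> polyfuns" "\<forall>v\<in>Z. f v = 0" "f (\<lambda>i. y i / r) \<noteq> 0"
    using real_closed_separate[OF Zcl] by blast
   obtain N A B where AB: "A \<in> polyfuns" "B \<in> polyfuns"
    "\<And>y r. r \<noteq> 0 \<and> r\<^sup>2 = ?d y y ==> (r\<^sup>2) ^ N * f (\<lambda>i. y i / r) = A y + r * B y"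
    using polyfuns_homogenize[OF f(1), of "Suc n"] by blast
   have van: "?d x x * A x = 0 \<and> ?d x x * B x = 0" if x: "x \<in> X" for x
   proof -
    obtain s z where sz: "z \<in> Z" "x = (\<lambda>i. s * z i)" using x by (auto simp: X_def)
    have dx: "?d x x = s\<^sup>2" unfolding sz(2) dot_scale Zunit[OF sz(1)] by (simp add: power2_eq_square)
    show ?thesis
    proof (cases "s = 0")
     case False
     have e1: "(\<lambda>i. x i / s) = z" "(\<lambda>i. x i / (- s)) = (\<lambda>i. - z i)" using False by (auto simp: sz(2))
     have "0 = A x + s * B x" using AB(3)[of s x] False dx e1(1) f(2) sz(1) by simp
     moreover have "0 = A x + (- s) * B x"
      using AB(3)[of "- s" x] False dx unfolding e1(2) using f(2) Z_minus[OF sz(1)] by simp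
     ultimately have "A x = 0" "s * B x = 0" by auto
     then show ?thesis using False by simp
    qed (simp add: dx)
   qed
   have "(\<lambda>x. ?d x x * A x) \<in> ?G" "(\<lambda>x. ?d x x * B x) \<in> ?G"
    using van AB(1,2) by (auto intro!: polyfuns_mult)
   moreover have "g y = 0" if "g \<in> ?G" for g using y that by blast
   ultimately have "?d y y * A y = 0" "?d y y * B y = 0" by blast+
   then have "A y = 0" "B y = 0" using dy by auto
   then have "(r\<^sup>2) ^ N * f (\<lambda>i. y i / r) = 0" using AB(3)[of r y] r by simp
   then show False using r f(3) by simp
  qed
 qed
qed

lemma circle_plane_X:
 assumes "great_circle n C" "C \<subseteq> Z" "x \<in> C" "y \<in> C"
 shows "(\<lambda>i. s * x i + t * y i) \<in> X"
proof -
 obtain u v where uv: "ortho (Suc n) u v" "C = gcirc (Suc n) u v" using assms(1) great_circle_iff by blast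
 define p where "p = (\<lambda>i. s * x i + t * y i)"
 have p: "p \<in> plane u v" unfolding p_def by (rule plane_lc) (use assms uv in \<open>auto simp: gcirc_def\<close>)
 show ?thesis
 proof (cases "p = (\<lambda>i. 0)")
  case True then show ?thesis using X_scale[OF ZX[of x], of 0] assms by (auto simp flip: p_def)
 next
  case False
  have pE: "p \<in> Eucl (Suc n)" using plane_Eucl uv(1) p unfolding ortho_def by blast
  define r where "r = sqrt (dot (Suc n) p p)"
  have r: "r > 0" "r * r = dot (Suc n) p p" using dot_self_pos[OF pE False] by (auto simp: r_def)
  define q where "q = (\<lambda>i. (1 / r) * p i)"
  have "q \<in> plane u v" unfolding q_def using plane_lc[OF p p, of "1 / r" 0] by simp
  moreover have "dot (Suc n) q q = 1" unfolding q_def dot_scale r(2)[symmetric] using r(1) by simp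
  ultimately have "q \<in> Z" using assms(2) by (auto simp: gcirc_def uv(2))
  from X_scale[OF ZX[OF this], of r] have "(\<lambda>i. r * q i) \<in> X" .
  moreover have "(\<lambda>i. r * q i) = p" using r by (auto simp: q_def)
  ultimately show ?thesis by (simp add: p_def)
 qed
qed

lemma gcirc_Z: "plane x y \<subseteq> X ==> gcirc (Suc n) x y \<subseteq> Z"
 using X_unit by (auto simp: gcirc_def)

lemma planes_many:
 assumes T: "infinite T" and ind: "\<And>\<tau>. \<tau> \<in> T ==> indep2 (x \<tau>) (y \<tau>)"
  and E: "\<And>\<tau>. \<tau> \<in> T ==> x \<tau> \<in> Eucl (Suc n)" "\<And>\<tau>. \<tau> \<in> T ==> y \<tau> \<in> Eucl (Suc n)"
  and sub: "\<And>\<tau>. \<tau> \<in> T ==> plane (x \<tau>) (y \<tau>) \<subseteq> X"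
  and inj: "\<And>\<tau> \<sigma>. \<tau> \<in> T ==> \<sigma> \<in> T ==> x \<tau> \<in> plane (x \<sigma>) (y \<sigma>) ==> y \<tau> \<in> plane (x \<sigma>) (y \<sigma>) ==> \<tau> = \<sigma>"
  and f: "f \<in> polyfuns" "\<And>\<tau> p. \<tau> \<in> T ==> p \<in> plane (x \<tau>) (y \<tau>) ==> f p = 0"
 shows "\<forall>z\<in>Z. f z = 0"
proof -
 define G where "G \<tau> = gcirc (Suc n) (x \<tau>) (y \<tau>)" for \<tau>
 have "inj_on G T"
 proof (rule inj_onI)
  fix \<tau> \<sigma> assume *: "\<tau> \<in> T" "\<sigma> \<in> T" "G \<tau> = G \<sigma>"
  then have s: "gcirc (Suc n) (x \<tau>) (y \<tau>) \<subseteq> plane (x \<sigma>) (y \<sigma>)" unfolding G_def by (auto simp: gcirc_def)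
  show "\<tau> = \<sigma>"
   by (rule inj[OF *(1,2)]; rule gcirc_plane[OF E[OF *(1)] _ s]; rule plane_mem)
 qed
 then have "infinite (G ` T)" using T finite_imageD by blast
 then show ?thesis
 proof (rule surface_many_great_circles[OF surf])
  show "great_circle n C" if "C \<in> G ` T" for C
   using that gcirc_great ind E by (auto simp: G_def)
  show "C \<subseteq> Z" if "C \<in> G ` T" for C
   using that gcirc_Z[OF sub] unfolding G_def by blast
  show "f p = 0" if "C \<in> G ` T" "p \<in> C" for C p
   using that f(2) by (auto simp: G_def gcirc_def)
 qed (rule f(1))
qed

text \<open>The planes would give infinitely many circles in a hyperplane, which would then contain \<open>Z\<close>.\<close>

lemma no_pencil:
 assumes E: "z \<in> Eucl (Suc n)" "a \<in> Eucl (Suc n)" "b \<in> Eucl (Suc n)"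
  and ind: "\<And>p q r. (\<And>i. p * z i + q * a i + r * b i = 0) ==> p = 0 \<and> q = 0 \<and> r = 0"
  and sub: "\<And>x s t. (\<lambda>i. s * z i + t * (a i + x * b i)) \<in> X"
 shows False
proof -
 define g where "g j = (if j = 0 then z else if j = 1 then a else b)" for j :: nat
 obtain \<alpha> where \<alpha>: "\<exists>i<Suc n. \<alpha> i \<noteq> 0" "\<forall>j<3. dot (Suc n) \<alpha> (g j) = 0"
  using exists_orthogonal[of 3 "Suc n" g] n3 by auto
 have a3: "dot (Suc n) \<alpha> z = 0" "dot (Suc n) \<alpha> a = 0" "dot (Suc n) \<alpha> b = 0"
  using \<alpha>(2)[rule_format, of 0] \<alpha>(2)[rule_format, of 1] \<alpha>(2)[rule_format, of 2] by (auto simp: g_def)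
 have "\<forall>x\<in>Z. dot (Suc n) \<alpha> x = 0"
 proof (rule planes_many[where T = "UNIV :: real set" and x = "\<lambda>\<tau>. z" and y = "\<lambda>\<tau> i. 1 * a i + \<tau> * b i"])
  show "infinite (UNIV :: real set)" by (rule infinite_UNIV_char_0)
  show "indep2 z (\<lambda>i. 1 * a i + \<tau> * b i)" for \<tau> unfolding indep2_def
  proof (intro allI impI)
   fix s t assume "\<forall>i. s * z i + t * (1 * a i + \<tau> * b i) = 0"
   then have "s * z i + t * a i + (t * \<tau>) * b i = 0" for i by (simp add: algebra_simps)
   from ind[OF this] show "s = 0 \<and> t = 0" by simp
  qed
  show "z \<in> Eucl (Suc n)" "(\<lambda>i. 1 * a i + \<tau> * b i) \<in> Eucl (Suc n)" for \<tau> using E by blast+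
  show "plane z (\<lambda>i. 1 * a i + \<tau> * b i) \<subseteq> X" for \<tau> using sub by (auto simp: plane_def)
  show "\<tau> = \<sigma>" if "(\<lambda>i. 1 * a i + \<tau> * b i) \<in> plane z (\<lambda>i. 1 * a i + \<sigma> * b i)" for \<tau> \<sigma>
  proof -
   from planeE[OF that] obtain s t where "\<And>i. 1 * a i + \<tau> * b i = s * z i + t * (1 * a i + \<sigma> * b i)"
    by blast
   then have "s * z i + (t - 1) * a i + (t * \<sigma> - \<tau>) * b i = 0" for i by (simp add: algebra_simps)
   from ind[OF this] show ?thesis by auto
  qed
  show "dot (Suc n) \<alpha> p = 0" if "p \<in> plane z (\<lambda>i. 1 * a i + \<tau> * b i)" for \<tau> p
  proof -
   from that obtain s t where p: "p = (\<lambda>i. s * z i + t * (1 * a i + \<tau> * b i))"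
    unfolding plane_def by blast
   show ?thesis unfolding p dot_lc' using a3 by simp
  qed
 qed auto
 then show False using not_hyperplane \<alpha>(1) by blast
qed

text \<open>Two planes in direct sum, spanned by \<open>a\<close>, \<open>b\<close> and by \<open>z0\<close>, \<open>w\<close>, together with infinitely many planes
  in \<open>X\<close> that meet both in lines.\<close>

definition transversal_family where
 "transversal_family a b z0 w T \<xi> \<longleftrightarrow>
  a \<in> Eucl (Suc n) \<and> b \<in> Eucl (Suc n) \<and> z0 \<in> Eucl (Suc n) \<and> w \<in> Eucl (Suc n) \<and>
  (\<forall>p q r s. (\<forall>i. p * a i + q * b i + r * z0 i + s * w i = 0) --> p = 0 \<and> q = 0 \<and> r = 0 \<and> s = 0) \<and>
  infinite T \<and>
  (\<forall>\<theta>\<in>T. \<forall>s t. (\<lambda>i. s * (z0 i + \<theta> * w i) + t * (a i + \<xi> \<theta> * b i)) \<in> X)"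

text \<open>Write \<open>C0\<close> for the circle in the plane of \<open>a\<close>, \<open>b\<close>, and \<open>L x\<close> for the second circle through
  its point in direction \<open>a + x * b\<close>. A polynomial \<open>f\<close> vanishing on \<open>X\<close> gives the polynomial \<open>f (s * z + t * (a + x * b))\<close> in \<open>x\<close>
 with coefficients depending on \<open>z\<close>, which vanishes for \<open>z \<in> L x\<close>. Let \<open>h\<close> have least degree among the
 polynomials that vanish for \<open>z \<in> L x\<close> for infinitely many \<open>x\<close> and whose leading coefficient does not vanish on
 \<open>Z\<close>. Pseudo-division by \<open>h\<close> leaves no remainder, so \<open>h = 0\<close> implies that the plane through \<open>z\<close> and
 \<open>a + x * b\<close> lies in \<open>X\<close>. By minimality the derivative of \<open>h\<close> does not vanish at some such pair, so
 the zero \<open>x\<close> persists for \<open>z\<close> nearby on another circle.\<close>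

lemma transversals: "\<exists>a b z0 w T \<xi>. transversal_family a b z0 w T \<xi>"
proof -
 let ?d = "dot (Suc n)"
 obtain p where p: "p \<in> Z" "p \<notin> B" using ZB by blast
 obtain C0 where C0: "great_circle n C0" "C0 \<subseteq> Z" "p \<in> C0" using other_circle[OF p] by blast
 obtain a b where ab: "ortho (Suc n) a b" "C0 = gcirc (Suc n) a b" using C0(1) great_circle_iff by blast
 have abE: "a \<in> Eucl (Suc n)" "b \<in> Eucl (Suc n)" and dab: "?d a a = 1" "?d b b = 1" "?d a b = 0" "?d b a = 0"
  using ab(1) by (auto simp: ortho_def dot_commute)
 define nr where "nr x = sqrt (1 + x\<^sup>2)" for x :: real
 have nr: "nr x > 0" "nr x * nr x = 1 + x\<^sup>2" for x by (auto simp: nr_def add_pos_nonneg)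
 define y where "y x = (\<lambda>i. (1 / nr x) * a i + (x / nr x) * b i)" for x
 have day: "?d a (y x) = 1 / nr x" and dby: "?d b (y x) = x / nr x" for x
  unfolding y_def dot_lc' dab by simp_all
 have y_unit: "?d (y x) (y x) = 1" for x
 proof -
  have "?d (y x) (y x) = (1 / nr x) * (1 / nr x) + (x / nr x) * (x / nr x)"
   by (subst (1) y_def) (simp only: dot_lc day dby)
  also have "\<dots> = (1 + x\<^sup>2) / (nr x * nr x)" by (simp add: add_divide_distrib power2_eq_square)
  also have "\<dots> = 1" unfolding nr(2) by (metis add_nonneg_eq_0_iff divide_self one_neq_zero zero_le_one zero_le_power2)
  finally show ?thesis .
 qed
 have "y x \<in> plane a b" for x unfolding y_def by (rule plane_memI)
 then have yC0: "y x \<in> C0" for x by (simp add: ab(2) gcirc_def y_unit)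
 have y_ratio: "x = ?d b (y x) / ?d a (y x)" for x unfolding day dby using nr(1)[of x] by simp
 have y_inj: "x = x'" if "y x = y x' \<or> y x = (\<lambda>i. - y x' i)" for x x'
  using that
 proof
  assume "y x = y x'" then show ?thesis using y_ratio[of x] y_ratio[of x'] by simp
 next
  assume e: "y x = (\<lambda>i. - y x' i)"
  have "?d v (y x) = - ?d v (y x')" for v unfolding e by (simp add: dot_def sum_negf)
  then show ?thesis using y_ratio[of x] y_ratio[of x'] by simp
 qed
 define S0 where "S0 = {x. y x \<notin> B}"
 have "finite (y ` (- S0))"
  by (rule finite_subset[OF _ great_circle_finite_meet[OF C0(1) Bcl C0(3) p(2)]]) (use yC0 in \<open>auto simp: S0_def\<close>)
 moreover have "inj_on y (- S0)" using y_inj by (auto intro: inj_onI)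
 ultimately have "finite (- S0)" by (rule finite_imageD)
 then have S0inf: "infinite S0"
  by (metis Compl_partition finite_UnI infinite_UNIV_char_0)
 have yZ: "y x \<in> Z" for x using yC0 C0(2) by blast
 have "\<forall>x\<in>S0. \<exists>D. great_circle n D \<and> D \<subseteq> Z \<and> y x \<in> D \<and> D \<noteq> C0"
  using other_circle[OF yZ] by (auto simp: S0_def)
 then obtain L where L: "\<And>x. x \<in> S0 ==> great_circle n (L x)" "\<And>x. x \<in> S0 ==> L x \<subseteq> Z"
  "\<And>x. x \<in> S0 ==> y x \<in> L x" "\<And>x. x \<in> S0 ==> L x \<noteq> C0" by metis
 have L_inj: "inj_on L S0"
 proof (rule inj_onI)
  fix x x' assume x: "x \<in> S0" "x' \<in> S0" "L x = L x'"
  show "x = x'"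
  proof (rule ccontr)
   assume ne: "x \<noteq> x'"
   then have "y x' \<noteq> y x" "y x' \<noteq> (\<lambda>i. - y x i)" using y_inj[of x' x] by auto
   moreover have "y x' \<in> L x" using L(3)[OF x(2)] x(3) by simp
   ultimately have "L x = C0"
    using great_circle_eqI[OF L(1)[OF x(1)] C0(1) L(3)[OF x(1)] _ yC0 yC0] by blast
   then show False using L(4)[OF x(1)] by blast
  qed
 qed
 have many: "\<forall>z\<in>Z. f z = 0" if S: "infinite S" "S \<subseteq> S0" and f: "f \<in> polyfuns" "\<And>x z. x \<in> S ==> z \<in> L x ==> f z = 0" for S f
 proof (rule surface_many_great_circles[OF surf])
  show "infinite (L ` S)" using S L_inj finite_imageD inj_on_subset by blast
  show "great_circle n C" "C \<subseteq> Z" if "C \<in> L ` S" for C using that L(1,2) S(2) by blast+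
  show "f z = 0" if "C \<in> L ` S" "z \<in> C" for C z using that f(2) by blast
 qed (rule f(1))
 have inL: "(\<lambda>i. s * z i + t * (a i + x * b i)) \<in> X" if "x \<in> S0" "z \<in> L x" for x z s t
 proof -
  have "(\<lambda>i. s * z i + (t * nr x) * y x i) \<in> X"
   by (rule circle_plane_X[OF L(1,2) that(2) L(3)]) (use that in auto)
  moreover have "(t * nr x) * y x i = t * (a i + x * b i)" for i
   unfolding y_def using nr(1)[of x] by (simp add: field_simps)
  ultimately show ?thesis by simp
 qed
 \<comment> \<open>zs h collects the x for which h vanishes along the whole circle L x.\<close>
 define zs where "zs h = {x\<in>S0. \<forall>z\<in>L x. EV z h x = 0}" for h
 \<comment> \<open>H consists of the candidates for h. If there were none, X would contain a pencil of planes through a point of Z.\<close>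
 define H where "H = {h. (\<exists>z\<in>Z. peval z (lead_coeff h) \<noteq> 0) \<and> infinite (zs h)}"
 have trunc: "(\<forall>z\<in>Z. \<forall>x. EV z r x = 0) \<or> (\<exists>r'\<in>H. degree r' \<le> degree r)" if inf: "infinite (zs r)" for r
  using EV_truncate[of Z r]
 proof
  assume "\<exists>h'. degree h' \<le> degree r \<and> (\<exists>z\<in>Z. peval z (lead_coeff h') \<noteq> 0) \<and> (\<forall>z\<in>Z. \<forall>x. EV z h' x = EV z r x)"
  then obtain r' where r': "degree r' \<le> degree r" "\<exists>z\<in>Z. peval z (lead_coeff r') \<noteq> 0" "\<forall>z\<in>Z. \<forall>x. EV z r' x = EV z r x" by blast
  have "EV z r' x = EV z r x" if "x \<in> S0" "z \<in> L x" for x z using r'(3) L(2) that by blast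
  then have "zs r' = zs r" by (auto simp: zs_def)
  then show ?thesis using r' inf by (auto simp: H_def)
 qed simp
 have line: "\<exists>h. zs h = S0 \<and> (\<forall>z x. EV z h x = f (\<lambda>i. s * z i + t * (a i + x * b i)))"
  if f: "f \<in> polyfuns" "\<forall>x\<in>X. f x = 0" for f s t
 proof -
  obtain h where h: "\<forall>z x. EV z h x = f (\<lambda>i. s * z i + t * (a i + x * b i))"
   using EV_line[OF f(1), of s t a b] by blast
  then have "zs h = S0" using inL f(2) by (auto simp: zs_def)
  then show ?thesis using h by blast
 qed
 have "H \<noteq> {}"
 proof
  assume He: "H = {}"
  obtain x1 where x1: "x1 \<in> S0" using S0inf not_finite_existsD by (metis (full_types) Collect_mem_eq)
  have "\<not> L x1 \<subseteq> L x1 \<inter> C0"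
   using great_circle_meet_finite[OF L(1)[OF x1] C0(1) L(4)[OF x1]] great_circle_infinite[OF L(1)[OF x1]] finite_subset by blast
  then obtain z1 where z1: "z1 \<in> L x1" "z1 \<notin> C0" by blast
  have z1Z: "z1 \<in> Z" using z1 L(2) x1 by blast
  show False
  proof (rule no_pencil[of z1 a b])
   show "z1 \<in> Eucl (Suc n)" "a \<in> Eucl (Suc n)" "b \<in> Eucl (Suc n)" using ZE z1Z abE by auto
   show "p = 0 \<and> q = 0 \<and> r = 0" if e: "\<And>i. p * z1 i + q * a i + r * b i = 0" for p q r
   proof -
    have "p = 0"
    proof (rule ccontr)
     assume "p \<noteq> 0"
     then have "z1 = (\<lambda>i. (- q / p) * a i + (- r / p) * b i)"
      using e by (auto simp: fun_eq_iff field_simps) (smt (verit, best) e mult.commute)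
     then have "z1 \<in> plane a b" by (metis plane_memI)
     then show False using z1(2) Zunit[OF z1Z] by (simp add: ab(2) gcirc_def)
    qed
    moreover have "q = 0 \<and> r = 0" using indep2D[OF ortho_indep2[OF ab(1)], of q r] e \<open>p = 0\<close> by simp
    ultimately show ?thesis by simp
   qed
   show "(\<lambda>i. s * z1 i + t * (a i + x * b i)) \<in> X" for x s t
   proof (rule ccontr)
    assume nX: "(\<lambda>i. s * z1 i + t * (a i + x * b i)) \<notin> X"
    have "(\<lambda>i. s * z1 i + t * (a i + x * b i)) \<in> Eucl (Suc n)" using ZE[OF z1Z] abE by (simp add: Eucl_iff)
    then obtain f where f: "f \<in> polyfuns" "\<forall>v\<in>X. f v = 0" "f (\<lambda>i. s * z1 i + t * (a i + x * b i)) \<noteq> 0"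
     using real_closed_separate[OF X_closed _ nX] by blast
    obtain h where h: "zs h = S0" "\<forall>z x. EV z h x = f (\<lambda>i. s * z i + t * (a i + x * b i))"
     using line[OF f(1,2)] by blast
    have "EV z1 h x = 0" using trunc[of h] h(1) S0inf He z1Z by auto
    then show False using h(2) f(3) by simp
   qed
  qed
 qed
 then obtain h0 where "h0 \<in> H" by blast
 then obtain h where h: "h \<in> H" "\<And>h'. h' \<in> H ==> degree h \<le> degree h'"
  using ex_has_least_nat[of "\<lambda>h. h \<in> H" h0 degree] by blast
 have h_inf: "infinite (zs h)" and h_lc: "\<exists>z\<in>Z. peval z (lead_coeff h) \<noteq> 0" using h(1) by (auto simp: H_def)
 have h0: "h \<noteq> 0" using h_lc by auto
 \<comment> \<open>The one equation h = 0 puts the plane into X.\<close>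
 have star: "(\<lambda>i. s * z i + t * (a i + x * b i)) \<in> X"
  if z: "z \<in> Z" "peval z (lead_coeff h) \<noteq> 0" "EV z h x = 0" for z x s t
 proof (rule ccontr)
  assume nX: "(\<lambda>i. s * z i + t * (a i + x * b i)) \<notin> X"
  have "(\<lambda>i. s * z i + t * (a i + x * b i)) \<in> Eucl (Suc n)" using ZE[OF z(1)] abE by (simp add: Eucl_iff)
  then obtain f where f: "f \<in> polyfuns" "\<forall>v\<in>X. f v = 0" "f (\<lambda>i. s * z i + t * (a i + x * b i)) \<noteq> 0"
   using real_closed_separate[OF X_closed _ nX] by blast
  obtain hf where hf: "zs hf = S0" "\<forall>z x. EV z hf x = f (\<lambda>i. s * z i + t * (a i + x * b i))"
   using line[OF f(1,2)] by blast
  obtain qq r where qr: "pseudo_divmod hf h = (qq, r)" by force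
  define k where "k = Suc (degree hf) - degree h"
  have eq: "smult (lead_coeff h ^ k) hf = h * qq + r" and dr: "r = 0 \<or> degree r < degree h"
   using pseudo_divmod[OF h0 qr] by (auto simp: k_def)
  have ev: "peval z' (lead_coeff h) ^ k * EV z' hf x' = EV z' h x' * EV z' qq x' + EV z' r x'" for z' x'
   using arg_cong[OF eq, of "\<lambda>g. EV z' g x'"] by (simp only: EV_smult EV_add EV_mult peval_power)
  have "zs h \<subseteq> zs r"
  proof
   fix x' assume x': "x' \<in> zs h"
   have "EV z' r x' = 0" if "z' \<in> L x'" for z'
   proof -
    have "EV z' hf x' = 0" using hf(1) x' that unfolding zs_def by blast
    moreover have "EV z' h x' = 0" using x' that unfolding zs_def by blast
    ultimately show ?thesis using ev[of z' x'] by simp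
   qed
   then show "x' \<in> zs r" using x' unfolding zs_def by blast
  qed
  then have "infinite (zs r)" using h_inf finite_subset by blast
  from trunc[OF this] have "EV z r x = 0"
  proof
   assume "\<exists>r'\<in>H. degree r' \<le> degree r"
   then have "degree h \<le> degree r" using h(2) by fastforce
   then show ?thesis using dr by auto
  qed (use z(1) in blast)
  then have "EV z hf x = 0" using ev[of z x] z(2,3) by simp
  then show False using hf(2) f(3) by simp
 qed
 have deg: "degree h \<noteq> 0"
 proof
  assume d: "degree h = 0"
  have "peval z (lead_coeff h) = 0" if "x \<in> zs h" "z \<in> L x" for x z
  proof -
   have "EV z h x = 0" using that unfolding zs_def by blast
   then show ?thesis using EV_degree_0[OF d, of z x] by simp
  qed
  then have "\<forall>z\<in>Z. peval z (lead_coeff h) = 0"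
   by (intro many[OF h_inf]) (auto simp: zs_def)
  then show False using h_lc by blast
 qed
 have pd: "finite (zs (pderiv h))"
 proof (rule ccontr)
  assume inf: "infinite (zs (pderiv h))"
  have "lead_coeff (pderiv h) = of_nat (degree h) * lead_coeff h"
   using deg by (simp add: degree_pderiv coeff_pderiv)
  then have "peval z (lead_coeff (pderiv h)) = peval z (of_nat (degree h)) * peval z (lead_coeff h)" for z
   by (simp only: peval_mult)
  moreover have "peval z (of_nat k) = of_nat k" for z :: "nat => real" and k
   by (induction k) (auto simp: peval_add)
  ultimately have "\<exists>z\<in>Z. peval z (lead_coeff (pderiv h)) \<noteq> 0" using h_lc deg by simp
  then have "pderiv h \<in> H" using inf by (simp add: H_def)
  from h(2)[OF this] show False using deg by (simp add: degree_pderiv)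
 qed
 have lcf: "finite {x\<in>S0. \<forall>z\<in>L x. peval z (lead_coeff h) = 0}"
 proof (rule ccontr)
  assume "infinite {x\<in>S0. \<forall>z\<in>L x. peval z (lead_coeff h) = 0}"
  then have "\<forall>z\<in>Z. peval z (lead_coeff h) = 0" by (rule many) auto
  then show False using h_lc by blast
 qed
 have "infinite (zs h - (zs (pderiv h) \<union> {x\<in>S0. \<forall>z\<in>L x. peval z (lead_coeff h) = 0}))"
  using h_inf pd lcf by (intro Diff_infinite_finite) auto
 then obtain x0 where "x0 \<in> zs h - (zs (pderiv h) \<union> {x\<in>S0. \<forall>z\<in>L x. peval z (lead_coeff h) = 0})"
  using infinite_imp_nonempty by blast
 moreover have "zs h \<subseteq> S0" by (auto simp: zs_def)
 ultimately have x0: "x0 \<in> zs h" "x0 \<notin> zs (pderiv h)" "\<not> (\<forall>z\<in>L x0. peval z (lead_coeff h) = 0)" "x0 \<in> S0"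
  by auto
 let ?L = "L x0"
 have Lg: "great_circle n ?L" "?L \<subseteq> Z" "y x0 \<in> ?L" "?L \<noteq> C0" using L x0(4) by blast+
 have y0B: "y x0 \<notin> B" using x0(4) by (simp add: S0_def)
 obtain u1 where u1: "u1 \<in> ?L" "peval u1 (lead_coeff h) \<noteq> 0" using x0(3) by blast
 obtain u2 where u2: "u2 \<in> ?L" "EV u2 (pderiv h) x0 \<noteq> 0" using x0(2,4) by (auto simp: zs_def)
 have fin1: "finite {z\<in>?L. peval z (lead_coeff h) = 0}"
  by (rule circle_finite_zeros[OF great_circle_around[OF Lg(1)] peval_polyfuns u1])
 have fin2: "finite {z\<in>?L. EV z (pderiv h) x0 = 0}"
  by (rule circle_finite_zeros[OF great_circle_around[OF Lg(1)] EV_polyfuns u2])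
 have fin3: "finite (?L \<inter> B)" by (rule great_circle_finite_meet[OF Lg(1) Bcl Lg(3) y0B])
 have fin4: "finite (?L \<inter> C0)" by (rule great_circle_meet_finite[OF Lg(1) C0(1) Lg(4)])
 have "\<not> ?L \<subseteq> {y x0, \<lambda>i. - y x0 i}" using great_circle_infinite[OF Lg(1)] finite_subset by blast
 then obtain v where v: "v \<in> ?L" "v \<noteq> y x0" "v \<noteq> (\<lambda>i. - y x0 i)" by blast
 have Lv: "?L = gcirc (Suc n) (y x0) v" using great_circle_plane[OF Lg(1,3) v] by blast
 define g3 where "g3 j = (if j = 0 then a else if j = 1 then b else v)" for j :: nat
 obtain \<alpha> where \<alpha>: "\<exists>i<Suc n. \<alpha> i \<noteq> 0" "\<forall>j<3. ?d \<alpha> (g3 j) = 0"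
  using exists_orthogonal[of 3 "Suc n" g3] n3 by auto
 have a3: "?d \<alpha> a = 0" "?d \<alpha> b = 0" "?d \<alpha> v = 0"
  using \<alpha>(2)[rule_format, of 0] \<alpha>(2)[rule_format, of 1] \<alpha>(2)[rule_format, of 2] by (auto simp: g3_def)
 have "?d \<alpha> (y x0) = 0" unfolding y_def dot_lc' using a3 by simp
 then have aL: "?d \<alpha> z = 0" if "z \<in> ?L" for z
  using that a3 unfolding Lv by (auto simp: gcirc_def plane_def dot_lc')
 have "\<forall>z\<in>?L - B. \<exists>D. great_circle n D \<and> D \<subseteq> Z \<and> z \<in> D \<and> D \<noteq> ?L"
  using other_circle Lg(2) by blast
 then obtain M where M: "\<And>z. z \<in> ?L - B ==> great_circle n (M z)" "\<And>z. z \<in> ?L - B ==> M z \<subseteq> Z"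
  "\<And>z. z \<in> ?L - B ==> z \<in> M z" "\<And>z. z \<in> ?L - B ==> M z \<noteq> ?L" by metis
 \<comment> \<open>The hyperplane orthogonal to \<alpha> contains C0 and L x0; only finitely many circles lie in it.\<close>
 define Bad where "Bad = {z\<in>?L - B. \<forall>q\<in>M z. ?d \<alpha> q = 0}"
 have "finite (M ` Bad)"
  by (rule finite_subset[OF _ hyperplane_finite[OF \<alpha>(1)]]) (use M in \<open>auto simp: Bad_def\<close>)
 moreover have "finite (?L \<inter> D)" if "D \<in> M ` Bad" for D
  using that great_circle_meet_finite[OF Lg(1)] M(1,4) unfolding Bad_def by blast
 ultimately have "finite (\<Union>D\<in>M ` Bad. ?L \<inter> D)" by blast
 moreover have "Bad \<subseteq> (\<Union>D\<in>M ` Bad. ?L \<inter> D)" using M(3) by (auto simp: Bad_def)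
 ultimately have fin5: "finite Bad" using finite_subset by blast
 have "infinite (?L - ({z\<in>?L. peval z (lead_coeff h) = 0} \<union> {z\<in>?L. EV z (pderiv h) x0 = 0} \<union> (?L \<inter> B) \<union> (?L \<inter> C0) \<union> Bad))"
  using great_circle_infinite[OF Lg(1)] fin1 fin2 fin3 fin4 fin5 by (intro Diff_infinite_finite) auto
 then obtain z0 where "z0 \<in> ?L - ({z\<in>?L. peval z (lead_coeff h) = 0} \<union> {z\<in>?L. EV z (pderiv h) x0 = 0} \<union> (?L \<inter> B) \<union> (?L \<inter> C0) \<union> Bad)"
  using infinite_imp_nonempty by blast
 then have z0: "z0 \<in> ?L" "peval z0 (lead_coeff h) \<noteq> 0" "EV z0 (pderiv h) x0 \<noteq> 0" "z0 \<notin> B" "z0 \<notin> C0" "z0 \<notin> Bad"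
  by auto
 have z0Z: "z0 \<in> Z" using z0(1) Lg(2) by blast
 obtain w where w: "w \<in> M z0" "?d \<alpha> w \<noteq> 0" using z0 by (auto simp: Bad_def)
 have M0: "great_circle n (M z0)" "M z0 \<subseteq> Z" "z0 \<in> M z0" using M z0 by blast+
 have wZ: "w \<in> Z" using w M0 by blast
 have ind: "p = 0 \<and> q = 0 \<and> r = 0 \<and> s = 0" if e: "\<And>i. p * a i + q * b i + r * z0 i + s * w i = 0" for p q r s
 proof -
  have "0 = ?d \<alpha> (\<lambda>i. p * a i + q * b i + r * z0 i + s * w i)" unfolding e by (simp add: dot_def)
  also have "\<dots> = p * ?d \<alpha> a + q * ?d \<alpha> b + r * ?d \<alpha> z0 + s * ?d \<alpha> w"
   unfolding dot_def by (simp add: algebra_simps sum.distrib sum_distrib_left)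
  finally have s0: "s = 0" using a3 aL[OF z0(1)] w(2) by simp
  have r0: "r = 0"
  proof (rule ccontr)
   assume r: "r \<noteq> 0"
   have "z0 i = (- p / r) * a i + (- q / r) * b i" for i
   proof -
    have "r * z0 i = - p * a i - q * b i" using e[of i] s0 by simp
    then have "z0 i = (- p * a i - q * b i) / r" using r by (simp add: field_simps)
    then show ?thesis by (simp add: diff_divide_distrib)
   qed
   then have "z0 = (\<lambda>i. (- p / r) * a i + (- q / r) * b i)" by blast
   then have "z0 \<in> plane a b" by (metis plane_memI)
   then show False using z0(5) Zunit[OF z0Z] by (simp add: ab(2) gcirc_def)
  qed
  have "p = 0 \<and> q = 0" using indep2D[OF ortho_indep2[OF ab(1)], of p q] e s0 r0 by simp
  then show ?thesis using s0 r0 by simp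
 qed
 have root0: "poly (map_poly (peval z0) h) x0 = 0" using x0(1) z0(1) by (auto simp: zs_def EV_poly)
 have "poly (pderiv (map_poly (peval z0) h)) x0 \<noteq> 0" using z0(3) by (simp add: EV_pderiv)
 then obtain x1 x2 where x12: "x1 < x2" "EV z0 h x1 * EV z0 h x2 < 0"
  using simple_root_sign_change[OF root0] unfolding EV_poly by blast
 define q where "q \<theta> = (\<lambda>i. 1 * z0 i + \<theta> * w i)" for \<theta>
 have qE: "q \<theta> \<in> Eucl (Suc n)" for \<theta> unfolding q_def using ZE[OF z0Z] ZE[OF wZ] by blast
 have q0: "q \<theta> \<noteq> (\<lambda>i. 0)" for \<theta>
 proof
  assume "q \<theta> = (\<lambda>i. 0)"
  then have "0 * a i + 0 * b i + 1 * z0 i + \<theta> * w i = 0" for i by (auto simp: q_def fun_eq_iff)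
  from ind[OF this] show False by simp
 qed
 define N where "N \<theta> = sqrt (?d (q \<theta>) (q \<theta>))" for \<theta>
 have N: "N \<theta> > 0" "N \<theta> * N \<theta> = ?d (q \<theta>) (q \<theta>)" for \<theta>
  using dot_self_pos[OF qE[of \<theta>] q0[of \<theta>]] by (auto simp: N_def)
 define zt where "zt \<theta> = (\<lambda>i. (1 / N \<theta>) * q \<theta> i)" for \<theta>
 have ztZ: "zt \<theta> \<in> Z" for \<theta>
 proof (rule X_unit)
  have "q \<theta> \<in> X" unfolding q_def by (rule circle_plane_X[OF M0 w(1)])
  then show "zt \<theta> \<in> X" unfolding zt_def by (rule X_scale)
  show "?d (zt \<theta>) (zt \<theta>) = 1" unfolding zt_def dot_scale N(2)[symmetric] using N(1)[of \<theta>] by simp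
 qed
 have zt0: "zt 0 = z0"
 proof -
  have "q 0 = z0" by (simp add: q_def)
  then have "N 0 = 1" unfolding N_def using Zunit[OF z0Z] by simp
  then show ?thesis using \<open>q 0 = z0\<close> by (simp add: zt_def)
 qed
 have contN: "continuous_on UNIV N" unfolding N_def dot_def q_def by (intro continuous_intros)
 have cont: "continuous_on UNIV (\<lambda>\<theta>. zt \<theta> i)" for i
  unfolding zt_def q_def using N(1)[THEN less_imp_neq] contN by (intro continuous_intros) auto
 have contP: "continuous_on UNIV (\<lambda>\<theta>. f (zt \<theta>))" if "f \<in> polyfuns" for f
  using polyfuns_continuous[OF that cont] .
 define T where "T = {\<theta>. EV (zt \<theta>) h x1 * EV (zt \<theta>) h x2 < 0} \<inter> {\<theta>. peval (zt \<theta>) (lead_coeff h) \<noteq> 0}"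
 have "open T" unfolding T_def
  by (intro open_Int open_Collect_less open_Collect_neq continuous_on_mult contP EV_polyfuns peval_polyfuns continuous_on_const)
 moreover have "0 \<in> T" unfolding T_def using zt0 x12(2) z0(2) by simp
 ultimately have Tinf: "infinite T" using finite_imp_not_open by blast
 have "\<exists>x. EV (zt \<theta>) h x = 0" if "\<theta> \<in> T" for \<theta>
  using poly_IVT[OF x12(1), of "map_poly (peval (zt \<theta>)) h"] that unfolding T_def EV_poly by blast
 then obtain \<xi> where \<xi>: "\<And>\<theta>. \<theta> \<in> T ==> EV (zt \<theta>) h (\<xi> \<theta>) = 0" by metis
 have fin: "(\<lambda>i. s * (z0 i + \<theta> * w i) + t * (a i + \<xi> \<theta> * b i)) \<in> X" if "\<theta> \<in> T" for \<theta> s t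
 proof -
  have "(\<lambda>i. (s * N \<theta>) * zt \<theta> i + t * (a i + \<xi> \<theta> * b i)) \<in> X"
   by (rule star[OF ztZ _ \<xi>[OF that]]) (use that in \<open>simp add: T_def\<close>)
  moreover have "(s * N \<theta>) * zt \<theta> i = s * (z0 i + \<theta> * w i)" for i
   using N(1)[of \<theta>] by (simp add: zt_def q_def)
  ultimately show ?thesis by simp
 qed
 have "transversal_family a b z0 w T \<xi>"
  unfolding transversal_family_def
 proof (intro conjI ballI allI abE ZE[OF z0Z] ZE[OF wZ] Tinf fin)
  show "(\<forall>i. p * a i + q * b i + r * z0 i + s * w i = 0) --> p = 0 \<and> q = 0 \<and> r = 0 \<and> s = 0" for p q r s
   using ind[of p q r s] by simp
 qed
 then show ?thesis by blast
qed

text \<open>If \<open>w1\<close> were a multiple of \<open>z1\<close>, then \<open>X\<close> would contain a pencil of planes through \<open>z1\<close> in a 3-space.\<close>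

lemma independent_components:
 assumes E: "z1 \<in> Eucl (Suc n)" "z2 \<in> Eucl (Suc n)" "w2 \<in> Eucl (Suc n)"
  and nz: "z1 \<noteq> (\<lambda>i. 0)" "z2 \<noteq> (\<lambda>i. 0)"
  and direct: "\<And>p q r s. (\<And>i. p * z1 i + q * w1 i + r * z2 i + s * w2 i = 0) ==>
    (\<forall>i. p * z1 i + q * w1 i = 0) \<and> (\<forall>i. r * z2 i + s * w2 i = 0)"
  and K: "\<And>s t p q. (\<lambda>i. s * (p * z1 i + q * w1 i) + t * (p * z2 i + q * w2 i)) \<in> X"
  and ne: "gcirc (Suc n) (\<lambda>i. z1 i + z2 i) (\<lambda>i. w1 i + w2 i) \<noteq> gcirc (Suc n) z1 z2"
  and ind: "indep2 (\<lambda>i. z1 i + z2 i) (\<lambda>i. w1 i + w2 i)"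
 shows "indep2 z1 w1"
proof (rule ccontr)
 assume "\<not> indep2 z1 w1"
 then obtain p q where pq: "\<And>i. p * z1 i + q * w1 i = 0" "\<not> (p = 0 \<and> q = 0)" unfolding indep2_def by blast
 have q: "q \<noteq> 0"
 proof
  assume "q = 0"
  then have "z1 i = 0" for i using pq(1)[of i] pq(2) by simp
  then show False using nz(1) by auto
 qed
 define k where "k = - p / q"
 have w1: "w1 i = k * z1 i" for i
 proof -
  have "q * w1 i = - p * z1 i" using pq(1)[of i] by simp
  then show ?thesis using q by (simp add: k_def field_simps)
 qed
 define v where "v = (\<lambda>i. 1 * w2 i + (- k) * z2 i)"
 show False
 proof (rule no_pencil[of z1 z2 v])
  show "z1 \<in> Eucl (Suc n)" "z2 \<in> Eucl (Suc n)" "v \<in> Eucl (Suc n)" unfolding v_def using E by blast+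
  show "p = 0 \<and> q = 0 \<and> r = 0" if e: "\<And>i. p * z1 i + q * z2 i + r * v i = 0" for p q r
  proof -
   have "p * z1 i + 0 * w1 i + (q - r * k) * z2 i + r * w2 i = 0" for i
    using e[of i] by (simp add: v_def algebra_simps)
   from direct[OF this] have d': "\<forall>i. p * z1 i + 0 * w1 i = 0" "\<forall>i. (q - r * k) * z2 i + r * w2 i = 0" by (rule conjunct1, rule conjunct2)
   have d: "p * z1 i = 0" "(q - r * k) * z2 i + r * w2 i = 0" for i using d'[rule_format, of i] by simp_all
   have "p = 0" using d(1) nz(1) by auto
   moreover have "r = 0"
   proof (rule ccontr)
    assume r: "r \<noteq> 0"
    define mu where "mu = - (q - r * k) / r"
    have "w2 i = mu * z2 i" for i
    proof -
     have "r * w2 i = - (q - r * k) * z2 i" using d(2)[of i] by (simp add: algebra_simps)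
     then show ?thesis using r by (simp add: mu_def field_simps)
    qed
    then have "(\<lambda>i. w1 i + w2 i) = (\<lambda>i. k * z1 i + mu * z2 i)" using w1 by simp
    then have "(\<lambda>i. w1 i + w2 i) \<in> plane z1 z2" by (simp only: plane_memI)
    moreover have "(\<lambda>i. z1 i + z2 i) \<in> plane z1 z2" using plane_memI[of 1 z1 1 z2] by simp
    ultimately have "plane (\<lambda>i. z1 i + z2 i) (\<lambda>i. w1 i + w2 i) = plane z1 z2"
     using indep2_plane_eq[OF ind] by blast
    then show False using ne by (simp add: gcirc_def)
   qed
   moreover have "q = 0" using d(2) \<open>r = 0\<close> nz(2) by auto
   ultimately show ?thesis by simp
  qed
  show "(\<lambda>i. s * z1 i + t * (z2 i + x * v i)) \<in> X" for x s t
  proof -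
   have "s * ((1 - x * k) * z1 i + x * w1 i) + t * ((1 - x * k) * z2 i + x * w2 i) = s * z1 i + t * (z2 i + x * v i)" for i
    unfolding w1 v_def by (simp add: algebra_simps)
   then show ?thesis using K[of s "1 - x * k" x t] by simp
  qed
 qed
qed

text \<open>The transversals of \<open>transversal_family\<close> are invariant under the two-parameter group that scales
  the planes of \<open>a\<close>, \<open>b\<close> and of \<open>z0\<close>, \<open>w\<close> separately. They are dense in \<open>Z\<close>, so \<open>X\<close> is invariant. Apply
  the group to a circle \<open>N\<close> through a general point \<open>z\<close> that is not the transversal through \<open>z\<close>: the
  resulting planes lie both in \<open>X\<close> and in a nondegenerate quadric, and every point of the quadric is on one.\<close>

lemma quadric:
 shows "n = 3" and "\<exists>l :: nat => nat => real. (\<forall>j<4. l j \<in> Eucl 4) \<and> (\<forall>c. \<exists>y\<in>Eucl 4. \<forall>j<4. dot 4 (l j) y = c j) \<and>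
  Z = {y \<in> topspace (nsphere 3). dot 4 (l 0) y * dot 4 (l 3) y = dot 4 (l 1) y * dot 4 (l 2) y}"
proof -
 obtain a b z0 w T \<xi> where fam: "transversal_family a b z0 w T \<xi>" using transversals by blast
 then have E: "a \<in> Eucl (Suc n)" "b \<in> Eucl (Suc n)" "z0 \<in> Eucl (Suc n)" "w \<in> Eucl (Suc n)" and T: "infinite T"
  by (simp_all add: transversal_family_def)
 have ind: "p = 0 \<and> q = 0 \<and> r = 0 \<and> s = 0" if "\<And>i. p * a i + q * b i + r * z0 i + s * w i = 0" for p q r s
  using fam that unfolding transversal_family_def by blast
 have tX: "(\<lambda>i. s * (z0 i + \<theta> * w i) + t * (a i + \<xi> \<theta> * b i)) \<in> X" if "\<theta> \<in> T" for \<theta> s t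
  using fam that unfolding transversal_family_def by blast
 have tmany: "\<forall>z\<in>Z. f z = 0"
  if f: "f \<in> polyfuns" "\<And>\<theta> s t. \<theta> \<in> T ==> f (\<lambda>i. s * (z0 i + \<theta> * w i) + t * (a i + \<xi> \<theta> * b i)) = 0" for f
 proof (rule planes_many[OF T, where x = "\<lambda>\<theta> i. z0 i + \<theta> * w i" and y = "\<lambda>\<theta> i. a i + \<xi> \<theta> * b i"])
  fix \<theta> assume \<theta>: "\<theta> \<in> T"
  show "(\<lambda>i. z0 i + \<theta> * w i) \<in> Eucl (Suc n)" "(\<lambda>i. a i + \<xi> \<theta> * b i) \<in> Eucl (Suc n)"
   using E by (simp_all add: Eucl_iff)
  show "plane (\<lambda>i. z0 i + \<theta> * w i) (\<lambda>i. a i + \<xi> \<theta> * b i) \<subseteq> X" using tX[OF \<theta>] by (auto simp: plane_def)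
  show "indep2 (\<lambda>i. z0 i + \<theta> * w i) (\<lambda>i. a i + \<xi> \<theta> * b i)" unfolding indep2_def
  proof (intro allI impI)
   fix s t assume "\<forall>i. s * (z0 i + \<theta> * w i) + t * (a i + \<xi> \<theta> * b i) = 0"
   then have "t * a i + (t * \<xi> \<theta>) * b i + s * z0 i + (s * \<theta>) * w i = 0" for i by (simp add: algebra_simps)
   from ind[OF this] show "s = 0 \<and> t = 0" by simp
  qed
  show "f p = 0" if "p \<in> plane (\<lambda>i. z0 i + \<theta> * w i) (\<lambda>i. a i + \<xi> \<theta> * b i)" for p
   using that f(2)[OF \<theta>] by (auto simp: plane_def)
  fix \<sigma> assume "\<sigma> \<in> T" and "(\<lambda>i. z0 i + \<theta> * w i) \<in> plane (\<lambda>i. z0 i + \<sigma> * w i) (\<lambda>i. a i + \<xi> \<sigma> * b i)"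
  from planeE[OF this(2)] obtain s t where
   "\<And>i. z0 i + \<theta> * w i = s * (z0 i + \<sigma> * w i) + t * (a i + \<xi> \<sigma> * b i)" by blast
  then have "t * a i + (t * \<xi> \<sigma>) * b i + (s - 1) * z0 i + (s * \<sigma> - \<theta>) * w i = 0" for i by (simp add: algebra_simps)
  from ind[OF this] show "\<theta> = \<sigma>" by auto
 qed (rule f(1))
 define g where "g j = (if j = 0 then a else if j = 1 then b else if j = 2 then z0 else w)" for j :: nat
 have g4: "g 0 = a" "g 1 = b" "g 2 = z0" "g 3 = w" by (auto simp: g_def)
 have lin: "dot m v (\<lambda>i. s * (z0 i + \<theta> * w i) + t * (a i + x * b i)) =
   s * (dot m v z0 + \<theta> * dot m v w) + t * (dot m v a + x * dot m v b)" for m v s t \<theta> x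
  unfolding dot_def by (simp add: algebra_simps sum.distrib sum_distrib_left)
 show n: "n = 3"
 proof (rule ccontr)
  assume "n \<noteq> 3"
  then have "4 < Suc n" using n3 by simp
  then obtain \<alpha> where \<alpha>: "\<exists>i<Suc n. \<alpha> i \<noteq> 0" "\<forall>j<4. dot (Suc n) \<alpha> (g j) = 0"
   using exists_orthogonal[of 4 "Suc n" g] by blast
  have "dot (Suc n) \<alpha> a = 0" "dot (Suc n) \<alpha> b = 0" "dot (Suc n) \<alpha> z0 = 0" "dot (Suc n) \<alpha> w = 0"
   using \<alpha>(2)[rule_format, of 0] \<alpha>(2)[rule_format, of 1] \<alpha>(2)[rule_format, of 2] \<alpha>(2)[rule_format, of 3]
   unfolding g4 by simp_all
  then have "\<forall>z\<in>Z. dot (Suc n) \<alpha> z = 0" by (intro tmany) (auto simp: lin)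
  then show False using not_hyperplane[OF \<alpha>(1)] by blast
 qed
 have m4: "Suc n = 4" using n by simp
 have sum4: "(\<Sum>j<4. F j) = F 0 + F 1 + F 2 + F (3::nat)" for F :: "nat => real"
  by (simp add: eval_nat_numeral)
 have less4: "j < 4 \<longleftrightarrow> j = 0 \<or> j = 1 \<or> j = 2 \<or> j = 3" for j :: nat by auto
 have li: "lin_indep 4 g" unfolding lin_indep_def sum4 g4
 proof (intro allI impI)
  fix c :: "nat => real" and j :: nat
  assume "\<forall>i. c 0 * a i + c 1 * b i + c 2 * z0 i + c 3 * w i = 0" "j < 4"
  with ind[of "c 0" "c 1" "c 2" "c 3"] show "c j = 0" by (auto simp: less4)
 qed
 have gE: "g j \<in> Eucl 4" if "j < 4" for j using E unfolding m4 by (simp add: g_def)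
 obtain l where l0: "\<forall>i<4. l i \<in> Eucl 4"
  "\<forall>i<4. \<forall>j<4. dot 4 (l i) (g j) = (if i = j then 1 else 0)"
  "\<forall>y\<in>Eucl 4. \<forall>i. y i = (\<Sum>j<4. dot 4 (l j) y * g j i)"
  using dual_basis[OF gE li] by blast
 note l = l0[rule_format]
 have dl: "dot 4 (l i) a = (if i = 0 then 1 else 0)" "dot 4 (l i) b = (if i = 1 then 1 else 0)"
  "dot 4 (l i) z0 = (if i = 2 then 1 else 0)" "dot 4 (l i) w = (if i = 3 then 1 else 0)" if "i < 4" for i
  using l(2)[OF that, of 0] l(2)[OF that, of 1] l(2)[OF that, of 2] l(2)[OF that, of 3] unfolding g4 by auto
 define A where "A y = (\<lambda>i. dot 4 (l 0) y * a i + dot 4 (l 1) y * b i)" for y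
 define A2 where "A2 y = (\<lambda>i. dot 4 (l 2) y * z0 i + dot 4 (l 3) y * w i)" for y
 have split: "y i = A y i + A2 y i" if "y \<in> Eucl 4" for y i
  using l(3)[OF that, of i] unfolding sum4 g4 A_def A2_def by simp
 have Alin: "A (\<lambda>i. p * x i + q * y i) = (\<lambda>i. p * A x i + q * A y i)"
  "A2 (\<lambda>i. p * x i + q * y i) = (\<lambda>i. p * A2 x i + q * A2 y i)" for p q x y
  unfolding A_def A2_def dot_lc' by (auto simp: algebra_simps)
 have AA: "A (A y) = A y" "A (A2 y) = (\<lambda>i. 0)" "A2 (A2 y) = A2 y" "A2 (A y) = (\<lambda>i. 0)" for y
  unfolding A_def A2_def dot_lc' by (simp_all add: dl)
 have AE: "A y \<in> Eucl 4" "A2 y \<in> Eucl 4" for y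
  unfolding A_def A2_def using E unfolding m4 by blast+
 have scale: "(\<lambda>i. s * A y i + t * A2 y i) \<in> X" if y: "y \<in> Z" for y s t
 proof (rule ccontr)
  assume nX: "(\<lambda>i. s * A y i + t * A2 y i) \<notin> X"
  have "(\<lambda>i. s * A y i + t * A2 y i) \<in> Eucl (Suc n)" unfolding m4 using AE by blast
  then obtain f where f: "f \<in> polyfuns" "\<forall>v\<in>X. f v = 0" "f (\<lambda>i. s * A y i + t * A2 y i) \<noteq> 0"
   using real_closed_separate[OF X_closed _ nX] by blast
  have "\<forall>z\<in>Z. f (\<lambda>i. s * A z i + t * A2 z i) = 0"
  proof (rule tmany)
   show "(\<lambda>z. f (\<lambda>i. s * A z i + t * A2 z i)) \<in> polyfuns"
    unfolding A_def A2_def by (rule polyfuns_comp[OF f(1)]) (intro polyfuns_add polyfuns_mult polyfuns_const dot_polyfuns)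
   fix \<theta> s' t' assume \<theta>: "\<theta> \<in> T"
   let ?p = "\<lambda>i. s' * (z0 i + \<theta> * w i) + t' * (a i + \<xi> \<theta> * b i)"
   have "A ?p = (\<lambda>i. t' * (a i + \<xi> \<theta> * b i))" "A2 ?p = (\<lambda>i. s' * (z0 i + \<theta> * w i))"
    unfolding A_def A2_def lin by (auto simp: dl algebra_simps)
   then have "(\<lambda>i. s * A ?p i + t * A2 ?p i) = (\<lambda>i. (t * s') * (z0 i + \<theta> * w i) + (s * t') * (a i + \<xi> \<theta> * b i))"
    by (auto simp: algebra_simps)
   then show "f (\<lambda>i. s * A ?p i + t * A2 ?p i) = 0" using tX[OF \<theta>] f(2) by simp
  qed
  then show False using f(3) y by blast
 qed
 have scaleX: "(\<lambda>i. s * A y i + t * A2 y i) \<in> X" if y: "y \<in> X" for y s t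
 proof -
  obtain r z where rz: "z \<in> Z" "y = (\<lambda>i. r * z i)" using y by (auto simp: X_def)
  have "A y = (\<lambda>i. r * A z i)" "A2 y = (\<lambda>i. r * A2 z i)"
   using Alin[of r z 0 z] by (simp_all add: rz(2))
  then show ?thesis using scale[OF rz(1), of "s * r" "t * r"] by (simp add: mult.assoc)
 qed
 obtain q0 where q0: "q0 \<in> Z" "q0 \<notin> B" using ZB by blast
 obtain fB where fB: "fB \<in> polyfuns" "\<forall>v\<in>B. fB v = 0" "fB q0 \<noteq> 0"
  using real_closed_separate[OF Bcl ZE[OF q0(1)] q0(2)] by blast
 have lnz: "\<exists>i<Suc n. l j i \<noteq> 0" if "j < 4" for j
 proof (rule ccontr)
  assume "\<not> ?thesis"
  then have "dot 4 (l j) (g j) = 0" unfolding m4 by (simp add: dot_def)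
  then show False using l(2)[OF that that] by simp
 qed
 define f2 where "f2 y = (dot 4 (l 0) y)\<^sup>2 + (dot 4 (l 1) y)\<^sup>2" for y
 define f3 where "f3 y = (dot 4 (l 2) y)\<^sup>2 + (dot 4 (l 3) y)\<^sup>2" for y
 have fp: "f2 \<in> polyfuns" "f3 \<in> polyfuns" unfolding f2_def[abs_def] f3_def[abs_def]
  by (intro polyfuns_add polyfuns_power dot_polyfuns)+
 have "\<exists>z\<in>Z. f2 z \<noteq> 0" using not_hyperplane[OF lnz, of 0] unfolding m4 f2_def by (auto simp: sum_power2_eq_zero_iff)
 then obtain q2 where q2: "q2 \<in> Z" "f2 q2 \<noteq> 0" by blast
 have "\<exists>z\<in>Z. f3 z \<noteq> 0" using not_hyperplane[OF lnz, of 2] unfolding m4 f3_def by (auto simp: sum_power2_eq_zero_iff)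
 then obtain q3 where q3: "q3 \<in> Z" "f3 q3 \<noteq> 0" by blast
 have "\<exists>z\<in>Z. fB z * (f2 z * f3 z) \<noteq> 0"
 proof (rule ccontr)
  assume no: "\<not> ?thesis"
  have "f2 z * f3 z = 0" if "z \<in> Z" for z
   by (rule poly_primeD[OF Zprime fB(1) polyfuns_mult[OF fp] _ q0(1) fB(3) that]) (use no in blast)
  from poly_primeD[OF Zprime fp this q2 q3(1)] show False using q3(2) by simp
 qed
 then obtain z where z: "z \<in> Z" "fB z \<noteq> 0" "f2 z \<noteq> 0" "f3 z \<noteq> 0" by auto
 have zB: "z \<notin> B" using z(2) fB(2) by blast
 obtain N where N: "great_circle n N" "N \<subseteq> Z" "z \<in> N" "N \<noteq> gcirc (Suc n) (A z) (A2 z)"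
  using other_circle[OF z(1) zB] by blast
 have "\<not> N \<subseteq> {z, \<lambda>i. - z i}" using great_circle_infinite[OF N(1)] finite_subset by blast
 then obtain w' where w': "w' \<in> N" "w' \<noteq> z" "w' \<noteq> (\<lambda>i. - z i)" by blast
 have Nz: "N = gcirc (Suc n) z w'" and izw: "indep2 z w'" using great_circle_plane[OF N(1,3) w'] by auto
 have zE: "z \<in> Eucl 4" and wE: "w' \<in> Eucl 4" using ZE z(1) w'(1) N(2) unfolding m4 by blast+
 define z1 z2 w1 w2 where defs: "z1 = A z" "z2 = A2 z" "w1 = A w'" "w2 = A2 w'"
 have zz: "z = (\<lambda>i. z1 i + z2 i)" "w' = (\<lambda>i. w1 i + w2 i)" using split[OF zE] split[OF wE] by (auto simp: defs)
 have z1n: "z1 \<noteq> (\<lambda>i. 0)"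
 proof
  assume "z1 = (\<lambda>i. 0)"
  then have "dot 4 (l 0) (A z) = 0" "dot 4 (l 1) (A z) = 0" by (simp_all add: defs dot_def)
  then show False using z(3) unfolding A_def dot_lc' f2_def by (simp add: dl)
 qed
 have z2n: "z2 \<noteq> (\<lambda>i. 0)"
 proof
  assume "z2 = (\<lambda>i. 0)"
  then have "dot 4 (l 2) (A2 z) = 0" "dot 4 (l 3) (A2 z) = 0" by (simp_all add: defs dot_def)
  then show False using z(4) unfolding A2_def dot_lc' f3_def by (simp add: dl)
 qed
 have direct: "(\<forall>i. p * z1 i + q * w1 i = 0) \<and> (\<forall>i. r * z2 i + s * w2 i = 0)"
  if e: "\<And>i. p * z1 i + q * w1 i + r * z2 i + s * w2 i = 0" for p q r s
 proof -
  have 1: "(\<lambda>i. 1 * (p * z1 i + q * w1 i) + 1 * (r * z2 i + s * w2 i)) = (\<lambda>i. 0)"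
   using e by (simp add: add.assoc)
  have "A (\<lambda>i. 1 * (p * z1 i + q * w1 i) + 1 * (r * z2 i + s * w2 i)) = (\<lambda>i. p * z1 i + q * w1 i)"
   unfolding Alin by (simp add: defs AA)
  moreover have "A2 (\<lambda>i. 1 * (p * z1 i + q * w1 i) + 1 * (r * z2 i + s * w2 i)) = (\<lambda>i. r * z2 i + s * w2 i)"
   unfolding Alin by (simp add: defs AA)
  moreover have "A (\<lambda>i. 0) = (\<lambda>i. 0)" "A2 (\<lambda>i. 0) = (\<lambda>i. 0)" by (simp_all add: A_def A2_def dot_def)
  ultimately show ?thesis unfolding 1 by metis
 qed
 have K: "(\<lambda>i. s * (p * z1 i + q * w1 i) + t * (p * z2 i + q * w2 i)) \<in> X" for s t p q
  using scaleX[OF circle_plane_X[OF N(1,2,3) w'(1), of p q], of s t] unfolding Alin by (simp add: defs)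
 have ne: "gcirc (Suc n) (\<lambda>i. z1 i + z2 i) (\<lambda>i. w1 i + w2 i) \<noteq> gcirc (Suc n) z1 z2"
 proof -
  have e: "gcirc (Suc n) (\<lambda>i. z1 i + z2 i) (\<lambda>i. w1 i + w2 i) = N" unfolding Nz zz[symmetric] ..
  have "N \<noteq> gcirc (Suc n) z1 z2" unfolding defs(1,2) by (rule N(4))
  then show ?thesis unfolding e .
 qed
 have izw': "indep2 (\<lambda>i. z1 i + z2 i) (\<lambda>i. w1 i + w2 i)" using izw unfolding zz .
 have E4: "z1 \<in> Eucl (Suc n)" "z2 \<in> Eucl (Suc n)" "w1 \<in> Eucl (Suc n)" "w2 \<in> Eucl (Suc n)"
  unfolding m4 defs using AE by auto
 have i1: "indep2 z1 w1"
  by (rule independent_components[OF E4(1,2,4) z1n z2n direct K ne izw'])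
 have i2: "indep2 z2 w2"
 proof (rule independent_components[OF E4(2,1,3) z2n z1n])
  show "(\<forall>i. p * z2 i + q * w2 i = 0) \<and> (\<forall>i. r * z1 i + s * w1 i = 0)"
   if "\<And>i. p * z2 i + q * w2 i + r * z1 i + s * w1 i = 0" for p q r s
   using direct[of r s p q] that by (simp add: algebra_simps)
  show "(\<lambda>i. s * (p * z2 i + q * w2 i) + t * (p * z1 i + q * w1 i)) \<in> X" for s t p q
   using K[of t p q s] by (simp add: add.commute)
  have "plane z2 z1 = plane z1 z2" by (intro equalityI plane_subset plane_mem)
  then have "gcirc (Suc n) z2 z1 = gcirc (Suc n) z1 z2" by (simp add: gcirc_def)
  then show "gcirc (Suc n) (\<lambda>i. z2 i + z1 i) (\<lambda>i. w2 i + w1 i) \<noteq> gcirc (Suc n) z2 z1"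
   using ne by (simp add: add.commute)
  show "indep2 (\<lambda>i. z2 i + z1 i) (\<lambda>i. w2 i + w1 i)" using izw' by (simp add: add.commute)
 qed
 have ind': "p = 0 \<and> q = 0 \<and> r = 0 \<and> s = 0" if "\<And>i. p * z1 i + q * w1 i + r * z2 i + s * w2 i = 0" for p q r s
  using direct[OF that] indep2D[OF i1, of p q] indep2D[OF i2, of r s] by blast
 define h where "h j = (if j = 0 then z1 else if j = 1 then w1 else if j = 2 then z2 else w2)" for j :: nat
 have h4: "h 0 = z1" "h 1 = w1" "h 2 = z2" "h 3 = w2" by (auto simp: h_def)
 have lih: "lin_indep 4 h" unfolding lin_indep_def sum4 h4
 proof (intro allI impI)
  fix c :: "nat => real" and j :: nat
  assume "\<forall>i. c 0 * z1 i + c 1 * w1 i + c 2 * z2 i + c 3 * w2 i = 0" "j < 4"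
  with ind'[of "c 0" "c 1" "c 2" "c 3"] show "c j = 0" by (auto simp: less4)
 qed
 have hE: "h j \<in> Eucl 4" for j using E4 unfolding m4 by (simp add: h_def)
 obtain k where k0: "\<forall>i<4. k i \<in> Eucl 4"
  "\<forall>i<4. \<forall>j<4. dot 4 (k i) (h j) = (if i = j then 1 else 0)"
  "\<forall>y\<in>Eucl 4. \<forall>i. y i = (\<Sum>j<4. dot 4 (k j) y * h j i)"
  using dual_basis[OF hE lih] by blast
 note k = k0[rule_format]
 have dk: "dot 4 (k i) z1 = (if i = 0 then 1 else 0)" "dot 4 (k i) w1 = (if i = 1 then 1 else 0)"
  "dot 4 (k i) z2 = (if i = 2 then 1 else 0)" "dot 4 (k i) w2 = (if i = 3 then 1 else 0)" if "i < 4" for i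
  using k(2)[OF that, of 0] k(2)[OF that, of 1] k(2)[OF that, of 2] k(2)[OF that, of 3] unfolding h4 by auto
 let ?Q = "\<lambda>y. dot 4 (k 0) y * dot 4 (k 3) y - dot 4 (k 1) y * dot 4 (k 2) y"
 have QZ: "\<forall>y\<in>Z. ?Q y = 0"
 proof (rule planes_many[where T = "UNIV :: real set" and x = "\<lambda>\<tau> i. 1 * z1 i + \<tau> * w1 i" and y = "\<lambda>\<tau> i. 1 * z2 i + \<tau> * w2 i"])
  show "infinite (UNIV :: real set)" by (rule infinite_UNIV_char_0)
  show "(\<lambda>i. 1 * z1 i + \<tau> * w1 i) \<in> Eucl (Suc n)" "(\<lambda>i. 1 * z2 i + \<tau> * w2 i) \<in> Eucl (Suc n)" for \<tau>
   using E4 by blast+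
  show "plane (\<lambda>i. 1 * z1 i + \<tau> * w1 i) (\<lambda>i. 1 * z2 i + \<tau> * w2 i) \<subseteq> X" for \<tau>
   using K[of _ 1 \<tau>] by (auto simp: plane_def)
  show "indep2 (\<lambda>i. 1 * z1 i + \<tau> * w1 i) (\<lambda>i. 1 * z2 i + \<tau> * w2 i)" for \<tau> unfolding indep2_def
  proof (intro allI impI)
   fix s t assume "\<forall>i. s * (1 * z1 i + \<tau> * w1 i) + t * (1 * z2 i + \<tau> * w2 i) = 0"
   then have "s * z1 i + (s * \<tau>) * w1 i + t * z2 i + (t * \<tau>) * w2 i = 0" for i by (simp add: algebra_simps)
   from ind'[OF this] show "s = 0 \<and> t = 0" by simp
  qed
  show "\<tau> = \<sigma>" if "(\<lambda>i. 1 * z1 i + \<tau> * w1 i) \<in> plane (\<lambda>i. 1 * z1 i + \<sigma> * w1 i) (\<lambda>i. 1 * z2 i + \<sigma> * w2 i)" for \<tau> \<sigma>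
  proof -
   from planeE[OF that] obtain s t where "\<And>i. 1 * z1 i + \<tau> * w1 i = s * (1 * z1 i + \<sigma> * w1 i) + t * (1 * z2 i + \<sigma> * w2 i)"
    by blast
   then have "(s - 1) * z1 i + (s * \<sigma> - \<tau>) * w1 i + t * z2 i + (t * \<sigma>) * w2 i = 0" for i by (simp add: algebra_simps)
   from ind'[OF this] show ?thesis by auto
  qed
  show "?Q \<in> polyfuns" by (intro polyfuns_diff polyfuns_mult dot_polyfuns)
  show "?Q p = 0" if "p \<in> plane (\<lambda>i. 1 * z1 i + \<tau> * w1 i) (\<lambda>i. 1 * z2 i + \<tau> * w2 i)" for \<tau> p
  proof -
   from that obtain s t where p: "p = (\<lambda>i. s * (1 * z1 i + \<tau> * w1 i) + t * (1 * z2 i + \<tau> * w2 i))"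
    unfolding plane_def by blast
   show ?thesis unfolding p dot_lc' by (simp add: dk)
  qed
 qed
 have conv: "y \<in> Z" if y: "y \<in> topspace (nsphere 3)" "?Q y = 0" for y
 proof (rule X_unit)
  have yE: "y \<in> Eucl 4" and y1: "dot 4 y y = 1" using y(1) by (auto simp: nsphere_iff)
  show "dot (Suc n) y y = 1" using y1 m4 by simp
  define c where "c j = dot 4 (k j) y" for j
  have yc: "y = (\<lambda>i. c 0 * z1 i + c 1 * w1 i + c 2 * z2 i + c 3 * w2 i)"
   using k(3)[OF yE] unfolding sum4 h4 c_def by blast
  have Qc: "c 0 * c 3 = c 1 * c 2" using y(2) by (simp add: c_def)
  have "\<exists>s t p q. s * p = c 0 \<and> s * q = c 1 \<and> t * p = c 2 \<and> t * q = c 3"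
  proof -
   consider "c 0 \<noteq> 0" | "c 0 = 0" "c 1 \<noteq> 0" | "c 0 = 0" "c 1 = 0" by blast
   then show ?thesis
   proof cases
    case 1
    then show ?thesis using Qc by (intro exI[of _ 1] exI[of _ "c 2 / c 0"] exI[of _ "c 0"] exI[of _ "c 1"]) (auto simp: field_simps)
   next
    case 2
    then show ?thesis using Qc by (intro exI[of _ 1] exI[of _ "c 3 / c 1"] exI[of _ "c 0"] exI[of _ "c 1"]) auto
   next
    case 3
    then show ?thesis by (intro exI[of _ 0] exI[of _ 1] exI[of _ "c 2"] exI[of _ "c 3"]) auto
   qed
  qed
  then obtain s t p q where stpq: "s * p = c 0" "s * q = c 1" "t * p = c 2" "t * q = c 3" by blast
  have "y i = s * (p * z1 i + q * w1 i) + t * (p * z2 i + q * w2 i)" for i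
   unfolding yc stpq[symmetric] by (simp add: algebra_simps)
  then have "y = (\<lambda>i. s * (p * z1 i + q * w1 i) + t * (p * z2 i + q * w2 i))" by blast
  then show "y \<in> X" using K by simp
 qed
 have "Z = {y \<in> topspace (nsphere 3). dot 4 (k 0) y * dot 4 (k 3) y = dot 4 (k 1) y * dot 4 (k 2) y}"
  using QZ conv sph n by auto
 moreover have "\<exists>y\<in>Eucl 4. \<forall>j<4. dot 4 (k j) y = c j" for c
 proof (rule bexI[of _ "\<lambda>i. \<Sum>j<4. c j * h j i"])
  show "\<forall>j<4. dot 4 (k j) (\<lambda>i. \<Sum>j<4. c j * h j i) = c j"
  proof (intro allI impI)
   fix j :: nat assume j: "j < 4"
   have "dot 4 (k j) (\<lambda>i. \<Sum>j<4. c j * h j i) = (\<Sum>i<4. c i * (if j = i then 1 else 0))"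
    unfolding dot_sum using k(2)[OF j] by (intro sum.cong) auto
   also have "\<dots> = c j" using j by (simp add: if_distrib cong: if_cong)
   finally show "dot 4 (k j) (\<lambda>i. \<Sum>j<4. c j * h j i) = c j" .
  qed
  show "(\<lambda>i. \<Sum>j<4. c j * h j i) \<in> Eucl 4" using hE by (simp add: Eucl_iff)
 qed
 ultimately show "\<exists>l :: nat => nat => real. (\<forall>j<4. l j \<in> Eucl 4) \<and> (\<forall>c. \<exists>y\<in>Eucl 4. \<forall>j<4. dot 4 (l j) y = c j) \<and>
  Z = {y \<in> topspace (nsphere 3). dot 4 (l 0) y * dot 4 (l 3) y = dot 4 (l 1) y * dot 4 (l 2) y}"
  using k(1) by blast
qed

end

section \<open>Principal axes\<close>

lemma sum4: "(\<Sum>j<4. F j) = F 0 + F 1 + F 2 + F (3::nat)" for F :: "nat => 'a::comm_monoid_add"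
 by (simp add: eval_nat_numeral add.assoc)

lemma less4: "j < 4 \<longleftrightarrow> j = 0 \<or> j = 1 \<or> j = 2 \<or> j = 3" for j :: nat by auto

text \<open>The unit sphere of 4-space is compact. It is parametrised by quadruples, among which it is a closed
  bounded subset of a Euclidean space.\<close>

lemma sphere_max:
 fixes Q :: "(nat => real) => real" and G :: "((nat => real) => real) set"
 assumes Q: "Q \<in> polyfuns" and G: "finite G" "G \<subseteq> polyfuns"
  and ne: "x0 \<in> Eucl 4" "dot 4 x0 x0 = 1" "\<forall>g\<in>G. g x0 = 0"
 shows "\<exists>u\<in>Eucl 4. dot 4 u u = 1 \<and> (\<forall>g\<in>G. g u = 0) \<and>
  (\<forall>y\<in>Eucl 4. dot 4 y y = 1 \<and> (\<forall>g\<in>G. g y = 0) --> Q y \<le> Q u)"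
proof -
 define \<phi> :: "real \<times> real \<times> real \<times> real => nat => real" where
  "\<phi> p = (\<lambda>i. if i = 0 then fst p else if i = 1 then fst (snd p) else if i = 2 then fst (snd (snd p))
    else if i = 3 then snd (snd (snd p)) else 0)" for p
 have \<phi>E: "\<phi> p \<in> Eucl 4" for p by (simp add: \<phi>_def Eucl_iff)
 have surj: "\<phi> (y 0, y 1, y 2, y 3) = y" if "y \<in> Eucl 4" for y
  using that unfolding \<phi>_def by (auto simp: fun_eq_iff Eucl_iff less4[symmetric] not_less)
 have "continuous_on UNIV (\<lambda>p. \<phi> p i)" for i
  by (cases "i = 0 \<or> i = 1 \<or> i = 2 \<or> i = 3") (auto simp: \<phi>_def intro!: continuous_intros)
 then have cont: "continuous_on UNIV (\<lambda>p. f (\<phi> p))" if "f \<in> polyfuns" for f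
  using polyfuns_continuous[OF that] by blast
 define K where "K = {p. dot 4 (\<phi> p) (\<phi> p) = 1} \<inter> (\<Inter>g\<in>G. {p. g (\<phi> p) = 0})"
 have "closed K" unfolding K_def
  by (intro closed_Int closed_INT ballI closed_Collect_eq cont continuous_on_const) (use G in auto)
 moreover have "bounded K"
 proof (rule boundedI[of _ 1])
  fix p assume "p \<in> K"
  then have "dot 4 (\<phi> p) (\<phi> p) = 1" by (simp add: K_def)
  then have "(fst p)\<^sup>2 + ((fst (snd p))\<^sup>2 + ((fst (snd (snd p)))\<^sup>2 + (snd (snd (snd p)))\<^sup>2)) = 1"
   by (simp add: dot_def sum4 \<phi>_def power2_eq_square)
  then show "norm p \<le> 1" by (simp add: norm_prod_def)
 qed
 ultimately have "compact K" by (simp add: compact_eq_bounded_closed)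
 moreover have "(x0 0, x0 1, x0 2, x0 3) \<in> K" using ne surj[OF ne(1)] by (simp add: K_def)
 ultimately obtain p where p: "p \<in> K" "\<forall>p'\<in>K. Q (\<phi> p') \<le> Q (\<phi> p)"
  using continuous_attains_sup[of K "\<lambda>p. Q (\<phi> p)"] continuous_on_subset[OF cont[OF Q]] by blast
 have "Q y \<le> Q (\<phi> p)" if "y \<in> Eucl 4" "dot 4 y y = 1" "\<forall>g\<in>G. g y = 0" for y
 proof -
  have "(y 0, y 1, y 2, y 3) \<in> K" using that surj[OF that(1)] by (simp add: K_def)
  then show ?thesis using p(2) surj[OF that(1)] by metis
 qed
 then show ?thesis using p(1) \<phi>E by (intro bexI[of _ "\<phi> p"]) (auto simp: K_def)
qed

lemma linear_le_square:
 fixes b :: real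
 assumes "\<And>t. t * b \<le> t\<^sup>2 * c" shows "b = 0"
proof (rule ccontr)
 assume b: "b \<noteq> 0"
 define t where "t = b / (\<bar>c\<bar> + 1)"
 have "t * (\<bar>c\<bar> + 1) = b" by (simp add: t_def add_nonneg_eq_0_iff)
 then have "t * b = t\<^sup>2 * (\<bar>c\<bar> + 1)" by (simp only: power2_eq_square mult.assoc)
 then have "t\<^sup>2 * (\<bar>c\<bar> + 1) \<le> t\<^sup>2 * c" using assms[of t] by simp
 moreover have "t\<^sup>2 > 0" using b by (simp add: t_def add_nonneg_eq_0_iff)
 ultimately have "\<bar>c\<bar> + 1 \<le> c" by (simp only: mult_le_cancel_left_pos)
 then show False by linarith
qed

text \<open>Choose the vectors successively as maxima of \<open>Q\<close> on the unit sphere of the orthogonal complement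
  of the previous ones. At a maximum the first variation vanishes: this is the clause on \<open>b\<close>.\<close>

lemma principal_axes:
 fixes Q :: "(nat => real) => real" and b :: "(nat => real) => (nat => real) => real"
 assumes Q: "Q \<in> polyfuns"
  and expand: "\<And>s x t y. Q (\<lambda>i. s * x i + t * y i) = s\<^sup>2 * Q x + 2 * s * t * b x y + t\<^sup>2 * Q y"
  and k: "k \<le> (4::nat)"
 shows "\<exists>u. (\<forall>i<k. u i \<in> Eucl 4) \<and> (\<forall>i<k. \<forall>j<k. dot 4 (u i) (u j) = (if i = j then 1 else 0)) \<and>
  (\<forall>i<k. \<forall>y\<in>Eucl 4. (\<forall>j\<le>i. dot 4 (u j) y = 0) --> b (u i) y = 0) \<and>
  (\<forall>i<k. \<forall>y\<in>Eucl 4. (\<forall>j<i. dot 4 (u j) y = 0) --> Q y \<le> Q (u i) * dot 4 y y)"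
 using k
proof (induction k)
 case 0 then show ?case by simp
next
 case (Suc k)
 then obtain u :: "nat => nat => real" where
  u1: "\<forall>i<k. u i \<in> Eucl 4" and u2: "\<forall>i<k. \<forall>j<k. dot 4 (u i) (u j) = (if i = j then 1 else 0)"
  and u3: "\<forall>i<k. \<forall>y\<in>Eucl 4. (\<forall>j\<le>i. dot 4 (u j) y = 0) --> b (u i) y = 0"
  and u4: "\<forall>i<k. \<forall>y\<in>Eucl 4. (\<forall>j<i. dot 4 (u j) y = 0) --> Q y \<le> Q (u i) * dot 4 y y"
  by auto
 have Q0: "Q (\<lambda>i. s * x i) = s\<^sup>2 * Q x" for s x using expand[of s x 0 x] by simp
 obtain d where d: "d \<in> Eucl 4" "\<exists>i<4. d i \<noteq> 0" "\<forall>j<k. dot 4 d (u j) = 0"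
  using exists_orthogonal[of k 4 u] Suc.prems by auto
 have dd: "dot 4 d d > 0" using dot_self_pos[OF d(1)] d(2) by auto
 define x0 where "x0 = (\<lambda>i. (1 / sqrt (dot 4 d d)) * d i)"
 have x0: "x0 \<in> Eucl 4" unfolding x0_def using d(1) by blast
 have x01: "dot 4 x0 x0 = 1" unfolding x0_def dot_scale using dd by (simp add: field_simps)
 have x0u: "\<forall>j<k. dot 4 (u j) x0 = 0" unfolding x0_def dot_scale using d(3) by (simp add: dot_commute)
 let ?G = "(\<lambda>j x. dot 4 (u j) x) ` {..<k}"
 have "\<exists>w\<in>Eucl 4. dot 4 w w = 1 \<and> (\<forall>g\<in>?G. g w = 0) \<and>
  (\<forall>y\<in>Eucl 4. dot 4 y y = 1 \<and> (\<forall>g\<in>?G. g y = 0) --> Q y \<le> Q w)"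
  by (rule sphere_max[OF Q _ _ x0 x01]) (use x0u in auto)
 then obtain w where w: "w \<in> Eucl 4" "dot 4 w w = 1" "\<forall>j<k. dot 4 (u j) w = 0"
  "\<And>y. y \<in> Eucl 4 ==> dot 4 y y = 1 ==> \<forall>j<k. dot 4 (u j) y = 0 ==> Q y \<le> Q w" by auto
 have max: "Q y \<le> Q w * dot 4 y y" if y: "y \<in> Eucl 4" "\<forall>j<k. dot 4 (u j) y = 0" for y
 proof (cases "y = (\<lambda>i. 0)")
  case True then show ?thesis using Q0[of 0 y] by (simp add: dot_def)
 next
  case False
  define r where "r = sqrt (dot 4 y y)"
  have r: "r > 0" "r * r = dot 4 y y" using dot_self_pos[OF y(1) False] by (auto simp: r_def)
  define y' where "y' = (\<lambda>i. (1 / r) * y i)"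
  have "dot 4 y' y' = 1" unfolding y'_def dot_scale r(2)[symmetric] using r(1) by simp
  moreover have "y' \<in> Eucl 4" unfolding y'_def using y(1) by blast
  moreover have "\<forall>j<k. dot 4 (u j) y' = 0" unfolding y'_def dot_scale using y(2) by simp
  ultimately have "Q y' \<le> Q w" using w(4) by blast
  then have "(1 / r)\<^sup>2 * Q y \<le> Q w" unfolding y'_def Q0 .
  then have "Q y \<le> Q w * r\<^sup>2" using r(1) by (simp add: field_simps)
  then show ?thesis using r(2) by (simp add: power2_eq_square)
 qed
 have bw: "b w y = 0" if y: "y \<in> Eucl 4" "\<forall>j<k. dot 4 (u j) y = 0" "dot 4 w y = 0" for y
 proof -
  have "t * (2 * b w y) \<le> t\<^sup>2 * (Q w * dot 4 y y - Q y)" for t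
  proof -
   have "(\<lambda>i. 1 * w i + t * y i) \<in> Eucl 4" using w(1) y(1) by blast
   moreover have "\<forall>j<k. dot 4 (u j) (\<lambda>i. 1 * w i + t * y i) = 0"
    using w y unfolding dot_lc' by simp
   ultimately have "Q (\<lambda>i. 1 * w i + t * y i) \<le> Q w * dot 4 (\<lambda>i. 1 * w i + t * y i) (\<lambda>i. 1 * w i + t * y i)"
    by (rule max)
   also have "dot 4 (\<lambda>i. 1 * w i + t * y i) (\<lambda>i. 1 * w i + t * y i) = 1 + t\<^sup>2 * dot 4 y y"
    unfolding dot_lc dot_lc' using w(2) y(3) by (simp add: dot_commute[of 4 y w] power2_eq_square)
   finally show ?thesis unfolding expand by (simp add: algebra_simps)
  qed
  from linear_le_square[OF this] show ?thesis by simp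
 qed
 define u' where "u' = u(k := w)"
 have u'k: "u' k = w" "\<And>i. i < k ==> u' i = u i" by (auto simp: u'_def)
 have "\<forall>i<Suc k. u' i \<in> Eucl 4" using u1 w(1) by (simp add: u'_def less_Suc_eq)
 moreover have "\<forall>i<Suc k. \<forall>j<Suc k. dot 4 (u' i) (u' j) = (if i = j then 1 else 0)"
 proof (intro allI impI)
  fix i j assume ij: "i < Suc k" "j < Suc k"
  consider "i = k" "j = k" | "i = k" "j < k" | "i < k" "j = k" | "i < k" "j < k" using ij by linarith
  then show "dot 4 (u' i) (u' j) = (if i = j then 1 else 0)"
  proof cases
   case 1 then show ?thesis using w(2) u'k by simp
  next
   case 2 then show ?thesis using w(3) u'k by (simp add: dot_commute[of 4 w])
  next
   case 3 then show ?thesis using w(3) u'k by simp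
  next
   case 4 then show ?thesis using u2 u'k by simp
  qed
 qed
 moreover have "\<forall>i<Suc k. \<forall>y\<in>Eucl 4. (\<forall>j\<le>i. dot 4 (u' j) y = 0) --> b (u' i) y = 0"
 proof (intro allI ballI impI)
  fix i y assume *: "i < Suc k" "y \<in> Eucl 4" "\<forall>j\<le>i. dot 4 (u' j) y = 0"
  show "b (u' i) y = 0"
  proof (cases "i = k")
   case True
   then have "\<forall>j<k. dot 4 (u j) y = 0" "dot 4 w y = 0" using *(3) u'k by (metis less_imp_le, metis order_refl)
   then show ?thesis using bw *(2) True u'k by simp
  next
   case False
   then have "i < k" using *(1) by simp
   then have "\<forall>j\<le>i. dot 4 (u j) y = 0" using *(3) u'k(2) by (metis le_less_trans)
   then show ?thesis using u3 \<open>i < k\<close> *(2) u'k(2) by simp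
  qed
 qed
 moreover have "\<forall>i<Suc k. \<forall>y\<in>Eucl 4. (\<forall>j<i. dot 4 (u' j) y = 0) --> Q y \<le> Q (u' i) * dot 4 y y"
 proof (intro allI ballI impI)
  fix i y assume *: "i < Suc k" "y \<in> Eucl 4" "\<forall>j<i. dot 4 (u' j) y = 0"
  show "Q y \<le> Q (u' i) * dot 4 y y"
  proof (cases "i = k")
   case True
   then show ?thesis using max *(2,3) u'k by simp
  next
   case False
   then have "i < k" using *(1) by simp
   then have "\<forall>j<i. dot 4 (u j) y = 0" using *(3) u'k(2) by (metis less_trans)
   then show ?thesis using u4 \<open>i < k\<close> *(2) u'k(2) by simp
  qed
 qed
 ultimately show ?case by blast
qed

text \<open>The forms \<open>c\<close> are the coordinates \<open>\<eta>\<close>, with dual basis \<open>v\<close>. The set \<open>Z\<close> is a torus: its points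
  are those with coordinates \<open>(cos s, sin s, cos t, sin t)\<close>, rescaled to norm 1.\<close>

definition torus_coords :: "(nat => nat => real) => (nat => nat => real) => (nat => real) => (nat => real) set => bool" where
 "torus_coords c v \<kappa> Z \<longleftrightarrow>
  (\<forall>j<4. c j \<in> Eucl 4) \<and> (\<forall>j<4. v j \<in> Eucl 4) \<and>
  (\<forall>i<4. \<forall>j<4. dot 4 (c i) (v j) = (if i = j then 1 else 0)) \<and>
  (\<forall>y\<in>Eucl 4. \<forall>i. y i = (\<Sum>j<4. dot 4 (c j) y * v j i)) \<and>
  (\<forall>x\<in>Eucl 4. \<forall>y\<in>Eucl 4. dot 4 x y = (\<Sum>j<4. \<kappa> j * (dot 4 (c j) x * dot 4 (c j) y))) \<and>
  (\<forall>j<4. \<kappa> j > 0) \<and> \<kappa> 0 \<le> \<kappa> 1 \<and> \<kappa> 2 \<le> \<kappa> 3 \<and>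
  Z = {y \<in> topspace (nsphere 3). (dot 4 (c 0) y)\<^sup>2 + (dot 4 (c 1) y)\<^sup>2 = (dot 4 (c 2) y)\<^sup>2 + (dot 4 (c 3) y)\<^sup>2}"

text \<open>The form \<open>l0 l3 - l1 l2\<close> has signature (2, 2), so it has two positive and two negative principal values \<open>e j\<close>.
  Scaling the axes by their square roots makes the form a signed sum of squares, and the norm
  gets the coefficients \<open>1 / \<bar>e j\<bar>\<close>.\<close>

lemma principal_coordinates:
 fixes l :: "nat => nat => real"
 assumes surj: "\<And>c. \<exists>y\<in>Eucl 4. \<forall>j<4. dot 4 (l j) y = c j"
  and Z: "Z = {y \<in> topspace (nsphere 3). dot 4 (l 0) y * dot 4 (l 3) y = dot 4 (l 1) y * dot 4 (l 2) y}"
 shows "\<exists>c v \<kappa>. torus_coords c v \<kappa> Z"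
proof -
 let ?d = "dot 4"
 define Q where "Q y = ?d (l 0) y * ?d (l 3) y - ?d (l 1) y * ?d (l 2) y" for y
 define b where "b x y = (?d (l 0) x * ?d (l 3) y + ?d (l 0) y * ?d (l 3) x
   - ?d (l 1) x * ?d (l 2) y - ?d (l 1) y * ?d (l 2) x) / 2" for x y
 have Qp: "Q \<in> polyfuns" unfolding Q_def[abs_def] by (intro polyfuns_diff polyfuns_mult dot_polyfuns)
 have expand: "Q (\<lambda>i. s * x i + t * y i) = s\<^sup>2 * Q x + 2 * s * t * b x y + t\<^sup>2 * Q y" for s x t y
  unfolding Q_def b_def dot_lc' by (simp add: field_simps power2_eq_square)
 obtain u :: "nat => nat => real" where u1: "\<forall>i<4. u i \<in> Eucl 4" and u2: "\<forall>i<4. \<forall>j<4. ?d (u i) (u j) = (if i = j then 1 else 0)"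
  and u3: "\<forall>i<4. \<forall>y\<in>Eucl 4. (\<forall>j\<le>i. ?d (u j) y = 0) --> b (u i) y = 0"
  and u4: "\<forall>i<4. \<forall>y\<in>Eucl 4. (\<forall>j<i. ?d (u j) y = 0) --> Q y \<le> Q (u i) * ?d y y"
  using principal_axes[OF Qp expand order_refl] by blast
 have uE: "u i \<in> Eucl 4" if "i < 4" for i using u1 that by blast
 have uu: "?d (u i) (u j) = (if i = j then 1 else 0)" if "i < 4" "j < 4" for i j using u2 that by blast
 have li: "lin_indep 4 u" unfolding lin_indep_def
 proof (intro allI impI)
  fix a :: "nat => real" and j :: nat assume a: "\<forall>i. (\<Sum>j<4. a j * u j i) = 0" and j: "j < 4"
  have "0 = ?d (u j) (\<lambda>i. \<Sum>j<4. a j * u j i)" using a by (simp add: dot_def)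
  also have "\<dots> = (\<Sum>i<4. a i * (if j = i then 1 else 0))"
   unfolding dot_sum using uu[OF j] by (intro sum.cong) auto
  also have "\<dots> = a j" using j by (simp add: if_distrib cong: if_cong)
  finally show "a j = 0" by simp
 qed
 obtain m where m: "\<forall>y\<in>Eucl 4. \<forall>i. y i = (\<Sum>j<4. ?d (m j) y * u j i)"
  using dual_basis[OF uE li] by blast
 have uexp: "y i = (\<Sum>j<4. ?d (u j) y * u j i)" if y: "y \<in> Eucl 4" for y i
 proof -
  have y': "y = (\<lambda>i. \<Sum>j<4. ?d (m j) y * u j i)" using m y by blast
  have "?d (u j) y = ?d (m j) y" if j: "j < 4" for j
  proof -
   have "?d (u j) y = ?d (u j) (\<lambda>i. \<Sum>j<4. ?d (m j) y * u j i)" using y' by simp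
   also have "\<dots> = (\<Sum>i<4. ?d (m i) y * (if j = i then 1 else 0))"
    unfolding dot_sum using uu[OF j] by (intro sum.cong) auto
   also have "\<dots> = ?d (m j) y" using j by (simp add: if_distrib cong: if_cong)
   finally show ?thesis .
  qed
  then show ?thesis using m y by simp
 qed
 define e where "e i = Q (u i)" for i
 have buu: "b (u i) (u j) = 0" if "i < j" "j < 4" for i j
  using u3 uE that uu by auto
 have Qe: "Q y = (\<Sum>j<4. e j * (?d (u j) y)\<^sup>2)" if y: "y \<in> Eucl 4" for y
 proof -
  define a where "a j = ?d (u j) y" for j
  have y4: "y = (\<lambda>i. 1 * (a 0 * u 0 i + a 1 * u 1 i) + 1 * (a 2 * u 2 i + a 3 * u 3 i))"
   using uexp[OF y] unfolding sum4 a_def by (simp add: algebra_simps fun_eq_iff)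
  have blin: "b (\<lambda>i. s * x i + t * y i) z = s * b x z + t * b y z" "b z (\<lambda>i. s * x i + t * y i) = s * b z x + t * b z y" for s t x y z
   unfolding b_def dot_lc' by (simp_all add: field_simps)
  have "Q y = (a 0)\<^sup>2 * e 0 + (a 1)\<^sup>2 * e 1 + (a 2)\<^sup>2 * e 2 + (a 3)\<^sup>2 * e 3"
   by (subst y4) (simp only: expand blin buu e_def, simp add: buu)
  then show ?thesis by (simp add: sum4 a_def mult.commute)
 qed
 have mono: "e j \<le> e i" if "i < j" "j < 4" for i j
 proof -
  have "\<forall>j'<i. ?d (u j') (u j) = 0" using uu that by auto
  moreover have "i < 4" using that by simp
  ultimately have "Q (u j) \<le> Q (u i) * ?d (u j) (u j)" using u4 uE[OF that(2)] by blast
  then show ?thesis using uu[of j j] that by (simp add: e_def)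
 qed
 have comb: "\<exists>s t. (s \<noteq> 0 \<or> t \<noteq> 0) \<and> s * \<alpha> + t * \<beta> = 0" for \<alpha> \<beta> :: real
 proof (cases "\<alpha> = 0 \<and> \<beta> = 0")
  case True then show ?thesis by (intro exI[of _ 1]) auto
 next
  case False then show ?thesis by (intro exI[of _ \<beta>] exI[of _ "- \<alpha>"]) auto
 qed
 have e1: "e 1 > 0"
 proof (rule ccontr)
  assume ne: "\<not> e 1 > 0"
  obtain p1 where p1: "p1 \<in> Eucl 4" "\<forall>j<4. ?d (l j) p1 = (if j = 0 \<or> j = 3 then 1 else 0)" using surj[of "\<lambda>j. if j = 0 \<or> j = 3 then 1 else 0"] by blast
  obtain p2 where p2: "p2 \<in> Eucl 4" "\<forall>j<4. ?d (l j) p2 = (if j = 1 then 1 else if j = 2 then - 1 else 0)" using surj[of "\<lambda>j. if j = 1 then 1 else if j = 2 then - 1 else 0"] by blast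
  obtain s t where st: "s \<noteq> 0 \<or> t \<noteq> 0" "s * ?d (u 0) p1 + t * ?d (u 0) p2 = 0" using comb by blast
  let ?y = "\<lambda>i. s * p1 i + t * p2 i"
  have yE: "?y \<in> Eucl 4" using p1 p2 by blast
  have "Q ?y = s\<^sup>2 + t\<^sup>2" unfolding Q_def dot_lc' using p1(2) p2(2) by (simp add: power2_eq_square)
  moreover have "Q ?y \<le> Q (u 1) * ?d ?y ?y" using u4[rule_format, of 1 ?y] yE st(2) by (simp add: dot_lc')
  moreover have "Q (u 1) * ?d ?y ?y \<le> 0" using ne dot_self_ge[of 4 ?y] by (simp add: e_def mult_nonpos_nonneg)
  ultimately have "s\<^sup>2 + t\<^sup>2 \<le> 0" by linarith
  then show False using st(1) by (simp add: sum_power2_le_zero_iff)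
 qed
 have e2: "e 2 < 0"
 proof (rule ccontr)
  assume ne: "\<not> e 2 < 0"
  obtain p1 where p1: "p1 \<in> Eucl 4" "\<forall>j<4. ?d (l j) p1 = (if j = 0 then 1 else if j = 3 then - 1 else 0)" using surj[of "\<lambda>j. if j = 0 then 1 else if j = 3 then - 1 else 0"] by blast
  obtain p2 where p2: "p2 \<in> Eucl 4" "\<forall>j<4. ?d (l j) p2 = (if j = 1 \<or> j = 2 then 1 else 0)" using surj[of "\<lambda>j. if j = 1 \<or> j = 2 then 1 else 0"] by blast
  obtain s t where st: "s \<noteq> 0 \<or> t \<noteq> 0" "s * ?d (u 3) p1 + t * ?d (u 3) p2 = 0" using comb by blast
  let ?y = "\<lambda>i. s * p1 i + t * p2 i"
  have yE: "?y \<in> Eucl 4" using p1 p2 by blast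
  have "Q ?y = - (s\<^sup>2 + t\<^sup>2)" unfolding Q_def dot_lc' using p1(2) p2(2) by (simp add: power2_eq_square)
  moreover have "?d (u 3) ?y = 0" using st(2) by (simp add: dot_lc')
  then have "Q ?y = e 0 * (?d (u 0) ?y)\<^sup>2 + e 1 * (?d (u 1) ?y)\<^sup>2 + e 2 * (?d (u 2) ?y)\<^sup>2"
   unfolding Qe[OF yE] sum4 by simp
  moreover have "e 0 \<ge> 0" using mono[of 0 1] e1 by simp
  ultimately have "s\<^sup>2 + t\<^sup>2 \<le> 0" using ne e1
   by (smt (verit) mult_nonneg_nonneg zero_le_power2)
  then show False using st(1) by (simp add: sum_power2_le_zero_iff)
 qed
 have e0: "e 0 > 0" "e 1 \<le> e 0" using mono[of 0 1] e1 by auto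
 have e3: "e 3 < 0" "e 3 \<le> e 2" using mono[of 2 3] e2 by auto
 define \<pi> where "\<pi> j = (if j = 2 then 3 else if j = 3 then 2 else j)" for j :: nat
 define w where "w j = sqrt \<bar>e (\<pi> j)\<bar>" for j
 define c where "c j = (\<lambda>i. w j * u (\<pi> j) i)" for j
 define v where "v j = (\<lambda>i. (1 / w j) * u (\<pi> j) i)" for j
 define \<kappa> where "\<kappa> j = 1 / \<bar>e (\<pi> j)\<bar>" for j
 have \<pi>: "\<pi> 0 = 0" "\<pi> 1 = 1" "\<pi> 2 = 3" "\<pi> 3 = 2" by (auto simp: \<pi>_def)
 have \<pi>4: "\<pi> j < 4" if "j < 4" for j using that by (auto simp: \<pi>_def)
 have \<pi>inj: "\<pi> i = \<pi> j \<longleftrightarrow> i = j" for i j by (auto simp: \<pi>_def)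
 have epos: "\<bar>e (\<pi> j)\<bar> > 0" if "j < 4" for j
  using that e0 e1 e2 e3 unfolding less4 by (auto simp: \<pi>[unfolded One_nat_def])
 have wpos: "w j > 0" "w j * w j = \<bar>e (\<pi> j)\<bar>" if "j < 4" for j using epos[OF that] by (auto simp: w_def)
 have dc: "?d (c j) y = w j * ?d (u (\<pi> j)) y" for j y by (simp add: c_def dot_scale)
 have cE: "\<forall>j<4. c j \<in> Eucl 4" "\<forall>j<4. v j \<in> Eucl 4" unfolding c_def v_def using uE \<pi>4 by blast+
 moreover have "\<forall>i<4. \<forall>j<4. ?d (c i) (v j) = (if i = j then 1 else 0)"
 proof (intro allI impI)
  fix i j :: nat assume ij: "i < 4" "j < 4"
  have "?d (c i) (v j) = w i * ((1 / w j) * ?d (u (\<pi> i)) (u (\<pi> j)))" unfolding dc v_def dot_scale by simp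
  also have "\<dots> = (if i = j then 1 else 0)" using uu[OF \<pi>4[OF ij(1)] \<pi>4[OF ij(2)]] wpos(1)[OF ij(1)] by (auto simp: \<pi>inj)
  finally show "?d (c i) (v j) = (if i = j then 1 else 0)" .
 qed
 moreover have "\<forall>y\<in>Eucl 4. \<forall>i. y i = (\<Sum>j<4. ?d (c j) y * v j i)"
 proof (intro ballI allI)
  fix y i assume y: "y \<in> Eucl 4"
  have "?d (c j) y * v j i = ?d (u (\<pi> j)) y * u (\<pi> j) i" if "j < 4" for j
   using wpos(1)[OF that] by (simp add: dc v_def)
  then have "(\<Sum>j<4. ?d (c j) y * v j i) = (\<Sum>j<4. ?d (u (\<pi> j)) y * u (\<pi> j) i)" by simp
  also have "\<dots> = y i" unfolding uexp[OF y, of i] sum4 \<pi> by simp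
  finally show "y i = (\<Sum>j<4. ?d (c j) y * v j i)" by simp
 qed
 moreover have "\<forall>x\<in>Eucl 4. \<forall>y\<in>Eucl 4. ?d x y = (\<Sum>j<4. \<kappa> j * (?d (c j) x * ?d (c j) y))"
 proof (intro ballI)
  fix x y assume x: "x \<in> Eucl 4" and y: "y \<in> Eucl 4"
  have "?d x y = ?d x (\<lambda>i. \<Sum>j<4. ?d (u j) y * u j i)" using uexp[OF y] by (metis (no_types, lifting) ext)
  also have "\<dots> = (\<Sum>j<4. ?d (u j) x * ?d (u j) y)" unfolding dot_sum by (simp add: dot_commute[of 4 x] mult.commute)
  also have "\<dots> = (\<Sum>j<4. ?d (u (\<pi> j)) x * ?d (u (\<pi> j)) y)" unfolding sum4 \<pi> by simp
  also have "\<dots> = (\<Sum>j<4. \<kappa> j * (?d (c j) x * ?d (c j) y))"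
  proof (rule sum.cong)
   fix j :: nat assume "j \<in> {..<4}"
   then have j: "j < 4" by simp
   have "\<kappa> j * (?d (c j) x * ?d (c j) y) = (\<kappa> j * (w j * w j)) * (?d (u (\<pi> j)) x * ?d (u (\<pi> j)) y)"
    by (simp add: dc)
   also have "\<kappa> j * (w j * w j) = 1" using epos[OF j] unfolding wpos(2)[OF j] \<kappa>_def by simp
   finally show "?d (u (\<pi> j)) x * ?d (u (\<pi> j)) y = \<kappa> j * (?d (c j) x * ?d (c j) y)" by simp
  qed simp
  finally show "?d x y = (\<Sum>j<4. \<kappa> j * (?d (c j) x * ?d (c j) y))" .
 qed
 moreover have "\<forall>j<4. \<kappa> j > 0" using epos by (simp add: \<kappa>_def)
 moreover have "\<kappa> 0 \<le> \<kappa> 1" unfolding \<kappa>_def \<pi> using e0 e1 by (simp add: frac_le)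
 moreover have "\<kappa> 2 \<le> \<kappa> 3" unfolding \<kappa>_def \<pi> by (rule frac_le) (use e3 e2 in auto)
 moreover have "Z = {y \<in> topspace (nsphere 3). (?d (c 0) y)\<^sup>2 + (?d (c 1) y)\<^sup>2 = (?d (c 2) y)\<^sup>2 + (?d (c 3) y)\<^sup>2}"
 proof -
  have "?d (l 0) y * ?d (l 3) y = ?d (l 1) y * ?d (l 2) y \<longleftrightarrow>
    (?d (c 0) y)\<^sup>2 + (?d (c 1) y)\<^sup>2 = (?d (c 2) y)\<^sup>2 + (?d (c 3) y)\<^sup>2" if "y \<in> topspace (nsphere 3)" for y
  proof -
   have y: "y \<in> Eucl 4" using that by (simp add: nsphere_iff)
   have c2: "(?d (c j) y)\<^sup>2 = \<bar>e (\<pi> j)\<bar> * (?d (u (\<pi> j)) y)\<^sup>2" if "j < 4" for j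
    using wpos(2)[OF that] by (simp add: dc power2_eq_square)
   have "Q y = (?d (c 0) y)\<^sup>2 + (?d (c 1) y)\<^sup>2 - (?d (c 2) y)\<^sup>2 - (?d (c 3) y)\<^sup>2"
    using c2[of 0] c2[of 1] c2[of 2] c2[of 3] e0 e1 e2 e3 unfolding Qe[OF y] sum4 \<pi> by simp
   then show ?thesis unfolding Q_def by linarith
  qed
  then show ?thesis unfolding Z by blast
 qed
 ultimately have "torus_coords c v \<kappa> Z" unfolding torus_coords_def by blast
 then show ?thesis by blast
qed

section \<open>Rational images\<close>

lemma polyfuns_if [intro]: "f \<in> polyfuns ==> g \<in> polyfuns ==> (\<lambda>x. if P then f x else g x) \<in> polyfuns"
 by (cases P) simp_all

text \<open>Composition with a rational map with denominator \<open>d\<close> is polynomial after multiplication by a power of \<open>d\<close>.\<close>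

lemma polyfuns_clear:
 assumes f: "f \<in> polyfuns" and d: "d \<in> polyfuns" and G: "\<And>i. G i \<in> polyfuns"
  and g: "\<And>i x. x \<in> S ==> d x * g x i = G i x"
 shows "\<exists>k. \<exists>F\<in>polyfuns. \<forall>x\<in>S. F x = d x ^ k * f (g x)"
 using f
proof (induction f rule: polyfuns_induct)
 case (const c)
 show ?case by (rule exI[of _ 0], rule bexI[of _ "\<lambda>x. c"]) auto
next
 case (var i)
 show ?case by (rule exI[of _ 1], rule bexI[of _ "G i"]) (use g G in auto)
next
 case (add f h)
 obtain k F where 1: "F \<in> polyfuns" "\<forall>x\<in>S. F x = d x ^ k * f (g x)" using add.IH by blast
 obtain l H where 2: "H \<in> polyfuns" "\<forall>x\<in>S. H x = d x ^ l * h (g x)" using add.IH by blast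
 show ?case
  by (rule exI[of _ "k + l"], rule bexI[of _ "\<lambda>x. d x ^ l * F x + d x ^ k * H x"])
   (use 1 2 d in \<open>auto simp: power_add algebra_simps intro!: polyfuns_add polyfuns_mult polyfuns_power\<close>)
next
 case (mult f h)
 obtain k F where 1: "F \<in> polyfuns" "\<forall>x\<in>S. F x = d x ^ k * f (g x)" using mult.IH by blast
 obtain l H where 2: "H \<in> polyfuns" "\<forall>x\<in>S. H x = d x ^ l * h (g x)" using mult.IH by blast
 show ?case
  by (rule exI[of _ "k + l"], rule bexI[of _ "\<lambda>x. F x * H x"])
   (use 1 2 in \<open>auto simp: power_add algebra_simps intro!: polyfuns_mult\<close>)
qed

lemma poly_prime_open:
 assumes A: "poly_prime A" and p: "p \<in> polyfuns" "a \<in> A" "p a \<noteq> 0"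
 shows "poly_prime {x\<in>A. p x \<noteq> 0}"
 unfolding poly_prime_def
proof (intro conjI ballI impI)
 show "{x \<in> A. p x \<noteq> 0} \<noteq> {}" using p by blast
 fix f g :: "('a => real) => real"
 assume fg: "f \<in> polyfuns" "g \<in> polyfuns" "\<forall>x\<in>{x \<in> A. p x \<noteq> 0}. f x = 0 \<or> g x = 0"
 have "p x * (f x * g x) = 0" if "x \<in> A" for x using fg(3) that by auto
 from poly_primeD[OF A p(1) polyfuns_mult[OF fg(1,2)] this p(2,3)]
 have z: "f x * g x = 0" if "x \<in> A" for x using that by simp
 show "(\<forall>x\<in>{x \<in> A. p x \<noteq> 0}. f x = 0) \<or> (\<forall>x\<in>{x \<in> A. p x \<noteq> 0}. g x = 0)"
  using poly_primeD[OF A fg(1,2) z] by blast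
qed

text \<open>An irreducible set has irreducible image under a rational map defined on it.\<close>

lemma poly_prime_image:
 assumes A: "poly_prime A" and d: "d \<in> polyfuns" "\<And>x. x \<in> A ==> d x \<noteq> 0" and G: "\<And>i. G i \<in> polyfuns"
  and g: "\<And>i x. x \<in> A ==> d x * g x i = G i x"
 shows "poly_prime (g ` A)"
 unfolding poly_prime_def
proof (intro conjI ballI impI)
 show "g ` A \<noteq> {}" using A by (auto simp: poly_prime_def)
 fix f h :: "('b => real) => real"
 assume fh: "f \<in> polyfuns" "h \<in> polyfuns" "\<forall>x\<in>g ` A. f x = 0 \<or> h x = 0"
 have "\<exists>k. \<exists>F\<in>polyfuns. \<forall>x\<in>A. F x = d x ^ k * f (g x)"
  by (rule polyfuns_clear[OF fh(1) d(1) G g])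
 then obtain k F where 1: "F \<in> polyfuns" "\<forall>x\<in>A. F x = d x ^ k * f (g x)" by blast
 have "\<exists>l. \<exists>H\<in>polyfuns. \<forall>x\<in>A. H x = d x ^ l * h (g x)"
  by (rule polyfuns_clear[OF fh(2) d(1) G g])
 then obtain l H where 2: "H \<in> polyfuns" "\<forall>x\<in>A. H x = d x ^ l * h (g x)" by blast
 have "\<forall>x\<in>A. F x = 0 \<or> H x = 0" using fh(3) 1(2) 2(2) by auto
 then have "(\<forall>x\<in>A. F x = 0) \<or> (\<forall>x\<in>A. H x = 0)" using A 1(1) 2(1) unfolding poly_prime_def by blast
 then show "(\<forall>x\<in>g ` A. f x = 0) \<or> (\<forall>x\<in>g ` A. h x = 0)" using 1(2) 2(2) d(2) by auto
qed

section \<open>Stereographic projection\<close>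

definition unstereo :: "(nat => real) => nat => real" where
 "unstereo w = (\<lambda>i. (if i < 3 then 2 * w i else if i = 3 then dot 3 w w - 1 else 0) / (1 + dot 3 w w))"

lemma sum3: "(\<Sum>j<3. F j) = F 0 + F 1 + F (2::nat)" for F :: "nat => 'a::comm_monoid_add"
 by (simp add: eval_nat_numeral add.assoc)

lemma sphere3_iff: "y \<in> topspace (nsphere 3) \<longleftrightarrow> y \<in> Eucl 4 \<and> dot 4 y y = 1"
 by (simp add: nsphere_iff)

lemma dot4_3: "dot 4 y y = dot 3 y y + y 3 * y 3"
 by (simp add: dot_def sum4 sum3)

lemma one_plus_dot: "1 + dot m w w > 0"
 using dot_self_ge[of m w] by linarith

lemma not_pole:
 assumes "y \<in> topspace (nsphere 3)" shows "y = north_pole \<longleftrightarrow> y 3 = 1"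
proof
 assume "y 3 = 1"
 then have "dot 3 y y = 0" using assms by (simp add: sphere3_iff dot4_3)
 then have "y 0 * y 0 + y 1 * y 1 + y 2 * y 2 = 0" by (simp add: dot_def sum3)
 then have z: "y 0 = 0" "y 1 = 0" "y 2 = 0" using sum_squares_eq_zero_iff
  by (smt (verit, best) mult_eq_0_iff zero_le_square)+
 show "y = north_pole"
 proof
  fix i :: nat
  have "i = 0 \<or> i = 1 \<or> i = 2 \<or> i = 3 \<or> i \<ge> 4" by linarith
  then show "y i = north_pole i" using z \<open>y 3 = 1\<close> assms by (auto simp: north_pole_def sphere3_iff Eucl_iff)
 qed
qed (simp add: north_pole_def)

lemma unstereo_sphere: "unstereo w \<in> topspace (nsphere 3)"
proof -
 let ?s = "dot 3 w w"
 have "dot 3 (unstereo w) (unstereo w) = 4 * ?s / (1 + ?s)\<^sup>2"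
  by (simp add: unstereo_def dot_def sum3 power2_eq_square add_divide_distrib[symmetric] algebra_simps)
 moreover have "unstereo w 3 * unstereo w 3 = (?s - 1)\<^sup>2 / (1 + ?s)\<^sup>2"
  by (simp add: unstereo_def power2_eq_square)
 ultimately have "dot 4 (unstereo w) (unstereo w) = (4 * ?s + (?s - 1)\<^sup>2) / (1 + ?s)\<^sup>2"
  by (simp add: dot4_3 add_divide_distrib)
 also have "4 * ?s + (?s - 1)\<^sup>2 = (1 + ?s)\<^sup>2" by (simp add: power2_eq_square algebra_simps)
 also have "\<dots> / (1 + ?s)\<^sup>2 = 1" using one_plus_dot[of 3 w] by simp
 finally have "dot 4 (unstereo w) (unstereo w) = 1" .
 moreover have "unstereo w \<in> Eucl 4" by (simp add: unstereo_def Eucl_iff)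
 ultimately show ?thesis by (simp add: sphere3_iff)
qed

lemma unstereo_3: "1 - unstereo w 3 = 2 / (1 + dot 3 w w)"
 using one_plus_dot[of 3 w] by (simp add: unstereo_def field_simps)

lemma unstereo_pole: "unstereo w 3 \<noteq> 1"
 using unstereo_3[of w] one_plus_dot[of 3 w] by fastforce

lemma stereo_unstereo: assumes "w \<in> Eucl 3" shows "stereo (unstereo w) = w"
proof
 fix i
 show "stereo (unstereo w) i = w i"
  using assms one_plus_dot[of 3 w] unfolding stereo_def unstereo_3
  by (auto simp: unstereo_def Eucl_iff field_simps)
qed

lemma stereo_Eucl: "stereo y \<in> Eucl 3"
 by (simp add: stereo_def Eucl_iff)

lemma unstereo_stereo:
 assumes "y \<in> topspace (nsphere 3)" "y 3 \<noteq> 1" shows "unstereo (stereo y) = y"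
proof -
 let ?t = "1 - y 3"
 have t: "?t \<noteq> 0" using assms(2) by simp
 have "dot 3 (stereo y) (stereo y) = dot 3 y y / ?t\<^sup>2"
  by (simp add: stereo_def dot_def sum3 power2_eq_square add_divide_distrib)
 also have "dot 3 y y = (1 + y 3) * ?t" using assms(1) by (simp add: sphere3_iff dot4_3 algebra_simps)
 finally have s: "dot 3 (stereo y) (stereo y) = (1 + y 3) / ?t" using t by (simp add: power2_eq_square)
 have s1: "1 + dot 3 (stereo y) (stereo y) = 2 / ?t" unfolding s using t by (simp add: field_simps)
 have s2: "dot 3 (stereo y) (stereo y) - 1 = 2 * y 3 / ?t" unfolding s using t by (simp add: field_simps)
 show ?thesis
 proof
  fix i :: nat
  have "i < 3 \<or> i = 3 \<or> i \<ge> 4" by linarith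
  then show "unstereo (stereo y) i = y i"
   unfolding unstereo_def s1 s2 using t assms(1) by (auto simp: stereo_def sphere3_iff Eucl_iff)
 qed
qed

lemma stereo_preimage_image:
 assumes "Z \<subseteq> topspace (nsphere 3)" shows "stereo_preimage (stereo_image Z) = Z - {north_pole}"
proof (intro equalityI subsetI)
 fix y assume "y \<in> stereo_preimage (stereo_image Z)"
 then have y: "y \<in> topspace (nsphere 3)" "y \<noteq> north_pole" "stereo y \<in> stereo ` (Z - {north_pole})"
  by (auto simp: stereo_preimage_def stereo_image_def)
 then obtain z where z: "z \<in> Z" "z \<noteq> north_pole" "stereo y = stereo z" by blast
 have "y = unstereo (stereo y)" using unstereo_stereo[OF y(1)] not_pole[OF y(1)] y(2) by simp
 also have "\<dots> = z" unfolding z(3) using unstereo_stereo[of z] not_pole[of z] z assms by blast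
 finally show "y \<in> Z - {north_pole}" using z by simp
next
 fix y assume "y \<in> Z - {north_pole}"
 then show "y \<in> stereo_preimage (stereo_image Z)"
  using assms by (auto simp: stereo_preimage_def stereo_image_def)
qed

lemma stereo_image_eq:
 assumes "Z \<subseteq> topspace (nsphere 3)" shows "stereo_image Z = {w\<in>Eucl 3. unstereo w \<in> Z}"
proof (intro equalityI subsetI)
 fix w assume "w \<in> stereo_image Z"
 then obtain z where z: "z \<in> Z" "z \<noteq> north_pole" "w = stereo z" by (auto simp: stereo_image_def)
 then have "unstereo w = z" using unstereo_stereo[of z] not_pole[of z] assms by blast
 then show "w \<in> {w\<in>Eucl 3. unstereo w \<in> Z}" using z stereo_Eucl by simp
next
 fix w assume w: "w \<in> {w\<in>Eucl 3. unstereo w \<in> Z}"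
 then have "w = stereo (unstereo w)" using stereo_unstereo by simp
 moreover have "unstereo w \<noteq> north_pole"
 proof
  assume "unstereo w = north_pole"
  then have "unstereo w 3 = 1" by (simp add: north_pole_def)
  then show False using unstereo_pole by blast
 qed
 ultimately show "w \<in> stereo_image Z" using w unfolding stereo_image_def by blast
qed

lemma stereo_clear:
 assumes "f \<in> polyfuns"
 shows "\<exists>k. \<exists>F\<in>polyfuns. \<forall>y\<in>{y. y 3 \<noteq> 1}. F y = (1 - y 3) ^ k * f (stereo y)"
 by (rule polyfuns_clear[OF assms, where G = "\<lambda>i y. if i < 3 then y i else 0"])
  (auto simp: stereo_def intro!: polyfuns_diff polyfuns_if)

lemma unstereo_clear:
 assumes "f \<in> polyfuns"
 shows "\<exists>k. \<exists>F\<in>polyfuns. \<forall>w. F w = (1 + dot 3 w w) ^ k * f (unstereo w)"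
proof -
 have "\<exists>k. \<exists>F\<in>polyfuns. \<forall>w\<in>UNIV. F w = (1 + dot 3 w w) ^ k * f (unstereo w)"
 proof (rule polyfuns_clear[OF assms, where G = "\<lambda>i w. if i < 3 then 2 * w i else if i = 3 then dot 3 w w - 1 else 0"])
  show "(\<lambda>w. 1 + dot 3 w w) \<in> polyfuns" by (intro polyfuns_add polyfuns_const dot_self_polyfuns)
  show "(\<lambda>w. if i < 3 then 2 * w i else if i = 3 then dot 3 w w - 1 else 0) \<in> polyfuns" for i :: nat
   by (cases "i < 3"; cases "i = 3") (auto intro!: polyfuns_mult polyfuns_diff)
  show "(1 + dot 3 w w) * unstereo w i = (if i < 3 then 2 * w i else if i = 3 then dot 3 w w - 1 else 0)" for i w
   using one_plus_dot[of 3 w] by (simp add: unstereo_def)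
 qed
 then show ?thesis by simp
qed

lemma poly_prime_stereo:
 assumes "poly_prime A" "A \<subseteq> topspace (nsphere 3)" "a \<in> A" "a 3 \<noteq> 1"
 shows "poly_prime (stereo_image A)"
proof -
 have p: "(\<lambda>y::nat => real. 1 - y 3) \<in> polyfuns" by (intro polyfuns_diff polyfuns_const polyfuns_var)
 have "poly_prime {y\<in>A. 1 - y 3 \<noteq> 0}" by (rule poly_prime_open[OF assms(1) p assms(3)]) (use assms(4) in simp)
 then have "poly_prime (stereo ` {y\<in>A. 1 - y 3 \<noteq> 0})"
  by (rule poly_prime_image[OF _ p, where G = "\<lambda>i y. if i < 3 then y i else 0"]) (auto simp: stereo_def intro!: polyfuns_if)
 moreover have "{y\<in>A. 1 - y 3 \<noteq> 0} = A - {north_pole}" using not_pole assms(2) by fastforce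
 ultimately show ?thesis by (simp add: stereo_image_def)
qed

lemma stereo_image_closed:
 assumes Z: "Z \<subseteq> topspace (nsphere 3)" "real_closed 4 Z" shows "real_closed 3 (stereo_image Z)"
proof (rule real_closedI)
 let ?G = "{g\<in>polyfuns. \<forall>w\<in>stereo_image Z. g w = 0}"
 show "?G \<subseteq> polyfuns" by blast
 show "stereo_image Z = {x \<in> Eucl 3. \<forall>g\<in>?G. g x = 0}"
 proof (intro equalityI subsetI)
  fix w assume "w \<in> stereo_image Z" then show "w \<in> {x \<in> Eucl 3. \<forall>g\<in>?G. g x = 0}"
   unfolding stereo_image_eq[OF Z(1)] by auto
 next
  fix w assume w: "w \<in> {x \<in> Eucl 3. \<forall>g\<in>?G. g x = 0}"
  have "unstereo w \<in> Z"
  proof (rule ccontr)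
   assume n: "unstereo w \<notin> Z"
   have "unstereo w \<in> Eucl 4" using unstereo_sphere by (simp add: sphere3_iff)
   then obtain f where f: "f \<in> polyfuns" "\<forall>v\<in>Z. f v = 0" "f (unstereo w) \<noteq> 0"
    using real_closed_separate[OF Z(2) _ n] by blast
   obtain k F where F: "F \<in> polyfuns" "\<forall>w. F w = (1 + dot 3 w w) ^ k * f (unstereo w)"
    using unstereo_clear[OF f(1)] by blast
   have "F \<in> ?G" using F f(2) unfolding stereo_image_eq[OF Z(1)] by simp
   then have "F w = 0" using w by blast
   then show False using F(2) f(3) one_plus_dot[of 3 w] by simp
  qed
  then show "w \<in> stereo_image Z" using w unfolding stereo_image_eq[OF Z(1)] by blast
 qed
qed

text \<open>The closures of the images under inverse projection of a chain in \<open>stereo_image Z\<close> form a chain in \<open>Z\<close>;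
  it is strict since a polynomial separating two members can be pulled back after clearing denominators.\<close>

lemma stereo_image_krull_dim_le:
 assumes Z: "Z \<subseteq> topspace (nsphere 3)" "surface 4 Z"
 shows "krull_dim (real_closed 3) (stereo_image Z) \<le> enat 2"
proof (rule krull_dim_le)
 fix F :: "nat => (nat => real) set"
 assume F: "\<And>i. i \<le> Suc 2 ==> irreducible_closed (real_closed 3) (F i)"
  "\<And>i. i \<le> Suc 2 ==> F i \<subseteq> stereo_image Z" "\<And>i. i < Suc 2 ==> F i \<subset> F (Suc i)"
 have Zcl: "real_closed 4 Z" using Z(2) by (auto simp: surface_def irreducible_closed_def)
 define G where "G i = real_z.zc 4 (unstereo ` F i)" for i
 have sub: "unstereo ` A \<subseteq> Eucl 4" for A using unstereo_sphere by (auto simp: sphere3_iff)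
 have irr: "irreducible_closed (real_closed 4) (G i)" if "i \<le> 3" for i
  unfolding G_def
 proof (rule real_irreducible_zc[OF sub])
  have P: "poly_prime (F i)" using F(1)[of i] that by (simp add: real_irreducible_iff)
  show "poly_prime (unstereo ` F i)"
  proof (rule poly_prime_image[OF P, where d = "\<lambda>w. 1 + dot 3 w w" and G = "\<lambda>i w. if i < 3 then 2 * w i else if i = 3 then dot 3 w w - 1 else 0"])
   show "(\<lambda>w. 1 + dot 3 w w) \<in> polyfuns" by (intro polyfuns_add polyfuns_const dot_self_polyfuns)
   show "(\<lambda>w. if i < 3 then 2 * w i else if i = 3 then dot 3 w w - 1 else 0) \<in> polyfuns" for i :: nat
    by (cases "i < 3"; cases "i = 3") (auto intro!: polyfuns_mult polyfuns_diff)
   show "1 + dot 3 w w \<noteq> 0" for w using one_plus_dot[of 3 w] by simp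
   show "(1 + dot 3 w w) * unstereo w i = (if i < 3 then 2 * w i else if i = 3 then dot 3 w w - 1 else 0)" for i w
    using one_plus_dot[of 3 w] by (simp add: unstereo_def)
  qed
 qed
 have FE: "F i \<subseteq> Eucl 3" if "i \<le> 3" for i
  using F(1)[of i] that real_closed_sub by (auto simp: irreducible_closed_def)
 have GZ: "G i \<subseteq> Z" if "i \<le> 3" for i
  unfolding G_def
 proof (rule real_z.zc_least)
  show "real_z.cl 4 Z" using Zcl by (simp add: real_closed_cl)
  show "unstereo ` F i \<subseteq> Z" using F(2)[of i] that unfolding stereo_image_eq[OF Z(1)] by auto
 qed
 have strict: "G i \<subset> G (Suc i)" if "i < 3" for i
 proof -
  have le: "G i \<subseteq> G (Suc i)" unfolding G_def
  proof (rule real_z.zc_least[OF real_z.cl_zc])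
   show "unstereo ` F i \<subseteq> real_z.zc 4 (unstereo ` F (Suc i))"
    using real_z.zc_superset[OF sub, of "F (Suc i)"] F(3)[of i] that by auto
  qed
  have "F i \<subset> F (Suc i)" using F(3)[of i] that by simp
  then obtain w where w: "w \<in> F (Suc i)" "w \<notin> F i" by blast
  have wE: "w \<in> Eucl 3" using FE[of "Suc i"] that w(1) by auto
  have Fcl: "real_closed 3 (F i)" using F(1)[of i] that by (simp add: irreducible_closed_def)
  obtain f where f: "f \<in> polyfuns" "\<forall>v\<in>F i. f v = 0" "f w \<noteq> 0"
   using real_closed_separate[OF Fcl wE w(2)] by blast
  obtain k H where H: "H \<in> polyfuns" "\<forall>y\<in>{y. y 3 \<noteq> 1}. H y = (1 - y 3) ^ k * f (stereo y)"
   using stereo_clear[OF f(1)] by blast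
  have Hu: "H (unstereo v) = (1 - unstereo v 3) ^ k * f v" if "v \<in> Eucl 3" for v
   using H(2) unstereo_pole[of v] stereo_unstereo[OF that] by simp
  have "unstereo w \<notin> G i"
  proof
   assume "unstereo w \<in> G i"
   then have in_zc: "unstereo w \<in> real_z.zc 4 (unstereo ` F i)" by (simp add: G_def)
   have van: "\<forall>a\<in>unstereo ` F i. H a = 0"
   proof (intro ballI, elim imageE)
    fix a u assume "a = unstereo u" "u \<in> F i"
    moreover have "u \<in> Eucl 3" using FE[of i] that \<open>u \<in> F i\<close> by auto
    ultimately show "H a = 0" using Hu f(2) by simp
   qed
   have "H (unstereo w) = 0"
    by (rule real_z.zcD[where t = "\<lambda>y. H y = 0", OF in_zc vanish_testsI[OF H(1)] van])
   then show False using Hu[OF wE] f(3) unstereo_pole[of w] by simp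
  qed
  moreover have "unstereo w \<in> G (Suc i)" unfolding G_def using real_z.zc_superset[OF sub] w(1) by blast
  ultimately show ?thesis using le by blast
 qed
 have "enat 3 \<le> krull_dim (real_closed 4) Z"
  by (rule krull_dim_ge[where F = G]) (use irr GZ strict in auto)
 then show False using Z(2) by (simp add: surface_def numeral_eq_enat)
qed

section \<open>Tori in principal coordinates\<close>

locale torus =
 fixes c v :: "nat => nat => real" and \<kappa> :: "nat => real" and Z :: "(nat => real) set"
 assumes coords: "torus_coords c v \<kappa> Z" and surf: "surface 4 Z"
begin

abbreviation "\<eta> j y \<equiv> dot 4 (c j) y"

lemmas tc1 = coords[unfolded torus_coords_def]
lemmas tc2 = tc1[THEN conjunct2]
lemmas tc3 = tc2[THEN conjunct2]
lemmas tc4 = tc3[THEN conjunct2]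
lemmas tc5 = tc4[THEN conjunct2]
lemmas tc6 = tc5[THEN conjunct2]
lemmas tc7 = tc6[THEN conjunct2]
lemmas tc8 = tc7[THEN conjunct2]
lemmas cE = tc1[THEN conjunct1, rule_format]
lemmas vE = tc2[THEN conjunct1, rule_format]
lemmas dual = tc3[THEN conjunct1, rule_format]
lemmas expand = tc4[THEN conjunct1, rule_format]
lemmas dot_coords = tc5[THEN conjunct1, rule_format]
lemmas \<kappa>_pos = tc6[THEN conjunct1, rule_format]
lemmas \<kappa>01 = tc7[THEN conjunct1]
lemmas \<kappa>23 = tc8[THEN conjunct1]
lemmas Z_eq = tc8[THEN conjunct2]

definition pt :: "(nat => real) => nat => real" where
 "pt \<xi> = (\<lambda>i. \<Sum>j<4. \<xi> j * v j i)"

lemma pt_Eucl: "pt \<xi> \<in> Eucl 4"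
 using vE by (simp add: pt_def Eucl_iff)

lemma \<eta>_pt: assumes "j < 4" shows "\<eta> j (pt \<xi>) = \<xi> j"
proof -
 have "\<eta> j (pt \<xi>) = (\<Sum>i<4. \<xi> i * (if j = i then 1 else 0))"
  unfolding pt_def dot_sum using dual[OF assms] by (intro sum.cong) auto
 then show ?thesis using assms by (simp add: if_distrib cong: if_cong)
qed

lemma eq_by_coords: assumes "x \<in> Eucl 4" "y \<in> Eucl 4" "\<And>j. j < 4 ==> \<eta> j x = \<eta> j y" shows "x = y"
 using expand[OF assms(1)] expand[OF assms(2)] assms(3) by auto

lemma norm_coords: "y \<in> Eucl 4 ==> dot 4 y y = (\<Sum>j<4. \<kappa> j * (\<eta> j y)\<^sup>2)"
 by (simp add: dot_coords power2_eq_square)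

lemma Z_iff: "y \<in> Z \<longleftrightarrow> y \<in> Eucl 4 \<and> (\<Sum>j<4. \<kappa> j * (\<eta> j y)\<^sup>2) = 1 \<and>
  (\<eta> 0 y)\<^sup>2 + (\<eta> 1 y)\<^sup>2 = (\<eta> 2 y)\<^sup>2 + (\<eta> 3 y)\<^sup>2"
 unfolding Z_eq by (auto simp: sphere3_iff norm_coords)

lemma Z_sphere: "Z \<subseteq> topspace (nsphere 3)"
 unfolding Z_eq by blast

lemma Zprime: "poly_prime Z" and Zclosed: "real_closed 4 Z"
 using surf unfolding surface_def real_irreducible_iff by auto

lemma Z_minus: "y \<in> Z ==> (\<lambda>i. - y i) \<in> Z"
proof -
 assume y: "y \<in> Z"
 have "\<eta> j (\<lambda>i. - y i) = - \<eta> j y" for j by (simp add: dot_def sum_negf)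
 then show ?thesis using y unfolding Z_iff by (simp add: Eucl_iff)
qed

text \<open>Every vector on the cone spanned by Z can be normalised.\<close>

lemma pt_Z:
 assumes "(\<xi> 0)\<^sup>2 + (\<xi> 1)\<^sup>2 = (\<xi> 2)\<^sup>2 + (\<xi> 3)\<^sup>2" "a\<^sup>2 = (\<Sum>j<4. \<kappa> j * (\<xi> j)\<^sup>2)" "a \<noteq> 0"
 shows "pt (\<lambda>j. \<xi> j / a) \<in> Z"
proof -
 have "(\<Sum>j<4. \<kappa> j * (\<eta> j (pt (\<lambda>j. \<xi> j / a)))\<^sup>2) = (\<Sum>j<4. \<kappa> j * (\<xi> j)\<^sup>2) / a\<^sup>2"
  by (simp add: \<eta>_pt power_divide sum_divide_distrib)
 also have "\<dots> = 1" unfolding assms(2)[symmetric] using assms(3) by simp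
 finally have "(\<Sum>j<4. \<kappa> j * (\<eta> j (pt (\<lambda>j. \<xi> j / a)))\<^sup>2) = 1" .
 moreover have "(\<eta> 0 (pt (\<lambda>j. \<xi> j / a)))\<^sup>2 + (\<eta> 1 (pt (\<lambda>j. \<xi> j / a)))\<^sup>2 = (\<eta> 2 (pt (\<lambda>j. \<xi> j / a)))\<^sup>2 + (\<eta> 3 (pt (\<lambda>j. \<xi> j / a)))\<^sup>2"
  using assms(1) by (simp add: \<eta>_pt power_divide add_divide_distrib[symmetric])
 ultimately show ?thesis unfolding Z_iff using pt_Eucl by blast
qed

text \<open>A great circle of \<open>Z\<close> given explicitly; it supplies the middle member of the chains that bound dimensions
  below.\<close>

definition C0 :: "(nat => real) set" where
 "C0 = gcirc 4 (\<lambda>i. v 0 i + v 2 i) (\<lambda>i. v 1 i + v 3 i)"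

lemma C0_great: "great_circle 3 C0"
proof -
 have E: "(\<lambda>i. v 0 i + v 2 i) \<in> Eucl (Suc 3)" "(\<lambda>i. v 1 i + v 3 i) \<in> Eucl (Suc 3)"
  using vE by (auto simp: Eucl_iff)
 have "indep2 (\<lambda>i. v 0 i + v 2 i) (\<lambda>i. v 1 i + v 3 i)" unfolding indep2_def
 proof (intro allI impI)
  fix s t assume *: "\<forall>i. s * (v 0 i + v 2 i) + t * (v 1 i + v 3 i) = 0"
  have "(\<lambda>i. s * (v 0 i + v 2 i) + t * (v 1 i + v 3 i)) = pt (\<lambda>j. if even j then s else t)"
   by (auto simp: pt_def sum4 algebra_simps)
  then have "pt (\<lambda>j. if even j then s else t) = (\<lambda>i. 0)" using * by auto
  then have "\<eta> j (pt (\<lambda>j. if even j then s else t)) = 0" for j by (simp add: dot_def)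
  from this[of 0] this[of 1] show "s = 0 \<and> t = 0" by (simp_all add: \<eta>_pt)
 qed
 from gcirc_great[OF this E] show ?thesis by (simp add: C0_def)
qed

lemma C0_coords: assumes "y \<in> C0" shows "\<eta> 0 y = \<eta> 2 y" "\<eta> 1 y = \<eta> 3 y"
proof -
 obtain s t where "y = (\<lambda>i. s * (v 0 i + v 2 i) + t * (v 1 i + v 3 i))"
  using assms by (auto simp: C0_def gcirc_def plane_def)
 then have "y = pt (\<lambda>j. if even j then s else t)" by (auto simp: pt_def sum4 algebra_simps)
 then show "\<eta> 0 y = \<eta> 2 y" "\<eta> 1 y = \<eta> 3 y" by (simp_all add: \<eta>_pt)
qed

lemma C0_Z: "C0 \<subseteq> Z"
proof
 fix y assume y: "y \<in> C0"
 then have "y \<in> topspace (nsphere 3)" using great_circle_sphere[OF C0_great y] by (simp add: sphere3_iff)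
 then show "y \<in> Z" unfolding Z_eq using C0_coords[OF y] by simp
qed

lemma exists_off_C0: "\<exists>y\<in>Z. y 3 \<noteq> 1 \<and> \<eta> 0 y \<noteq> \<eta> 2 y"
proof -
 define \<xi> :: "nat => real" where "\<xi> j = (if j = 0 then 1 else if j = 2 then - 1 else 0)" for j
 define a where "a = sqrt (\<kappa> 0 + \<kappa> 2)"
 have a: "a > 0" "a\<^sup>2 = \<kappa> 0 + \<kappa> 2" using \<kappa>_pos[of 0] \<kappa>_pos[of 2] by (auto simp: a_def)
 define y where "y = pt (\<lambda>j. \<xi> j / a)"
 have y: "y \<in> Z" unfolding y_def by (rule pt_Z) (use a in \<open>auto simp: \<xi>_def sum4\<close>)
 have e: "\<eta> 0 y = 1 / a" "\<eta> 2 y = - 1 / a" by (simp_all add: y_def \<eta>_pt \<xi>_def)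
 have ne: "\<eta> 0 y \<noteq> \<eta> 2 y" unfolding e using a(1) by (simp add: field_simps)
 show ?thesis
 proof (cases "y 3 = 1")
  case False then show ?thesis using y ne by blast
 next
  case True
  have "\<eta> j (\<lambda>i. - y i) = - \<eta> j y" for j by (simp add: dot_def sum_negf)
  then have "\<eta> 0 (\<lambda>i. - y i) \<noteq> \<eta> 2 (\<lambda>i. - y i)" using ne by simp
  then show ?thesis using Z_minus[OF y] True by (intro bexI[of _ "\<lambda>i. - y i"]) auto
 qed
qed

lemma C0_not_pole: "\<exists>y\<in>C0. y 3 \<noteq> 1"
proof -
 have "\<not> C0 \<subseteq> {north_pole}" using great_circle_infinite[OF C0_great] finite_subset by blast
 then obtain y where "y \<in> C0" "y \<noteq> north_pole" by blast
 then show ?thesis using not_pole[of y] C0_Z Z_sphere by blast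
qed

theorem stereo_image_surface: "surface 3 (stereo_image Z)"
 unfolding surface_def
proof
 obtain y1 where y1: "y1 \<in> Z" "y1 3 \<noteq> 1" "\<eta> 0 y1 \<noteq> \<eta> 2 y1" using exists_off_C0 by blast
 obtain y0 where y0: "y0 \<in> C0" "y0 3 \<noteq> 1" using C0_not_pole by blast
 show irrW: "irreducible_closed (real_closed 3) (stereo_image Z)"
  unfolding real_irreducible_iff
  using stereo_image_closed[OF Z_sphere Zclosed] poly_prime_stereo[OF Zprime Z_sphere y1(1,2)] by blast
 have C0s: "C0 \<subseteq> topspace (nsphere 3)" using C0_Z Z_sphere by blast
 have C0p: "poly_prime C0" and C0c: "real_closed 4 C0"
  using great_circle_irreducible[OF C0_great] by (auto simp: real_irreducible_iff)
 have irrC: "irreducible_closed (real_closed 3) (stereo_image C0)"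
  unfolding real_irreducible_iff
  using stereo_image_closed[OF C0s C0c] poly_prime_stereo[OF C0p C0s y0] by blast
 define F where "F i = (if i = 0 then {stereo y0} else if i = 1 then stereo_image C0 else stereo_image Z)" for i :: nat
 have "enat 2 \<le> krull_dim (real_closed 3) (stereo_image Z)"
 proof (rule krull_dim_ge[where F = F])
  show "irreducible_closed (real_closed 3) (F i)" for i
   using irrW irrC point_irreducible[OF stereo_Eucl] by (auto simp: F_def)
  have y0p: "y0 \<noteq> north_pole" using y0(2) by (auto simp: north_pole_def)
  have s0: "stereo y0 \<in> stereo_image C0" unfolding stereo_image_def using y0(1) y0p by blast
  have sCZ: "stereo_image C0 \<subseteq> stereo_image Z" unfolding stereo_image_def using C0_Z by blast
  show "F i \<subseteq> stereo_image Z" for i using s0 sCZ by (auto simp: F_def)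
  have "\<not> C0 \<subseteq> {y0, north_pole}" using great_circle_infinite[OF C0_great] finite_subset by blast
  then obtain y2 where y2: "y2 \<in> C0" "y2 \<noteq> y0" "y2 \<noteq> north_pole" by blast
  have us: "unstereo (stereo y) = y" if "y \<in> Z" "y \<noteq> north_pole" for y
   using unstereo_stereo[of y] not_pole[of y] that Z_sphere by blast
  have ne1: "stereo y2 \<noteq> stereo y0"
  proof
   assume "stereo y2 = stereo y0"
   moreover have "y2 \<in> Z" "y0 \<in> Z" using y2 y0(1) C0_Z by auto
   ultimately show False using us[of y2] us[of y0] y2 y0p by simp
  qed
  have in1: "stereo y2 \<in> stereo_image C0" unfolding stereo_image_def using y2 by blast
  have y1p: "y1 \<noteq> north_pole" using y1(2) by (auto simp: north_pole_def)
  have "stereo y1 \<notin> stereo_image C0"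
  proof
   assume "stereo y1 \<in> stereo_image C0"
   then have "unstereo (stereo y1) \<in> C0" unfolding stereo_image_eq[OF C0s] by blast
   then show False using us[OF y1(1) y1p] C0_coords y1(3) by simp
  qed
  moreover have "stereo y1 \<in> stereo_image Z" unfolding stereo_image_def using y1(1) y1p by blast
  ultimately show "F i \<subset> F (Suc i)" if "i < 2" for i
   using that s0 sCZ ne1 in1 by (auto simp: F_def less_2_cases_iff)
 qed
 moreover have "krull_dim (real_closed 3) (stereo_image Z) \<le> enat 2"
  by (rule stereo_image_krull_dim_le[OF Z_sphere surf])
 ultimately show "krull_dim (real_closed 3) (stereo_image Z) = 2" by (simp add: numeral_eq_enat order_antisym)
qed

end

section \<open>Projective Zariski topology\<close>

lemma proj_point_self: "x \<in> proj_point x"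
 unfolding proj_point_def by (rule CollectI, rule exI[of _ 1]) simp

lemma proj_point_scale: assumes "c \<noteq> 0" shows "proj_point (\<lambda>i. c * x i) = proj_point x"
proof (intro equalityI subsetI)
 fix y assume "y \<in> proj_point (\<lambda>i. c * x i)"
 then obtain d where "d \<noteq> 0" "y = (\<lambda>i. d * (c * x i))" by (auto simp: proj_point_def)
 then have "y = (\<lambda>i. (d * c) * x i)" "d * c \<noteq> 0" using assms by (auto simp: mult.assoc)
 then show "y \<in> proj_point x" unfolding proj_point_def by blast
next
 fix y assume "y \<in> proj_point x"
 then obtain d where "d \<noteq> 0" "y = (\<lambda>i. d * x i)" by (auto simp: proj_point_def)
 then have "y = (\<lambda>i. (d / c) * (c * x i))" "d / c \<noteq> 0" using assms by auto
 then show "y \<in> proj_point (\<lambda>i. c * x i)" unfolding proj_point_def by blast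
qed

lemma proj_point_mem: assumes "y \<in> proj_point x" shows "proj_point y = proj_point x"
proof -
 obtain c where "c \<noteq> 0" "y = (\<lambda>i. c * x i)" using assms by (auto simp: proj_point_def)
 then show ?thesis using proj_point_scale by simp
qed

lemma proj_spaceE: assumes "P \<in> proj_space N" "x \<in> P" shows "P = proj_point x \<and> x \<noteq> 0 \<and> (\<forall>i>N. x i = 0)"
proof -
 obtain z where z: "P = proj_point z" "z \<noteq> 0" "\<forall>i>N. z i = 0" using assms(1) by (auto simp: proj_space_def)
 obtain c where c: "c \<noteq> 0" "x = (\<lambda>i. c * z i)" using assms(2) z(1) by (auto simp: proj_point_def)
 have "x \<noteq> 0" using c z(2) by (auto simp: fun_eq_iff)
 then show ?thesis using proj_point_mem[of x z] z c assms(2) by simp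
qed

lemma proj_space_ne: "P \<in> proj_space N ==> \<exists>x. x \<in> P"
 using proj_point_self by (auto simp: proj_space_def)

lemma proj_spaceI: "x \<noteq> 0 ==> (\<And>i. i > N ==> x i = 0) ==> proj_point x \<in> proj_space N"
 unfolding proj_space_def by blast

lemma vanishes_at_iff:
 assumes "(\<lambda>x. peval x f) \<in> forms d" shows "vanishes_at f (proj_point x) \<longleftrightarrow> peval x f = 0"
 using forms_scale[OF assms] proj_point_self[of x] unfolding vanishes_at_def proj_point_def by auto

definition proj_tests :: "((nat => complex) set => bool) set" where
 "proj_tests = vanishes_at ` {f. homogeneous f}"

lemma homogeneous_mult:
 fixes f g :: "('v, 'a::comm_ring_1) mpoly"
 assumes "homogeneous f" "homogeneous g" shows "homogeneous (f * g)"
proof -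
 obtain d e where "\<And>m. m \<in> Poly_Mapping.keys f ==> mdegree m = d" "\<And>m. m \<in> Poly_Mapping.keys g ==> mdegree m = e"
  using assms unfolding homogeneous_def mdegree_def by blast
 then have "mdegree m = d + e" if "m \<in> Poly_Mapping.keys (f * g)" for m
  using that keys_mult[of f g] by (auto simp: mdegree_add)
 then show ?thesis unfolding homogeneous_def mdegree_def by blast
qed

interpretation proj_z: zariski "proj_space N" proj_tests for N
proof
 fix s t assume "s \<in> proj_tests" "t \<in> proj_tests"
 then obtain f g where fg: "s = vanishes_at f" "homogeneous f" "t = vanishes_at g" "homogeneous g"
  unfolding proj_tests_def by blast
 obtain d where d: "(\<lambda>x. peval x f) \<in> forms d" using homogeneous_forms[OF fg(2)] by blast
 obtain e where e: "(\<lambda>x. peval x g) \<in> forms e" using homogeneous_forms[OF fg(4)] by blast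
 have h: "homogeneous (f * g)" by (rule homogeneous_mult[OF fg(2,4)])
 obtain k where k: "(\<lambda>x. peval x (f * g)) \<in> forms k" using homogeneous_forms[OF h] by blast
 have "vanishes_at (f * g) P = (s P \<or> t P)" if "P \<in> proj_space N" for P
 proof -
  from that obtain x where P: "P = proj_point x" by (auto simp: proj_space_def)
  show ?thesis unfolding P fg(1,3) vanishes_at_iff[OF d] vanishes_at_iff[OF e] vanishes_at_iff[OF k]
   by (simp add: peval_mult)
 qed
 moreover have "vanishes_at (f * g) \<in> proj_tests" using h by (simp add: proj_tests_def)
 ultimately show "\<exists>r\<in>proj_tests. \<forall>x\<in>proj_space N. r x = (s x \<or> t x)" by blast
qed

lemma proj_closed_cl: "proj_closed N = proj_z.cl N"
proof
 fix V
 show "proj_closed N V = proj_z.cl N V"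
 proof
  assume "proj_closed N V"
  then obtain F where F: "\<forall>f\<in>F. homogeneous f" "V = {P \<in> proj_space N. \<forall>f\<in>F. vanishes_at f P}"
   by (auto simp: proj_closed_def)
  show "proj_z.cl N V" unfolding proj_z.cl_def
   by (rule exI[of _ "vanishes_at ` F"]) (use F in \<open>auto simp: proj_tests_def\<close>)
 next
  assume "proj_z.cl N V"
  then obtain T where T: "T \<subseteq> proj_tests" "V = {P\<in>proj_space N. \<forall>t\<in>T. t P}" by (auto simp: proj_z.cl_def)
  define F where "F = {f. homogeneous f \<and> vanishes_at f \<in> T}"
  have "T = vanishes_at ` F" using T(1) unfolding F_def proj_tests_def by auto
  then have "V = {P\<in>proj_space N. \<forall>t\<in>vanishes_at ` F. t P}" using T(2) by simp
  then have "V = {P\<in>proj_space N. \<forall>f\<in>F. vanishes_at f P}" by simp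
  then show "proj_closed N V" unfolding proj_closed_def by (intro exI[of _ F]) (simp add: F_def)
 qed
qed

lemma proj_closure_zc: assumes "A \<subseteq> proj_space N" shows "proj_closure N A = proj_z.zc N A"
proof
 show "proj_closure N A \<subseteq> proj_z.zc N A" unfolding proj_closure_def proj_closed_cl
  using proj_z.cl_zc proj_z.zc_superset[OF assms] by blast
 show "proj_z.zc N A \<subseteq> proj_closure N A" unfolding proj_closure_def proj_closed_cl
  using proj_z.zc_least by blast
qed

lemma form_test:
 assumes "f \<in> forms d"
 obtains t where "t \<in> proj_tests" "\<And>x. t (proj_point x) \<longleftrightarrow> f x = 0"
proof -
 obtain p where p: "f = (\<lambda>x. peval x p)" "homogeneous p" using assms by (metis formsE)
 have "vanishes_at p (proj_point x) \<longleftrightarrow> f x = 0" for x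
  using vanishes_at_iff[of p d x] assms p(1) by simp
 then show thesis using that[of "vanishes_at p"] p(2) by (simp add: proj_tests_def)
qed

definition form_zero :: "((nat => complex) => complex) => pt set => bool" where
 "form_zero f V \<longleftrightarrow> (\<forall>P\<in>V. \<forall>x\<in>P. f x = 0)"

lemma proj_test_form:
 assumes "t \<in> proj_tests"
 obtains f d where "f \<in> forms d" "\<And>x. t (proj_point x) \<longleftrightarrow> f x = 0"
proof -
 obtain p where p: "t = vanishes_at p" "homogeneous p" using assms by (auto simp: proj_tests_def)
 obtain d where "(\<lambda>x. peval x p) \<in> forms d" using homogeneous_forms[OF p(2)] by blast
 then show thesis using that[of "\<lambda>x. peval x p" d] vanishes_at_iff p(1) by blast
qed

lemma proj_space_ball: assumes "P \<in> proj_space N" "t \<in> proj_tests" "\<And>x. t (proj_point x) \<longleftrightarrow> f x = 0"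
 shows "t P \<longleftrightarrow> (\<forall>x\<in>P. f x = 0)"
 using proj_spaceE[OF assms(1)] proj_space_ne[OF assms(1)] assms(3) by metis

lemma proj_cl_form: assumes "f \<in> forms d" shows "proj_closed N {P\<in>proj_space N. \<forall>x\<in>P. f x = 0}"
proof -
 obtain t where t: "t \<in> proj_tests" "\<And>x. t (proj_point x) \<longleftrightarrow> f x = 0" using form_test[OF assms] by blast
 have "{P\<in>proj_space N. \<forall>x\<in>P. f x = 0} = {P\<in>proj_space N. t P}" using proj_space_ball[OF _ t] by blast
 then show ?thesis using proj_z.cl_test[OF t(1)] by (simp add: proj_closed_cl)
qed

lemma proj_closed_sub: "proj_closed N V ==> V \<subseteq> proj_space N"
 by (simp add: proj_closed_cl proj_z.cl_sub)

lemma proj_closed_separate: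
 assumes "proj_closed N V" "P \<in> proj_space N" "P \<notin> V"
 obtains f d where "f \<in> forms d" "form_zero f V" "\<And>x. x \<in> P ==> f x \<noteq> 0"
proof -
 obtain t where t: "t \<in> proj_tests" "\<forall>v\<in>V. t v" "\<not> t P"
  using proj_z.cl_separate[OF assms(1)[unfolded proj_closed_cl] assms(2,3)] by blast
 obtain f d where f: "f \<in> forms d" "\<And>x. t (proj_point x) \<longleftrightarrow> f x = 0" using proj_test_form[OF t(1)] by blast
 have "form_zero f V" unfolding form_zero_def
  using t(2) proj_space_ball[OF _ t(1) f(2)] proj_closed_sub[OF assms(1)] by blast
 moreover have "f x \<noteq> 0" if "x \<in> P" for x
  using t(3) f(2)[of x] proj_spaceE[OF assms(2) that] by metis
 ultimately show thesis using that f(1) by blast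
qed

lemma proj_irreducible_iff:
 "irreducible_closed (proj_closed N) V \<longleftrightarrow> proj_closed N V \<and> proj_z.prime V"
 unfolding proj_closed_cl proj_z.irreducible_iff ..

lemma proj_primeD:
 assumes "proj_z.prime V" "V \<subseteq> proj_space N" "f \<in> forms d" "g \<in> forms e"
  and "form_zero (\<lambda>x. f x * g x) V" "\<not> form_zero f V"
 shows "form_zero g V"
proof -
 obtain s where s: "s \<in> proj_tests" "\<And>x. s (proj_point x) \<longleftrightarrow> f x = 0" using form_test[OF assms(3)] by blast
 obtain t where t: "t \<in> proj_tests" "\<And>x. t (proj_point x) \<longleftrightarrow> g x = 0" using form_test[OF assms(4)] by blast
 have "s P \<or> t P" if P: "P \<in> V" for P
 proof -
  have PN: "P \<in> proj_space N" using P assms(2) by blast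
  obtain x where x: "x \<in> P" using proj_space_ne[OF PN] by blast
  then have "P = proj_point x" using proj_spaceE[OF PN] by blast
  moreover have "f x = 0 \<or> g x = 0" using assms(5) P x by (auto simp: form_zero_def)
  ultimately show ?thesis using s(2) t(2) by blast
 qed
 then have "(\<forall>P\<in>V. s P) \<or> (\<forall>P\<in>V. t P)" using assms(1) s(1) t(1) unfolding proj_z.prime_def by blast
 moreover have "\<not> (\<forall>P\<in>V. s P)"
  using assms(6) proj_space_ball[OF _ s] assms(2) unfolding form_zero_def by blast
 ultimately show ?thesis using proj_space_ball[OF _ t] assms(2) unfolding form_zero_def by blast
qed

lemma proj_point_closed:
 assumes "P \<in> proj_space N" shows "irreducible_closed (proj_closed N) {P}"
 unfolding proj_irreducible_iff
proof
 show "proj_z.prime {P}" by (auto simp: proj_z.prime_def)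
 obtain p where p: "p \<in> P" using proj_space_ne[OF assms] by blast
 note pP = proj_spaceE[OF assms p]
 obtain k where k: "p k \<noteq> 0" using pP by (auto simp: fun_eq_iff)
 define g where "g i x = p k * x i - p i * x k" for i and x :: "nat => complex"
 have gf: "g i \<in> forms (Suc 0)" for i unfolding g_def[abs_def] by (intro forms_diff forms_cmult forms_var)
 have "proj_z.zc N {P} \<subseteq> {P}"
 proof
  fix Q assume Q: "Q \<in> proj_z.zc N {P}"
  then have QN: "Q \<in> proj_space N" by (simp add: proj_z.zc_def)
  obtain x where x: "x \<in> Q" using proj_space_ne[OF QN] by blast
  note xQ = proj_spaceE[OF QN x]
  have "g i x = 0" for i
  proof -
   obtain t where t: "t \<in> proj_tests" "\<And>x. t (proj_point x) \<longleftrightarrow> g i x = 0" using form_test[OF gf[of i]] by blast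
   have "t P" using t(2)[of p] pP by (simp add: g_def)
   then have "t Q" using proj_z.zcD[OF Q t(1)] by simp
   then show ?thesis using t(2)[of x] xQ by metis
  qed
  then have xe: "x = (\<lambda>i. (x k / p k) * p i)" using k by (auto simp: g_def fun_eq_iff field_simps)
  have "x k / p k \<noteq> 0"
  proof
   assume "x k / p k = 0"
   then have "x i = 0" for i using fun_cong[OF xe, of i] k by simp
   then show False using xQ by (auto simp: fun_eq_iff)
  qed
  then have "x \<in> proj_point p" unfolding proj_point_def using xe by blast
  then have "x \<in> P" using pP by simp
  then show "Q \<in> {P}" using proj_spaceE[OF assms] xQ by simp
 qed
 then have "proj_z.zc N {P} = {P}" using proj_z.zc_superset[of "{P}" N] assms by blast
 then show "proj_closed N {P}" using proj_z.cl_zc[of N "{P}"] by (simp add: proj_closed_cl)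
qed

section \<open>Real points\<close>

definition hv :: "(nat => real) => nat => complex" where
 "hv y = (\<lambda>i. case i of 0 => 1 | Suc j => of_real (y j))"

lemma hv_simps [simp]: "hv y 0 = 1" "hv y (Suc j) = of_real (y j)"
 by (simp_all add: hv_def)

lemma embed_hv: "embed y = proj_point (hv y)"
 by (simp add: embed_def hv_def)

lemma embed_proj: assumes "y \<in> Eucl 4" shows "embed y \<in> proj_space 4"
 unfolding embed_hv
proof (rule proj_spaceI)
 show "hv y \<noteq> 0" by (auto simp: fun_eq_iff intro: exI[of _ 0])
 show "hv y i = 0" if "i > 4" for i using assms that by (cases i) (auto simp: Eucl_iff)
qed

lemma polyfuns_real_imag:
 assumes "f \<in> polyfuns"
 shows "\<exists>a\<in>polyfuns. \<exists>b\<in>polyfuns. \<forall>y. f (hv y) = Complex (a y) (b y)"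
 using assms
proof (induction f rule: polyfuns_induct)
 case (const c)
 show ?case by (rule bexI[of _ "\<lambda>y. Re c"], rule bexI[of _ "\<lambda>y. Im c"]) auto
next
 case (var i)
 show ?case
 proof (cases i)
  case 0
  show ?thesis by (rule bexI[of _ "\<lambda>y. 1"], rule bexI[of _ "\<lambda>y. 0"]) (auto simp: 0 complex_eq_iff)
 next
  case (Suc j)
  show ?thesis by (rule bexI[of _ "\<lambda>y. y j"], rule bexI[of _ "\<lambda>y. 0"]) (auto simp: Suc complex_eq_iff)
 qed
next
 case (add f g)
 obtain a b where 1: "a \<in> polyfuns" "b \<in> polyfuns" "\<forall>y. f (hv y) = Complex (a y) (b y)" using add.IH by blast
 obtain a' b' where 2: "a' \<in> polyfuns" "b' \<in> polyfuns" "\<forall>y. g (hv y) = Complex (a' y) (b' y)" using add.IH by blast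
 show ?case by (rule bexI[of _ "\<lambda>y. a y + a' y"], rule bexI[of _ "\<lambda>y. b y + b' y"])
  (use 1 2 in \<open>auto simp: complex_eq_iff\<close>)
next
 case (mult f g)
 obtain a b where 1: "a \<in> polyfuns" "b \<in> polyfuns" "\<forall>y. f (hv y) = Complex (a y) (b y)" using mult.IH by blast
 obtain a' b' where 2: "a' \<in> polyfuns" "b' \<in> polyfuns" "\<forall>y. g (hv y) = Complex (a' y) (b' y)" using mult.IH by blast
 show ?case by (rule bexI[of _ "\<lambda>y. a y * a' y - b y * b' y"], rule bexI[of _ "\<lambda>y. a y * b' y + b y * a' y"])
  (use 1 2 in \<open>auto simp: complex_eq_iff intro!: polyfuns_diff polyfuns_add polyfuns_mult\<close>)
qed

lemma polyfuns_norm: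
 assumes "f \<in> polyfuns"
 shows "\<exists>a\<in>polyfuns. \<forall>y. f (hv y) = 0 \<longleftrightarrow> a y = 0"
proof -
 obtain a b where ab: "a \<in> polyfuns" "b \<in> polyfuns" "\<forall>y. f (hv y) = Complex (a y) (b y)"
  using polyfuns_real_imag[OF assms] by blast
 show ?thesis
 proof (rule bexI[of _ "\<lambda>y. (a y)\<^sup>2 + (b y)\<^sup>2"])
  show "\<forall>y. f (hv y) = 0 \<longleftrightarrow> (a y)\<^sup>2 + (b y)\<^sup>2 = 0" using ab(3) by (simp add: complex_eq_iff sum_power2_eq_zero_iff)
  show "(\<lambda>y. (a y)\<^sup>2 + (b y)\<^sup>2) \<in> polyfuns" by (intro polyfuns_add polyfuns_power ab(1,2))
 qed
qed

text \<open>On real points a complex form vanishes iff a real polynomial does, namely its squared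
  absolute value (\<open>polyfuns_norm\<close>).\<close>

lemma embed_prime:
 assumes "poly_prime A" "A \<subseteq> Eucl 4" shows "proj_z.prime (embed ` A)"
 unfolding proj_z.prime_def
proof (intro conjI ballI impI)
 show "embed ` A \<noteq> {}" using assms(1) by (auto simp: poly_prime_def)
 fix s t assume st: "s \<in> proj_tests" "t \<in> proj_tests" "\<forall>x\<in>embed ` A. s x \<or> t x"
 obtain f d where f: "f \<in> forms d" "\<And>x. s (proj_point x) \<longleftrightarrow> f x = 0" using proj_test_form[OF st(1)] by blast
 obtain g e where g: "g \<in> forms e" "\<And>x. t (proj_point x) \<longleftrightarrow> g x = 0" using proj_test_form[OF st(2)] by blast
 obtain a where a: "a \<in> polyfuns" "\<forall>y. f (hv y) = 0 \<longleftrightarrow> a y = 0" using polyfuns_norm[OF forms_polyfuns[OF f(1)]] by blast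
 obtain b where b: "b \<in> polyfuns" "\<forall>y. g (hv y) = 0 \<longleftrightarrow> b y = 0" using polyfuns_norm[OF forms_polyfuns[OF g(1)]] by blast
 have sa: "s (embed y) \<longleftrightarrow> a y = 0" "t (embed y) \<longleftrightarrow> b y = 0" for y using f(2) g(2) a(2) b(2) by (simp_all add: embed_hv)
 have "\<forall>y\<in>A. a y = 0 \<or> b y = 0" using st(3) sa by blast
 then have "(\<forall>y\<in>A. a y = 0) \<or> (\<forall>y\<in>A. b y = 0)" using assms(1) a(1) b(1) unfolding poly_prime_def by blast
 then show "(\<forall>x\<in>embed ` A. s x) \<or> (\<forall>x\<in>embed ` A. t x)" using sa by blast
qed

lemma polyfuns_zero_on_reals:
 fixes f :: "('v => complex) => complex"
 assumes "f \<in> polyfuns" "\<And>r. f (\<lambda>i. of_real (r i)) = 0"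
 shows "f p = 0"
proof -
 let ?l = "\<lambda>t i. of_real (Re (p i)) + t * of_real (Im (p i)) :: complex"
 obtain P where P: "\<And>t. f (?l t) = poly P t"
  using polyfuns_line[OF assms(1), of "\<lambda>i. of_real (Re (p i))" "\<lambda>i. of_real (Im (p i))"] by blast
 have "poly P (of_real t) = 0" for t :: real
  using assms(2)[of "\<lambda>i. Re (p i) + t * Im (p i)"] P[of "of_real t"] by simp
 then have "range (of_real :: real => complex) \<subseteq> {t. poly P t = 0}" by auto
 moreover have "infinite (range (of_real :: real => complex))"
  using finite_imageD[OF _ inj_of_real] infinite_UNIV_char_0[where 'a = real] by blast
 ultimately have "P = 0" using poly_roots_finite finite_subset by blast
 then have "f (?l \<i>) = 0" using P by simp
 moreover have "?l \<i> = p" by (auto simp: complex_eq_iff)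
 ultimately show ?thesis by simp
qed

section \<open>The quadric P1 x P1\<close>

text \<open>The parametrisation of the quadric \<open>\<eta>0\<^sup>2 + \<eta>1\<^sup>2 = \<eta>2\<^sup>2 + \<eta>3\<^sup>2\<close> by two pairs of homogeneous parameters, that is, the
  Segre map in the coordinates \<open>\<eta>0 \<plusminus> \<eta>2\<close>, \<open>\<eta>3 \<plusminus> \<eta>1\<close>.\<close>

definition Qd :: "(nat => 'a::field_char_0) => nat => 'a" where
 "Qd p j = (if j = 0 then (p 0 * p 2 + p 1 * p 3) / 2 else if j = 1 then (p 1 * p 2 - p 0 * p 3) / 2
   else if j = 2 then (p 1 * p 3 - p 0 * p 2) / 2 else (p 0 * p 3 + p 1 * p 2) / 2)"

lemma Qd_polyfuns: "(\<lambda>p. Qd p j) \<in> polyfuns"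
proof -
 have *: "(\<lambda>p. f p / 2) \<in> polyfuns" if "f \<in> polyfuns" for f :: "(nat => 'a) => 'a"
  using polyfuns_mult[OF polyfuns_const[of "1/2"] that] by simp
 show ?thesis unfolding Qd_def
  by (intro polyfuns_if * polyfuns_add polyfuns_diff polyfuns_mult polyfuns_var)
qed

lemma Qd_quadric: "(Qd p 0)\<^sup>2 + (Qd p 1)\<^sup>2 = (Qd p 2)\<^sup>2 + (Qd p 3)\<^sup>2"
 by (simp add: Qd_def power2_eq_square field_simps)

lemma Qd_surj:
 fixes x :: "nat => 'a::field_char_0"
 assumes "(x 0)\<^sup>2 + (x 1)\<^sup>2 = (x 2)\<^sup>2 + (x 3)\<^sup>2"
 shows "\<exists>p. \<forall>j<4. Qd p j = x j"
proof -
 define l1 l2 l3 l4 where l: "l1 = x 0 - x 2" "l2 = x 3 - x 1" "l3 = x 3 + x 1" "l4 = x 0 + x 2"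
 have det: "l1 * l4 = l2 * l3" using assms by (simp add: l power2_eq_square algebra_simps)
 have "\<exists>a b c d. a * c = l1 \<and> a * d = l2 \<and> b * c = l3 \<and> b * d = l4"
 proof -
  consider "l1 \<noteq> 0" | "l1 = 0" "l2 \<noteq> 0" | "l1 = 0" "l2 = 0" by blast
  then show ?thesis
  proof cases
   case 1
   then show ?thesis using det by (intro exI[of _ 1] exI[of _ "l3 / l1"] exI[of _ l1] exI[of _ l2]) (auto simp: field_simps)
  next
   case 2
   then show ?thesis using det by (intro exI[of _ 1] exI[of _ "l4 / l2"] exI[of _ l1] exI[of _ l2]) auto
  next
   case 3
   then show ?thesis by (intro exI[of _ 0] exI[of _ 1] exI[of _ l3] exI[of _ l4]) auto
  qed
 qed
 then obtain a b c d where abcd: "a * c = l1" "a * d = l2" "b * c = l3" "b * d = l4" by blast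
 define p where "p j = (if j = 0 then a else if j = 1 then b else if j = 2 then c else d)" for j :: nat
 have "Qd p j = x j" if "j < 4" for j
  using that unfolding less4 Qd_def by (auto simp: p_def abcd l)
 then show ?thesis by blast
qed

lemma Qd_of_real: "Qd (\<lambda>i. of_real (r i)) j = (of_real (Qd r j) :: complex)"
 by (simp add: Qd_def)

section \<open>The complex model\<close>

context torus
begin

definition XC :: "nat => (nat => complex) => complex" where
 "XC j x = (\<Sum>i<4. of_real (c j i) * x (Suc i))"

text \<open>The inverse of the coordinate change \<open>x \<mapsto> (x 0, XC 0 x, \<dots>, XC 3 x)\<close>.\<close>

definition vec :: "complex => (nat => complex) => nat => complex" where
 "vec a \<xi> = (\<lambda>i. case i of 0 => a | Suc k => \<Sum>j<4. \<xi> j * of_real (v j k))"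

lemma vec_0 [simp]: "vec a \<xi> 0 = a"
 by (simp add: vec_def)

lemma vec_cong: "(\<And>j. j < 4 ==> \<xi> j = \<xi>' j) ==> vec a \<xi> = vec a \<xi>'"
 by (auto simp: vec_def fun_eq_iff split: nat.split intro!: sum.cong)

lemma vec_scale: "vec (t * a) (\<lambda>j. t * \<xi> j) = (\<lambda>i. t * vec a \<xi> i)"
 by (auto simp: vec_def fun_eq_iff sum_distrib_left mult.assoc split: nat.split)

lemma XC_form: "XC j \<in> forms (Suc 0)"
 unfolding XC_def[abs_def] by (intro forms_sum forms_cmult forms_var)

lemma XC_scale: "XC j (\<lambda>i. t * x i) = t * XC j x"
 by (simp add: XC_def sum_distrib_left algebra_simps)

lemma XC_vec: assumes "j < 4" shows "XC j (vec a \<xi>) = \<xi> j"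
proof -
 have "XC j (vec a \<xi>) = (\<Sum>i<4. \<Sum>k<4. of_real (c j i) * (\<xi> k * of_real (v k i)))"
  by (simp add: XC_def vec_def sum_distrib_left)
 also have "\<dots> = (\<Sum>k<4. \<xi> k * of_real (dot 4 (c j) (v k)))"
  by (subst sum.swap) (simp add: dot_def sum_distrib_left algebra_simps)
 also have "\<dots> = (\<Sum>k<4. \<xi> k * (if j = k then 1 else 0))" using dual[OF assms] by (intro sum.cong) auto
 also have "\<dots> = \<xi> j" using assms by (simp add: if_distrib cong: if_cong)
 finally show ?thesis .
qed

lemma cv_delta: assumes "i < 4" "k < 4" shows "(\<Sum>j<4. c j i * v j k) = (if k = i then 1 else 0)"
proof -
 define y :: "nat => real" where "y k = (if k = i then 1 else 0)" for k
 have "y \<in> Eucl 4" using assms by (auto simp: y_def Eucl_iff)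
 then have "y k = (\<Sum>j<4. dot 4 (c j) y * v j k)" by (rule expand)
 moreover have "dot 4 (c j) y = c j i" for j using assms by (simp add: dot_def y_def if_distrib cong: if_cong)
 ultimately show ?thesis by (simp add: y_def)
qed

lemma vec_XC: assumes "\<And>i. i > 4 ==> x i = 0" shows "vec (x 0) (\<lambda>j. XC j x) = x"
proof
 fix i
 show "vec (x 0) (\<lambda>j. XC j x) i = x i"
 proof (cases i)
  case (Suc k)
  show ?thesis
  proof (cases "k < 4")
   case True
   have "vec (x 0) (\<lambda>j. XC j x) i = (\<Sum>j<4. \<Sum>i<4. of_real (c j i) * x (Suc i) * of_real (v j k))"
    by (simp add: vec_def Suc XC_def sum_distrib_right)
   also have "\<dots> = (\<Sum>i<4. x (Suc i) * of_real (\<Sum>j<4. c j i * v j k))"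
    by (subst sum.swap) (simp add: sum_distrib_left algebra_simps)
   also have "\<dots> = (\<Sum>i<4. x (Suc i) * (if k = i then 1 else 0))"
    using cv_delta[OF _ True] by (intro sum.cong) auto
   also have "\<dots> = x i" using True by (simp add: Suc if_distrib cong: if_cong)
   finally show ?thesis .
  next
   case False
   then have "v j k = 0" if "j < 4" for j using vE[OF that] by (simp add: Eucl_iff)
   then show ?thesis using assms[of i] False by (simp add: vec_def Suc)
  qed
 qed simp
qed

lemma vec_supp: "i > 4 ==> vec a \<xi> i = 0"
 using vE by (cases i) (auto simp: vec_def Eucl_iff)

lemma XC_hv: "XC j (hv y) = of_real (\<eta> j y)"
 by (simp add: XC_def dot_def)

lemma hv_vec: "y \<in> Eucl 4 ==> hv y = vec 1 (\<lambda>j. of_real (\<eta> j y))"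
 using vec_XC[of "hv y"] embed_proj[of y] proj_spaceE[of "embed y" 4 "hv y"] proj_point_self[of "hv y"]
 by (simp add: XC_hv embed_hv)

definition onX :: "(nat => complex) => bool" where
 "onX x \<longleftrightarrow> (XC 0 x)\<^sup>2 + (XC 1 x)\<^sup>2 = (XC 2 x)\<^sup>2 + (XC 3 x)\<^sup>2 \<and> (x 0)\<^sup>2 = (\<Sum>j<4. of_real (\<kappa> j) * (XC j x)\<^sup>2)"

text \<open>The common zeros of the two homogenised equations of \<open>Z\<close>; it will turn out to be the Moebius model.\<close>

definition M :: "pt set" where
 "M = {P\<in>proj_space 4. \<forall>x\<in>P. onX x}"

definition q1 :: "(nat => complex) => complex" where
 "q1 x = (XC 0 x)\<^sup>2 + (XC 1 x)\<^sup>2 - ((XC 2 x)\<^sup>2 + (XC 3 x)\<^sup>2)"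

definition q2 :: "(nat => complex) => complex" where
 "q2 x = (x 0)\<^sup>2 - (\<Sum>j<4. of_real (\<kappa> j) * (XC j x)\<^sup>2)"

lemma q_forms: "q1 \<in> forms 2" "q2 \<in> forms 2"
 unfolding q1_def[abs_def] q2_def[abs_def]
 by (intro forms_diff forms_add forms_sum forms_cmult forms_power'[OF XC_form] forms_power'[OF forms_var]; simp)+

lemma onX_q: "onX x \<longleftrightarrow> q1 x = 0 \<and> q2 x = 0"
 by (simp add: onX_def q1_def q2_def)

lemma M_closed: "proj_closed 4 M"
proof -
 have "M = {P\<in>proj_space 4. \<forall>x\<in>P. q1 x = 0} \<inter> {P\<in>proj_space 4. \<forall>x\<in>P. q2 x = 0}"
  by (auto simp: M_def onX_q)
 then show ?thesis using proj_cl_form[OF q_forms(1)] proj_cl_form[OF q_forms(2)] proj_z.cl_Int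
  by (simp add: proj_closed_cl)
qed

lemma onX_scale: "onX x ==> onX (\<lambda>i. t * x i)"
 using forms_scale[OF q_forms(1)] forms_scale[OF q_forms(2)] by (simp add: onX_q)

lemma M_point: assumes "x \<noteq> 0" "\<And>i. i > 4 ==> x i = 0" "onX x" shows "proj_point x \<in> M"
proof -
 have "onX y" if "y \<in> proj_point x" for y using that onX_scale[OF assms(3)] by (auto simp: proj_point_def)
 then show ?thesis unfolding M_def using proj_spaceI[OF assms(1,2)] by blast
qed

lemma onX_hv: assumes "y \<in> Eucl 4" shows "onX (hv y) \<longleftrightarrow> y \<in> Z"
proof -
 have "(\<Sum>j<4. of_real (\<kappa> j) * (of_real (\<eta> j y))\<^sup>2) = (of_real (\<Sum>j<4. \<kappa> j * (\<eta> j y)\<^sup>2) :: complex)" by simp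
 moreover have "(of_real (\<eta> 0 y))\<^sup>2 + (of_real (\<eta> 1 y))\<^sup>2 = (of_real ((\<eta> 0 y)\<^sup>2 + (\<eta> 1 y)\<^sup>2) :: complex)"
  "(of_real (\<eta> 2 y))\<^sup>2 + (of_real (\<eta> 3 y))\<^sup>2 = (of_real ((\<eta> 2 y)\<^sup>2 + (\<eta> 3 y)\<^sup>2) :: complex)" by simp_all
 moreover have "(1::complex)\<^sup>2 = of_real s \<longleftrightarrow> s = 1" for s by (metis of_real_eq_1_iff power_one)
 ultimately show ?thesis unfolding onX_def XC_hv hv_simps Z_iff using assms by (simp only: of_real_eq_iff) blast
qed

lemma embed_M: assumes "y \<in> Eucl 4" shows "embed y \<in> M \<longleftrightarrow> y \<in> Z"
proof
 assume "embed y \<in> M"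
 then have "onX (hv y)" unfolding M_def using proj_point_self by (auto simp: embed_hv)
 then show "y \<in> Z" using onX_hv[OF assms] by simp
next
 assume "y \<in> Z"
 then have "onX (hv y)" using onX_hv[OF assms] by simp
 moreover note proj_spaceE[OF embed_proj[OF assms], of "hv y"] proj_point_self[of "hv y"]
 ultimately show "embed y \<in> M" unfolding embed_hv by (intro M_point) auto
qed

definition Kc :: "(nat => complex) => complex" where
 "Kc p = (\<Sum>j<4. of_real (\<kappa> j) * (Qd p j)\<^sup>2)"

lemma Kc_polyfuns: "Kc \<in> polyfuns"
 unfolding Kc_def[abs_def] by (intro polyfuns_sum polyfuns_mult polyfuns_const polyfuns_power Qd_polyfuns)

text \<open>The model is a double cover of the quadric, branched along \<open>Kc = 0\<close>: even powers of the coordinate \<open>x 0\<close>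
 can be eliminated.\<close>

lemma polyfuns_on_model:
 assumes "f \<in> polyfuns"
 shows "\<exists>A\<in>polyfuns. \<exists>B\<in>polyfuns. \<forall>p a. a\<^sup>2 = Kc p --> f (vec a (Qd p)) = A p + a * B p"
 using assms
proof (induction f rule: polyfuns_induct)
 case (const d)
 show ?case by (rule bexI[of _ "\<lambda>y. d"], rule bexI[of _ "\<lambda>y. 0"]) auto
next
 case (var i)
 show ?case
 proof (cases i)
  case 0
  show ?thesis by (rule bexI[of _ "\<lambda>y. 0"], rule bexI[of _ "\<lambda>y. 1"]) (auto simp: 0)
 next
  case (Suc k)
  show ?thesis
   by (rule bexI[of _ "\<lambda>p. \<Sum>j<4. Qd p j * of_real (v j k)"], rule bexI[of _ "\<lambda>y. 0"])
    (auto simp: Suc vec_def intro!: polyfuns_sum polyfuns_mult Qd_polyfuns)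
 qed
next
 case (add f g)
 obtain A B where 1: "A \<in> polyfuns" "B \<in> polyfuns" "\<forall>p a. a\<^sup>2 = Kc p --> f (vec a (Qd p)) = A p + a * B p" using add.IH by blast
 obtain A' B' where 2: "A' \<in> polyfuns" "B' \<in> polyfuns" "\<forall>p a. a\<^sup>2 = Kc p --> g (vec a (Qd p)) = A' p + a * B' p" using add.IH by blast
 show ?case
  by (rule bexI[of _ "\<lambda>p. A p + A' p"], rule bexI[of _ "\<lambda>p. B p + B' p"])
   (use 1 2 in \<open>auto simp: algebra_simps\<close>)
next
 case (mult f g)
 obtain A B where 1: "A \<in> polyfuns" "B \<in> polyfuns" "\<forall>p a. a\<^sup>2 = Kc p --> f (vec a (Qd p)) = A p + a * B p" using mult.IH by blast
 obtain A' B' where 2: "A' \<in> polyfuns" "B' \<in> polyfuns" "\<forall>p a. a\<^sup>2 = Kc p --> g (vec a (Qd p)) = A' p + a * B' p" using mult.IH by blast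
 have eq: "f (vec a (Qd p)) * g (vec a (Qd p)) = (A p * A' p + Kc p * (B p * B' p)) + a * (A p * B' p + B p * A' p)"
  if a: "a\<^sup>2 = Kc p" for a p
 proof -
  have "f (vec a (Qd p)) * g (vec a (Qd p)) = (A p + a * B p) * (A' p + a * B' p)" using 1(3) 2(3) a by simp
  also have "\<dots> = (A p * A' p + a\<^sup>2 * (B p * B' p)) + a * (A p * B' p + B p * A' p)"
   by (simp add: power2_eq_square algebra_simps)
  finally show ?thesis using a by simp
 qed
 show ?case
  by (rule bexI[of _ "\<lambda>p. A p * A' p + Kc p * (B p * B' p)"], rule bexI[of _ "\<lambda>p. A p * B' p + B p * A' p"], intro allI impI, rule eq)
   (use 1 2 Kc_polyfuns in \<open>auto intro!: polyfuns_add polyfuns_mult\<close>)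
qed

lemma onX_param:
 assumes "onX x" "\<And>i. i > 4 ==> x i = 0"
 shows "\<exists>p. (x 0)\<^sup>2 = Kc p \<and> x = vec (x 0) (Qd p)"
proof -
 obtain p where p: "\<forall>j<4. Qd p j = XC j x" using Qd_surj[of "\<lambda>j. XC j x"] assms(1) by (auto simp: onX_def)
 have "x = vec (x 0) (Qd p)" using vec_XC[of x] assms(2) vec_cong[of "Qd p" "\<lambda>j. XC j x"] p by simp
 moreover have "(x 0)\<^sup>2 = Kc p" using assms(1) p by (simp add: onX_def Kc_def)
 ultimately show ?thesis by blast
qed

text \<open>The real points are dense in the model. In the normal form \<open>A + x 0 * B\<close> of \<open>f\<close>, both roots \<open>\<plusminus> sqrt k\<close>
 of a real parameter give real points, so \<open>A\<close> and \<open>B\<close> vanish at real parameters with \<open>k \<noteq> 0\<close>, hence everywhere.\<close>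

lemma dense:
 assumes f: "f \<in> forms d" and van: "\<And>y. y \<in> Z ==> y \<noteq> north_pole ==> f (hv y) = 0"
  and x: "onX x" "\<And>i. i > 4 ==> x i = 0"
 shows "f x = 0"
proof -
 obtain y1 where y1: "y1 \<in> Z" "y1 3 \<noteq> 1" using exists_off_C0 by blast
 obtain a where a: "a \<in> polyfuns" "\<forall>y. f (hv y) = 0 \<longleftrightarrow> a y = 0" using polyfuns_norm[OF forms_polyfuns[OF f]] by blast
 have p: "(\<lambda>y::nat => real. 1 - y 3) \<in> polyfuns" by (intro polyfuns_diff polyfuns_const polyfuns_var)
 have "(1 - y 3) * a y = 0" if y: "y \<in> Z" for y
 proof (cases "y = north_pole")
  case True then show ?thesis by (simp add: north_pole_def)
 next
  case False then show ?thesis using van[OF y] a(2) by simp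
 qed
 from poly_primeD[OF Zprime p a(1) this y1(1)] y1(2) have vanZ: "f (hv y) = 0" if "y \<in> Z" for y
  using that a(2) by simp
 obtain A B where AB: "A \<in> polyfuns" "B \<in> polyfuns" "\<forall>p a. a\<^sup>2 = Kc p --> f (vec a (Qd p)) = A p + a * B p"
  using polyfuns_on_model[OF forms_polyfuns[OF f]] by blast
 have real0: "Kc (\<lambda>i. of_real (r i)) * A (\<lambda>i. of_real (r i)) = 0 \<and> Kc (\<lambda>i. of_real (r i)) * B (\<lambda>i. of_real (r i)) = 0" for r
 proof -
  let ?p = "\<lambda>i. of_real (r i) :: complex"
  define k where "k = (\<Sum>j<4. \<kappa> j * (Qd r j)\<^sup>2)"
  have Kk: "Kc ?p = of_real k" by (simp add: Kc_def k_def Qd_of_real)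
  have k0: "k \<ge> 0" unfolding k_def using \<kappa>_pos by (intro sum_nonneg mult_nonneg_nonneg) (auto intro: less_imp_le)
  show ?thesis
  proof (cases "k = 0")
   case False
   have key: "A ?p + of_real s * B ?p = 0" if s: "s\<^sup>2 = k" for s
   proof -
    have s0: "s \<noteq> 0" using s False by auto
    have "pt (\<lambda>j. Qd r j / s) \<in> Z"
     by (rule pt_Z[OF Qd_quadric]) (use s s0 in \<open>simp_all add: k_def\<close>)
    then have "f (hv (pt (\<lambda>j. Qd r j / s))) = 0" by (rule vanZ)
    moreover have "hv (pt (\<lambda>j. Qd r j / s)) = vec 1 (\<lambda>j. of_real (Qd r j / s))"
     unfolding hv_vec[OF pt_Eucl] by (rule vec_cong) (simp add: \<eta>_pt)
    moreover have "Qd ?p = (\<lambda>j. of_real (Qd r j))" using Qd_of_real by blast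
    then have "(\<lambda>i. of_real s * vec 1 (\<lambda>j. of_real (Qd r j / s)) i) = vec (of_real s) (Qd ?p)"
     unfolding vec_scale[symmetric] using s0 by (simp add: Qd_of_real)
    ultimately have "f (vec (of_real s) (Qd ?p)) = 0"
     using forms_scale[OF f, of "of_real s" "vec 1 (\<lambda>j. of_real (Qd r j / s))"] by simp
    moreover have "(of_real s)\<^sup>2 = Kc ?p" unfolding Kk using s by (metis of_real_power)
    ultimately show ?thesis using AB(3) by metis
   qed
   have k1: "A ?p + of_real (sqrt k) * B ?p = 0" by (rule key) (use k0 in simp)
   have k2: "A ?p + of_real (- sqrt k) * B ?p = 0" by (rule key) (use k0 in simp)
   have "2 * A ?p = (A ?p + of_real (sqrt k) * B ?p) + (A ?p + of_real (- sqrt k) * B ?p)" by simp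
   then have "A ?p = 0" unfolding k1 k2 by simp
   moreover have "of_real (sqrt k) * B ?p = 0" using k1 \<open>A ?p = 0\<close> by simp
   ultimately show ?thesis using False by simp
  qed (simp add: Kk)
 qed
 have KA: "Kc p * A p = 0" "Kc p * B p = 0" for p
  using polyfuns_zero_on_reals[OF polyfuns_mult[OF Kc_polyfuns AB(1)]] polyfuns_zero_on_reals[OF polyfuns_mult[OF Kc_polyfuns AB(2)]] real0
  by simp_all
 define p0 :: "nat => complex" where "p0 j = (if j = 0 \<or> j = 2 then 1 else 0)" for j
 have "Kc p0 = of_real ((\<kappa> 0 + \<kappa> 2) / 4)" by (simp add: Kc_def sum4 Qd_def p0_def power2_eq_square)
 moreover have "(\<kappa> 0 + \<kappa> 2) / 4 \<noteq> 0" using \<kappa>_pos[of 0] \<kappa>_pos[of 2] by simp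
 ultimately have K0: "Kc p0 \<noteq> 0" by (metis of_real_eq_0_iff)
 have AB0: "A p = 0" "B p = 0" for p
  using polyfuns_no_zero_divisors[OF Kc_polyfuns AB(1) KA(1) K0] polyfuns_no_zero_divisors[OF Kc_polyfuns AB(2) KA(2) K0] by auto
 obtain p where "(x 0)\<^sup>2 = Kc p" "x = vec (x 0) (Qd p)" using onX_param[OF x] by blast
 then have "f x = A p + x 0 * B p" using AB(3) by metis
 then show ?thesis using AB0 by simp
qed

theorem moebius_model_eq: "moebius_model (stereo_image Z) = M"
proof -
 have ZE: "Z \<subseteq> Eucl 4" using Z_sphere by (auto simp: sphere3_iff)
 have sub: "embed ` (Z - {north_pole}) \<subseteq> proj_space 4" using embed_proj ZE by blast
 have "moebius_model (stereo_image Z) = proj_z.zc 4 (embed ` (Z - {north_pole}))"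
  unfolding moebius_model_def stereo_preimage_image[OF Z_sphere] by (rule proj_closure_zc[OF sub])
 also have "\<dots> = M"
 proof
  show "proj_z.zc 4 (embed ` (Z - {north_pole})) \<subseteq> M"
   by (rule proj_z.zc_least) (use M_closed embed_M ZE in \<open>auto simp: proj_closed_cl\<close>)
  show "M \<subseteq> proj_z.zc 4 (embed ` (Z - {north_pole}))"
  proof
   fix P assume P: "P \<in> M"
   then have PN: "P \<in> proj_space 4" by (simp add: M_def)
   obtain x where x: "x \<in> P" using proj_space_ne[OF PN] by blast
   note xP = proj_spaceE[OF PN x]
   have "onX x" using P x by (simp add: M_def)
   have "t P" if t: "t \<in> proj_tests" "\<forall>a\<in>embed ` (Z - {north_pole}). t a" for t
   proof -
    obtain f d where f: "f \<in> forms d" "\<And>x. t (proj_point x) \<longleftrightarrow> f x = 0" using proj_test_form[OF t(1)] by blast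
    have "f x = 0"
    proof (rule dense[OF f(1) _ \<open>onX x\<close>])
     show "f (hv y) = 0" if "y \<in> Z" "y \<noteq> north_pole" for y
      using t(2) that f(2)[of "hv y"] by (auto simp: embed_hv)
    qed (use xP in blast)
    then show ?thesis using f(2)[of x] xP by simp
   qed
   then show "P \<in> proj_z.zc 4 (embed ` (Z - {north_pole}))" unfolding proj_z.zc_def using PN by (intro CollectI conjI ballI impI)
  qed
 qed
 finally show ?thesis .
qed

lemma M_irreducible: "irreducible_closed (proj_closed 4) M"
proof -
 have ZE: "Z \<subseteq> Eucl 4" using Z_sphere by (auto simp: sphere3_iff)
 have p: "(\<lambda>y::nat => real. 1 - y 3) \<in> polyfuns" by (intro polyfuns_diff polyfuns_const polyfuns_var)
 obtain y1 where y1: "y1 \<in> Z" "y1 3 \<noteq> 1" using exists_off_C0 by blast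
 have "{y\<in>Z. 1 - y 3 \<noteq> 0} = Z - {north_pole}" using not_pole Z_sphere by fastforce
 then have pr: "poly_prime (Z - {north_pole})" using poly_prime_open[OF Zprime p y1(1)] y1(2) by simp
 have sub: "embed ` (Z - {north_pole}) \<subseteq> proj_space 4" using embed_proj ZE by blast
 have "irreducible_closed (proj_z.cl 4) (proj_z.zc 4 (embed ` (Z - {north_pole})))"
  by (rule proj_z.prime_zc[OF sub embed_prime[OF pr]]) (use ZE in blast)
 moreover have "proj_z.zc 4 (embed ` (Z - {north_pole})) = M"
  using moebius_model_eq proj_closure_zc[OF sub] unfolding moebius_model_def stereo_preimage_image[OF Z_sphere] by simp
 ultimately show ?thesis by (simp add: proj_closed_cl)
qed

end

section \<open>Dimension of the complex model\<close>

lemma underdetermined_system_sets: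
 fixes A :: "'b => 'c => 'a::field"
 assumes "finite I" "finite J" "card J < card I"
 shows "\<exists>x. (\<exists>i\<in>I. x i \<noteq> 0) \<and> (\<forall>j\<in>J. (\<Sum>i\<in>I. A j i * x i) = 0)"
proof -
 obtain h where h: "bij_betw h {0..<card I} I" using ex_bij_betw_nat_finite[OF assms(1)] by blast
 obtain g where g: "bij_betw g {0..<card J} J" using ex_bij_betw_nat_finite[OF assms(2)] by blast
 obtain y where y: "\<exists>i<card I. y i \<noteq> 0" "\<forall>j<card J. (\<Sum>i<card I. A (g j) (h i) * y i) = 0"
  using underdetermined_system[OF assms(3), of "\<lambda>j i. A (g j) (h i)"] by blast
 define x where "x = (\<lambda>i. y (inv_into {0..<card I} h i))"
 have xh: "x (h i) = y i" if "i < card I" for i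
  using inv_into_f_f[OF bij_betw_imp_inj_on[OF h], of i] that by (simp add: x_def)
 have "\<exists>i\<in>I. x i \<noteq> 0"
 proof -
  obtain i where "i < card I" "y i \<noteq> 0" using y(1) by blast
  then show ?thesis using xh h by (intro bexI[of _ "h i"]) (auto simp: bij_betw_def)
 qed
 moreover have "(\<Sum>i\<in>I. A j i * x i) = 0" if j: "j \<in> J" for j
 proof -
  have "j \<in> g ` {0..<card J}" using g j by (simp add: bij_betw_def)
  then obtain j' where j': "j' < card J" "j = g j'" by auto
  have "(\<Sum>i\<in>I. A j i * x i) = (\<Sum>i\<in>{0..<card I}. A j (h i) * x (h i))"
   by (rule sum.reindex_bij_betw[OF h, symmetric])
  also have "\<dots> = (\<Sum>i<card I. A (g j') (h i) * y i)"
   by (rule sum.cong) (auto simp: xh j'(2))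
  finally show ?thesis using y(2) j'(1) by simp
 qed
 ultimately show ?thesis by blast
qed

definition ev :: "complex poly poly => complex => complex => complex" where
 "ev a \<sigma> \<tau> = poly (poly a [:\<sigma>:]) \<tau>"

lemma ev_add: "ev (a + b) \<sigma> \<tau> = ev a \<sigma> \<tau> + ev b \<sigma> \<tau>"
 by (simp add: ev_def)

lemma ev_mult: "ev (a * b) \<sigma> \<tau> = ev a \<sigma> \<tau> * ev b \<sigma> \<tau>"
 by (simp add: ev_def)

lemma ev_sum: "ev (\<Sum>i\<in>I. f i) \<sigma> \<tau> = (\<Sum>i\<in>I. ev (f i) \<sigma> \<tau>)"
 by (simp add: ev_def poly_sum)

lemma ev_smult: "ev (smult [:x:] a) \<sigma> \<tau> = x * ev a \<sigma> \<tau>"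
 by (simp add: ev_def)

text \<open>Affine parameters: the part of the quadric with \<open>XC 0 x - XC 2 x = 1\<close>.\<close>

definition pp :: "complex => complex => nat => complex" where
 "pp \<sigma> \<tau> j = (if j = 0 then 1 else if j = 1 then \<sigma> else if j = 2 then 1 else \<tau>)"

lemma polyfuns_pp:
 assumes "A \<in> polyfuns" shows "\<exists>a. \<forall>\<sigma> \<tau>. A (pp \<sigma> \<tau>) = ev a \<sigma> \<tau>"
 using assms
proof (induction A rule: polyfuns_induct)
 case (const c)
 show ?case by (rule exI[of _ "[:[:c:]:]"]) (simp add: ev_def)
next
 case (var i)
 consider "i = 0 \<or> i = 2" | "i = 1" | "i \<noteq> 0" "i \<noteq> 1" "i \<noteq> 2" by blast
 then show ?case
 proof cases
  case 1 then show ?thesis by (intro exI[of _ 1]) (auto simp: ev_def pp_def)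
 next
  case 2 then show ?thesis by (intro exI[of _ "[:0, 1:]"]) (auto simp: ev_def pp_def)
 next
  case 3 then show ?thesis by (intro exI[of _ "[:[:0, 1:]:]"]) (auto simp: ev_def pp_def)
 qed
next
 case (add f g) then show ?case by (metis ev_add)
next
 case (mult f g) then show ?case by (metis ev_mult)
qed

definition bid :: "nat => complex poly poly => bool" where
 "bid D a \<longleftrightarrow> degree a \<le> D \<and> (\<forall>i. degree (coeff a i) \<le> D)"

lemma bid_mono: "bid D a ==> D \<le> E ==> bid E a"
 unfolding bid_def by (meson order_trans)

lemma bid_add: "bid D a ==> bid D b ==> bid D (a + b)"
 unfolding bid_def by (simp add: degree_add_le)

lemma bid_mult: assumes "bid D a" "bid E b" shows "bid (D + E) (a * b)"
 unfolding bid_def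
proof (intro conjI allI)
 show "degree (a * b) \<le> D + E"
  using assms degree_mult_le[of a b] unfolding bid_def by linarith
 fix n
 show "degree (coeff (a * b) n) \<le> D + E" unfolding coeff_mult
 proof (rule degree_sum_le)
  fix i
  show "degree (coeff a i * coeff b (n - i)) \<le> D + E"
   using assms degree_mult_le[of "coeff a i" "coeff b (n - i)"] unfolding bid_def
   by (meson add_mono order_trans)
 qed simp
qed

lemma bid_ex: "\<exists>D. bid D a"
proof -
 define S where "S = (\<Sum>i\<le>degree a. degree (coeff a i))"
 have "degree (coeff a i) \<le> S" for i
 proof (cases "i \<le> degree a")
  case True then show ?thesis unfolding S_def by (intro member_le_sum) auto
 next
  case False then show ?thesis by (simp add: coeff_eq_0)
 qed
 then have "bid (degree a + S) a" unfolding bid_def by (auto intro: trans_le_add2)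
 then show ?thesis by blast
qed

lemma bid_coeff: "bid D a ==> i > D \<or> j > D ==> coeff (coeff a i) j = 0"
 unfolding bid_def by (metis coeff_0 coeff_eq_0 order.strict_trans1)

text \<open>If a homogeneous relation holds on \<open>W\<close> and \<open>f\<close> vanishes on \<open>V\<close> but not on \<open>W\<close>,
  then the lowest coefficient of the relation as a polynomial in \<open>f\<close> vanishes on \<open>V\<close>.\<close>

lemma peel:
 assumes W: "irreducible_closed (proj_closed N) W" and VW: "V \<subseteq> W"
  and f: "f \<in> forms m" "\<not> form_zero f W" "form_zero f V"
  and \<phi>: "\<And>a. a \<le> k ==> \<phi> a \<in> forms (D - a * m)" and km: "k * m \<le> D"
  and rel: "form_zero (\<lambda>x. \<Sum>a\<le>k. f x ^ a * \<phi> a x) W"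
  and a0: "a0 \<le> k" "\<And>a x. a < a0 ==> \<phi> a x = 0"
 shows "form_zero (\<phi> a0) V"
proof -
 have Wp: "proj_z.prime W" and WN: "W \<subseteq> proj_space N"
  using W proj_closed_sub by (auto simp: proj_irreducible_iff)
 define \<psi> where "\<psi> x = (\<Sum>a\<in>{a0<..k}. f x ^ (a - a0 - 1) * \<phi> a x)" for x
 define g where "g x = \<phi> a0 x + f x * \<psi> x" for x
 have eq: "(\<Sum>a\<le>k. f x ^ a * \<phi> a x) = f x ^ a0 * g x" for x
 proof -
  have "(\<Sum>a\<le>k. f x ^ a * \<phi> a x) = (\<Sum>a\<in>{a0..k}. f x ^ a * \<phi> a x)"
   using a0(2) by (intro sum.mono_neutral_right) auto
  also have "\<dots> = f x ^ a0 * \<phi> a0 x + (\<Sum>a\<in>{a0<..k}. f x ^ a * \<phi> a x)"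
   using a0(1) by (rule sum.head)
  also have "(\<Sum>a\<in>{a0<..k}. f x ^ a * \<phi> a x) = f x ^ a0 * (f x * \<psi> x)"
   unfolding \<psi>_def sum_distrib_left
  proof (rule sum.cong)
   fix a assume "a \<in> {a0<..k}"
   then have "a = a0 + 1 + (a - a0 - 1)" by auto
   then have "f x ^ a = f x ^ a0 * (f x * f x ^ (a - a0 - 1))" by (metis power_add power_one_right mult.assoc)
   then show "f x ^ a * \<phi> a x = f x ^ a0 * (f x * (f x ^ (a - a0 - 1) * \<phi> a x))" by (simp add: mult.assoc)
  qed simp
  finally show ?thesis by (simp add: g_def distrib_left)
 qed
 have gf: "g \<in> forms (D - a0 * m)"
 proof -
  have "(\<lambda>x. f x * (f x ^ (a - a0 - 1) * \<phi> a x)) \<in> forms (D - a0 * m)" if a: "a \<in> {a0<..k}" for a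
  proof (rule forms_mult'[OF f(1)])
   show "(\<lambda>x. f x ^ (a - a0 - 1) * \<phi> a x) \<in> forms ((a - a0 - 1) * m + (D - a * m))"
    by (rule forms_mult[OF forms_power[OF f(1)] \<phi>]) (use a in auto)
   have "a * m \<le> D" using a km by (meson greaterThanAtMost_iff le_trans mult_le_mono1)
   moreover have "a * m = a0 * m + m + (a - a0 - 1) * m"
    using a by (metis Suc_eq_plus1 Suc_leI add_mult_distrib diff_diff_left greaterThanAtMost_iff le_add_diff_inverse mult_1)
   ultimately show "m + ((a - a0 - 1) * m + (D - a * m)) = D - a0 * m" by linarith
  qed
  then have "(\<lambda>x. \<Sum>a\<in>{a0<..k}. f x * (f x ^ (a - a0 - 1) * \<phi> a x)) \<in> forms (D - a0 * m)" by (rule forms_sum)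
  then have "(\<lambda>x. f x * \<psi> x) \<in> forms (D - a0 * m)" by (simp add: \<psi>_def sum_distrib_left)
  from forms_add[OF \<phi>[OF a0(1)] this] show ?thesis by (simp add: g_def[abs_def])
 qed
 have "form_zero (\<lambda>x. f x ^ a0 * g x) W" using rel unfolding eq .
 moreover have "\<not> form_zero (\<lambda>x. f x ^ a0) W" using f(2) by (auto simp: form_zero_def)
 ultimately have "form_zero g W" by (rule proj_primeD[OF Wp WN forms_power[OF f(1)] gf])
 then show ?thesis using f(3) VW by (fastforce simp: form_zero_def g_def)
qed

context torus
begin

text \<open>\<open>a + x0 * b\<close> is the pullback of \<open>g\<close> to the affine chart of the double cover, as a polynomial in the
  two parameters.\<close>

definition R :: "((nat => complex) => complex) => complex poly poly => complex poly poly => bool" where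
 "R g a b \<longleftrightarrow> (\<forall>\<sigma> \<tau> x0. x0\<^sup>2 = Kc (pp \<sigma> \<tau>) --> g (vec x0 (Qd (pp \<sigma> \<tau>))) = ev a \<sigma> \<tau> + x0 * ev b \<sigma> \<tau>)"

lemma R_ex: assumes "g \<in> polyfuns" shows "\<exists>a b. R g a b"
proof -
 obtain A B where AB: "A \<in> polyfuns" "B \<in> polyfuns" "\<forall>p a. a\<^sup>2 = Kc p --> g (vec a (Qd p)) = A p + a * B p"
  using polyfuns_on_model[OF assms] by blast
 obtain a where "\<forall>\<sigma> \<tau>. A (pp \<sigma> \<tau>) = ev a \<sigma> \<tau>" using polyfuns_pp[OF AB(1)] by blast
 moreover obtain b where "\<forall>\<sigma> \<tau>. B (pp \<sigma> \<tau>) = ev b \<sigma> \<tau>" using polyfuns_pp[OF AB(2)] by blast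
 ultimately show ?thesis unfolding R_def using AB(3) by (intro exI[of _ a] exI[of _ b]) simp
qed

lemma R_mult:
 assumes kk: "\<And>\<sigma> \<tau>. Kc (pp \<sigma> \<tau>) = ev kk \<sigma> \<tau>" and "R g a b" "R g' a' b'"
 shows "R (\<lambda>x. g x * g' x) (a * a' + kk * (b * b')) (a * b' + b * a')"
 unfolding R_def
proof (intro allI impI)
 fix \<sigma> \<tau> x0 assume x0: "x0\<^sup>2 = Kc (pp \<sigma> \<tau>)"
 let ?x = "vec x0 (Qd (pp \<sigma> \<tau>))"
 have "g ?x * g' ?x = (ev a \<sigma> \<tau> + x0 * ev b \<sigma> \<tau>) * (ev a' \<sigma> \<tau> + x0 * ev b' \<sigma> \<tau>)"
  using assms(2,3) x0 by (simp add: R_def)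
 also have "\<dots> = (ev a \<sigma> \<tau> * ev a' \<sigma> \<tau> + x0\<^sup>2 * (ev b \<sigma> \<tau> * ev b' \<sigma> \<tau>)) + x0 * (ev a \<sigma> \<tau> * ev b' \<sigma> \<tau> + ev b \<sigma> \<tau> * ev a' \<sigma> \<tau>)"
  by (simp add: power2_eq_square algebra_simps)
 finally show "g ?x * g' ?x = ev (a * a' + kk * (b * b')) \<sigma> \<tau> + x0 * ev (a * b' + b * a') \<sigma> \<tau>"
  by (simp add: x0 kk ev_add ev_mult)
qed

definition bidrep :: "nat => ((nat => complex) => complex) => bool" where
 "bidrep n g \<longleftrightarrow> (\<exists>a b. R g a b \<and> bid n a \<and> bid n b)"

lemma bidrep_mono: "bidrep n g ==> n \<le> n' ==> bidrep n' g"
 unfolding bidrep_def using bid_mono by blast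

lemma bidrep_ex: "g \<in> polyfuns ==> \<exists>n. bidrep n g"
proof -
 assume "g \<in> polyfuns"
 then obtain a b where R: "R g a b" using R_ex by blast
 obtain D E where "bid D a" "bid E b" using bid_ex by blast
 then have "bid (D + E) a" "bid (D + E) b" using bid_mono by (metis le_add1, metis le_add2)
 then show ?thesis using R unfolding bidrep_def by blast
qed

lemma bidrep_1: "bidrep 0 (\<lambda>x. 1)"
 unfolding bidrep_def by (rule exI[of _ 1], rule exI[of _ 0]) (simp add: R_def ev_def bid_def)

lemma bidrep_mult_ex: "\<exists>d. \<forall>n n' g g'. bidrep n g --> bidrep n' g' --> bidrep (n + n' + d) (\<lambda>x. g x * g' x)"
proof -
 obtain kk where kk: "\<And>\<sigma> \<tau>. Kc (pp \<sigma> \<tau>) = ev kk \<sigma> \<tau>" using polyfuns_pp[OF Kc_polyfuns] by blast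
 obtain d where d: "bid d kk" using bid_ex by blast
 have "bidrep (n + n' + d) (\<lambda>x. g x * g' x)" if "bidrep n g" "bidrep n' g'" for n n' g g'
 proof -
  obtain a b where 1: "R g a b" "bid n a" "bid n b" using \<open>bidrep n g\<close> by (auto simp: bidrep_def)
  obtain a' b' where 2: "R g' a' b'" "bid n' a'" "bid n' b'" using \<open>bidrep n' g'\<close> by (auto simp: bidrep_def)
  have "bid (n + n' + d) (a * a' + kk * (b * b'))"
  proof (rule bid_add)
   show "bid (n + n' + d) (a * a')" by (rule bid_mono[OF bid_mult[OF 1(2) 2(2)]]) simp
   show "bid (n + n' + d) (kk * (b * b'))" by (rule bid_mono[OF bid_mult[OF d bid_mult[OF 1(3) 2(3)]]]) simp
  qed
  moreover have "bid (n + n' + d) (a * b' + b * a')"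
  proof (rule bid_add)
   show "bid (n + n' + d) (a * b')" by (rule bid_mono[OF bid_mult[OF 1(2) 2(3)]]) simp
   show "bid (n + n' + d) (b * a')" by (rule bid_mono[OF bid_mult[OF 1(3) 2(2)]]) simp
  qed
  ultimately show ?thesis unfolding bidrep_def using R_mult[OF kk 1(1) 2(1)] by blast
 qed
 then show ?thesis by blast
qed

text \<open>A count of dimensions: the \<open>(k + 1) ^ 3\<close> monomials of the relation have, in the chart, degrees linear in \<open>k\<close> in each
  of two parameters, so for large \<open>k\<close> there are fewer coefficients than monomials. The power of \<open>f0\<close> makes
  the relation homogeneous for forms \<open>f1\<close>, \<open>f2\<close>, \<open>f3\<close> of degrees \<open>m1\<close>, \<open>m2\<close>, \<open>m3\<close> and a linear form \<open>f0\<close>.\<close>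

lemma algebraic_relation:
 assumes f: "f1 \<in> polyfuns" "f2 \<in> polyfuns" "f3 \<in> polyfuns" "f0 \<in> polyfuns"
 shows "\<exists>k (z :: nat \<times> nat \<times> nat => complex). (\<exists>a\<le>k. \<exists>b\<le>k. \<exists>c\<le>k. z (a, b, c) \<noteq> 0) \<and>
  (\<forall>\<sigma> \<tau> x0. x0\<^sup>2 = Kc (pp \<sigma> \<tau>) --> (let x = vec x0 (Qd (pp \<sigma> \<tau>)) in
   (\<Sum>(a, b, c)\<in>{..k} \<times> {..k} \<times> {..k}. z (a, b, c) * (f3 x ^ a * f2 x ^ b * f1 x ^ c * f0 x ^ (k * (m1 + m2 + m3) - a * m3 - b * m2 - c * m1))) = 0))"
proof -
 obtain d where d: "\<And>n n' g g'. bidrep n g ==> bidrep n' g' ==> bidrep (n + n' + d) (\<lambda>x. g x * g' x)"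
  using bidrep_mult_ex by blast
 obtain n1 n2 n3 n0 where "bidrep n1 f1" "bidrep n2 f2" "bidrep n3 f3" "bidrep n0 f0" using bidrep_ex f by metis
 then have n: "bidrep (n1 + n2 + n3 + n0) f1" "bidrep (n1 + n2 + n3 + n0) f2" "bidrep (n1 + n2 + n3 + n0) f3" "bidrep (n1 + n2 + n3 + n0) f0"
  by (auto elim!: bidrep_mono)
 define E where "E = n1 + n2 + n3 + n0 + d"
 have pow: "bidrep ((i + j) * E) (\<lambda>x. g x * h x ^ j)" if "bidrep (i * E) g" "bidrep (n1 + n2 + n3 + n0) h" for i j g h
 proof (induction j)
  case 0 then show ?case using that(1) by simp
 next
  case (Suc j)
  have "bidrep ((i + j) * E + (n1 + n2 + n3 + n0) + d) (\<lambda>x. (g x * h x ^ j) * h x)" by (rule d[OF Suc that(2)])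
  then show ?case by (simp add: E_def algebra_simps)
 qed
 define m where "m = m1 + m2 + m3"
 define C where "C = (3 + m) * E"
 \<comment> \<open>With this k, twice the number of coefficients stays below the number of monomials.\<close>
 define k where "k = 2 * (C + 1)\<^sup>2"
 define e where "e a b c = k * m - a * m3 - b * m2 - c * m1" for a b c
 define mon where "mon = (\<lambda>(a, b, c) x. f3 x ^ a * f2 x ^ b * f1 x ^ c * f0 x ^ e a b c)"
 let ?I = "{..k} \<times> {..k} \<times> {..k}"
 have "bidrep (k * C) (mon t)" if "t \<in> ?I" for t
 proof -
  from that obtain a b c where t: "t = (a, b, c)" "a \<le> k" "b \<le> k" "c \<le> k" by auto
  have "bidrep ((((0 + a) + b) + c + e a b c) * E) (\<lambda>x. (((1 * f3 x ^ a) * f2 x ^ b) * f1 x ^ c) * f0 x ^ e a b c)"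
   by (intro pow n) (use bidrep_1 in simp)
  moreover have "((0 + a) + b) + c + e a b c \<le> k * (3 + m)" using t by (simp add: e_def algebra_simps)
  then have "(((0 + a) + b) + c + e a b c) * E \<le> k * C" unfolding C_def mult.assoc[symmetric] by (rule mult_le_mono1)
  ultimately show ?thesis unfolding t(1) mon_def using bidrep_mono by simp
 qed
 then have "\<forall>t\<in>?I. \<exists>a b. R (mon t) a b \<and> bid (k * C) a \<and> bid (k * C) b" by (simp add: bidrep_def)
 then obtain ca cb where cab: "\<And>t. t \<in> ?I ==> R (mon t) (ca t) (cb t)" "\<And>t. t \<in> ?I ==> bid (k * C) (ca t)" "\<And>t. t \<in> ?I ==> bid (k * C) (cb t)"
  by metis
 let ?J = "{..k * C} \<times> {..k * C} \<times> (UNIV :: bool set)"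
 have "card ?J < card ?I"
 proof -
  have "k * C + 1 \<le> (k + 1) * (C + 1)" by simp
  then have "(k * C + 1)\<^sup>2 \<le> ((k + 1) * (C + 1))\<^sup>2" by (rule power_mono) simp
  then have "2 * (k * C + 1)\<^sup>2 \<le> 2 * ((k + 1) * (C + 1))\<^sup>2" by simp
  also have "\<dots> = (k + 1)\<^sup>2 * (2 * (C + 1)\<^sup>2)" by (simp only: power_mult_distrib mult_ac)
  also have "\<dots> = (k + 1)\<^sup>2 * k" by (simp only: k_def)
  also have "\<dots> < (k + 1)\<^sup>2 * (k + 1)" by simp
  finally show ?thesis by (simp add: card_cartesian_product power2_eq_square algebra_simps)
 qed
 then obtain z where z: "\<exists>t\<in>?I. z t \<noteq> 0"
  "\<forall>j\<in>?J. (\<Sum>t\<in>?I. (case j of (i, j, fl) => coeff (coeff (if fl then ca t else cb t) i) j) * z t) = 0"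
  using underdetermined_system_sets[of ?I ?J "\<lambda>j t. case j of (i, j, fl) => coeff (coeff (if fl then ca t else cb t) i) j"]
  by (auto simp del: mem_Sigma_iff)
 have zero: "(\<Sum>t\<in>?I. smult [:z t:] (if fl then ca t else cb t)) = 0" for fl
 proof (intro poly_eqI)
  fix i j
  have "coeff (coeff (\<Sum>t\<in>?I. smult [:z t:] (if fl then ca t else cb t)) i) j =
   (\<Sum>t\<in>?I. coeff (coeff (if fl then ca t else cb t) i) j * z t)"
   by (simp add: coeff_sum mult.commute)
  also have "\<dots> = 0"
  proof (cases "i \<le> k * C \<and> j \<le> k * C")
   case True
   then have "(i, j, fl) \<in> ?J" by simp
   then show ?thesis using z(2)[rule_format, of "(i, j, fl)"] by simp
  next
   case False
   then have "i > k * C \<or> j > k * C" by linarith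
   then have "coeff (coeff (if fl then ca t else cb t) i) j = 0" if "t \<in> ?I" for t
    using bid_coeff[OF cab(2)[OF that]] bid_coeff[OF cab(3)[OF that]] by simp
   then show ?thesis by (intro sum.neutral) simp
  qed
  finally show "coeff (coeff (\<Sum>t\<in>?I. smult [:z t:] (if fl then ca t else cb t)) i) j = coeff (coeff 0 i) j" by simp
 qed
 have rel: "(\<Sum>t\<in>?I. z t * mon t (vec x0 (Qd (pp \<sigma> \<tau>)))) = 0" if x0: "x0\<^sup>2 = Kc (pp \<sigma> \<tau>)" for \<sigma> \<tau> x0
 proof -
  have "(\<Sum>t\<in>?I. z t * mon t (vec x0 (Qd (pp \<sigma> \<tau>)))) = (\<Sum>t\<in>?I. z t * (ev (ca t) \<sigma> \<tau> + x0 * ev (cb t) \<sigma> \<tau>))"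
  proof (rule sum.cong[OF refl])
   fix t assume "t \<in> ?I"
   from cab(1)[OF this] x0 show "z t * mon t (vec x0 (Qd (pp \<sigma> \<tau>))) = z t * (ev (ca t) \<sigma> \<tau> + x0 * ev (cb t) \<sigma> \<tau>)"
    by (simp add: R_def)
  qed
  also have "\<dots> = ev (\<Sum>t\<in>?I. smult [:z t:] (ca t)) \<sigma> \<tau> + x0 * ev (\<Sum>t\<in>?I. smult [:z t:] (cb t)) \<sigma> \<tau>"
   unfolding ev_sum ev_smult sum_distrib_left by (simp add: sum.distrib[symmetric] algebra_simps)
  also have "\<dots> = 0" using zero[of True] zero[of False] by (simp add: ev_def)
  finally show ?thesis .
 qed
 have "\<exists>a\<le>k. \<exists>b\<le>k. \<exists>c\<le>k. z (a, b, c) \<noteq> 0" using z(1) by auto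
 moreover have "(\<Sum>(a, b, c)\<in>?I. z (a, b, c) * (f3 x ^ a * f2 x ^ b * f1 x ^ c * f0 x ^ (k * (m1 + m2 + m3) - a * m3 - b * m2 - c * m1))) = (\<Sum>t\<in>?I. z t * mon t x)" for x
  by (rule sum.cong) (auto simp: mon_def e_def m_def)
 ultimately show ?thesis unfolding Let_def using rel by (intro exI[of _ k] exI[of _ z]) simp
qed

lemma chart:
 assumes "onX x" "\<And>i. i > 4 ==> x i = 0" "XC 0 x - XC 2 x = 1"
 shows "\<exists>\<sigma> \<tau>. (x 0)\<^sup>2 = Kc (pp \<sigma> \<tau>) \<and> x = vec (x 0) (Qd (pp \<sigma> \<tau>))"
proof -
 define \<sigma> where "\<sigma> = XC 3 x + XC 1 x"
 define \<tau> where "\<tau> = XC 3 x - XC 1 x"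
 have e: "(XC 0 x)\<^sup>2 + (XC 1 x)\<^sup>2 = (XC 2 x)\<^sup>2 + (XC 3 x)\<^sup>2" using assms(1) by (simp add: onX_def)
 have x0: "XC 0 x = 1 + XC 2 x" using assms(3) by (simp add: algebra_simps)
 have "\<sigma> * \<tau> = (XC 3 x)\<^sup>2 - (XC 1 x)\<^sup>2" by (simp add: \<sigma>_def \<tau>_def power2_eq_square algebra_simps)
 also have "\<dots> = (XC 0 x)\<^sup>2 - (XC 2 x)\<^sup>2" using e by (simp add: algebra_simps)
 also have "\<dots> = 1 + 2 * XC 2 x" unfolding x0 by (simp add: power2_eq_square algebra_simps)
 finally have st: "\<sigma> * \<tau> = 1 + 2 * XC 2 x" .
 have q: "\<forall>j<4. Qd (pp \<sigma> \<tau>) j = XC j x"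
 proof (intro allI impI)
  fix j :: nat assume "j < 4"
  then consider "j = 0" | "j = 1" | "j = 2" | "j = 3" by linarith
  then show "Qd (pp \<sigma> \<tau>) j = XC j x"
  proof cases
   case 1 then show ?thesis by (simp add: Qd_def pp_def st x0)
  next
   case 2 then show ?thesis by (simp add: Qd_def pp_def \<sigma>_def \<tau>_def)
  next
   case 3 then show ?thesis by (simp add: Qd_def pp_def st)
  next
   case 4 then show ?thesis by (simp add: Qd_def pp_def \<sigma>_def \<tau>_def)
  qed
 qed
 have "x = vec (x 0) (Qd (pp \<sigma> \<tau>))" using vec_XC[of x] assms(2) vec_cong[of "Qd (pp \<sigma> \<tau>)" "\<lambda>j. XC j x"] q by simp
 moreover have "(x 0)\<^sup>2 = Kc (pp \<sigma> \<tau>)" using assms(1) q by (simp add: onX_def Kc_def)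
 ultimately show ?thesis by blast
qed

lemma chart_zero:
 assumes f: "f \<in> forms d" and van: "\<And>\<sigma> \<tau> x0. x0\<^sup>2 = Kc (pp \<sigma> \<tau>) ==> f (vec x0 (Qd (pp \<sigma> \<tau>))) = 0"
 shows "form_zero f M"
proof (rule proj_primeD)
 show "proj_z.prime M" "M \<subseteq> proj_space 4" using M_irreducible by (auto simp: proj_irreducible_iff M_def)
 show "(\<lambda>x. XC 0 x - XC 2 x) \<in> forms (Suc 0)" by (intro forms_diff XC_form)
 show "f \<in> forms d" by (rule f)
 show "form_zero (\<lambda>x. (XC 0 x - XC 2 x) * f x) M" unfolding form_zero_def
 proof (intro ballI)
  fix P x assume P: "P \<in> M" "x \<in> P"
  have PN: "P \<in> proj_space 4" using P(1) by (simp add: M_def)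
  have xX: "onX x" using P by (simp add: M_def)
  define t where "t = XC 0 x - XC 2 x"
  show "(XC 0 x - XC 2 x) * f x = 0"
  proof (cases "t = 0")
   case False
   define x' where "x' = (\<lambda>i. (1 / t) * x i)"
   have "onX x'" unfolding x'_def by (rule onX_scale[OF xX])
   moreover have "x' i = 0" if "i > 4" for i using proj_spaceE[OF PN P(2)] that by (simp add: x'_def)
   moreover have "XC 0 x' - XC 2 x' = (1 / t) * t" unfolding x'_def XC_scale t_def by (simp only: right_diff_distrib)
   then have "XC 0 x' - XC 2 x' = 1" using False by simp
   ultimately obtain \<sigma> \<tau> where "(x' 0)\<^sup>2 = Kc (pp \<sigma> \<tau>)" "x' = vec (x' 0) (Qd (pp \<sigma> \<tau>))" using chart[of x'] by blast
   then have "f x' = 0" using van by metis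
   moreover have "f x' = (1 / t) ^ d * f x" unfolding x'_def by (rule forms_scale[OF f])
   ultimately show ?thesis using False by simp
  qed (simp add: t_def)
 qed
 obtain y where y: "y \<in> Z" "\<eta> 0 y \<noteq> \<eta> 2 y" using exists_off_C0 by blast
 have yE: "y \<in> Eucl 4" using y(1) Z_sphere by (auto simp: sphere3_iff)
 have "embed y \<in> M" using embed_M[OF yE] y(1) by simp
 moreover have "hv y \<in> embed y" unfolding embed_hv by (rule proj_point_self)
 moreover have "XC 0 (hv y) - XC 2 (hv y) \<noteq> 0" using y(2) by (simp add: XC_hv)
 ultimately show "\<not> form_zero (\<lambda>x. XC 0 x - XC 2 x) M" unfolding form_zero_def by blast
qed

lemma triple_sum:
 "(\<Sum>(a, b, c)\<in>{..k} \<times> {..k} \<times> {..k}. F a b c) = (\<Sum>a\<le>k. \<Sum>b\<le>k. \<Sum>c\<le>(k::nat). (F a b c :: complex))"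
 by (simp add: sum.cartesian_product)

text \<open>Suppose \<open>F 0 \<subset> F 1 \<subset> F 2 \<subset> F 3\<close> is a chain in \<open>M\<close>, and let \<open>f1\<close>, \<open>f2\<close>, \<open>f3\<close> be forms that separate its members.
  Descending the chain, an algebraic relation between them loses the variables \<open>f3\<close>, \<open>f2\<close>, \<open>f1\<close> one by
  one (\<open>peel\<close>), until a nonzero multiple of a power of \<open>f0\<close> vanishes on \<open>F 0\<close>; but \<open>f0\<close> is a coordinate that does
  not vanish at some point of \<open>F 0\<close>.\<close>

lemma proj_dim_le: "krull_dim (proj_closed 4) M \<le> enat 2"
proof (rule krull_dim_le)
 fix F :: "nat => pt set"
 assume F: "\<And>i. i \<le> Suc 2 ==> irreducible_closed (proj_closed 4) (F i)"
  "\<And>i. i \<le> Suc 2 ==> F i \<subseteq> M" "\<And>i. i < Suc 2 ==> F i \<subset> F (Suc i)"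
 have Fcl: "proj_closed 4 (F i)" if "i \<le> 3" for i using F(1)[of i] that by (simp add: proj_irreducible_iff)
 have FN: "F i \<subseteq> proj_space 4" if "i \<le> 3" for i using proj_closed_sub[OF Fcl[OF that]] .
 have sep: "\<exists>f d. f \<in> forms d \<and> form_zero f (F i) \<and> \<not> form_zero f (F (Suc i))" if "i < 3" for i
 proof -
  have "F i \<subset> F (Suc i)" using F(3)[of i] that by simp
  then obtain P where P: "P \<in> F (Suc i)" "P \<notin> F i" by blast
  have PN: "P \<in> proj_space 4" using P(1) FN[of "Suc i"] that by auto
  have i3: "i \<le> 3" using that by simp
  obtain f d where f: "f \<in> forms d" "form_zero f (F i)" "\<And>x. x \<in> P ==> f x \<noteq> 0"
   using proj_closed_separate[OF Fcl[OF i3] PN P(2)] by blast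
  then show ?thesis using P(1) proj_space_ne[OF PN] unfolding form_zero_def by blast
 qed
 obtain f1 m1 where f1: "f1 \<in> forms m1" "form_zero f1 (F 0)" "\<not> form_zero f1 (F 1)" using sep[of 0] by auto
 obtain f2 m2 where f2: "f2 \<in> forms m2" "form_zero f2 (F 1)" "\<not> form_zero f2 (F 2)" using sep[of 1] by (auto simp: numeral_2_eq_2)
 obtain f3 m3 where f3: "f3 \<in> forms m3" "form_zero f3 (F 2)" "\<not> form_zero f3 (F 3)" using sep[of 2] by (auto simp: numeral_3_eq_3)
 have "F 0 \<noteq> {}" using F(1)[of 0] by (simp add: irreducible_closed_def)
 then obtain P0 where P0: "P0 \<in> F 0" by blast
 then have P0N: "P0 \<in> proj_space 4" using FN[of 0] by auto
 obtain x0 where x0: "x0 \<in> P0" using proj_space_ne[OF P0N] by blast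
 obtain j where j: "x0 j \<noteq> 0" using proj_spaceE[OF P0N x0] by (auto simp: fun_eq_iff)
 define f0 where "f0 x = x j" for x :: "nat => complex"
 have f0: "f0 \<in> forms (Suc 0)" unfolding f0_def[abs_def] by (rule forms_var)
 define m where "m = m1 + m2 + m3"
 obtain k and z :: "nat \<times> nat \<times> nat => complex" where kz: "\<exists>a\<le>k. \<exists>b\<le>k. \<exists>c\<le>k. z (a, b, c) \<noteq> 0"
  "\<forall>\<sigma> \<tau> x0. x0\<^sup>2 = Kc (pp \<sigma> \<tau>) --> (let x = vec x0 (Qd (pp \<sigma> \<tau>)) in
   (\<Sum>(a, b, c)\<in>{..k} \<times> {..k} \<times> {..k}. z (a, b, c) * (f3 x ^ a * f2 x ^ b * f1 x ^ c * f0 x ^ (k * m - a * m3 - b * m2 - c * m1))) = 0)"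
  using algebraic_relation[OF forms_polyfuns[OF f1(1)] forms_polyfuns[OF f2(1)] forms_polyfuns[OF f3(1)] forms_polyfuns[OF f0], of m1 m2 m3]
  unfolding m_def by blast
 define e where "e a b c = k * m - a * m3 - b * m2 - c * m1" for a b c
 define \<phi>3 where "\<phi>3 a b c x = z (a, b, c) * f0 x ^ e a b c" for a b c x
 define \<phi>2 where "\<phi>2 a b x = (\<Sum>c\<le>k. f1 x ^ c * \<phi>3 a b c x)" for a b x
 define \<phi>1 where "\<phi>1 a x = (\<Sum>b\<le>k. f2 x ^ b * \<phi>2 a b x)" for a x
 have bound: "a * m3 + b * m2 + c * m1 \<le> k * m" if "a \<le> k" "b \<le> k" "c \<le> k" for a b c
 proof -
  have "a * m3 + b * m2 + c * m1 \<le> k * m3 + k * m2 + k * m1" using that by (intro add_mono mult_le_mono1)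
  also have "\<dots> = k * m" by (simp add: m_def algebra_simps)
  finally show ?thesis .
 qed
 have form3: "\<phi>3 a b c \<in> forms ((k * m - a * m3) - b * m2 - c * m1)" for a b c
  unfolding \<phi>3_def[abs_def] e_def by (intro forms_cmult forms_power'[OF f0]) simp
 have form2: "\<phi>2 a b \<in> forms ((k * m - a * m3) - b * m2)" if "a \<le> k" "b \<le> k" for a b
  unfolding \<phi>2_def[abs_def]
 proof (rule forms_sum)
  fix c assume "c \<in> {..k}"
  then show "(\<lambda>x. f1 x ^ c * \<phi>3 a b c x) \<in> forms ((k * m - a * m3) - b * m2)"
   by (intro forms_mult'[OF forms_power[OF f1(1)] form3]) (use bound[OF that, of c] in auto)
 qed
 have form1: "\<phi>1 a \<in> forms (k * m - a * m3)" if "a \<le> k" for a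
  unfolding \<phi>1_def[abs_def]
 proof (rule forms_sum)
  fix b assume "b \<in> {..k}"
  then show "(\<lambda>x. f2 x ^ b * \<phi>2 a b x) \<in> forms (k * m - a * m3)"
   by (intro forms_mult'[OF forms_power[OF f2(1)] form2]) (use that bound[OF that, of b 0] in auto)
 qed
 have form0: "(\<lambda>x. \<Sum>a\<le>k. f3 x ^ a * \<phi>1 a x) \<in> forms (k * m)"
 proof (rule forms_sum)
  fix a assume "a \<in> {..k}"
  then show "(\<lambda>x. f3 x ^ a * \<phi>1 a x) \<in> forms (k * m)"
   by (intro forms_mult'[OF forms_power[OF f3(1)] form1]) (use bound[of a 0 0] in auto)
 qed
 have nested: "(\<Sum>(a, b, c)\<in>{..k} \<times> {..k} \<times> {..k}. z (a, b, c) * (f3 x ^ a * f2 x ^ b * f1 x ^ c * f0 x ^ (k * m - a * m3 - b * m2 - c * m1)))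
  = (\<Sum>a\<le>k. f3 x ^ a * \<phi>1 a x)" for x
  unfolding triple_sum \<phi>1_def \<phi>2_def \<phi>3_def e_def sum_distrib_left
  by (intro sum.cong refl) (simp add: mult_ac)
 have "form_zero (\<lambda>x. \<Sum>a\<le>k. f3 x ^ a * \<phi>1 a x) M"
  by (rule chart_zero[OF form0]) (use kz(2) in \<open>unfold Let_def nested, blast\<close>)
 then have rel: "form_zero (\<lambda>x. \<Sum>a\<le>k. f3 x ^ a * \<phi>1 a x) (F 3)" using F(2)[of 3] by (auto simp: form_zero_def)
 define PA where "PA a \<longleftrightarrow> a \<le> k \<and> (\<exists>b\<le>k. \<exists>c\<le>k. z (a, b, c) \<noteq> 0)" for a
 define a0 where "a0 = (LEAST a. PA a)"
 have "\<exists>a. PA a" using kz(1) by (auto simp: PA_def)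
 then have a0: "PA a0" unfolding a0_def by (rule LeastI_ex)
 have a0l: "\<not> PA a" if "a < a0" for a using not_less_Least that unfolding a0_def by blast
 define PB where "PB b \<longleftrightarrow> b \<le> k \<and> (\<exists>c\<le>k. z (a0, b, c) \<noteq> 0)" for b
 define b0 where "b0 = (LEAST b. PB b)"
 have "\<exists>b. PB b" using a0 by (auto simp: PA_def PB_def)
 then have b0: "PB b0" unfolding b0_def by (rule LeastI_ex)
 have b0l: "\<not> PB b" if "b < b0" for b using not_less_Least that unfolding b0_def by blast
 define PC where "PC c \<longleftrightarrow> c \<le> k \<and> z (a0, b0, c) \<noteq> 0" for c
 define c0 where "c0 = (LEAST c. PC c)"
 have "\<exists>c. PC c" using b0 by (auto simp: PB_def PC_def)
 then have c0: "PC c0" unfolding c0_def by (rule LeastI_ex)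
 have c0l: "\<not> PC c" if "c < c0" for c using not_less_Least that unfolding c0_def by blast
 have ks: "a0 \<le> k" "b0 \<le> k" "c0 \<le> k" using a0 b0 c0 by (auto simp: PA_def PB_def PC_def)
 have sub: "F 2 \<subseteq> F 3" "F 1 \<subseteq> F 2" "F 0 \<subseteq> F 1"
  using F(3)[of 2] F(3)[of 1] F(3)[of 0] by (auto simp: numeral_2_eq_2 numeral_3_eq_3)
 have "form_zero (\<phi>1 a0) (F 2)"
 proof (rule peel[OF F(1)[of 3] sub(1) f3(1,3,2) form1 _ rel ks(1)])
  show "\<phi>1 a x = 0" if "a < a0" for a x
   using a0l[OF that] that ks(1) by (auto simp: PA_def \<phi>1_def \<phi>2_def \<phi>3_def)
  show "k * m3 \<le> k * m" by (simp add: m_def)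
 qed simp_all
 then have rel1: "form_zero (\<lambda>x. \<Sum>b\<le>k. f2 x ^ b * \<phi>2 a0 b x) (F 2)" by (simp add: \<phi>1_def[abs_def])
 have "form_zero (\<phi>2 a0 b0) (F 1)"
 proof (rule peel[OF F(1)[of 2] sub(2) f2(1,3,2) form2[OF ks(1)] _ rel1 ks(2)])
  show "\<phi>2 a0 b x = 0" if "b < b0" for b x
   using b0l[OF that] that ks(2) by (auto simp: PB_def \<phi>2_def \<phi>3_def)
  show "k * m2 \<le> k * m - a0 * m3" using bound[OF ks(1), of k 0] by simp
 qed simp_all
 then have rel2: "form_zero (\<lambda>x. \<Sum>c\<le>k. f1 x ^ c * \<phi>3 a0 b0 c x) (F 1)" by (simp add: \<phi>2_def[abs_def])
 have "form_zero (\<phi>3 a0 b0 c0) (F 0)"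
 proof (rule peel[OF F(1)[of 1] sub(3) f1(1,3,2) form3 _ rel2 ks(3)])
  show "\<phi>3 a0 b0 c x = 0" if "c < c0" for c x
   using c0l[OF that] that ks(3) by (auto simp: PC_def \<phi>3_def)
  show "k * m1 \<le> k * m - a0 * m3 - b0 * m2" using bound[OF ks(1,2), of k] by simp
 qed simp_all
 then have "\<phi>3 a0 b0 c0 x0 = 0" using P0 x0 by (auto simp: form_zero_def)
 then show False using c0 j by (simp add: \<phi>3_def PC_def f0_def)
qed

theorem proj_dim_M: "proj_dim 4 M = 2"
proof -
 have C0E: "C0 \<subseteq> Eucl 4" using great_circle_sphere[OF C0_great] by auto
 have sub: "embed ` C0 \<subseteq> proj_space 4" using embed_proj C0E by blast
 have C0p: "poly_prime C0" using great_circle_irreducible[OF C0_great] by (auto simp: real_irreducible_iff)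
 define V where "V = proj_z.zc 4 (embed ` C0)"
 have irrV: "irreducible_closed (proj_closed 4) V" unfolding V_def proj_closed_cl
  by (rule proj_z.prime_zc[OF sub embed_prime[OF C0p C0E]])
 have CV: "embed ` C0 \<subseteq> V" unfolding V_def by (rule proj_z.zc_superset[OF sub])
 have VM: "V \<subseteq> M" unfolding V_def
  by (rule proj_z.zc_least) (use M_closed embed_M C0E C0_Z in \<open>auto simp: proj_closed_cl\<close>)
 have "\<not> C0 \<subseteq> {}" using great_circle_infinite[OF C0_great] by auto
 then obtain y0 where y0: "y0 \<in> C0" by blast
 have "\<not> C0 \<subseteq> {y0}" using great_circle_infinite[OF C0_great] finite_subset by blast
 then obtain y2 where y2: "y2 \<in> C0" "y2 \<noteq> y0" by blast
 have ne1: "embed y2 \<noteq> embed y0"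
 proof
  assume "embed y2 = embed y0"
  then have "hv y2 \<in> proj_point (hv y0)" using proj_point_self[of "hv y2"] by (simp add: embed_hv)
  then obtain d where d: "hv y2 = (\<lambda>i. d * hv y0 i)" by (auto simp: proj_point_def)
  have "d = 1" using fun_cong[OF d, of 0] by simp
  then have "complex_of_real (y2 i) = of_real (y0 i)" for i using fun_cong[OF d, of "Suc i"] by simp
  then show False using y2(2) by auto
 qed
 obtain y1 where y1: "y1 \<in> Z" "\<eta> 0 y1 \<noteq> \<eta> 2 y1" using exists_off_C0 by blast
 have y1E: "y1 \<in> Eucl 4" using y1(1) Z_sphere by (auto simp: sphere3_iff)
 have y1M: "embed y1 \<in> M" using embed_M[OF y1E] y1(1) by simp
 have "(\<lambda>x. XC 0 x - XC 2 x) \<in> forms (Suc 0)" by (intro forms_diff XC_form)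
 from form_test[OF this] obtain t where t: "t \<in> proj_tests" "\<And>x. t (proj_point x) \<longleftrightarrow> XC 0 x - XC 2 x = 0" by blast
 have "embed y1 \<notin> V"
 proof
  assume "embed y1 \<in> V"
  then have "t (embed y1)" unfolding V_def
   by (rule proj_z.zcD[OF _ t(1)]) (auto simp: embed_hv t(2) XC_hv C0_coords)
  then show False using y1(2) by (simp add: embed_hv t(2) XC_hv)
 qed
 define F where "F i = (if i = 0 then {embed y0} else if i = 1 then V else M)" for i :: nat
 have "enat 2 \<le> krull_dim (proj_closed 4) M"
 proof (rule krull_dim_ge[where F = F])
  have "embed y0 \<in> proj_space 4" using embed_proj y0 C0E by blast
  then show "irreducible_closed (proj_closed 4) (F i)" for i
   using proj_point_closed irrV M_irreducible by (simp add: F_def)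
  show "F i \<subseteq> M" for i using CV VM y0 by (auto simp: F_def)
  show "F i \<subset> F (Suc i)" if "i < 2" for i
   using that CV VM y0 y2(1) ne1 y1M \<open>embed y1 \<notin> V\<close> by (auto simp: F_def less_2_cases_iff)
 qed
 then show ?thesis using proj_dim_le by (simp add: proj_dim_def numeral_eq_enat order_antisym)
qed

end

section \<open>Smoothness at real points\<close>

text \<open>By the chain rule, the derivative along a curve depends only on the velocity.\<close>

lemma polyfuns_curve:
 fixes f :: "('v => complex) => complex"
 assumes "f \<in> polyfuns"
 shows "\<exists>D. \<forall>\<gamma>. \<gamma> 0 = x \<and> (\<forall>i. ((\<lambda>t. \<gamma> t i) has_field_derivative v i) (at 0)) -->
  ((\<lambda>t. f (\<gamma> t)) has_field_derivative D) (at 0)"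
 using assms
proof (induction f rule: polyfuns_induct)
 case (const c) show ?case by (rule exI[of _ 0]) auto
next
 case (var i) show ?case by (rule exI[of _ "v i"]) auto
next
 case (add f g)
 obtain D where D: "\<forall>\<gamma>. \<gamma> 0 = x \<and> (\<forall>i. ((\<lambda>t. \<gamma> t i) has_field_derivative v i) (at 0)) -->
  ((\<lambda>t. f (\<gamma> t)) has_field_derivative D) (at 0)" using add.IH by blast
 obtain E where E: "\<forall>\<gamma>. \<gamma> 0 = x \<and> (\<forall>i. ((\<lambda>t. \<gamma> t i) has_field_derivative v i) (at 0)) -->
  ((\<lambda>t. g (\<gamma> t)) has_field_derivative E) (at 0)" using add.IH by blast
 show ?case
 proof (rule exI[of _ "D + E"], intro allI impI)
  fix \<gamma> assume *: "\<gamma> 0 = x \<and> (\<forall>i. ((\<lambda>t. \<gamma> t i) has_field_derivative v i) (at 0))"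
  show "((\<lambda>t. f (\<gamma> t) + g (\<gamma> t)) has_field_derivative D + E) (at 0)"
   by (rule DERIV_add[OF D[rule_format, OF *] E[rule_format, OF *]])
 qed
next
 case (mult f g)
 obtain D where D: "\<forall>\<gamma>. \<gamma> 0 = x \<and> (\<forall>i. ((\<lambda>t. \<gamma> t i) has_field_derivative v i) (at 0)) -->
  ((\<lambda>t. f (\<gamma> t)) has_field_derivative D) (at 0)" using mult.IH by blast
 obtain E where E: "\<forall>\<gamma>. \<gamma> 0 = x \<and> (\<forall>i. ((\<lambda>t. \<gamma> t i) has_field_derivative v i) (at 0)) -->
  ((\<lambda>t. g (\<gamma> t)) has_field_derivative E) (at 0)" using mult.IH by blast
 show ?case
 proof (rule exI[of _ "D * g x + E * f x"], intro allI impI)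
  fix \<gamma> assume *: "\<gamma> 0 = x \<and> (\<forall>i. ((\<lambda>t. \<gamma> t i) has_field_derivative v i) (at 0))"
  from DERIV_mult[OF D[rule_format, OF *] E[rule_format, OF *]] show "((\<lambda>t. f (\<gamma> t) * g (\<gamma> t)) has_field_derivative D * g x + E * f x) (at 0)"
   using * by simp
 qed
qed

lemma sum_fun: "(\<Sum>b\<in>B. F b) i = (\<Sum>b\<in>B. F b i)" for F :: "'b => 'c => 'a::comm_monoid_add"
 by (induction B rule: infinite_finite_induct) auto

context torus
begin

lemma M_form_zero:
 assumes f: "f \<in> forms d" "form_zero f M" and y: "onX y" "\<And>i. i > 4 ==> y i = 0"
 shows "f y = 0"
proof (cases "y = 0")
 case False
 then have "proj_point y \<in> M" using M_point y by blast
 then show ?thesis using f(2) proj_point_self unfolding form_zero_def by blast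
next
 case True
 obtain P where P: "P \<in> M" using M_irreducible by (auto simp: irreducible_closed_def)
 then obtain x where x: "x \<in> P" using proj_space_ne unfolding M_def by blast
 have "f (\<lambda>i. 0 * x i) = 0 ^ d * f x" by (rule forms_scale[OF f(1)])
 moreover have "f x = 0" using f(2) P x by (auto simp: form_zero_def)
 moreover have "y = (\<lambda>i. 0 * x i)" using True by (auto simp: fun_eq_iff)
 ultimately show ?thesis by simp
qed

text \<open>\<open>b1\<close> and \<open>b2\<close> are the polar forms of \<open>q1\<close> and \<open>q2\<close>.\<close>

definition b1 :: "(nat => complex) => (nat => complex) => complex" where
 "b1 x u = XC 0 x * XC 0 u + XC 1 x * XC 1 u - (XC 2 x * XC 2 u + XC 3 x * XC 3 u)"

definition b2 :: "(nat => complex) => (nat => complex) => complex" where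
 "b2 x u = x 0 * u 0 - (\<Sum>j<4. of_real (\<kappa> j) * (XC j x * XC j u))"

lemma XC_add: "XC j (\<lambda>i. x i + t * u i) = XC j x + t * XC j u"
 by (simp add: XC_def sum.distrib sum_distrib_left algebra_simps)

lemma q_line:
 "q1 (\<lambda>i. x i + t * u i) = q1 x + t * (2 * b1 x u) + t\<^sup>2 * q1 u"
 "q2 (\<lambda>i. x i + t * u i) = q2 x + t * (2 * b2 x u) + t\<^sup>2 * q2 u"
 unfolding q1_def q2_def b1_def b2_def XC_add sum4 by (simp_all add: power2_eq_square algebra_simps)

lemma tangent_subset:
 assumes u: "u \<in> cone_tangent_space 4 M x"
 shows "(\<forall>i>4. u i = 0) \<and> b1 x u = 0 \<and> b2 x u = 0"
proof (intro conjI)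
 show "\<forall>i>4. u i = 0" using u by (simp add: cone_tangent_space_def)
 have key: "b = 0" if f: "f \<in> forms 2" "form_zero f M" "\<And>t. f (\<lambda>i. x i + t * u i) = f x + t * (2 * b) + t\<^sup>2 * f u" for f b
 proof -
  obtain p where p: "f = (\<lambda>x. peval x p)" "homogeneous p" using f(1) by (metis formsE)
  have "\<forall>Q\<in>M. vanishes_at p Q" using f(2) unfolding form_zero_def vanishes_at_def p(1) .
  then have "((\<lambda>t. f (\<lambda>i. x i + t * u i)) has_field_derivative 0) (at 0)"
   using u p unfolding cone_tangent_space_def by blast
  moreover have "((\<lambda>t. f (\<lambda>i. x i + t * u i)) has_field_derivative 2 * b) (at 0)"
   unfolding f(3) by (auto intro!: derivative_eq_intros)
  ultimately have "0 = 2 * b" by (rule DERIV_unique)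
  then show ?thesis by simp
 qed
 have z: "form_zero q1 M" "form_zero q2 M" by (auto simp: form_zero_def M_def onX_q)
 show "b1 x u = 0" by (rule key[OF q_forms(1) z(1) q_line(1)])
 show "b2 x u = 0" by (rule key[OF q_forms(2) z(2) q_line(2)])
qed

text \<open>Given a velocity \<open>u\<close> that annihilates both gradients, the line \<open>x + t * u\<close> is corrected to second order to a
  curve in the cone over \<open>M\<close>: first by a multiple of the isotropic vector \<open>w\<close> to satisfy \<open>q1 = 0\<close>, then in the coordinate \<open>x 0\<close> by
  a square root to satisfy \<open>q2 = 0\<close>. All forms vanishing on \<open>M\<close> vanish along this curve
  for small \<open>t\<close>.\<close>

lemma tangent_superset:
 fixes w :: "nat => complex"
 assumes x: "onX x" "\<And>i. i > 4 ==> x i = 0" "x 0 \<noteq> 0"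
  and w: "(w 0)\<^sup>2 + (w 1)\<^sup>2 - ((w 2)\<^sup>2 + (w 3)\<^sup>2) = 0"
   "XC 0 x * w 0 + XC 1 x * w 1 - (XC 2 x * w 2 + XC 3 x * w 3) \<noteq> 0"
  and u: "\<And>i. i > 4 ==> u i = 0" "b1 x u = 0" "b2 x u = 0"
 shows "u \<in> cone_tangent_space 4 M x"
 unfolding cone_tangent_space_def
proof (intro CollectI conjI allI impI)
 show "u i = 0" if "i > 4" for i using u(1) that .
 fix p assume p: "homogeneous p \<and> (\<forall>Q\<in>M. vanishes_at p Q)"
 define f where "f = (\<lambda>x. peval x p)"
 obtain d where fd: "f \<in> forms d" using homogeneous_forms p unfolding f_def by blast
 have fz: "form_zero f M" using p unfolding form_zero_def vanishes_at_def f_def by blast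
 define \<beta> where "\<beta> t = (XC 0 x + t * XC 0 u) * w 0 + (XC 1 x + t * XC 1 u) * w 1
  - ((XC 2 x + t * XC 2 u) * w 2 + (XC 3 x + t * XC 3 u) * w 3)" for t
 \<comment> \<open>The correction solves q1 = 0 exactly, as w is isotropic.\<close>
 define h where "h t = - q1 u / (2 * \<beta> t)" for t
 define \<xi> where "\<xi> t j = XC j x + t * XC j u + t\<^sup>2 * h t * w j" for t and j :: nat
 define k where "k t = (\<Sum>j<4. of_real (\<kappa> j) * (\<xi> t j)\<^sup>2)" for t
 define a where "a t = x 0 * csqrt (k t / (x 0)\<^sup>2)" for t
 define \<gamma> where "\<gamma> t = vec (a t) (\<xi> t)" for t
 have \<beta>0: "\<beta> 0 \<noteq> 0" using w(2) by (simp add: \<beta>_def)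
 have \<xi>0: "\<xi> 0 j = XC j x" for j by (simp add: \<xi>_def)
 have k0: "k 0 = (x 0)\<^sup>2" using x(1) by (simp add: k_def \<xi>0 onX_def)
 have a0: "a 0 = x 0" using x(3) by (simp add: a_def k0)
 have "\<xi> 0 = (\<lambda>j. XC j x)" by (rule ext) (rule \<xi>0)
 then have \<gamma>0: "\<gamma> 0 = x" using vec_XC[of x] x(2) by (simp add: \<gamma>_def a0)
 have dh: "\<exists>D. (h has_field_derivative D) (at 0)"
 proof -
  have d\<beta>: "(\<beta> has_field_derivative (XC 0 u * w 0 + XC 1 u * w 1 - (XC 2 u * w 2 + XC 3 u * w 3))) (at 0)"
   unfolding \<beta>_def by (auto intro!: derivative_eq_intros)
  have "((\<lambda>t. - q1 u / (2 * \<beta> t)) has_field_derivative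
    (0 * (2 * \<beta> 0) - (- q1 u) * (2 * (XC 0 u * w 0 + XC 1 u * w 1 - (XC 2 u * w 2 + XC 3 u * w 3)))) / (2 * \<beta> 0 * (2 * \<beta> 0))) (at 0)"
   by (rule DERIV_divide[OF DERIV_const DERIV_cmult[OF d\<beta>]]) (use \<beta>0 in simp)
  then show ?thesis unfolding h_def by blast
 qed
 then obtain D where D: "(h has_field_derivative D) (at 0)" by blast
 have d\<xi>: "((\<lambda>t. \<xi> t j) has_field_derivative XC j u) (at 0)" for j
  unfolding \<xi>_def by (rule derivative_eq_intros D refl | simp)+
 have dk: "(k has_field_derivative 2 * x 0 * u 0) (at 0)"
 proof -
  have "(k has_field_derivative (\<Sum>j<4. of_real (\<kappa> j) * (2 * \<xi> 0 j * XC j u))) (at 0)"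
   unfolding k_def by (rule derivative_eq_intros d\<xi> refl | simp add: algebra_simps)+
  moreover have "(\<Sum>j<4. of_real (\<kappa> j) * (2 * \<xi> 0 j * XC j u)) = 2 * x 0 * u 0"
proof -
   have "(\<Sum>j<4. complex_of_real (\<kappa> j) * (2 * \<xi> 0 j * XC j u)) = 2 * (\<Sum>j<4. of_real (\<kappa> j) * (XC j x * XC j u))"
    by (simp add: \<xi>0 sum_distrib_left algebra_simps)
   then show ?thesis using u(3) by (simp add: b2_def)
  qed
  ultimately show ?thesis by simp
 qed
 have da: "(a has_field_derivative u 0) (at 0)"
 proof -
  have "((\<lambda>t. k t / (x 0)\<^sup>2) has_field_derivative 2 * x 0 * u 0 / (x 0)\<^sup>2) (at 0)"
   by (rule DERIV_cdivide[OF dk])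
  moreover have "(csqrt has_field_derivative inverse (2 * csqrt (k 0 / (x 0)\<^sup>2))) (at (k 0 / (x 0)\<^sup>2))"
   by (rule has_field_derivative_csqrt) (use x(3) in \<open>simp add: k0\<close>)
  ultimately have "((\<lambda>t. csqrt (k t / (x 0)\<^sup>2)) has_field_derivative inverse (2 * csqrt (k 0 / (x 0)\<^sup>2)) * (2 * x 0 * u 0 / (x 0)\<^sup>2)) (at 0)"
   by (rule DERIV_chain2[rotated])
  then have "(a has_field_derivative x 0 * (inverse (2 * csqrt (k 0 / (x 0)\<^sup>2)) * (2 * x 0 * u 0 / (x 0)\<^sup>2))) (at 0)"
   unfolding a_def by (rule DERIV_cmult)
  then show ?thesis using x(3) by (simp add: k0 power2_eq_square field_simps)
 qed
 have d\<gamma>: "((\<lambda>t. \<gamma> t i) has_field_derivative u i) (at 0)" for i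
 proof -
  have vv: "u i = vec (u 0) (\<lambda>j. XC j u) i" using vec_XC[of u] u(1) by simp
  show ?thesis
  proof (cases i)
   case 0 then show ?thesis using da by (simp add: \<gamma>_def)
  next
   case (Suc n)
   have "((\<lambda>t. \<Sum>j<4. \<xi> t j * of_real (c_v j n)) has_field_derivative (\<Sum>j<4. XC j u * of_real (c_v j n))) (at 0)" for c_v :: "nat => nat => real"
    by (rule derivative_eq_intros d\<xi> refl | simp)+
   then show ?thesis unfolding vv unfolding \<gamma>_def vec_def Suc by simp
  qed
 qed
 obtain E where E: "\<And>\<gamma>. \<gamma> 0 = x \<and> (\<forall>i. ((\<lambda>t. \<gamma> t i) has_field_derivative u i) (at 0)) ==>
  ((\<lambda>t. f (\<gamma> t)) has_field_derivative E) (at 0)"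
  using polyfuns_curve[OF forms_polyfuns[OF fd], of x u] by blast
 have "((\<lambda>t. f (\<gamma> t)) has_field_derivative E) (at 0)" by (rule E) (use \<gamma>0 d\<gamma> in blast)
 moreover have "((\<lambda>t. f (\<gamma> t)) has_field_derivative 0) (at 0)"
 proof -
  have "continuous (at 0) \<beta>" unfolding \<beta>_def by (intro continuous_intros)
  then have "eventually (\<lambda>t. \<beta> t \<noteq> 0) (at 0)"
   using \<beta>0 by (simp add: continuous_at tendsto_imp_eventually_ne isCont_def)
  moreover have "f (\<gamma> t) = 0" if "\<beta> t \<noteq> 0" for t
  proof (rule M_form_zero[OF fd fz])
   show "\<gamma> t i = 0" if "i > 4" for i unfolding \<gamma>_def using vec_supp that .
   have "q1 (\<gamma> t) = q1 x + t * (2 * b1 x u) + t\<^sup>2 * q1 u + 2 * (t\<^sup>2 * h t) * \<beta> t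
     + (t\<^sup>2 * h t)\<^sup>2 * ((w 0)\<^sup>2 + (w 1)\<^sup>2 - ((w 2)\<^sup>2 + (w 3)\<^sup>2))"
    unfolding q1_def b1_def \<gamma>_def \<beta>_def by (simp add: XC_vec \<xi>_def power2_eq_square algebra_simps)
   also have "\<dots> = 0" using x(1) u(2) w(1) that by (simp add: onX_q h_def)
   finally have q1: "q1 (\<gamma> t) = 0" .
   have "(a t)\<^sup>2 = k t" unfolding a_def using x(3) by (simp add: power_mult_distrib)
   then have "q2 (\<gamma> t) = 0" unfolding q2_def \<gamma>_def by (simp add: XC_vec k_def)
   then show "onX (\<gamma> t)" using q1 by (simp add: onX_q)
  qed
  ultimately have "eventually (\<lambda>t. f (\<gamma> t) = 0) (at 0)" by (rule eventually_mono)
  then have "eventually (\<lambda>t. f (\<gamma> t) = 0) (nhds 0)"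
   using fz M_form_zero[OF fd fz x(1,2)] \<gamma>0 by (simp add: eventually_nhds_conv_at)
  then have "((\<lambda>t. f (\<gamma> t)) has_field_derivative 0) (at 0) \<longleftrightarrow> ((\<lambda>t. 0) has_field_derivative 0) (at (0::complex))"
   by (intro DERIV_cong_ev) auto
  then show ?thesis by simp
 qed
 ultimately have "E = 0" by (rule DERIV_unique)
 moreover have "((\<lambda>t. f (\<lambda>i. x i + t * u i)) has_field_derivative E) (at 0)"
  by (rule E) (auto intro!: derivative_eq_intros)
 ultimately show "((\<lambda>t. peval (\<lambda>i. x i + t * u i) p) has_field_derivative 0) (at 0)" by (simp add: f_def)
qed

text \<open>One condition with \<open>N k \<noteq> 0\<close> eliminates \<open>XC k\<close>, the other one eliminates the coordinate \<open>0\<close>.\<close>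

lemma tangent_dim:
 assumes k: "k < 4" "N k \<noteq> 0" and x0: "x 0 \<noteq> 0"
 shows "vector_space.dim (\<lambda>c v i. c * v i) {v :: nat => complex. (\<forall>i>4. v i = 0) \<and> (\<Sum>j<4. N j * XC j v) = 0 \<and> b2 x v = 0} = 3"
  (is "vector_space.dim ?sc ?V = 3")
proof -
 interpret vs: vector_space ?sc by (rule vector_space_pointwise)
 define \<Phi> where "\<Phi> a = vec ((\<Sum>j<4. of_real (\<kappa> j) * (XC j x * a j)) / x 0) a" for a
 define b where "b j = \<Phi> (\<lambda>i. if i = j then 1 else if i = k then - N j / N k else 0)" for j
 define J where "J = {..<4} - {k}"
 have J: "finite J" "card J = 3" using k by (auto simp: J_def)
 have XCb: "XC i (b j) = (if i = j then 1 else if i = k then - N j / N k else 0)" if "i < 4" for i j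
  by (simp add: b_def \<Phi>_def XC_vec[OF that])
 have inj: "inj_on b J"
 proof (rule inj_onI)
  fix i j assume ij: "i \<in> J" "j \<in> J" "b i = b j"
  have "XC i (b i) = XC i (b j)" using ij(3) by simp
  then show "i = j" using XCb[of i i] XCb[of i j] ij(1) by (auto simp: J_def split: if_splits)
 qed
 have lin: "XC i (\<Sum>v\<in>S. ?sc (u v) v) = (\<Sum>v\<in>S. u v * XC i v)" for i S and u :: "(nat => complex) => complex"
 proof -
  have "XC i (\<Sum>v\<in>S. ?sc (u v) v) = (\<Sum>l<4. \<Sum>v\<in>S. of_real (c i l) * (u v * v (Suc l)))"
   by (simp add: XC_def sum_fun sum_distrib_left)
  also have "\<dots> = (\<Sum>v\<in>S. u v * XC i v)" by (subst sum.swap) (simp add: XC_def sum_distrib_left algebra_simps)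
  finally show ?thesis .
 qed
 show ?thesis
 proof (rule vs.dim_unique)
  show "b ` J \<subseteq> ?V"
  proof clarify
   fix j assume j: "j \<in> J"
   have "(\<Sum>i<4. N i * XC i (b j)) = (\<Sum>i<4. (if i = j then N j else 0) + (if i = k then - N j else 0))"
    using j k(2) by (intro sum.cong) (auto simp: XCb J_def)
   also have "\<dots> = 0" using j k(1) by (simp add: sum.distrib J_def)
   finally have 1: "(\<Sum>i<4. N i * XC i (b j)) = 0" .
   have "(\<Sum>i<4. of_real (\<kappa> i) * (XC i x * XC i (b j))) = (\<Sum>i<4. of_real (\<kappa> i) * (XC i x * (if i = j then 1 else if i = k then - N j / N k else 0)))"
    by (intro sum.cong) (auto simp: XCb)
   then have 2: "b2 x (b j) = 0" unfolding b2_def using x0 by (simp add: b_def \<Phi>_def)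
   show "(\<forall>i>4. b j i = 0) \<and> (\<Sum>i<4. N i * XC i (b j)) = 0 \<and> b2 x (b j) = 0"
    using 1 2 vec_supp by (simp add: b_def \<Phi>_def)
  qed
  show "?V \<subseteq> vs.span (b ` J)"
  proof
   fix v assume v: "v \<in> ?V"
   define s where "s = (\<Sum>j\<in>J. ?sc (XC j v) (b j))"
   have s_in: "s \<in> vs.span (b ` J)" unfolding s_def
    by (intro vs.span_sum vs.span_scale vs.span_base) auto
   have XCs: "XC i s = (\<Sum>j\<in>J. XC j v * XC i (b j))" for i
   proof -
    have "XC i s = (\<Sum>l<4. \<Sum>j\<in>J. of_real (c i l) * (XC j v * b j (Suc l)))"
     by (simp add: s_def XC_def[of i] sum_fun sum_distrib_left)
    also have "\<dots> = (\<Sum>j\<in>J. XC j v * XC i (b j))" by (subst sum.swap) (simp add: XC_def[of i] sum_distrib_left algebra_simps)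
    finally show ?thesis .
   qed
   have eq: "XC i s = XC i v" if i: "i < 4" for i
   proof (cases "i = k")
    case False
    have "XC i s = (\<Sum>j\<in>J. if i = j then XC j v else 0)"
     unfolding XCs using XCb[OF i] False by (intro sum.cong) auto
    also have "\<dots> = XC i v" using J(1) i False by (simp add: J_def)
    finally show ?thesis .
   next
    case True
    have "N k * XC k v + (\<Sum>j\<in>J. N j * XC j v) = 0"
     using v k(1) by (simp add: J_def sum.remove[of "{..<4}" k])
    then have "XC k v = - (\<Sum>j\<in>J. N j * XC j v) / N k" using k(2) by (simp add: field_simps add_eq_0_iff2)
    also have "\<dots> = (\<Sum>j\<in>J. XC j v * (- N j / N k))" by (simp add: sum_negf sum_divide_distrib mult.commute)
    also have "\<dots> = XC k s" unfolding XCs using XCb[OF k(1)] by (intro sum.cong) (auto simp: J_def)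
    finally show ?thesis using True by simp
   qed
   have b2b: "b2 x (b j) = 0" if "j \<in> J" for j
   proof -
    have "(\<Sum>i<4. of_real (\<kappa> i) * (XC i x * XC i (b j))) = (\<Sum>i<4. of_real (\<kappa> i) * (XC i x * (if i = j then 1 else if i = k then - N j / N k else 0)))"
     by (intro sum.cong) (auto simp: XCb)
    then show ?thesis unfolding b2_def using x0 by (simp add: b_def \<Phi>_def)
   qed
   have "x 0 * s 0 = (\<Sum>j\<in>J. XC j v * (x 0 * b j 0))" by (simp add: s_def sum_fun sum_distrib_left algebra_simps)
   also have "\<dots> = (\<Sum>j\<in>J. \<Sum>i<4. of_real (\<kappa> i) * (XC i x * (XC j v * XC i (b j))))"
    using b2b by (intro sum.cong) (auto simp: b2_def sum_distrib_left algebra_simps)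
   also have "\<dots> = (\<Sum>i<4. of_real (\<kappa> i) * (XC i x * XC i s))"
    by (subst sum.swap) (simp add: XCs sum_distrib_left)
   also have "\<dots> = (\<Sum>i<4. of_real (\<kappa> i) * (XC i x * XC i v))" using eq by (intro sum.cong) auto
   also have "\<dots> = x 0 * v 0" using v by (simp add: b2_def)
   finally have s0: "s 0 = v 0" using x0 by simp
   have supp: "s i = 0" if "i > 4" for i using vec_supp[OF that] by (simp add: s_def sum_fun b_def \<Phi>_def)
   have "s = vec (s 0) (\<lambda>j. XC j s)" using vec_XC[of s] supp by simp
   also have "\<dots> = vec (v 0) (\<lambda>j. XC j v)" unfolding s0 by (rule vec_cong[OF eq])
   also have "\<dots> = v" using vec_XC[of v] v by simp
   finally show "v \<in> vs.span (b ` J)" using s_in by simp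
  qed
  show "vs.independent (b ` J)"
  proof
   assume "vs.dependent (b ` J)"
   then obtain u where u: "\<exists>v\<in>b ` J. u v \<noteq> 0" "(\<Sum>v\<in>b ` J. ?sc (u v) v) = 0"
    using vs.dependent_finite[of "b ` J"] J(1) by blast
   obtain j where j: "j \<in> J" "u (b j) \<noteq> 0" using u(1) by blast
   then have j4: "j < 4" "j \<noteq> k" by (auto simp: J_def)
   have "0 = XC j (\<Sum>v\<in>b ` J. ?sc (u v) v)" unfolding u(2) by (simp add: XC_def)
   also have "\<dots> = (\<Sum>i\<in>J. u (b i) * XC j (b i))" unfolding lin by (rule sum.reindex[OF inj, unfolded comp_def])
   also have "\<dots> = (\<Sum>i\<in>J. if j = i then u (b i) else 0)" using XCb[OF j4(1)] j4 by (intro sum.cong) auto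
   also have "\<dots> = u (b j)" using J(1) j(1) by simp
   finally show False using j(2) by simp
  qed
  show "card (b ` J) = 3" using card_image[OF inj] J(2) by simp
 qed
qed

text \<open>At a real point \<open>x 0 \<noteq> 0\<close>, because the norm is definite. Changing the sign of the last two coordinates
  gives an isotropic vector whose \<open>b1\<close>-product with the point is a sum of squares.\<close>

theorem no_real_singularities: "without_real_singularities (stereo_image Z)"
 unfolding without_real_singularities_def moebius_model_eq
proof
 assume "\<exists>P. real_point P \<and> singular_point 4 M P"
 then obtain P r x where P: "P = proj_point (\<lambda>i. of_real (r i))" "P \<in> M" "x \<in> P"
  "enat (vector_space.dim (\<lambda>c v i. c * v i) (cone_tangent_space 4 M x)) \<noteq> eSuc (proj_dim 4 M)"
  unfolding real_point_def singular_point_def by blast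
 have PN: "P \<in> proj_space 4" using P(2) by (simp add: M_def)
 obtain s where s: "s \<noteq> 0" "x = (\<lambda>i. s * of_real (r i))" using P(1,3) by (auto simp: proj_point_def)
 have xX: "onX x" using P(2,3) by (simp add: M_def)
 have xs: "x i = 0" if "i > 4" for i using proj_spaceE[OF PN P(3)] that by blast
 have xn: "x \<noteq> 0" using proj_spaceE[OF PN P(3)] by blast
 define \<rho> where "\<rho> j = dot 4 (c j) (\<lambda>i. r (Suc i))" for j
 have XCx: "XC j x = s * of_real (\<rho> j)" for j
  by (simp add: s(2) XC_def \<rho>_def dot_def sum_distrib_left algebra_simps)
 have "onX (\<lambda>i. (1 / s) * x i)" by (rule onX_scale[OF xX])
 moreover have "(\<lambda>i. (1 / s) * x i) = (\<lambda>i. of_real (r i))" using s(1) by (simp add: s(2))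
 ultimately have "onX (\<lambda>i. of_real (r i))" by simp
 moreover have "XC j (\<lambda>i. of_real (r i)) = of_real (\<rho> j)" for j by (simp add: XC_def \<rho>_def dot_def)
 ultimately have "complex_of_real ((\<rho> 0)\<^sup>2 + (\<rho> 1)\<^sup>2) = of_real ((\<rho> 2)\<^sup>2 + (\<rho> 3)\<^sup>2)"
  "complex_of_real ((r 0)\<^sup>2) = of_real (\<Sum>j<4. \<kappa> j * (\<rho> j)\<^sup>2)" by (simp_all add: onX_def)
 then have q\<rho>: "(\<rho> 0)\<^sup>2 + (\<rho> 1)\<^sup>2 = (\<rho> 2)\<^sup>2 + (\<rho> 3)\<^sup>2" and k\<rho>: "(r 0)\<^sup>2 = (\<Sum>j<4. \<kappa> j * (\<rho> j)\<^sup>2)"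
  by (simp_all only: of_real_eq_iff)
 have some: "\<exists>j<4. \<rho> j \<noteq> 0"
 proof (rule ccontr)
  assume "\<not> ?thesis"
  then have z: "\<rho> j = 0" if "j < 4" for j using that by blast
  then have "r 0 = 0" using k\<rho> by simp
  then have "x 0 = 0" by (simp add: s(2))
  moreover have "x = vec (x 0) (\<lambda>j. XC j x)" using vec_XC[of x] xs by simp
  moreover have "vec (x 0) (\<lambda>j. XC j x) = vec (x 0) (\<lambda>j. 0)" by (rule vec_cong) (simp add: XCx z)
  ultimately have "x = vec 0 (\<lambda>j. 0)" by simp
  then have "x = 0" by (auto simp: vec_def fun_eq_iff split: nat.split)
  then show False using xn by simp
 qed
 have sumpos: "(\<rho> 0)\<^sup>2 + (\<rho> 1)\<^sup>2 + (\<rho> 2)\<^sup>2 + (\<rho> 3)\<^sup>2 > 0"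
 proof -
  obtain j where "j < 4" "\<rho> j \<noteq> 0" using some by blast
  then have "(\<Sum>j<4. (\<rho> j)\<^sup>2) > 0" by (intro sum_pos2[of _ j]) auto
  then show ?thesis by (simp only: sum4)
 qed
 have "r 0 \<noteq> 0"
 proof
  assume "r 0 = 0"
  then have "(\<Sum>j<4. \<kappa> j * (\<rho> j)\<^sup>2) = 0" using k\<rho> by simp
  then have "\<forall>j\<in>{..<4}. \<kappa> j * (\<rho> j)\<^sup>2 = 0"
   by (subst (asm) sum_nonneg_eq_0_iff) (auto intro!: mult_nonneg_nonneg less_imp_le[OF \<kappa>_pos])
  then have "\<rho> j = 0" if "j < 4" for j using \<kappa>_pos[OF that] that by force
  then show False using some by blast
 qed
 then have x0: "x 0 \<noteq> 0" using s by simp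
 define w :: "nat => complex" where "w j = (if j < 2 then of_real (\<rho> j) else - of_real (\<rho> j))" for j
 have w1: "(w 0)\<^sup>2 + (w 1)\<^sup>2 - ((w 2)\<^sup>2 + (w 3)\<^sup>2) = 0"
 proof -
  have "(w 0)\<^sup>2 + (w 1)\<^sup>2 - ((w 2)\<^sup>2 + (w 3)\<^sup>2) = of_real ((\<rho> 0)\<^sup>2 + (\<rho> 1)\<^sup>2 - ((\<rho> 2)\<^sup>2 + (\<rho> 3)\<^sup>2))" by (simp add: w_def)
  then show ?thesis by (simp only: q\<rho> diff_self of_real_0)
 qed
 have w2: "XC 0 x * w 0 + XC 1 x * w 1 - (XC 2 x * w 2 + XC 3 x * w 3) \<noteq> 0"
 proof -
  have "XC 0 x * w 0 + XC 1 x * w 1 - (XC 2 x * w 2 + XC 3 x * w 3) = s * of_real ((\<rho> 0)\<^sup>2 + (\<rho> 1)\<^sup>2 + (\<rho> 2)\<^sup>2 + (\<rho> 3)\<^sup>2)"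
   by (simp add: XCx w_def power2_eq_square algebra_simps)
  then show ?thesis using s(1) sumpos by (metis less_irrefl mult_eq_0_iff of_real_eq_0_iff)
 qed
 define N where "N j = (if j < 2 then XC j x else - XC j x)" for j
 have bN: "b1 x u = (\<Sum>j<4. N j * XC j u)" for u by (simp add: b1_def sum4 N_def)
 have "cone_tangent_space 4 M x = {v. (\<forall>i>4. v i = 0) \<and> (\<Sum>j<4. N j * XC j v) = 0 \<and> b2 x v = 0}"
  using tangent_subset[of _ x] tangent_superset[OF xX xs x0 w1 w2] unfolding bN by blast
 moreover obtain k where "k < 4" "\<rho> k \<noteq> 0" using some by blast
 moreover have "N k \<noteq> 0" using \<open>\<rho> k \<noteq> 0\<close> s(1) by (simp add: N_def XCx)
 ultimately have "vector_space.dim (\<lambda>c v i. c * v i) (cone_tangent_space 4 M x) = 3"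
  using tangent_dim[where x = x and N = N, OF _ _ x0] by simp
 then show False using P(4) by (simp add: proj_dim_M eSuc_numeral numeral_eq_enat eSuc_enat)
qed

end

section \<open>The degree\<close>

text \<open>Up to the factor 27, the discriminant of \<open>a x\<^sup>4 + b x\<^sup>3 + c x\<^sup>2 + d x + e\<close>, in terms of its classical
  invariants \<open>I\<close> and \<open>J\<close>.\<close>

definition quartic_disc :: "'a::comm_ring_1 => 'a => 'a => 'a => 'a => 'a" where
 "quartic_disc a b c d e =
  4 * (12 * a * e - 3 * b * d + c\<^sup>2) ^ 3 - (72 * a * c * e + 9 * b * c * d - 27 * a * d\<^sup>2 - 27 * e * b\<^sup>2 - 2 * c ^ 3)\<^sup>2"

text \<open>At a double root \<open>x\<close> let \<open>k = c + 3 b x + 6 a x\<^sup>2\<close>; then \<open>I = k\<^sup>2\<close> and \<open>J = - 2 k\<^sup>3\<close>.\<close>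

lemma quartic_disc_double_root:
 fixes x :: "'a::comm_ring_1"
 assumes "e + x * (d + x * (c + x * (b + x * a))) = 0" "d + x * (2 * c + x * (3 * b + x * (4 * a))) = 0"
 shows "quartic_disc a b c d e = 0"
proof -
 have d: "d = - (x * (2 * c + x * (3 * b + x * (4 * a))))" using assms(2) by (simp add: eq_neg_iff_add_eq_0)
 have "e = - (x * (d + x * (c + x * (b + x * a))))" using assms(1) by (simp add: eq_neg_iff_add_eq_0)
 then have e: "e = x * x * (c + x * (2 * b + x * (3 * a)))" unfolding d by (simp add: algebra_simps)
 define k where "k = c + 3 * b * x + 6 * a * x * x"
 have I: "12 * a * e - 3 * b * d + c\<^sup>2 = k\<^sup>2" unfolding d e k_def by (simp add: power2_eq_square algebra_simps)
 have J: "72 * a * c * e + 9 * b * c * d - 27 * a * d\<^sup>2 - 27 * e * b\<^sup>2 - 2 * c ^ 3 = - 2 * k ^ 3"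
  unfolding d e k_def by (simp add: power2_eq_square power3_eq_cube algebra_simps)
 show ?thesis unfolding quartic_disc_def I J by (simp add: power_mult_distrib flip: power_mult)
qed

lemma card_roots_quartic:
 fixes a :: complex
 assumes "a \<noteq> 0" "quartic_disc a b c d e \<noteq> 0"
 shows "finite {x. poly [:e, d, c, b, a:] x = 0} \<and> card {x. poly [:e, d, c, b, a:] x = 0} = 4"
proof -
 let ?p = "[:e, d, c, b, a:]"
 have deg: "degree ?p = 4" using assms(1) by simp
 have "rsquarefree ?p" unfolding rsquarefree_roots
 proof (intro allI notI)
  fix x assume "poly ?p x = 0 \<and> poly (pderiv ?p) x = 0"
  then have "e + x * (d + x * (c + x * (b + x * a))) = 0" "d + x * (2 * c + x * (3 * b + x * (4 * a))) = 0"
   by (simp_all add: pderiv_pCons algebra_simps)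
  then show False using quartic_disc_double_root assms(2) by blast
 qed
 then have dec: "smult (lead_coeff ?p) (\<Prod>z | poly ?p z = 0. [:- z, 1:]) = ?p"
  by (rule complex_poly_decompose_rsquarefree)
 have fin: "finite {x. poly ?p x = 0}" using deg by (intro poly_roots_finite) auto
 have "4 = degree (smult (lead_coeff ?p) (\<Prod>z | poly ?p z = 0. [:- z, 1:]))" using arg_cong[OF dec, of degree] deg by metis
 also have "\<dots> = degree (\<Prod>z | poly ?p z = 0. [:- z, 1:])" using assms(1) by (simp only: degree_smult_eq) simp
 also have "\<dots> = (\<Sum>z | poly ?p z = 0. degree [:- z, 1:])" by (rule degree_prod_eq_sum_degree) auto
 also have "\<dots> = card {x. poly ?p x = 0}" by simp
 finally show ?thesis using fin by simp
qed

context torus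
begin

definition LL :: "(nat \<times> nat => complex) => nat => nat => complex" where
 "LL a j k = (\<Sum>i<4. a (j, Suc i) * of_real (v k i))"

text \<open>Eliminating the coordinate \<open>x 0\<close> from the two linear equations leaves \<open>\<Sum> cc a k * XC k x = 0\<close>.\<close>

definition cc :: "(nat \<times> nat => complex) => nat => complex" where
 "cc a k = a (0, 0) * LL a 1 k - a (1, 0) * LL a 0 k"

definition "d1 a = cc a 0 - cc a 2"
definition "d2 a = cc a 3 - cc a 1"
definition "d3 a = cc a 1 + cc a 3"
definition "d4 a = cc a 0 + cc a 2"
definition "dd a = d1 a * d4 a - d2 a * d3 a"

text \<open>The conic that the plane \<open>cc a\<close> cuts out of the quadric: for a first Segre parameter \<open>(1, \<sigma>)\<close> the
  plane determines the second one.\<close>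

definition curve :: "(nat \<times> nat => complex) => complex => nat => complex" where
 "curve a \<sigma> = Qd (\<lambda>i. if i = 0 then 1 else if i = 1 then \<sigma> else if i = 2 then d2 a + d4 a * \<sigma> else - (d1 a + d3 a * \<sigma>))"

text \<open>\<open>xc a i k\<close> is the coefficient of \<open>\<sigma> ^ i\<close> in \<open>curve a \<sigma> k\<close>, and \<open>xx\<close> is its double.\<close>

definition xx :: "(nat \<times> nat => complex) => nat => nat => complex" where
 "xx a i k =
  (if i = 0 then if k = 0 then d2 a else if k = 1 then d1 a else if k = 2 then - d2 a else - d1 a
   else if i = 1 then if k = 0 then d4 a - d1 a else if k = 1 then d2 a + d3 a else if k = 2 then - (d1 a + d4 a) else d2 a - d3 a
   else if k = 0 then - d3 a else if k = 1 then d4 a else if k = 2 then - d3 a else d4 a)"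

definition xc :: "(nat \<times> nat => complex) => nat => nat => complex" where
 "xc a i k = 1/2 * xx a i k"

definition yc :: "(nat \<times> nat => complex) => nat => complex" where
 "yc a i = (\<Sum>k<4. LL a 0 k * xc a i k)"

definition bc :: "(nat \<times> nat => complex) => nat => nat => complex" where
 "bc a i j = yc a i * yc a j - (a (0, 0))\<^sup>2 * (\<Sum>k<4. of_real (\<kappa> k) * (xc a i k * xc a j k))"

text \<open>The quartic that the second quadric becomes on the conic.\<close>

definition rc :: "(nat \<times> nat => complex) => complex poly" where
 "rc a = [:bc a 0 0, 2 * bc a 0 1, 2 * bc a 0 2 + bc a 1 1, 2 * bc a 1 2, bc a 2 2:]"

text \<open>The factors say that \<open>x 0\<close> can be eliminated, that the conic is irreducible, that its point at infinity is not on the second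
  quadric, and that the quartic has simple roots.\<close>

definition degree_cond :: "(nat \<times> nat => complex) => complex" where
 "degree_cond a = a (0, 0) * dd a * bc a 2 2 *
   quartic_disc (bc a 2 2) (2 * bc a 1 2) (2 * bc a 0 2 + bc a 1 1) (2 * bc a 0 1) (bc a 0 0)"

lemma degree_cond_polyfuns: "degree_cond \<in> polyfuns"
proof -
 have LL: "(\<lambda>a. LL a j k) \<in> polyfuns" for j k unfolding LL_def by (intro polyfuns_sum polyfuns_mult polyfuns_var polyfuns_const)
 have cc: "(\<lambda>a. cc a k) \<in> polyfuns" for k unfolding cc_def by (intro polyfuns_diff polyfuns_mult polyfuns_var LL)
 have d: "(\<lambda>a. d1 a) \<in> polyfuns" "(\<lambda>a. d2 a) \<in> polyfuns" "(\<lambda>a. d3 a) \<in> polyfuns" "(\<lambda>a. d4 a) \<in> polyfuns"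
  unfolding d1_def d2_def d3_def d4_def by (intro polyfuns_add polyfuns_diff cc)+
 have xc: "(\<lambda>a. xc a i k) \<in> polyfuns" for i k
  unfolding xc_def xx_def by (intro polyfuns_mult polyfuns_const polyfuns_if polyfuns_add polyfuns_diff polyfuns_uminus d)
 have yc: "(\<lambda>a. yc a i) \<in> polyfuns" for i unfolding yc_def by (intro polyfuns_sum polyfuns_mult LL xc)
 have bc: "(\<lambda>a. bc a i j) \<in> polyfuns" for i j
  unfolding bc_def by (intro polyfuns_sum polyfuns_diff polyfuns_power polyfuns_mult polyfuns_var polyfuns_const yc xc)
 show ?thesis unfolding degree_cond_def[abs_def] quartic_disc_def dd_def
  by (intro polyfuns_add polyfuns_diff polyfuns_power polyfuns_mult polyfuns_var polyfuns_const bc d)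
qed

lemma hyper: "(\<Sum>i\<le>4. a (j, i) * vec x0 X i) = a (j, 0) * x0 + (\<Sum>k<4. LL a j k * X k)"
proof -
 have "(\<Sum>i\<le>4. a (j, i) * vec x0 X i) = a (j, 0) * x0 + (\<Sum>i<4. a (j, Suc i) * (\<Sum>k<4. X k * of_real (v k i)))"
 proof -
  have "{..4::nat} = {..<Suc 4}" by auto
  then show ?thesis by (simp only: sum.lessThan_Suc_shift) (simp add: vec_def)
 qed
 also have "(\<Sum>i<4. a (j, Suc i) * (\<Sum>k<4. X k * of_real (v k i))) = (\<Sum>k<4. LL a j k * X k)"
  unfolding LL_def sum_distrib_left sum_distrib_right by (subst sum.swap) (simp add: mult_ac)
 finally show ?thesis .
qed

lemma Qd_lin:
 fixes p :: "nat => complex"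
 shows "Qd p 0 - Qd p 2 = p 0 * p 2" "Qd p 3 - Qd p 1 = p 0 * p 3" "Qd p 1 + Qd p 3 = p 1 * p 2" "Qd p 0 + Qd p 2 = p 1 * p 3"
proof -
 have h: "(A + B) / 2 - (B - A) / 2 = A" "(A + B) / 2 + (B - A) / 2 = B" "(B - A) / 2 + (A + B) / 2 = B" for A B :: complex
  by (simp_all add: add_divide_distrib diff_divide_distrib)
 show "Qd p 0 - Qd p 2 = p 0 * p 2" "Qd p 3 - Qd p 1 = p 0 * p 3" "Qd p 1 + Qd p 3 = p 1 * p 2" "Qd p 0 + Qd p 2 = p 1 * p 3"
  by (simp_all add: Qd_def h)
qed

lemma curve_simps:
 "curve a \<sigma> 0 - curve a \<sigma> 2 = d2 a + d4 a * \<sigma>" "curve a \<sigma> 3 - curve a \<sigma> 1 = - (d1 a + d3 a * \<sigma>)"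
 "curve a \<sigma> 1 + curve a \<sigma> 3 = \<sigma> * (d2 a + d4 a * \<sigma>)" "curve a \<sigma> 0 + curve a \<sigma> 2 = \<sigma> * - (d1 a + d3 a * \<sigma>)"
 unfolding curve_def Qd_lin by simp_all

lemma curve_xc: assumes "k < 4" shows "curve a \<sigma> k = xc a 0 k + \<sigma> * xc a 1 k + \<sigma>\<^sup>2 * xc a 2 k"
proof -
 have c: "2 * curve a \<sigma> 0 = (curve a \<sigma> 0 - curve a \<sigma> 2) + (curve a \<sigma> 0 + curve a \<sigma> 2)"
  "2 * curve a \<sigma> 1 = (curve a \<sigma> 1 + curve a \<sigma> 3) - (curve a \<sigma> 3 - curve a \<sigma> 1)"
  "2 * curve a \<sigma> 2 = (curve a \<sigma> 0 + curve a \<sigma> 2) - (curve a \<sigma> 0 - curve a \<sigma> 2)"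
  "2 * curve a \<sigma> 3 = (curve a \<sigma> 1 + curve a \<sigma> 3) + (curve a \<sigma> 3 - curve a \<sigma> 1)" by simp_all
 have "2 * curve a \<sigma> k = xx a 0 k + \<sigma> * xx a 1 k + \<sigma>\<^sup>2 * xx a 2 k"
  using assms[unfolded less4] by (elim disjE) (simp_all only: c curve_simps, simp_all add: xx_def power2_eq_square algebra_simps)
 moreover have "curve a \<sigma> k = 1/2 * (2 * curve a \<sigma> k)" by simp
 ultimately have "curve a \<sigma> k = 1/2 * (xx a 0 k + \<sigma> * xx a 1 k + \<sigma>\<^sup>2 * xx a 2 k)" by (simp only:)
 then show ?thesis unfolding xc_def by (simp only: distrib_left mult.left_commute)
qed

lemma curve_plane: "(\<Sum>k<4. cc a k * curve a \<sigma> k) = 0"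
proof -
 have "2 * (\<Sum>k<4. cc a k * curve a \<sigma> k) = d1 a * (curve a \<sigma> 0 - curve a \<sigma> 2) + d4 a * (curve a \<sigma> 0 + curve a \<sigma> 2)
   + d2 a * (curve a \<sigma> 3 - curve a \<sigma> 1) + d3 a * (curve a \<sigma> 1 + curve a \<sigma> 3)"
  unfolding sum4 d1_def d2_def d3_def d4_def by (simp add: algebra_simps)
 also have "\<dots> = 0" unfolding curve_simps by (simp add: algebra_simps)
 finally show ?thesis by simp
qed

lemma curve_quadric: "(curve a \<sigma> 0)\<^sup>2 + (curve a \<sigma> 1)\<^sup>2 = (curve a \<sigma> 2)\<^sup>2 + (curve a \<sigma> 3)\<^sup>2"
 unfolding curve_def by (rule Qd_quadric)

lemma curve_quartic:
 "(\<Sum>k<4. LL a 0 k * curve a \<sigma> k)\<^sup>2 - (a (0, 0))\<^sup>2 * (\<Sum>k<4. of_real (\<kappa> k) * (curve a \<sigma> k)\<^sup>2) = poly (rc a) \<sigma>"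
proof -
 have y: "(\<Sum>k<4. LL a 0 k * curve a \<sigma> k) = yc a 0 + \<sigma> * yc a 1 + \<sigma>\<^sup>2 * yc a 2"
  unfolding yc_def sum_distrib_left sum.distrib[symmetric] by (rule sum.cong) (auto simp: curve_xc algebra_simps)
 define K where "K i j = (\<Sum>k<4. of_real (\<kappa> k) * (xc a i k * xc a j k))" for i j
 have "(\<Sum>k<4. of_real (\<kappa> k) * (curve a \<sigma> k)\<^sup>2) = K 0 0 + 2 * \<sigma> * K 0 1 + \<sigma>\<^sup>2 * (2 * K 0 2 + K 1 1) + 2 * \<sigma>^3 * K 1 2 + \<sigma>^4 * K 2 2"
 proof -
  have h: "k * (p + s * q + s\<^sup>2 * r)\<^sup>2 = k * (p * p) + 2 * s * (k * (p * q)) + s\<^sup>2 * (2 * (k * (p * r)) + k * (q * q))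
    + 2 * s ^ 3 * (k * (q * r)) + s ^ 4 * (k * (r * r))" for k p q r s :: complex
   by (simp add: power2_eq_square power3_eq_cube power4_eq_xxxx algebra_simps)
  show ?thesis unfolding K_def sum_distrib_left sum.distrib[symmetric]
   by (rule sum.cong[OF refl], subst curve_xc, simp, rule h)
 qed
 then show ?thesis unfolding y rc_def bc_def K_def[symmetric]
  by (simp add: power2_eq_square power3_eq_cube power4_eq_xxxx algebra_simps)
qed

lemma cc_zero_iff:
 assumes "a (0, 0) \<noteq> 0" "a (0, 0) * x0 + (\<Sum>k<4. LL a 0 k * X k) = 0"
 shows "a (1, 0) * x0 + (\<Sum>k<4. LL a 1 k * X k) = 0 \<longleftrightarrow> (\<Sum>k<4. cc a k * X k) = 0"
proof -
 have "(\<Sum>k<4. cc a k * X k) = a (0, 0) * (\<Sum>k<4. LL a 1 k * X k) - a (1, 0) * (\<Sum>k<4. LL a 0 k * X k)"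
  by (simp add: cc_def sum_distrib_left sum_subtractf left_diff_distrib mult.assoc)
 also have "(\<Sum>k<4. LL a 0 k * X k) = - (a (0, 0) * x0)" using assms(2) by (simp add: eq_neg_iff_add_eq_0 add.commute)
 finally have "(\<Sum>k<4. cc a k * X k) = a (0, 0) * (a (1, 0) * x0 + (\<Sum>k<4. LL a 1 k * X k))" by (simp add: algebra_simps)
 then show ?thesis using assms(1) by simp
qed

definition section_point :: "(nat \<times> nat => complex) => complex => nat => complex" where
 "section_point a \<sigma> = vec (- (\<Sum>k<4. LL a 0 k * curve a \<sigma> k) / a (0, 0)) (curve a \<sigma>)"

definition on_lines :: "(nat \<times> nat => complex) => (nat => complex) => bool" where
 "on_lines a x \<longleftrightarrow> (\<Sum>i\<le>4. a (0, i) * x i) = 0 \<and> (\<Sum>i\<le>4. a (1, i) * x i) = 0"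

lemma on_lines_scale: assumes "on_lines a x" shows "on_lines a (\<lambda>i. t * x i)"
proof -
 have "(\<Sum>i\<le>4. a (j, i) * (t * x i)) = t * (\<Sum>i\<le>4. a (j, i) * x i)" for j
  unfolding sum_distrib_left by (rule sum.cong) (simp_all add: mult.left_commute)
 then show ?thesis using assms unfolding on_lines_def by simp
qed

lemma curve_nonzero:
 assumes "dd a \<noteq> 0" shows "d2 a + d4 a * \<sigma> \<noteq> 0 \<or> - (d1 a + d3 a * \<sigma>) \<noteq> 0"
proof (rule ccontr)
 assume "\<not> ?thesis"
 then have "d2 a + d4 a * \<sigma> = 0" "d1 a + d3 a * \<sigma> = 0"
  by (simp_all only: de_Morgan_disj not_not neg_equal_0_iff_equal)
 then have "dd a = 0" unfolding dd_def by algebra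
 then show False using assms by simp
qed

lemma section_point_good:
 assumes a: "a (0, 0) \<noteq> 0" "dd a \<noteq> 0" and \<sigma>: "poly (rc a) \<sigma> = 0"
 shows "onX (section_point a \<sigma>)" "on_lines a (section_point a \<sigma>)" "section_point a \<sigma> \<noteq> 0"
  "proj_point (section_point a \<sigma>) \<in> M"
proof -
 let ?X = "curve a \<sigma>" let ?Y = "\<Sum>k<4. LL a 0 k * curve a \<sigma> k"
 have "?Y\<^sup>2 = (a (0, 0))\<^sup>2 * (\<Sum>k<4. of_real (\<kappa> k) * (?X k)\<^sup>2)" using curve_quartic[of a \<sigma>] \<sigma> by simp
 then have "(- ?Y / a (0, 0))\<^sup>2 = (\<Sum>k<4. of_real (\<kappa> k) * (?X k)\<^sup>2)" using a(1) by (simp add: power_divide)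
 then show X: "onX (section_point a \<sigma>)" using curve_quadric[of a \<sigma>]
  unfolding onX_def section_point_def by (simp add: XC_vec)
 have 0: "a (0, 0) * (- ?Y / a (0, 0)) + ?Y = 0" using a(1) by simp
 show "on_lines a (section_point a \<sigma>)"
  unfolding on_lines_def section_point_def hyper using 0 cc_zero_iff[OF a(1) 0] curve_plane by blast
 show n: "section_point a \<sigma> \<noteq> 0"
 proof
  assume z: "section_point a \<sigma> = 0"
  have "?X j = 0" if "j < 4" for j
  proof -
   have "XC j (section_point a \<sigma>) = ?X j" unfolding section_point_def by (rule XC_vec[OF that])
   then show ?thesis unfolding z by (simp add: XC_def)
  qed
  then have "?X 0 = 0" "?X 1 = 0" "?X 2 = 0" "?X 3 = 0" by simp_all
  then show False using curve_nonzero[OF a(2), of \<sigma>] curve_simps(1,2)[of a \<sigma>] by simp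
 qed
 show "proj_point (section_point a \<sigma>) \<in> M"
  by (rule M_point[OF n _ X]) (simp add: section_point_def vec_supp)
qed

lemma section_point_inj:
 assumes "dd a \<noteq> 0" "proj_point (section_point a \<sigma>) = proj_point (section_point a \<tau>)"
 shows "\<sigma> = \<tau>"
proof -
 have "section_point a \<sigma> \<in> proj_point (section_point a \<tau>)" using assms(2) proj_point_self by metis
 then obtain s where s: "s \<noteq> 0" "section_point a \<sigma> = (\<lambda>i. s * section_point a \<tau> i)" by (auto simp: proj_point_def)
 have *: "curve a \<sigma> j = s * curve a \<tau> j" if "j < 4" for j
 proof -
  have "XC j (section_point a \<sigma>) = s * XC j (section_point a \<tau>)" unfolding s(2) by (rule XC_scale)
  then show ?thesis unfolding section_point_def by (simp only: XC_vec[OF that])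
 qed
 let ?u = "\<lambda>\<sigma>. d2 a + d4 a * \<sigma>" let ?w = "\<lambda>\<sigma>. - (d1 a + d3 a * \<sigma>)"
 have X: "curve a \<sigma> 0 = s * curve a \<tau> 0" "curve a \<sigma> 1 = s * curve a \<tau> 1" "curve a \<sigma> 2 = s * curve a \<tau> 2" "curve a \<sigma> 3 = s * curve a \<tau> 3"
  by (rule *; simp)+
 have "curve a \<sigma> 0 - curve a \<sigma> 2 = s * (curve a \<tau> 0 - curve a \<tau> 2)" unfolding X by (simp only: right_diff_distrib)
 then have "?u \<sigma> = s * ?u \<tau>" unfolding curve_simps .
 moreover have "curve a \<sigma> 3 - curve a \<sigma> 1 = s * (curve a \<tau> 3 - curve a \<tau> 1)" unfolding X by (simp only: right_diff_distrib)
 then have "?w \<sigma> = s * ?w \<tau>" unfolding curve_simps .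
 moreover have "curve a \<sigma> 1 + curve a \<sigma> 3 = s * (curve a \<tau> 1 + curve a \<tau> 3)" unfolding X by (simp only: distrib_left)
 then have "\<sigma> * ?u \<sigma> = s * (\<tau> * ?u \<tau>)" unfolding curve_simps .
 moreover have "curve a \<sigma> 0 + curve a \<sigma> 2 = s * (curve a \<tau> 0 + curve a \<tau> 2)" unfolding X by (simp only: distrib_left)
 then have "\<sigma> * ?w \<sigma> = s * (\<tau> * ?w \<tau>)" unfolding curve_simps .
 ultimately have "\<sigma> * ?u \<sigma> = \<tau> * ?u \<sigma>" "\<sigma> * ?w \<sigma> = \<tau> * ?w \<sigma>" by (simp_all only: mult.left_commute)
 then show ?thesis using curve_nonzero[OF assms(1), of \<sigma>] by (metis mult_right_cancel)
qed

lemma section_point_surj: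
 assumes a: "a (0, 0) \<noteq> 0" "dd a \<noteq> 0" "bc a 2 2 \<noteq> 0" and P: "P \<in> M" and x: "x \<in> P" "on_lines a x"
 shows "\<exists>\<sigma>. poly (rc a) \<sigma> = 0 \<and> P = proj_point (section_point a \<sigma>)"
proof -
 have PN: "P \<in> proj_space 4" and xX: "onX x" using P x(1) by (auto simp: M_def)
 note xP = proj_spaceE[OF PN x(1)]
 have xs: "x i = 0" if "i > 4" for i using xP that by blast
 obtain p where p: "(x 0)\<^sup>2 = Kc p" "x = vec (x 0) (Qd p)" using onX_param[OF xX xs] by blast
 have h: "a (0, 0) * x 0 + (\<Sum>k<4. LL a 0 k * Qd p k) = 0" "a (1, 0) * x 0 + (\<Sum>k<4. LL a 1 k * Qd p k) = 0"
  using x(2) unfolding on_lines_def by (subst (asm) (1 2) p(2), simp only: hyper)+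
 have pl: "(\<Sum>k<4. cc a k * Qd p k) = 0" using cc_zero_iff[OF a(1) h(1)] h(2) by blast
 have "2 * (\<Sum>k<4. cc a k * Qd p k) = p 2 * (d1 a * p 0 + d3 a * p 1) + p 3 * (d2 a * p 0 + d4 a * p 1)"
  unfolding sum4 Qd_def d1_def d2_def d3_def d4_def by (simp add: field_simps)
 then have pl': "p 2 * (d1 a * p 0 + d3 a * p 1) + p 3 * (d2 a * p 0 + d4 a * p 1) = 0" using pl by simp
 have nz: "\<exists>j. Qd p j \<noteq> 0"
 proof (rule ccontr)
  assume "\<not> ?thesis"
  then have z: "Qd p j = 0" for j by blast
  then have "x 0 = 0" using p(1) by (simp add: Kc_def)
  then have "x = vec 0 (\<lambda>j. 0)" using p(2) vec_cong[of "Qd p" "\<lambda>j. 0"] z by metis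
  then have "x = 0" by (auto simp: vec_def fun_eq_iff split: nat.split)
  then show False using xP by blast
 qed
 then have non: "p 0 \<noteq> 0 \<or> p 1 \<noteq> 0" and non2: "p 2 \<noteq> 0 \<or> p 3 \<noteq> 0" by (auto simp: Qd_def split: if_splits)
 define U W where "U = d2 a * p 0 + d4 a * p 1" and "W = - (d1 a * p 0 + d3 a * p 1)"
 have UW: "U \<noteq> 0 \<or> W \<noteq> 0"
 proof (rule ccontr)
  assume "\<not> ?thesis"
  then have "U = 0" "W = 0" by auto
  then have "dd a * p 0 = 0" "dd a * p 1 = 0" unfolding U_def W_def dd_def by algebra+
  then show False using a(2) non by simp
 qed
 have "\<exists>t. p 2 = t * U \<and> p 3 = t * W"
 proof (cases "U = 0")
  case True
  then have W: "W \<noteq> 0" using UW by blast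
  have "p 2 * W = 0" using pl' True unfolding U_def W_def by algebra
  then have "p 2 = 0" using W by simp
  then show ?thesis using True W by (intro exI[of _ "p 3 / W"]) simp
 next
  case False
  have "p 3 * U = p 2 * W" using pl' unfolding U_def W_def by algebra
  then show ?thesis using False by (intro exI[of _ "p 2 / U"]) (simp add: field_simps)
 qed
 then obtain t where t: "p 2 = t * U" "p 3 = t * W" by blast
 have t0: "t \<noteq> 0" using t non2 by auto
 have xk: "(a (0, 0) * x 0)\<^sup>2 = (\<Sum>k<4. LL a 0 k * Qd p k)\<^sup>2"
  using h(1) by (simp add: add_eq_0_iff)
 have p0: "p 0 \<noteq> 0"
 proof
  assume z: "p 0 = 0"
  have Q: "Qd p k = t * (p 1)\<^sup>2 * xc a 2 k" if "k < 4" for k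
   using that[unfolded less4] by (elim disjE) (simp_all add: Qd_def xc_def xx_def t U_def W_def z power2_eq_square algebra_simps)
  have "(\<Sum>k<4. LL a 0 k * Qd p k) = t * (p 1)\<^sup>2 * yc a 2"
   unfolding yc_def sum_distrib_left by (rule sum.cong) (auto simp: Q)
  note Y = this
  have K: "(x 0)\<^sup>2 = (t * (p 1)\<^sup>2)\<^sup>2 * (\<Sum>k<4. of_real (\<kappa> k) * (xc a 2 k * xc a 2 k))"
   unfolding p(1) Kc_def sum_distrib_left by (rule sum.cong) (auto simp: Q power2_eq_square)
  have "(t * (p 1)\<^sup>2)\<^sup>2 * bc a 2 2 = (t * (p 1)\<^sup>2 * yc a 2)\<^sup>2 - (a (0, 0) * x 0)\<^sup>2"
   unfolding bc_def power_mult_distrib[of "a (0, 0)"] K power_mult_distrib[of _ "yc a 2"]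
   by (simp add: power2_eq_square[of "yc a 2"] right_diff_distrib mult.left_commute)
  also have "\<dots> = 0" using xk unfolding Y by simp
  finally have "(t * (p 1)\<^sup>2)\<^sup>2 * bc a 2 2 = 0" .
  then show False using t0 non z a(3) by simp
 qed
 define \<sigma> where "\<sigma> = p 1 / p 0"
 define s where "s = t * (p 0)\<^sup>2"
 have s0: "s \<noteq> 0" using t0 p0 by (simp add: s_def)
 have p1: "p 1 = \<sigma> * p 0" using p0 by (simp add: \<sigma>_def)
 have Q: "Qd p k = s * curve a \<sigma> k" if "k < 4" for k
  using that[unfolded less4] by (elim disjE) (simp_all add: Qd_def curve_def s_def t U_def W_def p1[unfolded One_nat_def] power2_eq_square field_simps)
 have QY: "(\<Sum>k<4. LL a 0 k * Qd p k) = s * (\<Sum>k<4. LL a 0 k * curve a \<sigma> k)"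
  unfolding sum_distrib_left by (rule sum.cong) (auto simp: Q)
 have QK: "(x 0)\<^sup>2 = s\<^sup>2 * (\<Sum>k<4. of_real (\<kappa> k) * (curve a \<sigma> k)\<^sup>2)"
  unfolding p(1) Kc_def sum_distrib_left by (rule sum.cong) (auto simp: Q power_mult_distrib)
 have x0: "x 0 = s * (- (\<Sum>k<4. LL a 0 k * curve a \<sigma> k) / a (0, 0))"
  using h(1) a(1) unfolding QY by (simp add: field_simps eq_neg_iff_add_eq_0)
 have "s\<^sup>2 * poly (rc a) \<sigma> = 0"
  using xk[symmetric] unfolding curve_quartic[symmetric] QY power_mult_distrib QK by (simp add: algebra_simps)
 then have "poly (rc a) \<sigma> = 0" using s0 by simp
 moreover have "x = (\<lambda>i. s * section_point a \<sigma> i)"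
 proof -
  have "x = vec (x 0) (\<lambda>k. s * curve a \<sigma> k)" by (subst p(2)) (rule vec_cong[OF Q])
  then show ?thesis unfolding section_point_def vec_scale[symmetric] x0[symmetric] .
 qed
 then have "P = proj_point (section_point a \<sigma>)" using xP proj_point_scale[OF s0] by metis
 ultimately show ?thesis by blast
qed

lemma section_card:
 assumes "degree_cond a \<noteq> 0"
 shows "finite {P \<in> M. \<forall>x\<in>P. on_lines a x} \<and> card {P \<in> M. \<forall>x\<in>P. on_lines a x} = 4"
proof -
 have a: "a (0, 0) \<noteq> 0" "dd a \<noteq> 0" "bc a 2 2 \<noteq> 0" using assms by (auto simp: degree_cond_def)
 have c: "finite {\<sigma>. poly (rc a) \<sigma> = 0} \<and> card {\<sigma>. poly (rc a) \<sigma> = 0} = 4"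
  unfolding rc_def by (rule card_roots_quartic[OF a(3)]) (use assms in \<open>simp add: degree_cond_def\<close>)
 have "{P \<in> M. \<forall>x\<in>P. on_lines a x} = (\<lambda>\<sigma>. proj_point (section_point a \<sigma>)) ` {\<sigma>. poly (rc a) \<sigma> = 0}"
 proof (intro equalityI subsetI)
  fix P assume P: "P \<in> {P \<in> M. \<forall>x\<in>P. on_lines a x}"
  then obtain x where "x \<in> P" using proj_space_ne unfolding M_def by blast
  then have "\<exists>\<sigma>. poly (rc a) \<sigma> = 0 \<and> P = proj_point (section_point a \<sigma>)" using section_point_surj[OF a] P by blast
  then show "P \<in> (\<lambda>\<sigma>. proj_point (section_point a \<sigma>)) ` {\<sigma>. poly (rc a) \<sigma> = 0}" by blast
 next
  fix P assume "P \<in> (\<lambda>\<sigma>. proj_point (section_point a \<sigma>)) ` {\<sigma>. poly (rc a) \<sigma> = 0}"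
  then obtain \<sigma> where \<sigma>: "poly (rc a) \<sigma> = 0" "P = proj_point (section_point a \<sigma>)" by blast
  note g = section_point_good[OF a(1,2) \<sigma>(1)]
  have "on_lines a x" if "x \<in> P" for x
  proof -
   from that obtain t where "x = (\<lambda>i. t * section_point a \<sigma> i)" by (auto simp: \<sigma>(2) proj_point_def)
   then show ?thesis using on_lines_scale[OF g(2)] by simp
  qed
  then show "P \<in> {P \<in> M. \<forall>x\<in>P. on_lines a x}" using g(4) \<sigma>(2) by blast
 qed
 moreover have "inj_on (\<lambda>\<sigma>. proj_point (section_point a \<sigma>)) {\<sigma>. poly (rc a) \<sigma> = 0}"
  by (rule inj_onI) (rule section_point_inj[OF a(2)])
 ultimately show ?thesis using c by (simp add: card_image)
qed

text \<open>The hyperplanes \<open>x 0 = w * XC 0 x\<close> and \<open>XC 2 x = 0\<close>, with \<open>w\<close> such that the quartic has the form \<open>K * (\<sigma>\<^sup>4 + 1)\<close>.\<close>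

lemma degree_cond_nonzero: "\<exists>a. degree_cond a \<noteq> 0"
proof -
 define w where "w = csqrt (of_real (\<kappa> 0 - \<kappa> 1 / 2 + \<kappa> 3 / 2))"
 have w2: "w * w = of_real (\<kappa> 0) - of_real (\<kappa> 1) / 2 + of_real (\<kappa> 3) / 2"
  unfolding w_def power2_eq_square[symmetric] by simp
 define a where "a = (\<lambda>q :: nat \<times> nat. if snd q = 0 then if fst q = 0 then -1 else 0
  else if fst q = 0 then w * of_real (c 0 (snd q - 1)) else of_real (c 2 (snd q - 1)) :: complex)"
 have a0: "a (0, 0) = -1" "a (1, 0) = 0" by (simp_all add: a_def)
 have L0: "LL a 0 k = (if k = 0 then w else 0)" if "k < 4" for k
 proof -
  have "LL a 0 k = w * of_real (dot 4 (c 0) (v k))" by (simp add: LL_def a_def dot_def sum_distrib_left mult.assoc)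
  then show ?thesis using dual[of 0 k] that by auto
 qed
 have L1: "LL a 1 k = (if k = 2 then 1 else 0)" if "k < 4" for k
 proof -
  have "LL a 1 k = of_real (dot 4 (c 2) (v k))" by (simp add: LL_def a_def dot_def)
  then show ?thesis using dual[of 2 k] that by auto
 qed
 have cc: "cc a k = (if k = 2 then -1 else 0)" if "k < 4" for k
  unfolding cc_def a0 L1[OF that] by simp
 have d: "d1 a = 1" "d2 a = 0" "d3 a = 0" "d4 a = -1" by (simp_all add: d1_def d2_def d3_def d4_def cc)
 have y: "yc a i = w * xc a i 0" for i unfolding yc_def sum4 by (simp add: L0)
 have b: "bc a 0 0 = - of_real ((\<kappa> 1 + \<kappa> 3) / 4)" "bc a 2 2 = - of_real ((\<kappa> 1 + \<kappa> 3) / 4)" "bc a 0 1 = 0" "bc a 1 2 = 0"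
  "2 * bc a 0 2 + bc a 1 1 = 0"
  unfolding bc_def y a0 sum4 by (simp_all add: xc_def xx_def d w2 field_simps)
 have "\<kappa> 1 + \<kappa> 3 > 0" using \<kappa>_pos[of 1] \<kappa>_pos[of 3] by simp
 then have n: "complex_of_real ((\<kappa> 1 + \<kappa> 3) / 4) \<noteq> 0" by (simp only: of_real_eq_0_iff) simp
 define K where "K = complex_of_real ((\<kappa> 1 + \<kappa> 3) / 4)"
 have "K \<noteq> 0" using n unfolding K_def .
 then have "degree_cond a \<noteq> 0" unfolding degree_cond_def b a0 dd_def d quartic_disc_def K_def[symmetric] by simp
 then show ?thesis by blast
qed

theorem moebius_degree: "has_moebius_degree (stereo_image Z) 4"
 unfolding has_moebius_degree_def moebius_model_eq has_degree_def proj_dim_M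
proof -
 obtain G where G: "degree_cond = (\<lambda>a. peval a G)" using degree_cond_polyfuns by (auto simp: polyfuns_def)
 have eq: "{P \<in> M. \<forall>j. enat j < 2 --> (\<forall>x\<in>P. (\<Sum>i\<le>4. a (j, i) * x i) = 0)} = {P \<in> M. \<forall>x\<in>P. on_lines a x}" for a
 proof -
  have "enat j < 2 \<longleftrightarrow> j = 0 \<or> j = 1" for j by (simp add: numeral_eq_enat) linarith
  then show ?thesis unfolding on_lines_def by auto
 qed
 have "G \<noteq> 0"
 proof
  assume "G = 0"
  then have "degree_cond a = 0" for a unfolding G by (simp add: peval_def)
  then show False using degree_cond_nonzero by blast
 qed
 moreover have "\<forall>a. peval a G \<noteq> 0 -->
     (let S = {P \<in> M. \<forall>j. enat j < 2 --> (\<forall>x\<in>P. (\<Sum>i\<le>4. a (j, i) * x i) = 0)}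
      in finite S \<and> card S = 4)"
  unfolding eq Let_def using section_card unfolding G by blast
 ultimately show "\<exists>G. G \<noteq> 0 \<and> (\<forall>a. peval a G \<noteq> 0 -->
     (let S = {P \<in> M. \<forall>j. enat j < 2 --> (\<forall>x\<in>P. (\<Sum>i\<le>4. a (j, i) * x i) = 0)}
      in finite S \<and> card S = 4))" by (intro exI[of _ G] conjI)
qed

end

section \<open>Isotropic planes through a point of a quadric\<close>

text \<open>The matrices whose graph is a plane isotropic for the form \<open>A1 x0\<^sup>2 + A2 x1\<^sup>2 - P x2\<^sup>2 - R x3\<^sup>2\<close> and orthogonal to \<open>Y\<close>.\<close>

definition isograph :: "real => real => real => real => real => real => real => real => (real \<times> real \<times> real \<times> real) set" where
 "isograph A1 A2 P R Y0 Y1 Y2 Y3 = {(a, b, e, d). P * a\<^sup>2 + R * e\<^sup>2 = A1 \<and> P * b\<^sup>2 + R * d\<^sup>2 = A2 \<and>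
   P * (a * b) + R * (e * d) = 0 \<and> P * (a * Y2) + R * (e * Y3) = A1 * Y0 \<and> P * (b * Y2) + R * (d * Y3) = A2 * Y1}"

lemma orthogonal_2x2:
 fixes a b e d :: real
 assumes "a\<^sup>2 + e\<^sup>2 = 1" "b\<^sup>2 + d\<^sup>2 = 1" "a * b + e * d = 0"
 shows "b = - e \<and> d = a \<or> b = e \<and> d = - a"
proof -
 define k where "k = a * d - b * e"
 have d: "d = k * a" "b = - (k * e)" unfolding k_def using assms(1,3) by algebra+
 have "k\<^sup>2 * (a\<^sup>2 + e\<^sup>2) = 1" using assms(2) unfolding d by (simp add: power_mult_distrib algebra_simps)
 then have "k\<^sup>2 = 1" using assms(1) by simp
 then have "k = 1 \<or> k = - 1" by (simp add: power2_eq_1_iff)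
 then show ?thesis using d by auto
qed

lemma isograph_orthogonal:
 assumes "(a, b, e, d) \<in> isograph 1 1 1 1 Y0 Y1 Y2 Y3"
 shows "a * Y0 + b * Y1 = Y2" "e * Y0 + d * Y1 = Y3"
proof -
 have h: "a\<^sup>2 + e\<^sup>2 = 1" "b\<^sup>2 + d\<^sup>2 = 1" "a * b + e * d = 0" "a * Y2 + e * Y3 = Y0" "b * Y2 + d * Y3 = Y1"
  using assms by (simp_all add: isograph_def)
 have "(b = - e \<and> d = a) \<or> (b = e \<and> d = - a)" by (rule orthogonal_2x2[OF h(1-3)])
 then show "a * Y0 + b * Y1 = Y2" "e * Y0 + d * Y1 = Y3"
  using h(1) unfolding h(4,5)[symmetric] by (auto; algebra)+
qed

text \<open>For coefficients 1 these are orthogonal matrices taking \<open>(Y0, Y1)\<close> to \<open>(Y2, Y3)\<close>: one rotation and one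
  reflection.\<close>

lemma card_isograph_orthogonal:
 assumes "Y0\<^sup>2 + Y1\<^sup>2 = Y2\<^sup>2 + Y3\<^sup>2" "Y0 \<noteq> 0"
 shows "card (isograph 1 1 1 1 Y0 Y1 Y2 Y3) = 2"
proof -
 define N where "N = Y2\<^sup>2 + Y3\<^sup>2"
 have N: "N > 0" unfolding N_def assms(1)[symmetric] using assms(2) by (simp add: add_pos_nonneg)
 define a e a' e' where ae: "a = (Y0 * Y2 + Y1 * Y3) / N" "e = (Y0 * Y3 - Y1 * Y2) / N"
  "a' = (Y0 * Y2 - Y1 * Y3) / N" "e' = (Y0 * Y3 + Y1 * Y2) / N"
 have aN: "N * a = Y0 * Y2 + Y1 * Y3" "N * e = Y0 * Y3 - Y1 * Y2" "N * a' = Y0 * Y2 - Y1 * Y3" "N * e' = Y0 * Y3 + Y1 * Y2"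
  using N by (simp_all add: ae)
 have N2: "N = Y2\<^sup>2 + Y3\<^sup>2" "N = Y0\<^sup>2 + Y1\<^sup>2" using assms(1) by (simp_all add: N_def)
 have c: "x = y" if "N * x = N * y" for x y using N that by simp
 have c2: "x = y" if "N * N * x = N * N * y" for x y using N that by simp
 have n: "a\<^sup>2 + e\<^sup>2 = 1" "a'\<^sup>2 + e'\<^sup>2 = 1"
  by (rule c2, use aN N2 in algebra)+
 have y: "a * Y2 + e * Y3 = Y0" "a * Y3 - e * Y2 = Y1" "a' * Y2 + e' * Y3 = Y0" "e' * Y2 - a' * Y3 = Y1"
  by (rule c, use aN N2 in algebra)+
 have "isograph 1 1 1 1 Y0 Y1 Y2 Y3 = {(a, - e, e, a), (a', e', e', - a')}"
 proof (intro equalityI subsetI)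
  fix z assume z: "z \<in> isograph 1 1 1 1 Y0 Y1 Y2 Y3"
  obtain p q s t where zz: "z = (p, q, s, t)" by (cases z)
  have h: "p\<^sup>2 + s\<^sup>2 = 1" "q\<^sup>2 + t\<^sup>2 = 1" "p * q + s * t = 0" "p * Y2 + s * Y3 = Y0" "q * Y2 + t * Y3 = Y1"
   using z by (simp_all add: isograph_def zz)
  have "(q = - s \<and> t = p) \<or> (q = s \<and> t = - p)" by (rule orthogonal_2x2[OF h(1-3)])
  then show "z \<in> {(a, - e, e, a), (a', e', e', - a')}"
  proof (elim disjE conjE)
   assume qt: "q = - s" "t = p"
   have "p = a" by (rule c, unfold aN, unfold N2(1) h(4,5)[symmetric] qt) (simp add: power2_eq_square algebra_simps)
   moreover have "s = e" by (rule c, unfold aN, unfold N2(1) h(4,5)[symmetric] qt) (simp add: power2_eq_square algebra_simps)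
   ultimately show ?thesis using qt zz by simp
  next
   assume qt: "q = s" "t = - p"
   have "p = a'" by (rule c, unfold aN, unfold N2(1) h(4,5)[symmetric] qt) (simp add: power2_eq_square algebra_simps)
   moreover have "s = e'" by (rule c, unfold aN, unfold N2(1) h(4,5)[symmetric] qt) (simp add: power2_eq_square algebra_simps)
   ultimately show ?thesis using qt zz by simp
  qed
 next
  fix z assume "z \<in> {(a, - e, e, a), (a', e', e', - a')}"
  then show "z \<in> isograph 1 1 1 1 Y0 Y1 Y2 Y3"
   using n y by (auto simp: isograph_def algebra_simps)
 qed
 moreover have "(a, - e, e, a) \<noteq> (a', e', e', - a')"
 proof
  assume "(a, - e, e, a) = (a', e', e', - a')"
  then have "a = 0" "e = 0" by auto
  then show False using n(1) by simp
 qed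
 ultimately show ?thesis by simp
qed

text \<open>The second column vanishes. The first one lies on an ellipse and has a prescribed product with
  \<open>(Y2, Y3)\<close>; the excess \<open>l\<close> makes the line meet the ellipse in two points.\<close>

lemma card_isograph_degenerate:
 assumes PR: "P > 0" "R > 0" and A: "A1 > 0" "l > 0" and Y: "P * Y2\<^sup>2 + R * Y3\<^sup>2 = A1 * Y0\<^sup>2 + l"
 shows "card (isograph A1 0 P R Y0 Y1 Y2 Y3) = 2"
proof -
 define N where "N = P * Y2\<^sup>2 + R * Y3\<^sup>2"
 have N: "N > 0" unfolding N_def Y using A by (simp add: add_nonneg_pos)
 have c: "x = y" if "N * x = N * y" for x y using N that by simp
 define k where "k = sqrt (A1 * l / (P * R))"
 have k: "k > 0" "P * R * k\<^sup>2 = A1 * l" using PR A by (simp_all add: k_def)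
 define f where "f s = ((A1 * Y0 * Y2 + R * Y3 * s) / N, 0::real, (A1 * Y0 * Y3 - P * Y2 * s) / N, 0::real)" for s
 have "isograph A1 0 P R Y0 Y1 Y2 Y3 = {f k, f (- k)}"
 proof (intro equalityI subsetI)
  fix z assume z: "z \<in> isograph A1 0 P R Y0 Y1 Y2 Y3"
  obtain a b e d where zz: "z = (a, b, e, d)" by (cases z)
  have h: "P * a\<^sup>2 + R * e\<^sup>2 = A1" "P * b\<^sup>2 + R * d\<^sup>2 = 0" "P * (a * Y2) + R * (e * Y3) = A1 * Y0"
   using z by (simp_all add: isograph_def zz)
  have "P * b\<^sup>2 \<ge> 0" "R * d\<^sup>2 \<ge> 0" using PR by auto
  then have "P * b\<^sup>2 = 0" "R * d\<^sup>2 = 0" using h(2) by linarith+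
  then have bd: "b = 0" "d = 0" using PR by auto
  define s where "s = a * Y3 - e * Y2"
  have "N * a = A1 * Y0 * Y2 + R * Y3 * s" "N * e = A1 * Y0 * Y3 - P * Y2 * s"
   unfolding N_def s_def using h(3) by algebra+
  then have "a = (A1 * Y0 * Y2 + R * Y3 * s) / N" "e = (A1 * Y0 * Y3 - P * Y2 * s) / N"
   using N by (simp_all add: field_simps)
  then have zf: "z = f s" using zz bd by (simp add: f_def)
  have "P * R * s\<^sup>2 = (P * a\<^sup>2 + R * e\<^sup>2) * N - (P * (a * Y2) + R * (e * Y3))\<^sup>2"
   unfolding s_def N_def by (simp add: power2_eq_square algebra_simps)
  also have "\<dots> = A1 * N - (A1 * Y0)\<^sup>2" unfolding h ..
  also have "\<dots> = A1 * l" unfolding N_def Y by (simp add: power2_eq_square algebra_simps)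
  also have "\<dots> = P * R * k\<^sup>2" using k by simp
  finally have "s\<^sup>2 = k\<^sup>2" using PR by simp
  then show "z \<in> {f k, f (- k)}" using zf by (auto simp: power2_eq_iff)
 next
  fix z assume "z \<in> {f k, f (- k)}"
  then obtain s where s: "z = f s" "s\<^sup>2 = k\<^sup>2" by auto
  define a e where ae: "a = (A1 * Y0 * Y2 + R * Y3 * s) / N" "e = (A1 * Y0 * Y3 - P * Y2 * s) / N"
  have aN: "N * a = A1 * Y0 * Y2 + R * Y3 * s" "N * e = A1 * Y0 * Y3 - P * Y2 * s" using N by (simp_all add: ae)
  have ks: "P * R * s\<^sup>2 = A1 * l" using k s by simp
  have NY: "N = A1 * Y0\<^sup>2 + l" using Y by (simp add: N_def)
  have "N * N * (P * a\<^sup>2 + R * e\<^sup>2) = N * ((A1 * Y0)\<^sup>2 + P * R * s\<^sup>2)"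
   using aN N_def by algebra
  also have "\<dots> = N * N * A1" unfolding ks NY by (simp add: power2_eq_square algebra_simps)
  finally have 1: "P * a\<^sup>2 + R * e\<^sup>2 = A1" using N by simp
  have 2: "P * (a * Y2) + R * (e * Y3) = A1 * Y0" by (rule c) (use aN N_def in algebra)
  show "z \<in> isograph A1 0 P R Y0 Y1 Y2 Y3"
   using 1 2 unfolding s(1) f_def ae[symmetric] isograph_def by simp
 qed
 moreover have "f k \<noteq> f (- k)"
 proof
  assume "f k = f (- k)"
  then have "(R * Y3) * k = 0" "(P * Y2) * k = 0" using N by (auto simp: f_def field_simps)
  then have "Y3 = 0" "Y2 = 0" using PR k by auto
  then show False using N by (simp add: N_def)
 qed
 ultimately show ?thesis by simp
qed

lemma isograph_0:
 assumes "P > 0" "R > 0"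
 shows "isograph 0 0 P R Y0 Y1 Y2 Y3 = {(0, 0, 0, 0)}"
proof -
 have zero: "a = 0 \<and> e = 0" if "P * a\<^sup>2 + R * e\<^sup>2 = 0" for a e
 proof -
  have "P * a\<^sup>2 \<ge> 0" "R * e\<^sup>2 \<ge> 0" using assms by auto
  then have "P * a\<^sup>2 = 0" "R * e\<^sup>2 = 0" using that by linarith+
  then show ?thesis using assms by auto
 qed
 have "z = (0, 0, 0, 0)" if "z \<in> isograph 0 0 P R Y0 Y1 Y2 Y3" for z
 proof -
  obtain a b e d where z: "z = (a, b, e, d)" by (cases z)
  have "P * a\<^sup>2 + R * e\<^sup>2 = 0" "P * b\<^sup>2 + R * d\<^sup>2 = 0" using that by (simp_all add: isograph_def z)
  from zero[OF this(1)] zero[OF this(2)] show ?thesis unfolding z by simp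
 qed
 moreover have "(0, 0, 0, 0) \<in> isograph 0 0 P R Y0 Y1 Y2 Y3" by (simp add: isograph_def)
 ultimately show ?thesis by blast
qed

text \<open>The columns are an orthogonal basis for the form \<open>P x2\<^sup>2 + R x3\<^sup>2\<close>, in which \<open>(Y2, Y3)\<close> has the coordinates \<open>Y0\<close>, \<open>Y1\<close>; so
  \<open>Y\<close> would be isotropic.\<close>

lemma isograph_empty:
 assumes PR: "P > 0" "R > 0" and A: "A2 \<le> A1" "A2 \<noteq> 0" and Y: "P * Y2\<^sup>2 + R * Y3\<^sup>2 \<noteq> A1 * Y0\<^sup>2 + A2 * Y1\<^sup>2"
 shows "isograph A1 A2 P R Y0 Y1 Y2 Y3 = {}"
proof (rule ccontr)
 assume "\<not> ?thesis"
 then obtain a b e d where "(a, b, e, d) \<in> isograph A1 A2 P R Y0 Y1 Y2 Y3" by (metis all_not_in_conv prod_cases4)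
 then have h: "P * a\<^sup>2 + R * e\<^sup>2 = A1" "P * b\<^sup>2 + R * d\<^sup>2 = A2" "P * (a * b) + R * (e * d) = 0"
  "P * (a * Y2) + R * (e * Y3) = A1 * Y0" "P * (b * Y2) + R * (d * Y3) = A2 * Y1" by (simp_all add: isograph_def)
 have "P * b\<^sup>2 \<ge> 0" "R * d\<^sup>2 \<ge> 0" using PR by auto
 then have A2: "A2 > 0" using A(2) h(2) by linarith
 then have A1: "A1 > 0" using A(1) by linarith
 have "P * R * (a * d - b * e)\<^sup>2 = (P * a\<^sup>2 + R * e\<^sup>2) * (P * b\<^sup>2 + R * d\<^sup>2) - (P * (a * b) + R * (e * d))\<^sup>2"
  by (simp add: power2_eq_square algebra_simps)
 then have det: "P * R * (a * d - b * e)\<^sup>2 = A1 * A2" unfolding h(1-3) by simp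
 then have D: "a * d - b * e \<noteq> 0" using A1 A2 by auto
 define x x' where "x = Y2 - Y0 * a - Y1 * b" and "x' = Y3 - Y0 * e - Y1 * d"
 have "P * a * x + R * e * x' = (P * (a * Y2) + R * (e * Y3)) - Y0 * (P * a\<^sup>2 + R * e\<^sup>2) - Y1 * (P * (a * b) + R * (e * d))"
  "P * b * x + R * d * x' = (P * (b * Y2) + R * (d * Y3)) - Y0 * (P * (a * b) + R * (e * d)) - Y1 * (P * b\<^sup>2 + R * d\<^sup>2)"
  unfolding x_def x'_def by (simp_all add: power2_eq_square algebra_simps)
 then have "P * a * x + R * e * x' = 0" "P * b * x + R * d * x' = 0" unfolding h by simp_all
 then have "P * (a * d - b * e) * x = 0" "R * (a * d - b * e) * x' = 0" by algebra+
 then have "x = 0" "x' = 0" using PR D by auto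
 then have "Y2 = Y0 * a + Y1 * b" "Y3 = Y0 * e + Y1 * d" by (simp_all add: x_def x'_def)
 then have "P * Y2\<^sup>2 + R * Y3\<^sup>2 = Y0\<^sup>2 * (P * a\<^sup>2 + R * e\<^sup>2) + Y1\<^sup>2 * (P * b\<^sup>2 + R * d\<^sup>2) + 2 * (Y0 * Y1) * (P * (a * b) + R * (e * d))"
  by (simp add: power2_eq_square algebra_simps)
 then have "P * Y2\<^sup>2 + R * Y3\<^sup>2 = A1 * Y0\<^sup>2 + A2 * Y1\<^sup>2" unfolding h by simp
 then show False using Y by simp
qed

section \<open>Circles on the surface\<close>

lemma dot_add: "dot m u (\<lambda>i. x i + y i) = dot m u x + dot m u y" "dot m (\<lambda>i. x i + y i) u = dot m x u + dot m y u"
 by (simp_all add: dot_def algebra_simps sum.distrib)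

lemma dot_affine: "dot n (\<lambda>i. x i + (s * u i + t * w i)) z = dot n x z + (s * dot n u z + t * dot n w z)"
 "dot n z (\<lambda>i. x i + (s * u i + t * w i)) = dot n z x + (s * dot n z u + t * dot n z w)"
 by (simp_all only: dot_add(1,2)[of n z x "\<lambda>i. s * u i + t * w i"] dot_add(2)[of n x "\<lambda>i. s * u i + t * w i" z] dot_lc dot_lc')

context torus
begin

definition bq :: "(nat => real) => (nat => real) => real" where
 "bq x y = \<eta> 0 x * \<eta> 0 y + \<eta> 1 x * \<eta> 1 y - (\<eta> 2 x * \<eta> 2 y + \<eta> 3 x * \<eta> 3 y)"

lemma bq_commute: "bq x y = bq y x" by (simp add: bq_def mult.commute)

lemma bq_lc: "bq (\<lambda>i. s * x i + t * y i) z = s * bq x z + t * bq y z" "bq z (\<lambda>i. s * x i + t * y i) = s * bq z x + t * bq z y"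
 by (simp_all add: bq_def dot_lc' algebra_simps)

lemma bq_add: "bq (\<lambda>i. x i + y i) z = bq x z + bq y z" "bq z (\<lambda>i. x i + y i) = bq z x + bq z y"
 by (simp_all only: bq_def dot_add) (simp_all add: algebra_simps)

lemma bq_affine: "bq (\<lambda>i. x i + (s * u i + t * w i)) z = bq x z + (s * bq u z + t * bq w z)"
 "bq z (\<lambda>i. x i + (s * u i + t * w i)) = bq z x + (s * bq z u + t * bq z w)"
 by (simp_all only: bq_def dot_affine) (simp_all add: algebra_simps)

lemma Z_bq: "y \<in> Z \<longleftrightarrow> y \<in> Eucl 4 \<and> dot 4 y y = 1 \<and> bq y y = 0"
 unfolding Z_iff using norm_coords[of y] by (auto simp: bq_def power2_eq_square)

definition span_slice :: "(nat => real) => (nat => real) => (nat => real) => (nat => real) set" where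
 "span_slice y u w = {z. \<exists>x\<in>plane u w. z = (\<lambda>i. y i + x i) \<and> dot 4 z z = 1}"

lemma span_sliceI: "x \<in> plane u w ==> z = (\<lambda>i. y i + x i) ==> dot 4 z z = 1 ==> z \<in> span_slice y u w"
 unfolding span_slice_def mem_Collect_eq by (intro bexI[of _ x] conjI)

lemma span_sliceE:
 assumes "z \<in> span_slice y u w"
 obtains x where "x \<in> plane u w" "z = (\<lambda>i. y i + x i)" "dot 4 z z = 1"
 using assms unfolding span_slice_def mem_Collect_eq by (elim bexE conjE)

text \<open>Evaluate the norm and \<open>q\<close> at the points of the circle with parameters \<open>(\<plusminus>1, 0)\<close>, \<open>(0, \<plusminus>1)\<close> and
  \<open>(3/5, 4/5)\<close>.\<close>

lemma circle_data:
 assumes C: "circle 4 C" "C \<subseteq> Z" "y \<in> C"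
 obtains u w l where "ortho 4 u w" "C = span_slice y u w" "bq u u = l" "bq w w = l" "bq u w = 0"
  "bq y u = l * dot 4 y u" "bq y w = l * dot 4 y w"
proof -
 obtain m r where cr: "m \<in> Eucl 4" "r > 0" "circle_around 4 m r C" using C(1) unfolding circle_def by blast
 obtain u w where uw: "ortho 4 u w" "C = {\<lambda>i. m i + a * (r * u i) + b * (r * w i) | a b. a\<^sup>2 + b\<^sup>2 = (1::real)}"
  "C = {\<lambda>i. m i + r * (cos t * u i + sin t * w i) | t. True}"
  by (rule circle_around_param[OF cr(3)])
 have o: "dot 4 u u = 1" "dot 4 w w = 1" "dot 4 u w = 0" "dot 4 w u = 0" "u \<in> Eucl 4" "w \<in> Eucl 4"
  using uw(1) by (auto simp: ortho_def dot_commute)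
 define f where "f a b = (\<lambda>i. m i + ((a * r) * u i + (b * r) * w i))" for a b
 have fC: "C = {f a b | a b. a\<^sup>2 + b\<^sup>2 = 1}" unfolding uw(2) f_def by (simp add: mult.assoc add.assoc)
 have fdot: "dot 4 (f a b) (f a b) = dot 4 m m + 2 * a * r * dot 4 m u + 2 * b * r * dot 4 m w + r\<^sup>2 * (a\<^sup>2 + b\<^sup>2)" for a b
  unfolding f_def dot_affine by (simp add: o dot_commute[of 4 u m] dot_commute[of 4 w m] power2_eq_square algebra_simps)
 have fbq: "bq (f a b) (f a b) = bq m m + 2 * a * r * bq m u + 2 * b * r * bq m w + r\<^sup>2 * (a\<^sup>2 * bq u u + 2 * a * b * bq u w + b\<^sup>2 * bq w w)" for a b
  unfolding f_def bq_affine by (simp add: bq_commute[of u m] bq_commute[of w m] bq_commute[of w u] power2_eq_square algebra_simps)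
 have fZ: "dot 4 (f a b) (f a b) = 1" "bq (f a b) (f a b) = 0" if "a\<^sup>2 + b\<^sup>2 = 1" for a b
 proof -
  have "f a b \<in> Z" using C(2) that unfolding fC by blast
  then show "dot 4 (f a b) (f a b) = 1" "bq (f a b) (f a b) = 0" unfolding Z_bq by simp_all
 qed
 have "dot 4 m m + 2 * r * dot 4 m u + r\<^sup>2 = 1" "dot 4 m m - 2 * r * dot 4 m u + r\<^sup>2 = 1"
  "dot 4 m m + 2 * r * dot 4 m w + r\<^sup>2 = 1" "dot 4 m m - 2 * r * dot 4 m w + r\<^sup>2 = 1"
  using fZ(1)[of 1 0] fZ(1)[of "-1" 0] fZ(1)[of 0 1] fZ(1)[of 0 "-1"] unfolding fdot by simp_all
 then have "r * dot 4 m u = 0" "r * dot 4 m w = 0" and n: "dot 4 m m + r\<^sup>2 = 1" by linarith+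
 then have ou: "dot 4 m u = 0" "dot 4 m w = 0" using cr(2) by auto
 have b4: "bq m m + 2 * r * bq m u + r\<^sup>2 * bq u u = 0" "bq m m - 2 * r * bq m u + r\<^sup>2 * bq u u = 0"
  "bq m m + 2 * r * bq m w + r\<^sup>2 * bq w w = 0" "bq m m - 2 * r * bq m w + r\<^sup>2 * bq w w = 0"
  using fZ(2)[of 1 0] fZ(2)[of "-1" 0] fZ(2)[of 0 1] fZ(2)[of 0 "-1"] unfolding fbq by simp_all
 then have "r * bq m u = 0" "r * bq m w = 0" and r2: "r\<^sup>2 * bq u u = r\<^sup>2 * bq w w" by linarith+
 then have bo: "bq m u = 0" "bq m w = 0" using cr(2) by auto
 have uu: "bq w w = bq u u" using r2 cr(2) by simp
 have "bq (f (3/5) (4/5)) (f (3/5) (4/5)) = 0" by (rule fZ(2)) (simp add: power2_eq_square)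
 moreover have "bq (f (3/5) (4/5)) (f (3/5) (4/5)) = (bq m m + 2 * r * bq m u + r\<^sup>2 * bq u u) + r\<^sup>2 * (24/25 * bq u w)"
  unfolding fbq bo uu by (simp add: power2_eq_square algebra_simps)
 ultimately have "r\<^sup>2 * (24/25 * bq u w) = 0" unfolding b4(1) by simp
 then have buw: "bq u w = 0" using cr(2) by simp
 obtain a0 b0 where y: "y = f a0 b0" "a0\<^sup>2 + b0\<^sup>2 = 1" using C(3) unfolding fC by blast
 have yu: "bq y u = bq u u * dot 4 y u" "bq y w = bq u u * dot 4 y w"
  unfolding y(1) f_def bq_affine dot_affine using buw uu by (simp_all add: bo o ou bq_commute[of w u])
 have shift: "(\<lambda>i. y i + (s * u i + t * w i)) = f (a0 + s / r) (b0 + t / r)" for s t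
  unfolding y(1) f_def using cr(2) by (auto simp: fun_eq_iff field_simps)
 have "C = span_slice y u w"
 proof (intro equalityI subsetI)
  fix z assume "z \<in> C"
  then obtain a b where z: "z = f a b" "a\<^sup>2 + b\<^sup>2 = 1" unfolding fC by blast
  have "z = (\<lambda>i. y i + (((a - a0) * r) * u i + ((b - b0) * r) * w i))" unfolding shift z(1) using cr(2) by simp
  moreover have "dot 4 z z = 1" using fZ(1) z by simp
  moreover have "(\<lambda>i. ((a - a0) * r) * u i + ((b - b0) * r) * w i) \<in> plane u w" by blast
  ultimately show "z \<in> span_slice y u w" by (intro span_sliceI)
 next
  fix z assume "z \<in> span_slice y u w"
  then obtain x where x: "x \<in> plane u w" "z = (\<lambda>i. y i + x i)" "dot 4 z z = 1" by (rule span_sliceE)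
  obtain s t where st: "x = (\<lambda>i. s * u i + t * w i)" using x(1) unfolding plane_def by blast
  have z: "z = f (a0 + s / r) (b0 + t / r)" using x(2) st shift by simp
  have "dot 4 m m + r\<^sup>2 * ((a0 + s / r)\<^sup>2 + (b0 + t / r)\<^sup>2) = 1" using x(3) unfolding z fdot ou by simp
  then have "r\<^sup>2 * ((a0 + s / r)\<^sup>2 + (b0 + t / r)\<^sup>2) = r\<^sup>2" using n by linarith
  then have "(a0 + s / r)\<^sup>2 + (b0 + t / r)\<^sup>2 = 1" using cr(2) by simp
  then show "z \<in> C" unfolding fC z by blast
 qed
 then show thesis using that[of u w "bq u u"] uw(1) uu buw yu by blast
qed

definition gv :: "real => real => real => real => real => real => nat => real" where
 "gv a b e d s t = pt (\<lambda>j. if j = 0 then s else if j = 1 then t else if j = 2 then a * s + b * t else e * s + d * t)"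

lemma gv_coords: "\<eta> 0 (gv a b e d s t) = s" "\<eta> 1 (gv a b e d s t) = t"
 "\<eta> 2 (gv a b e d s t) = a * s + b * t" "\<eta> 3 (gv a b e d s t) = e * s + d * t"
 unfolding gv_def by (subst \<eta>_pt, simp, simp)+

lemma gv_Eucl: "gv a b e d s t \<in> Eucl 4" unfolding gv_def by (rule pt_Eucl)

lemma gv_lin: "gv a b e d s t = (\<lambda>i. s * gv a b e d 1 0 i + t * gv a b e d 0 1 i)"
 by (simp add: gv_def pt_def sum4 algebra_simps fun_eq_iff)

definition iso :: "(nat => real) => real => (real \<times> real \<times> real \<times> real) set" where
 "iso y l = isograph (1 - l * \<kappa> 0) (1 - l * \<kappa> 1) (1 + l * \<kappa> 2) (1 + l * \<kappa> 3) (\<eta> 0 y) (\<eta> 1 y) (\<eta> 2 y) (\<eta> 3 y)"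

lemma iso_iff:
 assumes y: "y \<in> Eucl 4"
 shows "(a, b, e, d) \<in> iso y l \<longleftrightarrow>
  bq (gv a b e d 1 0) (gv a b e d 1 0) = l * dot 4 (gv a b e d 1 0) (gv a b e d 1 0) \<and>
  bq (gv a b e d 0 1) (gv a b e d 0 1) = l * dot 4 (gv a b e d 0 1) (gv a b e d 0 1) \<and>
  bq (gv a b e d 1 0) (gv a b e d 0 1) = l * dot 4 (gv a b e d 1 0) (gv a b e d 0 1) \<and>
  bq y (gv a b e d 1 0) = l * dot 4 y (gv a b e d 1 0) \<and> bq y (gv a b e d 0 1) = l * dot 4 y (gv a b e d 0 1)"
 unfolding iso_def isograph_def dot_coords[OF gv_Eucl gv_Eucl] dot_coords[OF y gv_Eucl] bq_def sum4 gv_coords mem_Collect_eq prod.case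
proof (intro arg_cong2[of _ _ _ _ "(\<and>)"])
qed (auto simp: power2_eq_square algebra_simps)

text \<open>For \<open>l \<ge> 0\<close> the first two coordinates are injective on the plane: a vector in the kernel has
  \<open>q \<le> 0\<close>, while \<open>q\<close> is \<open>l\<close> times its squared norm.\<close>

lemma gv_plane:
 assumes o: "ortho 4 u w" and l: "l \<ge> 0" and b: "bq u u = l" "bq w w = l" "bq u w = 0"
 shows "\<exists>a b e d. plane u w = plane (gv a b e d 1 0) (gv a b e d 0 1)"
proof -
 have oo: "dot 4 u u = 1" "dot 4 w w = 1" "dot 4 u w = 0" "dot 4 w u = 0" "u \<in> Eucl 4" "w \<in> Eucl 4"
  using o by (auto simp: ortho_def dot_commute)
 define x where "x s t = (\<lambda>i. s * u i + t * w i)" for s t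
 have xE: "x s t \<in> Eucl 4" for s t unfolding x_def using oo by blast
 have \<eta>x: "\<eta> j (x s t) = s * \<eta> j u + t * \<eta> j w" for j s t unfolding x_def by (rule dot_lc')
 have bx: "bq (x s t) (x s t) = l * (s\<^sup>2 + t\<^sup>2)" for s t
  unfolding x_def bq_lc using b by (simp add: bq_commute[of w u] power2_eq_square algebra_simps)
 define D where "D = \<eta> 0 u * \<eta> 1 w - \<eta> 1 u * \<eta> 0 w"
 have inj: "s = 0 \<and> t = 0" if "\<eta> 0 (x s t) = 0" "\<eta> 1 (x s t) = 0" for s t
 proof -
  have "- ((\<eta> 2 (x s t))\<^sup>2 + (\<eta> 3 (x s t))\<^sup>2) = l * (s\<^sup>2 + t\<^sup>2)" using bx[of s t] that by (simp add: bq_def power2_eq_square)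
  moreover have "l * (s\<^sup>2 + t\<^sup>2) \<ge> 0" using l by simp
  ultimately have "(\<eta> 2 (x s t))\<^sup>2 + (\<eta> 3 (x s t))\<^sup>2 = 0" by (smt (verit) zero_le_power2)
  then have "\<eta> 2 (x s t) = 0" "\<eta> 3 (x s t) = 0" by (simp_all add: sum_power2_eq_zero_iff)
  then have "dot 4 (x s t) (x s t) = 0" unfolding dot_coords[OF xE xE] sum4 using that by simp
  moreover have "dot 4 (x s t) (x s t) = s\<^sup>2 + t\<^sup>2" unfolding x_def dot_lc dot_lc' oo by (simp add: power2_eq_square)
  ultimately show ?thesis by (simp add: sum_power2_eq_zero_iff)
 qed
 have D: "D \<noteq> 0"
 proof
  assume "D = 0"
  then have 0: "\<eta> 0 u * \<eta> 1 w = \<eta> 1 u * \<eta> 0 w" by (simp add: D_def)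
  have "\<eta> 0 w = 0 \<and> - \<eta> 0 u = 0" by (rule inj) (unfold \<eta>x, use 0 in \<open>simp_all add: algebra_simps\<close>)
  moreover have "\<eta> 1 w = 0 \<and> - \<eta> 1 u = 0" by (rule inj) (unfold \<eta>x, use 0 in \<open>simp_all add: algebra_simps\<close>)
  ultimately have "(1::real) = 0 \<and> (0::real) = 0" by (intro inj) (simp_all add: \<eta>x)
  then show False by simp
 qed
 define e1 where "e1 = x (\<eta> 1 w / D) (- \<eta> 1 u / D)"
 define e2 where "e2 = x (- \<eta> 0 w / D) (\<eta> 0 u / D)"
 have c: "\<eta> 0 e1 = 1" "\<eta> 1 e1 = 0" "\<eta> 0 e2 = 0" "\<eta> 1 e2 = 1"
  unfolding e1_def e2_def \<eta>x using D by (simp_all add: divide_simps) (simp_all add: D_def algebra_simps)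
 let ?g = "gv (\<eta> 2 e1) (\<eta> 2 e2) (\<eta> 3 e1) (\<eta> 3 e2)"
 have ee: "e1 \<in> Eucl 4" "e2 \<in> Eucl 4" unfolding e1_def e2_def by (rule xE)+
 have "e1 = ?g 1 0"
 proof (rule eq_by_coords[OF ee(1) gv_Eucl])
  fix j :: nat assume "j < 4"
  then show "\<eta> j e1 = \<eta> j (?g 1 0)" unfolding less4 by (elim disjE; hypsubst; simp add: gv_coords gv_coords[unfolded One_nat_def] c c[unfolded One_nat_def])
 qed
 moreover have "e2 = ?g 0 1"
 proof (rule eq_by_coords[OF ee(2) gv_Eucl])
  fix j :: nat assume "j < 4"
  then show "\<eta> j e2 = \<eta> j (?g 0 1)" unfolding less4 by (elim disjE; hypsubst; simp add: gv_coords gv_coords[unfolded One_nat_def] c c[unfolded One_nat_def])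
 qed
 moreover have "indep2 e1 e2" unfolding indep2_def
 proof (intro allI impI)
  fix s t assume "\<forall>i. s * e1 i + t * e2 i = 0"
  then have "(\<lambda>i. s * e1 i + t * e2 i) = (\<lambda>i. 0)" by (simp add: fun_eq_iff)
  then have "\<eta> j (\<lambda>i. s * e1 i + t * e2 i) = 0" for j by (simp add: dot_def)
  from this[of 0] this[of 1] show "s = 0 \<and> t = 0" unfolding dot_lc' c by simp
 qed
 then have "plane e1 e2 = plane u w" by (rule indep2_plane_eq) (unfold e1_def e2_def x_def, (rule plane_memI)+)
 ultimately show ?thesis by metis
qed

definition slice :: "(nat => real) => real \<times> real \<times> real \<times> real => (nat => real) set" where
 "slice y = (\<lambda>(a, b, e, d). {z. \<exists>s t. z = (\<lambda>i. y i + gv a b e d s t i) \<and> dot 4 z z = 1})"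

lemma slice_span: "slice y (a, b, e, d) = span_slice y (gv a b e d 1 0) (gv a b e d 0 1)"
proof (intro equalityI subsetI)
 fix z assume "z \<in> slice y (a, b, e, d)"
 then obtain s t where st: "z = (\<lambda>i. y i + gv a b e d s t i)" "dot 4 z z = 1" by (auto simp: slice_def)
 show "z \<in> span_slice y (gv a b e d 1 0) (gv a b e d 0 1)"
  by (rule span_sliceI[OF _ st]) (subst gv_lin, rule plane_memI)
next
 fix z assume "z \<in> span_slice y (gv a b e d 1 0) (gv a b e d 0 1)"
 then obtain x where x: "x \<in> plane (gv a b e d 1 0) (gv a b e d 0 1)" "z = (\<lambda>i. y i + x i)" "dot 4 z z = 1" by (rule span_sliceE)
 obtain s t where "x = gv a b e d s t" using x(1) unfolding plane_def gv_lin[symmetric] by blast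
 then show "z \<in> slice y (a, b, e, d)" using x unfolding slice_def prod.case mem_Collect_eq by (intro exI[of _ s] exI[of _ t]) simp
qed

text \<open>The slope is the eigenvalue \<open>l\<close> for which the plane of the circle is isotropic for \<open>q - l * norm\<^sup>2\<close>. It is stated
  by means of the points of the circle, so that it does not depend on coordinates.\<close>

definition slope :: "(nat => real) => (nat => real) set => real => bool" where
 "slope y C l \<longleftrightarrow> (\<forall>z\<in>C. bq (\<lambda>i. z i - y i) (\<lambda>i. z i - y i) = l * dot 4 (\<lambda>i. z i - y i) (\<lambda>i. z i - y i))"

definition circs :: "(nat => real) => (nat => real) set set" where
 "circs y = {C. circle 4 C \<and> y \<in> C \<and> C \<subseteq> Z}"

lemma circle_slope: assumes "C \<in> circs y" shows "\<exists>l. slope y C l"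
proof -
 have C: "circle 4 C" "C \<subseteq> Z" "y \<in> C" using assms by (auto simp: circs_def)
 obtain u w l where d: "ortho 4 u w" "C = span_slice y u w" "bq u u = l" "bq w w = l" "bq u w = 0"
  by (rule circle_data[OF C]) blast
 have oo: "dot 4 u u = 1" "dot 4 w w = 1" "dot 4 u w = 0" "dot 4 w u = 0"
  using d(1) by (auto simp: ortho_def dot_commute)
 have "slope y C l" unfolding slope_def
 proof
  fix z assume "z \<in> C"
  then obtain x where x: "x \<in> plane u w" "z = (\<lambda>i. y i + x i)" "dot 4 z z = 1" unfolding d(2) by (rule span_sliceE)
  then have zx: "(\<lambda>i. z i - y i) = x" by simp
  obtain s t where st: "x = (\<lambda>i. s * u i + t * w i)" using x(1) unfolding plane_def by blast
  show "bq (\<lambda>i. z i - y i) (\<lambda>i. z i - y i) = l * dot 4 (\<lambda>i. z i - y i) (\<lambda>i. z i - y i)"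
   unfolding zx st bq_lc dot_lc dot_lc' oo using d(3-5) by (simp add: bq_commute[of w u] algebra_simps)
 qed
 then show ?thesis by blast
qed

lemma slope_unique:
 assumes C: "C \<in> circs y" and "slope y C l" "slope y C l'" shows "l = l'"
proof -
 have "circle 4 C" "C \<subseteq> Z" using C by (auto simp: circs_def)
 then have "infinite C" unfolding circle_def using circle_infinite by fastforce
 then obtain z where z: "z \<in> C" "z \<noteq> y" using finite_subset[of C "{y}"] by blast
 have "z \<in> Eucl 4" "y \<in> Eucl 4" using C z by (auto simp: circs_def Z_bq)
 then have "(\<lambda>i. z i - y i) \<in> Eucl 4" using Eucl_lc[of z 4 y 1 "-1"] by simp
 then have "dot 4 (\<lambda>i. z i - y i) (\<lambda>i. z i - y i) > 0" by (rule dot_self_pos) (use z in \<open>auto simp: fun_eq_iff\<close>)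
 moreover have "l * dot 4 (\<lambda>i. z i - y i) (\<lambda>i. z i - y i) = l' * dot 4 (\<lambda>i. z i - y i) (\<lambda>i. z i - y i)"
  using assms(2,3) z(1) unfolding slope_def by metis
 ultimately show ?thesis by simp
qed

lemma circle_iso:
 assumes C: "C \<in> circs y" and l: "slope y C l" "l \<ge> 0"
 shows "\<exists>T\<in>iso y l. C = slice y T"
proof -
 have C': "circle 4 C" "C \<subseteq> Z" "y \<in> C" using C by (auto simp: circs_def)
 then have yE: "y \<in> Eucl 4" by (auto simp: Z_bq)
 obtain u w k where d: "ortho 4 u w" "C = span_slice y u w" "bq u u = k" "bq w w = k" "bq u w = 0"
  "bq y u = k * dot 4 y u" "bq y w = k * dot 4 y w"
  by (rule circle_data[OF C']) blast
 have oo: "dot 4 u u = 1" "dot 4 w w = 1" "dot 4 u w = 0" "dot 4 w u = 0"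
  using d(1) by (auto simp: ortho_def dot_commute)
 have bl: "bq x x' = k * dot 4 x x'" if x: "x \<in> plane u w" "x' \<in> plane u w" for x x'
 proof -
  obtain s t s' t' where st: "x = (\<lambda>i. s * u i + t * w i)" "x' = (\<lambda>i. s' * u i + t' * w i)" using x unfolding plane_def by blast
  show ?thesis unfolding st bq_lc dot_lc dot_lc' oo using d(3-5) by (simp add: bq_commute[of w u] algebra_simps)
 qed
 have bly: "bq y x = k * dot 4 y x" if x: "x \<in> plane u w" for x
 proof -
  obtain s t where st: "x = (\<lambda>i. s * u i + t * w i)" using x unfolding plane_def by blast
  show ?thesis unfolding st bq_lc dot_lc' d(6,7) by (simp add: algebra_simps)
 qed
 have "slope y C k" unfolding slope_def
 proof
  fix z assume "z \<in> C"
  then obtain x where x: "x \<in> plane u w" "z = (\<lambda>i. y i + x i)" "dot 4 z z = 1" unfolding d(2) by (rule span_sliceE)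
  then have zx: "(\<lambda>i. z i - y i) = x" by simp
  show "bq (\<lambda>i. z i - y i) (\<lambda>i. z i - y i) = k * dot 4 (\<lambda>i. z i - y i) (\<lambda>i. z i - y i)"
   unfolding zx by (rule bl[OF x(1) x(1)])
 qed
 then have kl: "k = l" using slope_unique[OF C] l(1) by blast
 then obtain a b e d' where g: "plane u w = plane (gv a b e d' 1 0) (gv a b e d' 0 1)"
  using gv_plane[OF d(1) l(2)] d(3-5) by blast
 have m: "gv a b e d' 1 0 \<in> plane u w" "gv a b e d' 0 1 \<in> plane u w" unfolding g by (rule plane_mem)+
 have "(a, b, e, d') \<in> iso y l"
  unfolding iso_iff[OF yE] kl[symmetric] using bl bly m by blast
 moreover have "C = slice y (a, b, e, d')" unfolding slice_span d(2) span_slice_def g ..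
 ultimately show ?thesis by blast
qed

end

lemma squared_cases: "A\<^sup>2 + B\<^sup>2 = r\<^sup>2 ==> r > 0 ==> \<exists>t. A = r * cos t \<and> B = r * sin t" for A B r :: real
proof -
 assume "A\<^sup>2 + B\<^sup>2 = r\<^sup>2" and r: "r > 0"
 then have "(A / r)\<^sup>2 + (B / r)\<^sup>2 = 1" by (simp add: power_divide add_divide_distrib[symmetric])
 then obtain t where "A / r = cos t" "B / r = sin t" using sincos_total_2pi by metis
 then show ?thesis using r by (intro exI[of _ t]) (simp add: field_simps)
qed

context torus
begin

lemma gv_indep: "indep2 (gv a b e d 1 0) (gv a b e d 0 1)" unfolding indep2_def
proof (intro allI impI)
 fix s t assume "\<forall>i. s * gv a b e d 1 0 i + t * gv a b e d 0 1 i = 0"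
 then have z: "gv a b e d s t = (\<lambda>i. 0)" by (subst gv_lin) (simp add: fun_eq_iff)
 have "\<eta> 0 (gv a b e d s t) = 0" "\<eta> 1 (gv a b e d s t) = 0" unfolding z by (simp_all add: dot_def)
 then show "s = 0 \<and> t = 0" unfolding gv_coords by simp
qed

lemma iso_plane:
 assumes y: "y \<in> Eucl 4" and T: "(a, b, e, d) \<in> iso y l" and x: "x \<in> plane (gv a b e d 1 0) (gv a b e d 0 1)"
 shows "bq x x = l * dot 4 x x" "bq y x = l * dot 4 y x"
proof -
 let ?e = "gv a b e d 1 0" and ?f = "gv a b e d 0 1"
 note h = T[unfolded iso_iff[OF y]]
 obtain s t where st: "x = (\<lambda>i. s * ?e i + t * ?f i)" using x unfolding plane_def by blast
 show "bq y x = l * dot 4 y x" unfolding st bq_lc dot_lc' using h by (simp add: algebra_simps)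
 show "bq x x = l * dot 4 x x" unfolding st bq_lc dot_lc dot_lc' using h
  by (simp add: bq_commute[of ?f ?e] dot_commute[of 4 ?f ?e] algebra_simps)
qed

text \<open>The vector \<open>x0\<close> ensures that the affine plane through \<open>y\<close> is not tangent to the sphere.\<close>

lemma slice_circs:
 assumes y: "y \<in> Z" and T: "T \<in> iso y l" and nz: "T = (a, b, e, d)" "x0 \<in> plane (gv a b e d 1 0) (gv a b e d 0 1)" "dot 4 y x0 \<noteq> 0"
 shows "slice y T \<in> circs y \<and> slope y (slice y T) l"
proof -
 have yE: "y \<in> Eucl 4" "dot 4 y y = 1" "bq y y = 0" using y by (auto simp: Z_bq)
 have T': "(a, b, e, d) \<in> iso y l" using T nz(1) by simp
 define V where "V = plane (gv a b e d 1 0) (gv a b e d 0 1)"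
 note iso = iso_plane[OF yE(1) T', folded V_def]
 have S: "slice y T = span_slice y (gv a b e d 1 0) (gv a b e d 0 1)" unfolding nz(1) by (rule slice_span)
 have VE: "V \<subseteq> Eucl 4" unfolding V_def by (rule plane_Eucl[OF gv_Eucl gv_Eucl])
 obtain u w where uw: "ortho 4 u w" "gcirc 4 (gv a b e d 1 0) (gv a b e d 0 1) = gcirc 4 u w"
  using gcirc_great[OF gv_indep, of a b e d 3] gv_Eucl great_circle_iff[of 3] by auto
 have oo: "dot 4 u u = 1" "dot 4 w w = 1" "dot 4 u w = 0" "dot 4 w u = 0" "u \<in> Eucl 4" "w \<in> Eucl 4"
  using uw(1) by (auto simp: ortho_def dot_commute)
 have "u \<in> gcirc 4 u w" "w \<in> gcirc 4 u w" unfolding gcirc_def using oo plane_mem by auto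
 then have "u \<in> gcirc 4 (gv a b e d 1 0) (gv a b e d 0 1)" "w \<in> gcirc 4 (gv a b e d 1 0) (gv a b e d 0 1)"
  unfolding uw(2) by simp_all
 then have uV: "u \<in> V" "w \<in> V" unfolding V_def gcirc_def by simp_all
 have Vuw: "plane u w = V" unfolding V_def
  by (rule indep2_plane_eq[OF ortho_indep2[OF uw(1)]]) (use uV in \<open>simp_all add: V_def\<close>)
 define A B where "A = dot 4 y u" and "B = dot 4 y w"
 define m where "m = (\<lambda>i. y i + ((- A) * u i + (- B) * w i))"
 define r where "r = sqrt (A\<^sup>2 + B\<^sup>2)"
 have AB: "A\<^sup>2 + B\<^sup>2 > 0"
 proof -
  have "x0 \<in> plane u w" using nz(2) Vuw V_def by simp
  then obtain s t where st: "x0 = (\<lambda>i. s * u i + t * w i)" unfolding plane_def by blast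
  have "s * A + t * B \<noteq> 0" using nz(3) unfolding st dot_lc' A_def B_def .
  then have "A \<noteq> 0 \<or> B \<noteq> 0" by auto
  then show ?thesis by (simp add: sum_power2_gt_zero_iff)
 qed
 have r: "r > 0" "r\<^sup>2 = A\<^sup>2 + B\<^sup>2" using AB by (simp_all add: r_def)
 have mE: "m \<in> Eucl 4"
 proof -
  have "(\<lambda>i. (- A) * u i + (- B) * w i) \<in> Eucl 4" using oo by blast
  from Eucl_lc[OF yE(1) this, of 1 1] show ?thesis by (simp add: m_def)
 qed
 have mu: "dot 4 m u = 0" "dot 4 m w = 0" unfolding m_def dot_affine using oo by (simp_all add: A_def B_def)
 have mm: "dot 4 m m = 1 - r\<^sup>2"
 proof -
  have "dot 4 m (\<lambda>i. y i + ((- A) * u i + (- B) * w i)) = dot 4 m y + ((- A) * dot 4 m u + (- B) * dot 4 m w)"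
   by (rule dot_affine(2))
  then have "dot 4 m m = dot 4 m y" unfolding m_def[symmetric] mu by simp
  also have "\<dots> = 1 - (A\<^sup>2 + B\<^sup>2)" unfolding m_def dot_affine(1) yE(2)
   by (simp add: dot_commute[of 4 u y] dot_commute[of 4 w y] A_def B_def power2_eq_square)
  finally show ?thesis using r by simp
 qed
 define g where "g s t = (\<lambda>i. m i + (s * u i + t * w i))" for s t
 have gn: "dot 4 (g s t) (g s t) = 1 - r\<^sup>2 + (s\<^sup>2 + t\<^sup>2)" for s t
  unfolding g_def dot_affine using oo mu mm by (simp add: dot_commute[of 4 u m] dot_commute[of 4 w m] power2_eq_square)
 have ys: "(\<lambda>i. y i + (s * u i + t * w i)) = g (A + s) (B + t)" for s t
  unfolding g_def m_def by (simp add: fun_eq_iff algebra_simps)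
 have eq: "slice y T = {\<lambda>i. m i + r * (cos t * u i + sin t * w i) | t. True}"
 proof (intro equalityI subsetI)
  fix z assume "z \<in> slice y T"
  then obtain x where x: "x \<in> V" "z = (\<lambda>i. y i + x i)" "dot 4 z z = 1" unfolding S V_def by (rule span_sliceE)
  obtain s t where st: "x = (\<lambda>i. s * u i + t * w i)" using x(1) unfolding Vuw[symmetric] plane_def by blast
  have z: "z = g (A + s) (B + t)" using x(2) unfolding st ys .
  have "(A + s)\<^sup>2 + (B + t)\<^sup>2 = r\<^sup>2" using x(3) unfolding z gn by simp
  from squared_cases[OF this r(1)] obtain p where p: "A + s = r * cos p" "B + t = r * sin p" by blast
  have "z = (\<lambda>i. m i + r * (cos p * u i + sin p * w i))" unfolding z p g_def by (simp add: fun_eq_iff algebra_simps)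
  then show "z \<in> {\<lambda>i. m i + r * (cos t * u i + sin t * w i) | t. True}" by blast
 next
  fix z assume "z \<in> {\<lambda>i. m i + r * (cos t * u i + sin t * w i) | t. True}"
  then obtain p where p: "z = (\<lambda>i. m i + r * (cos p * u i + sin p * w i))" by blast
  have zg: "z = g (r * cos p) (r * sin p)" unfolding p g_def by (simp add: fun_eq_iff algebra_simps)
  have "dot 4 z z = 1" unfolding zg gn by (simp add: power_mult_distrib distrib_left[symmetric])
  moreover have "z = (\<lambda>i. y i + ((r * cos p - A) * u i + (r * sin p - B) * w i))" unfolding ys zg by simp
  moreover have "(\<lambda>i. (r * cos p - A) * u i + (r * sin p - B) * w i) \<in> V" unfolding Vuw[symmetric] by (rule plane_memI)
  ultimately show "z \<in> slice y T" unfolding S V_def by (intro span_sliceI)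
 qed
 have "circle_around 4 m r (slice y T)" unfolding circle_around_def eq using oo by blast
 then have c: "circle 4 (slice y T)" unfolding circle_def using mE r(1) by blast
 have bz: "bq (\<lambda>i. z i - y i) (\<lambda>i. z i - y i) = l * dot 4 (\<lambda>i. z i - y i) (\<lambda>i. z i - y i) \<and> z \<in> Z" if zS: "z \<in> slice y T" for z
 proof -
  from zS obtain x where x: "x \<in> V" "z = (\<lambda>i. y i + x i)" "dot 4 z z = 1" unfolding S V_def by (rule span_sliceE)
  have zx: "(\<lambda>i. z i - y i) = x" using x(2) by simp
  have zE: "z \<in> Eucl 4" unfolding x(2) using Eucl_lc[OF yE(1), of x 1 1] x(1) VE by auto
  have "bq z z = 2 * bq y x + bq x x" unfolding x(2) bq_add yE(3) by (simp add: bq_commute[of x y])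
  also have "\<dots> = l * (2 * dot 4 y x + dot 4 x x)" unfolding iso[OF x(1)] by (simp add: algebra_simps)
  also have "2 * dot 4 y x + dot 4 x x = dot 4 z z - dot 4 y y" unfolding x(2) dot_add by (simp add: dot_commute[of 4 x y])
  also have "\<dots> = 0" using x(3) yE(2) by simp
  finally have "bq z z = 0" by simp
  then show ?thesis unfolding zx using iso(1)[OF x(1)] zE x(3) by (simp add: Z_bq)
 qed
 have "y \<in> slice y T" unfolding S
 proof (rule span_sliceI)
  show "(\<lambda>i. 0 * gv a b e d 1 0 i + 0 * gv a b e d 0 1 i) \<in> plane (gv a b e d 1 0) (gv a b e d 0 1)" by (rule plane_memI)
 qed (use yE in simp_all)
 then show ?thesis using c bz unfolding circs_def slope_def by blast
qed

text \<open>The reflection of \<open>y\<close> in the hyperplane orthogonal to a vector of the plane lies on the circle, so the circle determines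
  every vector of the plane that is not orthogonal to \<open>y\<close>; these span the plane.\<close>

lemma slice_inj:
 assumes y: "y \<in> Z" and nz: "x0 \<in> plane (gv a b e d 1 0) (gv a b e d 0 1)" "dot 4 y x0 \<noteq> 0"
  and eq: "slice y (a, b, e, d) = slice y (a', b', e', d')"
 shows "(a, b, e, d) = (a', b', e', d')"
proof -
 have yE: "y \<in> Eucl 4" "dot 4 y y = 1" using y by (auto simp: Z_bq)
 define m n where "m = dot 4 y (gv a b e d 1 0)" and "n = dot 4 y (gv a b e d 0 1)"
 have yg: "dot 4 y (gv a b e d s t) = s * m + t * n" for s t
  by (subst gv_lin) (simp only: dot_lc' m_def n_def)
 have main: "a * s + b * t = a' * s + b' * t \<and> e * s + d * t = e' * s + d' * t" if st: "s * m + t * n \<noteq> 0" for s t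
 proof -
  define x where "x = gv a b e d s t"
  have xE: "x \<in> Eucl 4" unfolding x_def by (rule gv_Eucl)
  have yx: "dot 4 y x \<noteq> 0" unfolding x_def yg using st .
  have "x \<noteq> (\<lambda>i. 0)" using yx by (auto simp: dot_def)
  then have xx: "dot 4 x x > 0" by (rule dot_self_pos[OF xE])
  \<comment> \<open>With this factor y + k x is the mirror image of y.\<close>
  define k where "k = - 2 * dot 4 y x / dot 4 x x"
  have k: "k \<noteq> 0" "k * dot 4 x x = - 2 * dot 4 y x" using yx xx by (simp_all add: k_def)
  have kx: "(\<lambda>i. y i + k * x i) = (\<lambda>i. y i + gv a b e d (k * s) (k * t) i)"
   unfolding x_def gv_lin[of a b e d s t] gv_lin[of a b e d "k * s" "k * t"] by (simp add: algebra_simps)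
  have "dot 4 (\<lambda>i. y i + k * x i) (\<lambda>i. y i + k * x i) = 1 + k * (2 * dot 4 y x + k * dot 4 x x)"
   unfolding dot_add dot_scale yE(2) by (simp add: dot_commute[of 4 x y] algebra_simps)
  also have "\<dots> = 1" using k by simp
  finally have "(\<lambda>i. y i + k * x i) \<in> slice y (a, b, e, d)" unfolding kx slice_def prod.case mem_Collect_eq by blast
  then have "(\<lambda>i. y i + gv a b e d (k * s) (k * t) i) \<in> slice y (a', b', e', d')" unfolding eq kx .
  then obtain s' t' where "(\<lambda>i. y i + gv a b e d (k * s) (k * t) i) = (\<lambda>i. y i + gv a' b' e' d' s' t' i)"
   unfolding slice_def prod.case mem_Collect_eq by blast
  then have gg: "gv a b e d (k * s) (k * t) = gv a' b' e' d' s' t'" by (simp add: fun_eq_iff)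
  have h: "k * s = s'" "k * t = t'" "a * (k * s) + b * (k * t) = a' * s' + b' * t'" "e * (k * s) + d * (k * t) = e' * s' + d' * t'"
   using arg_cong[OF gg, of "\<eta> 0"] arg_cong[OF gg, of "\<eta> 1"] arg_cong[OF gg, of "\<eta> 2"] arg_cong[OF gg, of "\<eta> 3"]
   unfolding gv_coords by simp_all
  have "k * (a * s + b * t) = k * (a' * s + b' * t)" "k * (e * s + d * t) = k * (e' * s + d' * t)"
   using h(3,4) unfolding h(1,2)[symmetric] by (simp_all add: algebra_simps)
  then show ?thesis using k(1) by simp
 qed
 have mn: "m \<noteq> 0 \<or> n \<noteq> 0"
 proof -
  obtain s t where "x0 = gv a b e d s t" using nz(1) unfolding plane_def gv_lin[symmetric] by blast
  then show ?thesis using nz(2) yg by auto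
 qed
 then have "m * m + n * n > 0" using sum_power2_gt_zero_iff[of m n] by (simp add: power2_eq_square)
 then have mm: "m * m + n * n \<noteq> 0" by linarith
 have all: "a * s + b * t = a' * s + b' * t \<and> e * s + d * t = e' * s + d' * t" for s t
 proof (cases "s * m + t * n = 0")
  case False then show ?thesis by (rule main)
 next
  case True
  then have "(s + m) * m + (t + n) * n \<noteq> 0" using mm by (simp add: algebra_simps)
  from main[OF this] main[OF mm] show ?thesis by (simp add: algebra_simps)
 qed
 from all[of 1 0] all[of 0 1] show ?thesis by simp
qed

lemma slice_not_orthogonal:
 assumes y: "y \<in> Z" "\<eta> 1 y \<noteq> 0" and T: "(a, b, e, d) \<in> iso y l" and l: "l = 0 \<or> l * \<kappa> 1 = 1"
 shows "\<exists>x0\<in>plane (gv a b e d 1 0) (gv a b e d 0 1). dot 4 y x0 \<noteq> 0"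
 using l
proof
 have yE: "y \<in> Eucl 4" "dot 4 y y = 1" using y by (auto simp: Z_bq)
 assume l: "l = 0"
 then have "(a, b, e, d) \<in> isograph 1 1 1 1 (\<eta> 0 y) (\<eta> 1 y) (\<eta> 2 y) (\<eta> 3 y)" using T by (simp add: iso_def)
 note h = isograph_orthogonal[OF this]
 have "gv a b e d (\<eta> 0 y) (\<eta> 1 y) = y"
 proof (rule eq_by_coords[OF gv_Eucl yE(1)])
  fix j :: nat assume "j < 4"
  then show "\<eta> j (gv a b e d (\<eta> 0 y) (\<eta> 1 y)) = \<eta> j y" unfolding less4
   by (elim disjE; hypsubst; unfold gv_coords h) (rule refl)+
 qed
 then have "y \<in> plane (gv a b e d 1 0) (gv a b e d 0 1)" by (subst (asm) gv_lin) (metis plane_memI)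
 then show ?thesis using yE(2) by force
next
 have yE: "y \<in> Eucl 4" "dot 4 y y = 1" using y by (auto simp: Z_bq)
 assume l: "l * \<kappa> 1 = 1"
 have k: "\<kappa> 1 > 0" "\<kappa> 2 > 0" "\<kappa> 3 > 0" using \<kappa>_pos by simp_all
 have l0: "l > 0" using l k(1) by (metis zero_less_mult_pos2 zero_less_one)
 have "(1 + l * \<kappa> 2) * b\<^sup>2 + (1 + l * \<kappa> 3) * d\<^sup>2 = 0" using T l by (simp add: iso_def isograph_def)
 moreover have "(1 + l * \<kappa> 2) > 0" "(1 + l * \<kappa> 3) > 0" using l0 k by (simp_all add: add_pos_pos)
 then have "(1 + l * \<kappa> 2) * b\<^sup>2 \<ge> 0" "(1 + l * \<kappa> 3) * d\<^sup>2 \<ge> 0" by simp_all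
 ultimately have "(1 + l * \<kappa> 2) * b\<^sup>2 = 0" "(1 + l * \<kappa> 3) * d\<^sup>2 = 0" by linarith+
 then have bd: "b = 0" "d = 0" using \<open>(1 + l * \<kappa> 2) > 0\<close> \<open>(1 + l * \<kappa> 3) > 0\<close> by auto
 have "dot 4 y (gv a b e d 0 1) = \<kappa> 1 * \<eta> 1 y"
  unfolding dot_coords[OF yE(1) gv_Eucl] sum4 gv_coords bd by simp
 then have "dot 4 y (gv a b e d 0 1) \<noteq> 0" using y(2) k by simp
 then show ?thesis using plane_mem by blast
qed

lemma card_slope:
 assumes y: "y \<in> Z" "\<eta> 1 y \<noteq> 0" and l: "l \<ge> 0" "l = 0 \<or> l * \<kappa> 1 = 1"
 shows "card {C\<in>circs y. slope y C l} = card (iso y l)"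
proof -
 have "bij_betw (slice y) (iso y l) {C\<in>circs y. slope y C l}"
  unfolding bij_betw_def
 proof (intro conjI inj_onI equalityI subsetI)
  fix T T' assume T: "T \<in> iso y l" and eq: "slice y T = slice y T'"
  obtain a b e d a' b' e' d' where TT: "T = (a, b, e, d)" "T' = (a', b', e', d')" by (cases T, cases T')
  obtain x0 where x: "x0 \<in> plane (gv a b e d 1 0) (gv a b e d 0 1)" "dot 4 y x0 \<noteq> 0"
   using slice_not_orthogonal[OF y T[unfolded TT] l(2)] by blast
  show "T = T'" unfolding TT by (rule slice_inj[OF y(1) x eq[unfolded TT]])
 next
  fix C assume "C \<in> slice y ` iso y l"
  then obtain T where T: "T \<in> iso y l" "C = slice y T" by blast
  obtain a b e d where TT: "T = (a, b, e, d)" by (cases T)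
  obtain x0 where x: "x0 \<in> plane (gv a b e d 1 0) (gv a b e d 0 1)" "dot 4 y x0 \<noteq> 0"
   using slice_not_orthogonal[OF y T(1)[unfolded TT] l(2)] by blast
  show "C \<in> {C\<in>circs y. slope y C l}" unfolding T(2) using slice_circs[OF y(1) T(1) TT x] by simp
 next
  fix C assume "C \<in> {C\<in>circs y. slope y C l}"
  then show "C \<in> slice y ` iso y l" using circle_iso[of C y l] l(1) by blast
 qed
 from bij_betw_same_card[OF this] show ?thesis ..
qed

lemma iso_norm:
 assumes "y \<in> Z"
 shows "(1 + l * \<kappa> 2) * (\<eta> 2 y)\<^sup>2 + (1 + l * \<kappa> 3) * (\<eta> 3 y)\<^sup>2 = (1 - l * \<kappa> 0) * (\<eta> 0 y)\<^sup>2 + (1 - l * \<kappa> 1) * (\<eta> 1 y)\<^sup>2 + l"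
proof -
 have h: "\<kappa> 0 * (\<eta> 0 y)\<^sup>2 + \<kappa> 1 * (\<eta> 1 y)\<^sup>2 + \<kappa> 2 * (\<eta> 2 y)\<^sup>2 + \<kappa> 3 * (\<eta> 3 y)\<^sup>2 = 1"
  "(\<eta> 0 y)\<^sup>2 + (\<eta> 1 y)\<^sup>2 = (\<eta> 2 y)\<^sup>2 + (\<eta> 3 y)\<^sup>2" using assms unfolding Z_iff sum4 by simp_all
 have "l * (\<kappa> 0 * (\<eta> 0 y)\<^sup>2 + \<kappa> 1 * (\<eta> 1 y)\<^sup>2 + \<kappa> 2 * (\<eta> 2 y)\<^sup>2 + \<kappa> 3 * (\<eta> 3 y)\<^sup>2) = l" unfolding h(1) by simp
 then show ?thesis using h(2) by (simp add: algebra_simps)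
qed

lemma card_circs_orthogonal:
 assumes y: "y \<in> Z" "\<eta> 0 y \<noteq> 0" "\<eta> 1 y \<noteq> 0"
 shows "card {C\<in>circs y. slope y C 0} = 2"
proof -
 have "card {C\<in>circs y. slope y C 0} = card (iso y 0)" by (rule card_slope) (use y in simp_all)
 also have "\<dots> = 2" unfolding iso_def using card_isograph_orthogonal[of "\<eta> 0 y" "\<eta> 1 y" "\<eta> 2 y" "\<eta> 3 y"] y by (simp add: Z_iff)
 finally show ?thesis .
qed

lemma card_circs_tangent:
 assumes y: "y \<in> Z" "\<eta> 1 y \<noteq> 0"
 shows "card {C\<in>circs y. slope y C (1 / \<kappa> 1)} = (if \<kappa> 0 < \<kappa> 1 then 2 else 1)"
proof -
 define l where "l = 1 / \<kappa> 1"
 have k: "\<kappa> 0 > 0" "\<kappa> 1 > 0" "\<kappa> 2 > 0" "\<kappa> 3 > 0" using \<kappa>_pos by simp_all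
 have l: "l > 0" "l * \<kappa> 1 = 1" using k by (simp_all add: l_def)
 have P: "1 + l * \<kappa> 2 > 0" "1 + l * \<kappa> 3 > 0" using l k by (simp_all add: add_pos_pos)
 have "card {C\<in>circs y. slope y C l} = card (iso y l)" by (rule card_slope) (use y l in simp_all)
 also have "\<dots> = (if \<kappa> 0 < \<kappa> 1 then 2 else 1)"
 proof (cases "\<kappa> 0 < \<kappa> 1")
  case True
  then have A: "1 - l * \<kappa> 0 > 0" using k by (simp add: l_def)
  have "card (iso y l) = 2" unfolding iso_def l(2) diff_self
   by (rule card_isograph_degenerate[OF P A l(1)]) (use iso_norm[OF y(1), of l] l(2) in simp)
  then show ?thesis using True by simp
 next
  case False
  then have "\<kappa> 0 = \<kappa> 1" using \<kappa>01 by simp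
  then have "iso y l = {(0, 0, 0, 0)}" unfolding iso_def using l(2) isograph_0[OF P] by simp
  then show ?thesis using False by simp
 qed
 finally show ?thesis unfolding l_def .
qed

text \<open>For other positive \<open>l\<close> the form is nondegenerate on the first two coordinates, and \<open>y\<close> has value \<open>- l \<noteq> 0\<close> under it.\<close>

lemma slope_positive:
 assumes C: "C \<in> circs y" "slope y C l" "l > 0"
 shows "l = 1 / \<kappa> 1"
proof (rule ccontr)
 assume n: "l \<noteq> 1 / \<kappa> 1"
 have k: "\<kappa> 0 > 0" "\<kappa> 1 > 0" "\<kappa> 2 > 0" "\<kappa> 3 > 0" using \<kappa>_pos by simp_all
 have yZ: "y \<in> Z" using C(1) by (auto simp: circs_def)
 have P: "1 + l * \<kappa> 2 > 0" "1 + l * \<kappa> 3 > 0" using C(3) k by (simp_all add: add_pos_pos)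
 have "l * \<kappa> 0 \<le> l * \<kappa> 1" using \<kappa>01 C(3) by simp
 then have "iso y l = {}" unfolding iso_def
  by (intro isograph_empty[OF P]) (use n k iso_norm[OF yZ, of l] C(3) in \<open>auto simp: field_simps\<close>)
 then show False using circle_iso[OF C(1,2)] C(3) by force
qed

definition swap :: "nat => nat" where
 "swap j = (if j = 0 then 2 else if j = 1 then 3 else if j = 2 then 0 else if j = 3 then 1 else j)"

text \<open>Exchanging the two sides of the equation of \<open>Z\<close> changes the sign of \<open>q\<close> and of the slopes, which reduces negative slopes to
  positive ones.\<close>

lemma torus_swap: "torus (\<lambda>j. c (swap j)) (\<lambda>j. v (swap j)) (\<lambda>j. \<kappa> (swap j)) Z"
proof
 have s: "swap 0 = 2" "swap 1 = 3" "swap 2 = 0" "swap 3 = 1" by (simp_all add: swap_def)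
 have s4: "swap j < 4" if "j < 4" for j using that by (auto simp: swap_def)
 have sinj: "swap i = swap j \<longleftrightarrow> i = j" if "i < 4" "j < 4" for i j using that unfolding less4 by (auto simp: swap_def)
 have ss: "(\<Sum>j<4. F (swap j)) = (\<Sum>j<4. F j)" for F :: "nat => real" unfolding sum4 s by simp
 show "torus_coords (\<lambda>j. c (swap j)) (\<lambda>j. v (swap j)) (\<lambda>j. \<kappa> (swap j)) Z"
  unfolding torus_coords_def
 proof (intro conjI allI impI ballI)
  show "c (swap j) \<in> Eucl 4" "v (swap j) \<in> Eucl 4" "\<kappa> (swap j) > 0" if "j < 4" for j
   using cE vE \<kappa>_pos s4[OF that] by blast+
  show "dot 4 (c (swap i)) (v (swap j)) = (if i = j then 1 else 0)" if "i < 4" "j < 4" for i j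
   using dual[OF s4 s4, OF that] sinj[OF that] by simp
  show "y i = (\<Sum>j<4. dot 4 (c (swap j)) y * v (swap j) i)" if "y \<in> Eucl 4" for y i
   using expand[OF that, of i] ss[of "\<lambda>j. \<eta> j y * v j i"] by simp
  show "dot 4 x y = (\<Sum>j<4. \<kappa> (swap j) * (dot 4 (c (swap j)) x * dot 4 (c (swap j)) y))" if "x \<in> Eucl 4" "y \<in> Eucl 4" for x y
   using dot_coords[OF that] ss[of "\<lambda>j. \<kappa> j * (\<eta> j x * \<eta> j y)"] by simp
  show "\<kappa> (swap 0) \<le> \<kappa> (swap 1)" "\<kappa> (swap 2) \<le> \<kappa> (swap 3)" unfolding s using \<kappa>01 \<kappa>23 by simp_all
  show "Z = {y \<in> topspace (nsphere 3). (dot 4 (c (swap 0)) y)\<^sup>2 + (dot 4 (c (swap 1)) y)\<^sup>2 =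
    (dot 4 (c (swap 2)) y)\<^sup>2 + (dot 4 (c (swap 3)) y)\<^sup>2}"
   unfolding s by (subst Z_eq) (auto simp: eq_commute)
 qed
 show "surface 4 Z" by (rule surf)
qed

theorem card_circs:
 assumes y: "y \<in> Z" "\<And>j. j < 4 ==> \<eta> j y \<noteq> 0"
 shows "finite (circs y) \<and> card (circs y) = 2 + (if \<kappa> 0 < \<kappa> 1 then 2 else 1) + (if \<kappa> 2 < \<kappa> 3 then 2 else 1)"
proof -
 interpret sw: torus "\<lambda>j. c (swap j)" "\<lambda>j. v (swap j)" "\<lambda>j. \<kappa> (swap j)" Z by (rule torus_swap)
 have s: "swap 0 = 2" "swap 1 = 3" "swap 2 = 0" "swap 3 = 1" by (simp_all add: swap_def)
 have bqs: "sw.bq x z = - bq x z" for x z unfolding sw.bq_def bq_def s by simp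
 have sls: "sw.slope y C l \<longleftrightarrow> slope y C (- l)" for C l
  unfolding sw.slope_def slope_def bqs by (intro ball_cong refl) linarith
 have k: "\<kappa> 1 > 0" "\<kappa> 3 > 0" using \<kappa>_pos by simp_all
 have nz: "\<eta> 0 y \<noteq> 0" "\<eta> 1 y \<noteq> 0" "\<eta> 3 y \<noteq> 0" using y(2) by simp_all
 define S where "S l = {C\<in>circs y. slope y C l}" for l
 have c0: "card (S 0) = 2" unfolding S_def by (rule card_circs_orthogonal[OF y(1) nz(1,2)])
 have c1: "card (S (1 / \<kappa> 1)) = (if \<kappa> 0 < \<kappa> 1 then 2 else 1)" unfolding S_def by (rule card_circs_tangent[OF y(1) nz(2)])
 have c3: "card (S (- (1 / \<kappa> 3))) = (if \<kappa> 2 < \<kappa> 3 then 2 else 1)"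
  using sw.card_circs_tangent[OF y(1)] nz(3) unfolding s sls S_def by simp
 have un: "circs y = S 0 \<union> S (1 / \<kappa> 1) \<union> S (- (1 / \<kappa> 3))"
 proof (intro equalityI subsetI)
  fix C assume C: "C \<in> circs y"
  then obtain l where l: "slope y C l" using circle_slope by blast
  consider "l = 0" | "l > 0" | "l < 0" by linarith
  then have "l = 0 \<or> l = 1 / \<kappa> 1 \<or> l = - (1 / \<kappa> 3)"
  proof cases
   case 2 then show ?thesis using slope_positive[OF C l] by simp
  next
   case 3
   have "sw.slope y C (- l)" using l unfolding sls by simp
   from sw.slope_positive[OF C this] 3 show ?thesis unfolding s by simp
  qed simp
  then show "C \<in> S 0 \<union> S (1 / \<kappa> 1) \<union> S (- (1 / \<kappa> 3))" using C l unfolding S_def by auto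
 qed (auto simp: S_def)
 have fin: "finite (S 0)" "finite (S (1 / \<kappa> 1))" "finite (S (- (1 / \<kappa> 3)))"
  by (rule card_ge_0_finite, unfold c0 c1 c3, simp)+
 have dis: "S l \<inter> S l' = {}" if "l \<noteq> l'" for l l' using slope_unique that unfolding S_def by blast
 have p: "1 / \<kappa> 1 > 0" "1 / \<kappa> 3 > 0" using k by simp_all
 have d1: "S 0 \<inter> S (1 / \<kappa> 1) = {}" by (rule dis) (use p in linarith)
 have "1 / \<kappa> 1 \<noteq> - (1 / \<kappa> 3)" "0 \<noteq> - (1 / \<kappa> 3)" using p by linarith+
 from dis[OF this(1)] dis[OF this(2)]
 have d2: "(S 0 \<union> S (1 / \<kappa> 1)) \<inter> S (- (1 / \<kappa> 3)) = {}" by blast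
 have "card (circs y) = card (S 0) + card (S (1 / \<kappa> 1)) + card (S (- (1 / \<kappa> 3)))"
  unfolding un using card_Un_disjoint[OF _ fin(3) d2] card_Un_disjoint[OF fin(1,2) d1] fin by simp
 then show ?thesis unfolding c0 c1 c3 using fin un by simp
qed

text \<open>Its zero set is the exceptional set for the count of circles.\<close>

definition coord_prod :: "(nat => complex) => complex" where
 "coord_prod x = (XC 0 x * XC 1 x) * (XC 2 x * XC 3 x)"

lemma coord_prod_form: "coord_prod \<in> forms 4"
 unfolding coord_prod_def[abs_def] by (intro forms_mult'[where d = 2 and e = 2] forms_mult'[where d = "Suc 0" and e = "Suc 0"] XC_form) simp_all

definition B0 :: "pt set" where "B0 = {P\<in>proj_space 4. \<forall>x\<in>P. coord_prod x = 0}"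

lemma B0_closed: "proj_closed 4 B0" unfolding B0_def by (rule proj_cl_form[OF coord_prod_form])

lemma embed_B0:
 assumes "y \<in> Eucl 4" shows "embed y \<in> B0 \<longleftrightarrow> (\<exists>j<4. \<eta> j y = 0)"
proof -
 have cp: "coord_prod (hv y) = 0 \<longleftrightarrow> (\<exists>j<4. \<eta> j y = 0)"
  unfolding coord_prod_def XC_hv by (auto simp: less4)
 have "coord_prod x = 0" if "coord_prod (hv y) = 0" "x \<in> embed y" for x
 proof -
  from that(2) obtain k where "x = (\<lambda>i. k * hv y i)" unfolding embed_hv proj_point_def by blast
  then show ?thesis using forms_scale[OF coord_prod_form, of k "hv y"] that(1) by simp
 qed
 moreover have "hv y \<in> embed y" unfolding embed_hv by (rule proj_point_self)
 ultimately have "embed y \<in> B0 \<longleftrightarrow> coord_prod (hv y) = 0"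
  unfolding B0_def using embed_proj[OF assms] by blast
 then show ?thesis using cp by simp
qed

lemma circles_through_eq: "circles_through (stereo_image Z) y = circs y"
proof -
 have "embed ` C \<subseteq> M \<longleftrightarrow> C \<subseteq> Z" if "circle 4 C" for C
 proof -
  from that obtain m r where cr: "m \<in> Eucl 4" "circle_around 4 m r C" unfolding circle_def by blast
  have "C \<subseteq> Eucl 4"
  proof
   fix z assume z: "z \<in> C"
   obtain u w where uw: "u \<in> Eucl 4" "w \<in> Eucl 4" "C = {\<lambda>i. m i + r * (cos t * u i + sin t * w i) | t. True}"
    using cr(2) unfolding circle_around_def by (elim bexE conjE)
   obtain t where t: "z = (\<lambda>i. m i + r * (cos t * u i + sin t * w i))" using z unfolding uw(3) by blast
   have "(\<lambda>i. cos t * u i + sin t * w i) \<in> Eucl 4" using uw by blast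
   from Eucl_lc[OF cr(1) this, of 1 r] show "z \<in> Eucl 4" unfolding t by simp
  qed
  then show ?thesis using embed_M by blast
 qed
 then show ?thesis unfolding circles_through_def circs_def moebius_model_eq by blast
qed

lemma exists_generic: "\<exists>y\<in>Z. \<forall>j<4. \<eta> j y \<noteq> 0"
proof -
 define a where "a = sqrt (\<Sum>j<4. \<kappa> j)"
 have "(\<Sum>j<4. \<kappa> j) > 0" unfolding sum4 using \<kappa>_pos by (simp add: add_pos_pos)
 then have a: "a\<^sup>2 = (\<Sum>j<4. \<kappa> j * 1\<^sup>2)" "a \<noteq> 0" by (simp_all add: a_def)
 have "pt (\<lambda>j. 1 / a) \<in> Z" by (rule pt_Z[of "\<lambda>j. 1", OF _ a]) simp
 moreover have "\<forall>j<4. \<eta> j (pt (\<lambda>j. 1 / a)) \<noteq> 0" using a(2) by (simp add: \<eta>_pt)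
 ultimately show ?thesis by blast
qed

text \<open>The count is exact on a dense set, so it cannot be exceeded outside any proper closed set \<open>B\<close>: some real
  point avoids both \<open>B\<close> and the exceptional set.\<close>

lemma circled_card:
 assumes N: "\<And>y. y \<in> Z ==> (\<And>j. j < 4 ==> \<eta> j y \<noteq> 0) ==> finite (circs y) \<and> card (circs y) = N"
 shows "circled (enat N) (stereo_image Z)"
 unfolding circled_def
proof (intro conjI impI)
 obtain y0 where y0: "y0 \<in> Z" "\<forall>j<4. \<eta> j y0 \<noteq> 0" using exists_generic by blast
 have y0E: "y0 \<in> Eucl 4" using y0 by (simp add: Z_iff)
 have MB: "\<not> M \<subseteq> B0" using embed_M[OF y0E] embed_B0[OF y0E] y0 by blast
 show "at_least_circled (enat N) (stereo_image Z)"
  unfolding at_least_circled_def moebius_model_eq circles_through_eq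
 proof (intro exI[of _ B0] conjI ballI impI B0_closed MB)
  fix y assume y: "y \<in> Eucl 4" "embed y \<in> M - B0"
  have "y \<in> Z" "\<And>j. j < 4 ==> \<eta> j y \<noteq> 0" using y embed_M[OF y(1)] embed_B0[OF y(1)] by auto
  then show "enat N \<le> enat (card (circs y))" using N by simp
 qed
 show "\<not> at_least_circled (enat N + 1) (stereo_image Z)"
 proof
  assume "at_least_circled (enat N + 1) (stereo_image Z)"
  then obtain B where B: "proj_closed 4 B" "\<not> M \<subseteq> B"
   "\<And>y. y \<in> Eucl 4 ==> embed y \<in> M - B ==> finite (circs y) ==> enat N + 1 \<le> enat (card (circs y))"
   unfolding at_least_circled_def moebius_model_eq circles_through_eq by blast
  have cl: "proj_closed 4 (B \<union> B0)" using B(1) B0_closed proj_z.cl_Un unfolding proj_closed_cl by blast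
  have "\<exists>y\<in>Z. embed y \<notin> B \<union> B0"
  proof (rule ccontr)
   assume "\<not> ?thesis"
   then have "embed ` stereo_preimage (stereo_image Z) \<subseteq> B \<union> B0" unfolding stereo_preimage_image[OF Z_sphere] by blast
   then have "moebius_model (stereo_image Z) \<subseteq> B \<union> B0" using cl unfolding moebius_model_def proj_closure_def by blast
   then have sub: "M \<subseteq> B \<union> B0" unfolding moebius_model_eq .
   have c: "proj_closed 4 (M \<inter> B)" "proj_closed 4 (M \<inter> B0)"
    using M_closed B(1) B0_closed proj_z.cl_Int unfolding proj_closed_cl by blast+
   have "M = (M \<inter> B) \<union> (M \<inter> B0)" using sub by blast
   then have "M = M \<inter> B \<or> M = M \<inter> B0" using M_irreducible c unfolding irreducible_closed_def by blast
   then show False using B(2) MB by blast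
  qed
  then obtain y where y: "y \<in> Z" "embed y \<notin> B" "embed y \<notin> B0" by blast
  have yE: "y \<in> Eucl 4" using y by (simp add: Z_iff)
  have g: "finite (circs y) \<and> card (circs y) = N" by (rule N) (use y embed_B0[OF yE] in auto)
  have "enat N + 1 \<le> enat N" using B(3)[OF yE] y g embed_M[OF yE] by auto
  then show False by (simp add: one_enat_def)
 qed
qed

theorem circle_count:
 "circled (enat (2 + (if \<kappa> 0 < \<kappa> 1 then 2 else 1) + (if \<kappa> 2 < \<kappa> 3 then 2 else 1))) (stereo_image Z)"
 by (rule circled_card) (rule card_circs)

end

section \<open>The classification\<close>

theorem corollary3:
  fixes n :: nat and Z :: "(nat \<Rightarrow> real) set"
  assumes "n \<ge> 3"
    and "surface (Suc n) Z"
    and "Z \<subseteq> topspace (nsphere n)"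
    and "two_great_circles_through_general_point n Z"
    and "\<not> in_hyperplane_section n Z"
  shows "n = 3 \<and>
    (blum_cyclide (stereo_image Z) \<or> perseus_cyclide (stereo_image Z) \<or>
     ring_cyclide (stereo_image Z))"
proof -
  obtain B where B: "real_closed (Suc n) B" "\<not> Z \<subseteq> B"
    "\<forall>p \<in> Z - B. \<exists>C D. C \<noteq> D \<and> great_circle n C \<and> great_circle n D \<and> p \<in> C \<inter> D \<and> C \<union> D \<subseteq> Z"
    using assms(4) unfolding two_great_circles_through_general_point_def by (elim exE conjE)
  have dr: "doubly_ruled n Z B"
    by (rule doubly_ruled.intro[OF assms(1-3) B(1,2) B(3)[rule_format] assms(5)])
  have n: "n = 3" by (rule doubly_ruled.quadric(1)[OF dr])
  obtain l :: "nat \<Rightarrow> nat \<Rightarrow> real" where l: "\<forall>c. \<exists>y\<in>Eucl 4. \<forall>j<4. dot 4 (l j) y = c j"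
    "Z = {y \<in> topspace (nsphere 3). dot 4 (l 0) y * dot 4 (l 3) y = dot 4 (l 1) y * dot 4 (l 2) y}"
    using doubly_ruled.quadric(2)[OF dr] by (elim exE conjE)
  obtain c v \<kappa> where cv: "torus_coords c v \<kappa> Z"
    using principal_coordinates[OF l(1)[rule_format] l(2)] by (elim exE)
  have "surface 4 Z" using assms(2) n by simp
  then interpret torus c v \<kappa> Z using cv by unfold_locales
  have D: "darboux_cyclide (stereo_image Z)"
    unfolding darboux_cyclide_def using stereo_image_surface moebius_degree by blast
  consider "\<kappa> 0 < \<kappa> 1" "\<kappa> 2 < \<kappa> 3" | "(\<kappa> 0 < \<kappa> 1) \<noteq> (\<kappa> 2 < \<kappa> 3)" | "\<not> \<kappa> 0 < \<kappa> 1" "\<not> \<kappa> 2 < \<kappa> 3"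
    by blast
  then show ?thesis
  proof cases
    case 1
    then have "circled 6 (stereo_image Z)" using circle_count by (simp add: numeral_eq_enat)
    then show ?thesis using n D no_real_singularities unfolding blum_cyclide_def by blast
  next
    case 2
    then have "(if \<kappa> 0 < \<kappa> 1 then 2 else 1) + (if \<kappa> 2 < \<kappa> 3 then 2 else 1) = (3::nat)" by simp
    then have "2 + (if \<kappa> 0 < \<kappa> 1 then 2 else 1) + (if \<kappa> 2 < \<kappa> 3 then 2 else 1) = (5::nat)" by linarith
    then have "circled 5 (stereo_image Z)" using circle_count by (simp only: numeral_eq_enat)
    then show ?thesis using n D no_real_singularities unfolding perseus_cyclide_def by blast
  next
    case 3
    then have "circled 4 (stereo_image Z)" using circle_count by (simp add: numeral_eq_enat)
    then show ?thesis using n D no_real_singularities unfolding ring_cyclide_def by blast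
  qed
qed

end
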